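(* Let $(G_{\mathbb{C}},H_{\mathbb{C}})$ be a non-symmetric reductive spherical pair of rank-one type, i.e. one of $(SO(7,\mathbb{C}),G_2(\mathbb{C}))$, $(Spin(7,\mathbb{C}),G_2(\mathbb{C}))$, $(G_2(\mathbb{C}),SL(3,\mathbb{C}))$. Let $\theta$ be a Cartan involution of $G_{\mathbb{C}}$ with $\theta(H_{\mathbb{C}})=H_{\mathbb{C}}$ and $G_u=G_{\mathbb{C}}^{\theta}$. Then the $G_u$-action (by left translation) on the complex homogeneous space $G_{\mathbb{C}}/H_{\mathbb{C}}$ is strongly visible.
   Context: Strongly visible: a holomorphic action of a Lie group $G$ on a connected complex manifold $D$ is called strongly visible if there exist a real submanifold $S$ of $D$ (called a slice) and an anti-holomorphic diffeomorphism $\sigma$ of $D$ such that (V.1) $D=G\cdot S$; (S.1) $\sigma|_S=\operatorname{id}_S$; (S.2) $\sigma(x)\in G\cdot x$ for all $x\in D$. Cayley algebra: $\mathfrak{C}$ is the 8-dimensional real algebra with basis $e_0,\dots,e_7$, where $e_0$ is the unit, $e_i^2=-e_0$ for $i\ge 1$, $e_ie_j=-e_je_i$ for distinct $i,j\geq 1$, and $e_1e_2=e_3$, $e_1e_4=e_5$, $e_1e_6=e_7$, $e_2e_5=e_7$, $e_2e_6=e_4$, $e_3e_5=e_6$, $e_3e_4=e_7$ (each listed relation $e_ie_j=e_k$ also gives $e_je_k=e_i$ and $e_ke_i=e_j$). $\mathfrak{C}_{\mathbb{C}}=\mathfrak{C}\otimes_{\mathbb{R}}\mathbb{C}$ carries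 the complex symmetric bilinear form with $(e_i,e_j)=\delta_{ij}$. Groups: $SO(8,\mathbb{C})=\{g\in SL(8,\mathbb{C}):{}^tgg=I_8\}$ acts on $\mathfrak{C}_{\mathbb{C}}$ via the basis $e_0,\dots,e_7$, and $SO(7,\mathbb{C})=\{g\in SO(8,\mathbb{C}):ge_0=e_0\}$. $G_2(\mathbb{C})=\{g\in SO(8,\mathbb{C}):(gx)(gy)=g(xy)\ \forall x,y\in\mathfrak{C}_{\mathbb{C}}\}\subset SO(7,\mathbb{C})$. $Spin(7,\mathbb{C})=\{g\in SO(8,\mathbb{C}):\exists g_0\in SO(7,\mathbb{C})\text{ with }(g_0x)(gy)=g(xy)\ \forall x,y\in\mathfrak{C}_{\mathbb{C}}\}$; it contains $G_2(\mathbb{C})$ as the stabilizer of $e_0$. $SL(3,\mathbb{C})$ is realized as $\{g\in G_2(\mathbb{C}):ge_1=e_1\}$. A Cartan involution $\theta$ of the complex group $G_{\mathbb{C}}$ (regarded as a real Lie group) is an involutive automorphism whose fixed point group $G_u$ is a maximal compact subgroup of $G_{\mathbb{C}}$. *)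

theory Defs
  imports
    "HOL-Analysis.Analysis"
    "HOL-Algebra.Group_Action"
    "HOL-Algebra.Left_Coset"
begin

section \<open>Smooth and holomorphic maps between finite-dimensional spaces\<close>

text \<open>\<^term>\<open>S\<close> is meant to be open; the derivatives are then the ordinary iterated ones.\<close>

primrec Ck_on :: "nat \<Rightarrow> ('a::euclidean_space \<Rightarrow> 'b::euclidean_space) \<Rightarrow> 'a set \<Rightarrow> bool" where
  "Ck_on 0 f S \<longleftrightarrow> continuous_on S f"
| "Ck_on (Suc k) f S \<longleftrightarrow>
     (\<forall>x\<in>S. f differentiable (at x)) \<and> (\<forall>v. Ck_on k (\<lambda>x. frechet_derivative f (at x) v) S)"

definition smooth_on :: "('a::euclidean_space \<Rightarrow> 'b::euclidean_space) \<Rightarrow> 'a set \<Rightarrow> bool" where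
  "smooth_on f U \<longleftrightarrow> open U \<and> (\<forall>k. Ck_on k f U)"

text \<open>The complex structures of source and target enter through their complex scalar
  multiplications, because \<^typ>\<open>complex^'n\<close> and the matrix space
  \<^typ>\<open>complex^'n^'m\<close> carry them by different functions. Holomorphic means
  \<open>C\<^sup>\<infinity>\<close> with complex-linear derivative (Cauchy--Riemann).\<close>

definition holomorphic_map_on ::
  "(complex \<Rightarrow> 'a \<Rightarrow> 'a) \<Rightarrow> (complex \<Rightarrow> 'b \<Rightarrow> 'b) \<Rightarrow>
     ('a::euclidean_space \<Rightarrow> 'b::euclidean_space) \<Rightarrow> 'a set \<Rightarrow> bool" where
  "holomorphic_map_on sA sB f U \<longleftrightarrow>
     smooth_on f U \<and>
     (\<forall>x\<in>U. \<forall>c v. frechet_derivative f (at x) (sA c v) = sB c (frechet_derivative f (at x) v))"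

definition antiholomorphic_map_on ::
  "(complex \<Rightarrow> 'a \<Rightarrow> 'a) \<Rightarrow> (complex \<Rightarrow> 'b \<Rightarrow> 'b) \<Rightarrow>
     ('a::euclidean_space \<Rightarrow> 'b::euclidean_space) \<Rightarrow> 'a set \<Rightarrow> bool" where
  "antiholomorphic_map_on sA sB f U \<longleftrightarrow> holomorphic_map_on sA (\<lambda>c. sB (cnj c)) f U"

abbreviation mat_scale :: "complex \<Rightarrow> complex^'n^'m \<Rightarrow> complex^'n^'m" where
  "mat_scale c \<equiv> map_matrix ((*) c)"

text \<open>Maps on a subset \<^term>\<open>W\<close> that need not be open. For \<^term>\<open>W\<close> an embedded
  (complex) submanifold these are exactly the smooth (holomorphic) maps on it.\<close>

definition smooth_rel :: "('a::euclidean_space \<Rightarrow> 'b::euclidean_space) \<Rightarrow> 'a set \<Rightarrow> bool" where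
  "smooth_rel f W \<longleftrightarrow>
     (\<forall>p\<in>W. \<exists>N F. p \<in> N \<and> smooth_on F N \<and> (\<forall>q\<in>N \<inter> W. F q = f q))"

definition holomorphic_rel ::
  "(complex \<Rightarrow> 'a \<Rightarrow> 'a) \<Rightarrow> (complex \<Rightarrow> 'b \<Rightarrow> 'b) \<Rightarrow>
     ('a::euclidean_space \<Rightarrow> 'b::euclidean_space) \<Rightarrow> 'a set \<Rightarrow> bool" where
  "holomorphic_rel sA sB f W \<longleftrightarrow>
     (\<forall>p\<in>W. \<exists>N F. p \<in> N \<and> holomorphic_map_on sA sB F N \<and> (\<forall>q\<in>N \<inter> W. F q = f q))"

section \<open>Complex manifolds\<close>

text \<open>The values of a coordinate map outside the chart domain are irrelevant. The complex
  dimension of the manifold is the cardinality of the index type \<^typ>\<open>'n\<close>.\<close>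

type_synonym ('a, 'n) chart = "'a set \<times> ('a \<Rightarrow> complex^'n)"

definition complex_manifold :: "'a topology \<Rightarrow> ('a, 'n::finite) chart set \<Rightarrow> bool" where
  "complex_manifold X A \<longleftrightarrow>
     Hausdorff_space X \<and> second_countable X \<and>
     (\<Union>(U, \<phi>)\<in>A. U) = topspace X \<and>
     (\<forall>(U, \<phi>)\<in>A. openin X U \<and> open (\<phi> ` U) \<and>
        homeomorphic_map (subtopology X U) (top_of_set (\<phi> ` U)) \<phi>) \<and>
     (\<forall>(U, \<phi>)\<in>A. \<forall>(V, \<psi>)\<in>A.
        holomorphic_map_on (*s) (*s) (\<psi> \<circ> inv_into U \<phi>) (\<phi> ` (U \<inter> V)))"

definition holomorphic_manifold_map ::
  "'a topology \<Rightarrow> ('a, 'm::finite) chart set \<Rightarrow> 'b topology \<Rightarrow> ('b, 'n::finite) chart set \<Rightarrow>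
     ('a \<Rightarrow> 'b) \<Rightarrow> bool" where
  "holomorphic_manifold_map X A Y B f \<longleftrightarrow>
     continuous_map X Y f \<and>
     (\<forall>(U, \<phi>)\<in>A. \<forall>(V, \<psi>)\<in>B.
        holomorphic_map_on (*s) (*s) (\<psi> \<circ> f \<circ> inv_into U \<phi>) (\<phi> ` {x\<in>U. f x \<in> V}))"

definition antiholomorphic_manifold_map ::
  "'a topology \<Rightarrow> ('a, 'm::finite) chart set \<Rightarrow> 'b topology \<Rightarrow> ('b, 'n::finite) chart set \<Rightarrow>
     ('a \<Rightarrow> 'b) \<Rightarrow> bool" where
  "antiholomorphic_manifold_map X A Y B f \<longleftrightarrow>
     continuous_map X Y f \<and>
     (\<forall>(U, \<phi>)\<in>A. \<forall>(V, \<psi>)\<in>B.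
        antiholomorphic_map_on (*s) (*s) (\<psi> \<circ> f \<circ> inv_into U \<phi>) (\<phi> ` {x\<in>U. f x \<in> V}))"

definition antiholomorphic_diffeo :: "'a topology \<Rightarrow> ('a, 'n::finite) chart set \<Rightarrow> ('a \<Rightarrow> 'a) \<Rightarrow> bool"
  where
  "antiholomorphic_diffeo X A \<sigma> \<longleftrightarrow>
     (\<exists>\<tau>. homeomorphic_maps X X \<sigma> \<tau> \<and>
          antiholomorphic_manifold_map X A X A \<sigma> \<and> antiholomorphic_manifold_map X A X A \<tau>)"

text \<open>An embedded real submanifold (of constant real dimension \<^term>\<open>d\<close>): near each of its points
  it is flattened onto a real \<^term>\<open>d\<close>-dimensional subspace by a real diffeomorphism
  \<^term>\<open>F\<close> between open sets, precomposed with a holomorphic chart.\<close>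

definition real_submanifold :: "'a topology \<Rightarrow> ('a, 'n::finite) chart set \<Rightarrow> 'a set \<Rightarrow> bool" where
  "real_submanifold X A S \<longleftrightarrow>
     S \<subseteq> topspace X \<and>
     (\<exists>d. \<forall>p\<in>S. \<exists>(U, \<phi>)\<in>A.
      \<exists>W (F :: complex^'n \<Rightarrow> complex^'n) F' L.
        p \<in> U \<and> \<phi> p \<in> W \<and> W \<subseteq> \<phi> ` U \<and>
        smooth_on F W \<and> smooth_on F' (F ` W) \<and> (\<forall>w\<in>W. F' (F w) = w) \<and>
        subspace L \<and> dim L = d \<and>
        F ` (W \<inter> \<phi> ` (S \<inter> U)) = F ` W \<inter> L)"

section \<open>Matrix Lie groups and strongly visible actions\<close>

definition matrix_group :: "(complex^'m^'m::finite) set \<Rightarrow> (complex^'m^'m) monoid" where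
  "matrix_group G = \<lparr>carrier = G, monoid.mult = (**), one = mat 1\<rparr>"

definition matrix_lie_group :: "(complex^'m^'m::finite) set \<Rightarrow> bool" where
  "matrix_lie_group K \<longleftrightarrow>
     subgroup K (matrix_group {A. invertible A}) \<and> closedin (top_of_set {A. invertible A}) K"

text \<open>The last clause says that the action map is \<open>C\<^sup>\<infinity>\<close> on the product of the Lie group
  (an embedded submanifold of the matrix space) and the manifold, read in charts.\<close>

definition holomorphic_action ::
  "(complex^'m^'m::finite) set \<Rightarrow> (complex^'m^'m \<Rightarrow> 'a \<Rightarrow> 'a) \<Rightarrow> 'a topology \<Rightarrow>
     ('a, 'n::finite) chart set \<Rightarrow> bool" where
  "holomorphic_action K act X A \<longleftrightarrow>
     group_action (matrix_group K) (topspace X) act \<and>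
     (\<forall>g\<in>K. holomorphic_manifold_map X A X A (act g)) \<and>
     continuous_map (prod_topology (top_of_set K) X) X (\<lambda>(g, x). act g x) \<and>
     (\<forall>(U, \<phi>)\<in>A. \<forall>(V, \<psi>)\<in>A.
        smooth_rel (\<lambda>(g, z). \<psi> (act g (inv_into U \<phi> z)))
          {(g, z). g \<in> K \<and> z \<in> \<phi> ` U \<and> act g (inv_into U \<phi> z) \<in> V})"

definition strongly_visible ::
  "(complex^'m^'m::finite) set \<Rightarrow> (complex^'m^'m \<Rightarrow> 'a \<Rightarrow> 'a) \<Rightarrow> 'a topology \<Rightarrow>
     ('a, 'n::finite) chart set \<Rightarrow> bool" where
  "strongly_visible K act X A \<longleftrightarrow>
     matrix_lie_group K \<and> complex_manifold X A \<and> connected_space X \<and>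
     holomorphic_action K act X A \<and>
     (\<exists>S \<sigma>. real_submanifold X A S \<and> antiholomorphic_diffeo X A \<sigma> \<and>
        topspace X = (\<Union>g\<in>K. act g ` S) \<and>
        (\<forall>x\<in>S. \<sigma> x = x) \<and>
        (\<forall>x\<in>topspace X. \<sigma> x \<in> orbit (matrix_group K) act x))"

definition maximal_compact_subgroup :: "(complex^'m^'m::finite) set \<Rightarrow> (complex^'m^'m) set \<Rightarrow> bool"
  where
  "maximal_compact_subgroup G K \<longleftrightarrow>
     subgroup K (matrix_group G) \<and> compact K \<and>
     (\<forall>L. subgroup L (matrix_group G) \<and> compact L \<and> K \<subseteq> L \<longrightarrow> L = K)"

text \<open>\<^term>\<open>\<theta>\<close> is an automorphism of \<^term>\<open>G\<close> as a \<^emph>\<open>real\<close> Lie group, hence only smooth;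
  its inverse is itself.\<close>

definition cartan_involution ::
  "(complex^'m^'m::finite) set \<Rightarrow> (complex^'m^'m \<Rightarrow> complex^'m^'m) \<Rightarrow> bool" where
  "cartan_involution G \<theta> \<longleftrightarrow>
     \<theta> \<in> iso (matrix_group G) (matrix_group G) \<and> smooth_rel \<theta> G \<and>
     (\<forall>g\<in>G. \<theta> (\<theta> g) = g) \<and>
     maximal_compact_subgroup G {g\<in>G. \<theta> g = g}"

section \<open>Complex homogeneous spaces\<close>

definition quotient_topology :: "'a topology \<Rightarrow> ('a \<Rightarrow> 'b) \<Rightarrow> 'b topology" where
  "quotient_topology X p =
     topology (\<lambda>U. U \<subseteq> p ` topspace X \<and> openin X {x \<in> topspace X. p x \<in> U})"

lemma openin_quotient_topology:
  "openin (quotient_topology X p) U \<longleftrightarrow>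
     U \<subseteq> p ` topspace X \<and> openin X {x \<in> topspace X. p x \<in> U}"
proof -
  let ?P = "\<lambda>U. U \<subseteq> p ` topspace X \<and> openin X {x \<in> topspace X. p x \<in> U}"
  have "istopology ?P"
    unfolding istopology_def
  proof (intro conjI allI impI)
    fix S T assume S: "?P S" and T: "?P T"
    have eq: "{x \<in> topspace X. p x \<in> S \<inter> T} =
        {x \<in> topspace X. p x \<in> S} \<inter> {x \<in> topspace X. p x \<in> T}"
      by blast
    show "S \<inter> T \<subseteq> p ` topspace X" using S by blast
    show "openin X {x \<in> topspace X. p x \<in> S \<inter> T}"
      unfolding eq using S T by blast
  next
    fix \<K> assume K: "\<forall>S\<in>\<K>. ?P S"
    have eq: "{x \<in> topspace X. p x \<in> \<Union>\<K>} = (\<Union>S\<in>\<K>. {x \<in> topspace X. p x \<in> S})"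
      by blast
    show "\<Union>\<K> \<subseteq> p ` topspace X" using K by blast
    show "openin X {x \<in> topspace X. p x \<in> \<Union>\<K>}"
      unfolding eq using K by blast
  qed
  then show ?thesis
    by (simp add: quotient_topology_def topology_inverse')
qed

lemma topspace_quotient_topology: "topspace (quotient_topology X p) = p ` topspace X"
proof -
  have "{x \<in> topspace X. p x \<in> p ` topspace X} = topspace X"
    by blast
  then have "openin (quotient_topology X p) (p ` topspace X)"
    by (simp add: openin_quotient_topology)
  then show ?thesis
    by (metis openin_quotient_topology openin_subset openin_topspace subset_antisym)
qed

definition coset_space :: "(complex^'m^'m::finite) set \<Rightarrow> (complex^'m^'m) set \<Rightarrow> (complex^'m^'m) set topology"
  where
  "coset_space G H = quotient_topology (top_of_set G) (\<lambda>g. g <#\<^bsub>matrix_group G\<^esub> H)"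

text \<open>The complex structure of \<open>G/H\<close> is the one for which the projection \<open>\<pi> : G \<rightarrow> G/H\<close> is a
  holomorphic submersion. Accordingly \<open>(U, \<phi>)\<close> is a chart iff \<open>\<phi> \<circ> \<pi>\<close> is holomorphic and
  \<open>\<phi>\<close> has an inverse that lifts locally to holomorphic maps \<^term>\<open>s\<close> into \<open>G\<close>; this describes
  the maximal atlas.\<close>

definition coset_charts ::
  "(complex^'m^'m::finite) set \<Rightarrow> (complex^'m^'m) set \<Rightarrow> ((complex^'m^'m) set, 'n::finite) chart set"
  where
  "coset_charts G H =
     {(U, \<phi>). let \<pi> = (\<lambda>g. g <#\<^bsub>matrix_group G\<^esub> H) in
        openin (coset_space G H) U \<and> inj_on \<phi> U \<and> open (\<phi> ` U) \<and>
        holomorphic_rel mat_scale (*s) (\<phi> \<circ> \<pi>) {g \<in> G. \<pi> g \<in> U} \<and>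
        (\<forall>z \<in> \<phi> ` U. \<exists>V s. z \<in> V \<and> V \<subseteq> \<phi> ` U \<and>
           holomorphic_map_on (*s) mat_scale s V \<and> s ` V \<subseteq> G \<and>
           (\<forall>w\<in>V. \<pi> (s w) \<in> U \<and> \<phi> (\<pi> (s w)) = w))}"

definition left_translation ::
  "(complex^'m^'m::finite) set \<Rightarrow> (complex^'m^'m) set \<Rightarrow> complex^'m^'m \<Rightarrow> (complex^'m^'m) set \<Rightarrow> (complex^'m^'m) set"
  where
  "left_translation G H g = (\<lambda>x \<in> lcosets\<^bsub>matrix_group G\<^esub> H. g <#\<^bsub>matrix_group G\<^esub> x)"

section \<open>The Cayley algebra and the groups\<close>

definition cayley_lines :: "(8 \<times> 8 \<times> 8) set" where
  "cayley_lines = {(1,2,3), (1,4,5), (1,6,7), (2,5,7), (2,6,4), (3,5,6), (3,4,7)}"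

definition cayley_cyclic :: "8 \<Rightarrow> 8 \<Rightarrow> 8 \<Rightarrow> bool" where
  "cayley_cyclic i j k \<longleftrightarrow>
     (i, j, k) \<in> cayley_lines \<or> (j, k, i) \<in> cayley_lines \<or> (k, i, j) \<in> cayley_lines"

text \<open>The coefficient of \<open>e\<^sub>k\<close> in \<open>e\<^sub>i e\<^sub>j\<close>; the index type \<^typ>\<open>8\<close> has elements \<open>0, \<dots>, 7\<close>.\<close>

definition cayley_coeff :: "8 \<Rightarrow> 8 \<Rightarrow> 8 \<Rightarrow> complex" where
  "cayley_coeff i j k =
     (if i = 0 then (if k = j then 1 else 0)
      else if j = 0 then (if k = i then 1 else 0)
      else if i = j then (if k = 0 then -1 else 0)
      else if cayley_cyclic i j k then 1
      else if cayley_cyclic j i k then -1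
      else 0)"

definition cayley_mult :: "complex^8 \<Rightarrow> complex^8 \<Rightarrow> complex^8" (infixl "\<bullet>\<^sub>C" 70) where
  "x \<bullet>\<^sub>C y = (\<chi> k. \<Sum>i\<in>UNIV. \<Sum>j\<in>UNIV. cayley_coeff i j k * x $ i * y $ j)"

definition cayley_e :: "8 \<Rightarrow> complex^8" where
  "cayley_e i = axis i 1"

definition SO8C :: "(complex^8^8) set" where
  "SO8C = {g. det g = 1 \<and> transpose g ** g = mat 1}"

definition SO7C :: "(complex^8^8) set" where
  "SO7C = {g \<in> SO8C. g *v cayley_e 0 = cayley_e 0}"

definition G2C :: "(complex^8^8) set" where
  "G2C = {g \<in> SO8C. \<forall>x y. (g *v x) \<bullet>\<^sub>C (g *v y) = g *v (x \<bullet>\<^sub>C y)}"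

definition Spin7C :: "(complex^8^8) set" where
  "Spin7C = {g \<in> SO8C. \<exists>g0 \<in> SO7C. \<forall>x y. (g0 *v x) \<bullet>\<^sub>C (g *v y) = g *v (x \<bullet>\<^sub>C y)}"

definition SL3C :: "(complex^8^8) set" where
  "SL3C = {g \<in> G2C. g *v cayley_e 1 = cayley_e 1}"

end

theory Submission
  imports Defs
begin

text \<open>
  The involution \<open>\<theta>\<close> enters only through the maximal compact subgroup \<open>K\<close> that it fixes. A minimum
  \<open>q\<close> of \<open>g \<mapsto> sup {norm (kg) | k \<in> K}\<close> on the closed set \<open>G\<close> makes every \<open>q\<^sup>-\<^sup>1 k q\<close> real, because
  otherwise, with \<open>h = q\<^sup>-\<^sup>1 k q\<close>, the point \<open>q (h h\<^sup>\<dagger>)\<^sup>1\<^sup>/\<^sup>4\<close> would have a smaller supremum. So \<open>K\<close> is conjugate to the group of real points of \<open>G\<close>, and it suffices to treat that group.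

  For \<open>Spin(7)\<close> and \<open>G\<^sub>2\<close> the orbit of \<open>e\<^sub>\<alpha>\<close> (\<open>\<alpha> = 0\<close> and \<open>\<alpha> = 1\<close>) identifies \<open>G/H\<close> with a complex sphere.
  For \<open>SO(7)\<close> the spin lift \<open>h\<close> of \<open>g\<close> is determined up to sign and identifies \<open>G/H\<close> with the quotient
  of the complex 7-sphere by \<open>\<plusminus>1\<close>, via \<open>g \<mapsto> h e\<^sub>0\<close>. The real and imaginary parts of a point \<open>x + \<i> y\<close> of
  the complex sphere are orthogonal with \<open>|x|\<^sup>2 - |y|\<^sup>2 = 1\<close>, and the real points of \<open>G\<close> are transitive
  on orthonormal pairs, so every orbit meets the curve \<open>cosh t e\<^sub>\<alpha> + \<i> sinh t e\<^sub>\<beta>\<close>, which is the slice.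
  With a real diagonal \<open>A \<in> H\<close> such that \<open>A e\<^sub>\<alpha> = e\<^sub>\<alpha>\<close> and \<open>A e\<^sub>\<beta> = - e\<^sub>\<beta>\<close>, the map \<open>\<sigma> (gH) = A g\<^sup>* H\<close>,
  where \<open>g\<^sup>*\<close> is the complex conjugate of \<open>g\<close>, fixes the slice pointwise; then (S.2) follows from (V.1)
  and (S.1) because \<open>A\<close> normalises the group of real points.
\<close>

section \<open>Calculus of smooth and holomorphic maps\<close>

text \<open>Each group is cut out by bilinear identities. A multiplicative function of the
  eigenvalues of a Hermitian matrix preserves such identities, since a product of eigenvectors
  belongs to the product of the eigenvalues; this keeps the fourth root n of
  \<open>h ** adjoint_mat h\<close> in G. A fourth root is forced: |a n|^2 is the inner product of a
  and a n^2, and it is compared with the mean of |a|^2 and |a h|^2.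

  The elements that move points are products of left multiplications by imaginary octonions a,
  because these are spin lifts of minus the reflection in a, up to scale. Being rational in a, they
  also give holomorphic local sections and continuous curves.

  The obstacle in SO(7) is the sign of h, which admits no global holomorphic choice. With p = h e_0
  the vector 8 p_0 p is quadratic in h and polynomial in g, and the ratios of its entries are
  coordinates of the projective point of p. Spheres fit the same criterion: adding e_\<alpha> to g
  e_\<alpha> turns the ratios into stereographic coordinates. In both cases the slice becomes a
  segment of an imaginary coordinate axis, which z \<mapsto> - cnj z fixes.\<close>

lemma differentiable_cong_open:
  assumes "open S" "x \<in> S" "\<And>y. y \<in> S \<Longrightarrow> f y = g y"
  shows "f differentiable (at x) \<longleftrightarrow> g differentiable (at x)"
    and "frechet_derivative f (at x) = frechet_derivative g (at x)"
proof -
  have "(f has_derivative D) (at x) \<longleftrightarrow> (g has_derivative D) (at x)" for D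
    using has_derivative_transform_within_open[of f D x UNIV S g]
      has_derivative_transform_within_open[of g D x UNIV S f] assms by auto
  then show "f differentiable (at x) \<longleftrightarrow> g differentiable (at x)"
    "frechet_derivative f (at x) = frechet_derivative g (at x)"
    by (auto simp: differentiable_def frechet_derivative_def)
qed

lemma Ck_on_cong:
  assumes "open S" "\<And>x. x \<in> S \<Longrightarrow> f x = g x"
  shows "Ck_on k f S \<longleftrightarrow> Ck_on k g S"
  using assms(2)
proof (induction k arbitrary: f g)
  case 0
  then show ?case by (auto intro: continuous_on_cong)
next
  case (Suc k)
  have "f differentiable (at x) \<longleftrightarrow> g differentiable (at x)" if "x \<in> S" for x
    using differentiable_cong_open(1)[OF assms(1) that] Suc.prems by blast
  moreover have "Ck_on k (\<lambda>x. frechet_derivative f (at x) v) S \<longleftrightarrow>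
      Ck_on k (\<lambda>x. frechet_derivative g (at x) v) S" for v
    by (rule Suc.IH) (use differentiable_cong_open(2)[OF assms(1)] Suc.prems in metis)
  ultimately show ?case by simp
qed

lemma Ck_on_subset: "Ck_on k f S \<Longrightarrow> T \<subseteq> S \<Longrightarrow> Ck_on k f T"
  by (induction k arbitrary: f) (auto intro: continuous_on_subset)

lemma Ck_on_local:
  "(\<And>x. x \<in> S \<Longrightarrow> \<exists>N. open N \<and> x \<in> N \<and> Ck_on k f N) \<Longrightarrow> Ck_on k f S"
proof (induction k arbitrary: f)
  case 0
  then show ?case
    by (metis Ck_on.simps(1) continuous_at_imp_continuous_on continuous_on_eq_continuous_at)
next
  case (Suc k)
  have "f differentiable (at x)" if "x \<in> S" for x
    using Suc.prems[OF that] by auto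
  moreover have "Ck_on k (\<lambda>x. frechet_derivative f (at x) v) S" for v
    by (rule Suc.IH) (use Suc.prems in \<open>metis Ck_on.simps(2)\<close>)
  ultimately show ?case by simp
qed

lemma Ck_on_SucD: "Ck_on (Suc k) f S \<Longrightarrow> Ck_on k f S"
proof (induction k arbitrary: f)
  case 0
  then show ?case
    by (auto intro!: continuous_at_imp_continuous_on differentiable_imp_continuous_within)
next
  case (Suc k)
  then show ?case by (metis Ck_on.simps(2))
qed

lemma Ck_on_const: "Ck_on k (\<lambda>x. c) S"
  by (induction k arbitrary: c) auto

lemma Ck_on_linear:
  assumes "bounded_linear f"
  shows "Ck_on k f S"
proof (cases k)
  case 0
  then show ?thesis using assms by (simp add: linear_continuous_on)
next
  case (Suc m)
  have "(f has_derivative f) (at x)" for x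
    using assms by (rule bounded_linear_imp_has_derivative)
  then have "f differentiable (at x)" "frechet_derivative f (at x) = f" for x
    unfolding differentiable_def using frechet_derivative_at by metis+
  then show ?thesis by (simp add: Suc Ck_on_const)
qed

text \<open>\<open>Ck_on\<close> is stated through \<open>frechet_derivative\<close>; by uniqueness
  of the derivative any explicit family \<open>f'\<close> may be used instead. The closure rules for
  sums, bilinear maps, compositions and inverses all induct through this rule.\<close>

lemma Ck_on_SucI:
  assumes "open S" "\<And>x. x \<in> S \<Longrightarrow> (f has_derivative f' x) (at x)"
    and "\<And>v. Ck_on k (\<lambda>x. f' x v) S"
  shows "Ck_on (Suc k) f S"
proof -
  have "frechet_derivative f (at x) = f' x" if "x \<in> S" for x
    using frechet_derivative_at[OF assms(2)[OF that]] by simp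
  then have "Ck_on k (\<lambda>x. frechet_derivative f (at x) v) S" for v
    using assms(3)[of v] Ck_on_cong[OF assms(1), of "\<lambda>x. frechet_derivative f (at x) v" "\<lambda>x. f' x v"]
    by auto
  then show ?thesis using assms(2) by (auto simp: differentiable_def)
qed

lemma Ck_on_SucE:
  assumes "Ck_on (Suc k) f S" "x \<in> S"
  shows "(f has_derivative frechet_derivative f (at x)) (at x)"
  using assms frechet_derivative_works by auto

lemma Ck_on_Suc_derivative:
  "Ck_on (Suc k) f S \<Longrightarrow> Ck_on k (\<lambda>x. frechet_derivative f (at x) v) S"
  by simp

lemma Ck_on_add:
  "open S \<Longrightarrow> Ck_on k f S \<Longrightarrow> Ck_on k g S \<Longrightarrow> Ck_on k (\<lambda>x. f x + g x) S"
proof (induction k arbitrary: f g)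
  case 0
  then show ?case by (auto intro: continuous_on_add)
next
  case (Suc k)
  show ?case
  proof (rule Ck_on_SucI[OF Suc.prems(1)])
    show "((\<lambda>x. f x + g x) has_derivative
        (\<lambda>v. frechet_derivative f (at x) v + frechet_derivative g (at x) v)) (at x)"
      if "x \<in> S" for x
      using has_derivative_add[OF Ck_on_SucE[OF Suc.prems(2) that] Ck_on_SucE[OF Suc.prems(3) that]] .
    show "Ck_on k (\<lambda>x. frechet_derivative f (at x) v + frechet_derivative g (at x) v) S" for v
      using Suc.prems by (intro Suc.IH) auto
  qed
qed

lemma Ck_on_sum:
  "open S \<Longrightarrow> (\<And>i. i \<in> I \<Longrightarrow> Ck_on k (f i) S) \<Longrightarrow> Ck_on k (\<lambda>x. \<Sum>i\<in>I. f i x) S"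
  by (induction I rule: infinite_finite_induct) (auto intro: Ck_on_const Ck_on_add)

lemma Ck_on_bilinear:
  assumes "bounded_bilinear b"
  shows "open S \<Longrightarrow> Ck_on k f S \<Longrightarrow> Ck_on k g S \<Longrightarrow> Ck_on k (\<lambda>x. b (f x) (g x)) S"
proof (induction k arbitrary: f g)
  case 0
  then show ?case using bounded_bilinear.continuous_on[OF assms] by auto
next
  case (Suc k)
  show ?case
  proof (rule Ck_on_SucI[OF Suc.prems(1)])
    show "((\<lambda>x. b (f x) (g x)) has_derivative
        (\<lambda>v. b (f x) (frechet_derivative g (at x) v) + b (frechet_derivative f (at x) v) (g x))) (at x)"
      if "x \<in> S" for x
      using bounded_bilinear.FDERIV[OF assms Ck_on_SucE[OF Suc.prems(2) that] Ck_on_SucE[OF Suc.prems(3) that]] .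
    show "Ck_on k (\<lambda>x. b (f x) (frechet_derivative g (at x) v) + b (frechet_derivative f (at x) v) (g x)) S" for v
      using Suc.prems Suc.IH Ck_on_SucD[OF Suc.prems(2)] Ck_on_SucD[OF Suc.prems(3)]
      by (auto intro!: Ck_on_add)
  qed
qed

text \<open>The chain rule produces the derivative of g in the direction \<open>?Df x v\<close>,
  which moves with x, while \<open>Ck_on\<close> speaks of fixed directions only. Expanding that
  direction over \<open>Basis\<close> leaves a sum of products whose factors are C^k, by the
  induction hypothesis for the directional derivatives of g.\<close>

lemma Ck_on_compose:
  fixes f :: "'a::euclidean_space \<Rightarrow> 'b::euclidean_space" and g :: "'b \<Rightarrow> 'c::euclidean_space"
  shows "open S \<Longrightarrow> open T \<Longrightarrow> f ` S \<subseteq> T \<Longrightarrow> Ck_on k f S \<Longrightarrow> Ck_on k g T \<Longrightarrow> Ck_on k (g \<circ> f) S"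
proof (induction k arbitrary: g)
  case 0
  then show ?case using continuous_on_compose continuous_on_subset Ck_on.simps(1) by metis
next
  case (Suc k)
  let ?Df = "\<lambda>x. frechet_derivative f (at x)" and ?Dg = "\<lambda>y. frechet_derivative g (at y)"
  show ?case
  proof (rule Ck_on_SucI[OF Suc.prems(1)])
    show "((g \<circ> f) has_derivative (\<lambda>v. \<Sum>b\<in>Basis. (?Df x v \<bullet> b) *\<^sub>R ?Dg (f x) b)) (at x)"
      if "x \<in> S" for x
    proof -
      have D: "(g has_derivative ?Dg (f x)) (at (f x))"
        using Suc.prems that by (intro Ck_on_SucE[OF Suc.prems(5)]) auto
      then have L: "linear (?Dg (f x))" by (rule has_derivative_linear)
      have "?Dg (f x) w = (\<Sum>b\<in>Basis. (w \<bullet> b) *\<^sub>R ?Dg (f x) b)" for w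
        by (subst euclidean_representation[of w, symmetric])
          (simp only: linear_sum[OF L] linear_scale[OF L])
      then have "?Dg (f x) \<circ> ?Df x = (\<lambda>v. \<Sum>b\<in>Basis. (?Df x v \<bullet> b) *\<^sub>R ?Dg (f x) b)"
        unfolding o_def by blast
      then show ?thesis
        using diff_chain_at[OF Ck_on_SucE[OF Suc.prems(4) that] D] by (simp only:)
    qed
    note * = Ck_on_Suc_derivative[OF Suc.prems(4)] Ck_on_Suc_derivative[OF Suc.prems(5)]
    have 1: "Ck_on k (\<lambda>x. ?Dg (f x) b) S" for b
      using Suc.IH[OF Suc.prems(1-3) Ck_on_SucD[OF Suc.prems(4)] *(2)] unfolding o_def .
    have 2: "Ck_on k (\<lambda>x. ?Df x v \<bullet> b) S" for v b
      using Ck_on_bilinear[OF bounded_bilinear_inner Suc.prems(1) *(1) Ck_on_const] .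
    have 3: "Ck_on k (\<lambda>x. (?Df x v \<bullet> b) *\<^sub>R ?Dg (f x) b) S" for v b
      using Ck_on_bilinear[OF bounded_bilinear_scaleR Suc.prems(1) 2 1] .
    show "Ck_on k (\<lambda>x. \<Sum>b\<in>Basis. (?Df x v \<bullet> b) *\<^sub>R ?Dg (f x) b) S" for v
      using Ck_on_sum[OF Suc.prems(1), of Basis k "\<lambda>b x. (?Df x v \<bullet> b) *\<^sub>R ?Dg (f x) b"] 3
      by blast
  qed
qed

text \<open>The derivative of 1/f is a product of 1/f, Df and 1/f, so one degree less of smoothness
  of 1/f is enough, and the induction supplies it.\<close>

lemma Ck_on_inverse:
  fixes f :: "'a::euclidean_space \<Rightarrow> complex"
  shows "open S \<Longrightarrow> (\<And>x. x \<in> S \<Longrightarrow> f x \<noteq> 0) \<Longrightarrow> Ck_on k f S \<Longrightarrow> Ck_on k (\<lambda>x. inverse (f x)) S"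
proof (induction k)
  case 0
  then show ?case by (auto intro: continuous_on_inverse)
next
  case (Suc k)
  let ?Df = "\<lambda>x. frechet_derivative f (at x)"
  note I = Suc.IH[OF Suc.prems(1,2) Ck_on_SucD[OF Suc.prems(3)]]
  show ?case
  proof (rule Ck_on_SucI[OF Suc.prems(1)])
    show "((\<lambda>x. inverse (f x)) has_derivative (\<lambda>v. - (inverse (f x) * ?Df x v * inverse (f x)))) (at x)"
      if "x \<in> S" for x
      using Deriv.has_derivative_inverse[OF Suc.prems(2)[OF that] Ck_on_SucE[OF Suc.prems(3) that]] .
    have "Ck_on k (\<lambda>x. (-1) * (inverse (f x) * ?Df x v * inverse (f x))) S" for v
      by (intro Ck_on_bilinear[OF bounded_bilinear_mult] Ck_on_const Suc.prems(1) I
          Ck_on_Suc_derivative[OF Suc.prems(3)])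
    then show "Ck_on k (\<lambda>x. - (inverse (f x) * ?Df x v * inverse (f x))) S" for v
      by simp
  qed
qed

lemma smooth_on_compose:
  "smooth_on f S \<Longrightarrow> smooth_on g T \<Longrightarrow> f ` S \<subseteq> T \<Longrightarrow> smooth_on (g \<circ> f) S"
  unfolding smooth_on_def using Ck_on_compose by blast

lemma smooth_on_imp_continuous_on: "smooth_on f S \<Longrightarrow> continuous_on S f"
  unfolding smooth_on_def using Ck_on.simps(1) by blast

lemma smooth_on_linear: "bounded_linear f \<Longrightarrow> open S \<Longrightarrow> smooth_on f S"
  by (simp add: smooth_on_def Ck_on_linear)

lemma smooth_on_subset: "smooth_on f S \<Longrightarrow> open T \<Longrightarrow> T \<subseteq> S \<Longrightarrow> smooth_on f T"
  by (auto simp: smooth_on_def intro: Ck_on_subset)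

lemma smooth_on_bilinear:
  "bounded_bilinear b \<Longrightarrow> smooth_on f S \<Longrightarrow> smooth_on g S \<Longrightarrow> smooth_on (\<lambda>x. b (f x) (g x)) S"
  by (simp add: smooth_on_def Ck_on_bilinear)

lemma smooth_on_has_derivative:
  assumes "smooth_on f S" "x \<in> S"
  shows "(f has_derivative frechet_derivative f (at x)) (at x)"
  using assms Ck_on_SucE[of 0] unfolding smooth_on_def by blast

lemma smooth_on_local:
  assumes "\<And>x. x \<in> S \<Longrightarrow> \<exists>N. x \<in> N \<and> N \<subseteq> S \<and> smooth_on f N"
  shows "smooth_on f S"
proof -
  have "open S" using assms unfolding smooth_on_def by (metis open_subopen)
  moreover have "Ck_on k f S" for k
  proof (rule Ck_on_local)
    show "\<exists>N. open N \<and> x \<in> N \<and> Ck_on k f N" if "x \<in> S" for x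
      using assms[OF that] by (auto simp: smooth_on_def)
  qed
  ultimately show ?thesis by (simp add: smooth_on_def)
qed

lemma holomorphic_map_onI:
  assumes "smooth_on f U"
    and "\<And>x. x \<in> U \<Longrightarrow> (f has_derivative f' x) (at x)"
    and "\<And>x c v. x \<in> U \<Longrightarrow> f' x (sA c v) = sB c (f' x v)"
  shows "holomorphic_map_on sA sB f U"
proof -
  have "frechet_derivative f (at x) = f' x" if "x \<in> U" for x
    using frechet_derivative_at[OF assms(2)[OF that]] by simp
  then show ?thesis by (simp add: holomorphic_map_on_def assms)
qed

lemma holomorphic_map_onD:
  assumes "holomorphic_map_on sA sB f U"
  shows "smooth_on f U" "open U"
    and "x \<in> U \<Longrightarrow> (f has_derivative frechet_derivative f (at x)) (at x)"
    and "x \<in> U \<Longrightarrow> frechet_derivative f (at x) (sA c v) = sB c (frechet_derivative f (at x) v)"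
proof -
  show "smooth_on f U" using assms by (simp add: holomorphic_map_on_def)
  then show "open U" "x \<in> U \<Longrightarrow> (f has_derivative frechet_derivative f (at x)) (at x)"
    using smooth_on_has_derivative by (simp add: smooth_on_def, blast)
  show "x \<in> U \<Longrightarrow> frechet_derivative f (at x) (sA c v) = sB c (frechet_derivative f (at x) v)"
    using assms by (simp add: holomorphic_map_on_def)
qed

lemma holomorphic_map_on_compose:
  assumes f: "holomorphic_map_on sA sB f S" and g: "holomorphic_map_on sB sC g T"
    and "f ` S \<subseteq> T"
  shows "holomorphic_map_on sA sC (g \<circ> f) S"
proof (rule holomorphic_map_onI)
  show "smooth_on (g \<circ> f) S"
    using smooth_on_compose assms(3) f g unfolding holomorphic_map_on_def by blast
  show "((g \<circ> f) has_derivative (frechet_derivative g (at (f x)) \<circ> frechet_derivative f (at x))) (at x)"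
    if "x \<in> S" for x
    using that assms(3)
    by (intro diff_chain_at holomorphic_map_onD(3)[OF f] holomorphic_map_onD(3)[OF g]) auto
  show "(frechet_derivative g (at (f x)) \<circ> frechet_derivative f (at x)) (sA c v) =
      sC c ((frechet_derivative g (at (f x)) \<circ> frechet_derivative f (at x)) v)" if "x \<in> S" for x c v
    using that assms(3) by (auto simp: holomorphic_map_onD(4)[OF f] holomorphic_map_onD(4)[OF g] image_subset_iff)
qed

text \<open>Conjugating the scalars of source and target simultaneously does not affect holomorphy, so
  antiholomorphic maps can be composed with holomorphic ones.\<close>

lemma holomorphic_map_on_scalars:
  "holomorphic_map_on sA sB f U \<Longrightarrow> holomorphic_map_on (\<lambda>c. sA (\<kappa> c)) (\<lambda>c. sB (\<kappa> c)) f U"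
  by (simp add: holomorphic_map_on_def)

lemma holomorphic_map_on_subset:
  "holomorphic_map_on sA sB f S \<Longrightarrow> open T \<Longrightarrow> T \<subseteq> S \<Longrightarrow> holomorphic_map_on sA sB f T"
  unfolding holomorphic_map_on_def using smooth_on_subset by blast

lemma holomorphic_map_on_cong:
  assumes "holomorphic_map_on sA sB f S" "\<And>x. x \<in> S \<Longrightarrow> f x = g x"
  shows "holomorphic_map_on sA sB g S"
proof -
  have o: "open S" using assms(1) holomorphic_map_onD(2) by blast
  have "smooth_on g S"
    using assms Ck_on_cong[OF o] holomorphic_map_onD(1)[OF assms(1)] unfolding smooth_on_def by blast
  then show ?thesis
    using assms differentiable_cong_open(2)[OF o, of _ f g] unfolding holomorphic_map_on_def by metis
qed

lemma holomorphic_map_on_local: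
  assumes "\<And>x. x \<in> S \<Longrightarrow> \<exists>N. x \<in> N \<and> N \<subseteq> S \<and> holomorphic_map_on sA sB f N"
  shows "holomorphic_map_on sA sB f S"
proof -
  have "smooth_on f S"
  proof (rule smooth_on_local)
    show "\<exists>N. x \<in> N \<and> N \<subseteq> S \<and> smooth_on f N" if "x \<in> S" for x
      using assms[OF that] by (auto simp: holomorphic_map_on_def)
  qed
  moreover have "frechet_derivative f (at x) (sA c v) = sB c (frechet_derivative f (at x) v)"
    if "x \<in> S" for x c v
    using assms[OF that] by (auto simp: holomorphic_map_on_def)
  ultimately show ?thesis by (simp add: holomorphic_map_on_def)
qed

lemma holomorphic_map_on_linear:
  assumes "linear f" "\<And>c v. f (sA c v) = sB c (f v)" "open S"
  shows "holomorphic_map_on sA sB f S"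
proof -
  have "bounded_linear f" using assms(1) by (simp add: linear_conv_bounded_linear)
  then show ?thesis
    using assms smooth_on_linear
    by (intro holomorphic_map_onI[where f' = "\<lambda>_. f"]) (auto intro: bounded_linear_imp_has_derivative)
qed

lemma holomorphic_map_on_const:
  assumes "\<And>c. sB c 0 = 0" "open S"
  shows "holomorphic_map_on sA sB (\<lambda>x. b) S"
  using assms
  by (intro holomorphic_map_onI[where f' = "\<lambda>_ _. 0"]) (auto simp: smooth_on_def Ck_on_const)

lemma holomorphic_map_on_add:
  assumes f: "holomorphic_map_on sA sB f S" and g: "holomorphic_map_on sA sB g S"
    and "\<And>c x y. sB c (x + y) = sB c x + sB c y"
  shows "holomorphic_map_on sA sB (\<lambda>x. f x + g x) S"
proof (rule holomorphic_map_onI)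
  show "smooth_on (\<lambda>x. f x + g x) S"
    using f g by (auto simp: holomorphic_map_on_def smooth_on_def intro: Ck_on_add)
  show "((\<lambda>x. f x + g x) has_derivative
      (\<lambda>v. frechet_derivative f (at x) v + frechet_derivative g (at x) v)) (at x)" if "x \<in> S" for x
    using that by (intro has_derivative_add holomorphic_map_onD(3)[OF f] holomorphic_map_onD(3)[OF g])
qed (simp add: holomorphic_map_onD(4)[OF f] holomorphic_map_onD(4)[OF g] assms(3))

lemma holomorphic_map_on_bilinear:
  assumes b: "bilinear b"
    and "\<And>c x y. b (sB c x) y = sD c (b x y)" "\<And>c x y. b x (sC c y) = sD c (b x y)"
    and "\<And>c x y. sD c (x + y) = sD c x + sD c y"
    and f: "holomorphic_map_on sA sB f S" and g: "holomorphic_map_on sA sC g S"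
  shows "holomorphic_map_on sA sD (\<lambda>x. b (f x) (g x)) S"
proof (rule holomorphic_map_onI)
  have bb: "bounded_bilinear b" using b by (simp add: bilinear_conv_bounded_bilinear)
  show "smooth_on (\<lambda>x. b (f x) (g x)) S"
    using smooth_on_bilinear[OF bb] f g unfolding holomorphic_map_on_def by blast
  show "((\<lambda>x. b (f x) (g x)) has_derivative
        (\<lambda>v. b (f x) (frechet_derivative g (at x) v) + b (frechet_derivative f (at x) v) (g x))) (at x)"
    if "x \<in> S" for x
    using bounded_bilinear.FDERIV[OF bb holomorphic_map_onD(3)[OF f that] holomorphic_map_onD(3)[OF g that]] .
qed (simp add: holomorphic_map_onD(4)[OF f] holomorphic_map_onD(4)[OF g] assms(2-4))

lemma holomorphic_map_on_inverse:
  fixes f :: "'a::euclidean_space \<Rightarrow> complex"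
  assumes f: "holomorphic_map_on sA (*) f S" and "\<And>x. x \<in> S \<Longrightarrow> f x \<noteq> 0"
  shows "holomorphic_map_on sA (*) (\<lambda>x. inverse (f x)) S"
proof (rule holomorphic_map_onI)
  show "smooth_on (\<lambda>x. inverse (f x)) S"
    using assms by (auto simp: holomorphic_map_on_def smooth_on_def intro!: Ck_on_inverse)
  show "((\<lambda>x. inverse (f x)) has_derivative
      (\<lambda>v. - (inverse (f x) * frechet_derivative f (at x) v * inverse (f x)))) (at x)" if "x \<in> S" for x
    using Deriv.has_derivative_inverse[OF assms(2)[OF that] holomorphic_map_onD(3)[OF f that]] .
qed (simp add: holomorphic_map_onD(4)[OF f])

lemma holomorphic_rel_imp_continuous_on:
  assumes "holomorphic_rel sA sB f W"
  shows "continuous_on W f"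
  unfolding continuous_on_eq_continuous_within
proof
  fix p assume p: "p \<in> W"
  obtain N F where N: "p \<in> N" "holomorphic_map_on sA sB F N" "\<forall>q\<in>N \<inter> W. F q = f q"
    using assms p unfolding holomorphic_rel_def by blast
  have o: "open N" and "continuous_on N F"
    using holomorphic_map_onD[OF N(2)] smooth_on_imp_continuous_on by auto
  then have "continuous (at p within W) F"
    using N(1) continuous_at_imp_continuous_at_within continuous_on_eq_continuous_at by blast
  moreover have "eventually (\<lambda>q. F q = f q) (at p within W)"
    unfolding eventually_at_topological using o N by blast
  ultimately show "continuous (at p within W) f"
    using N p by (metis (mono_tags, lifting) Int_iff continuous_within tendsto_cong)
qed

lemma holomorphic_relI:
  assumes "holomorphic_map_on sA sB F N" "W \<subseteq> N" "\<And>q. q \<in> W \<Longrightarrow> F q = f q"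
  shows "holomorphic_rel sA sB f W"
  unfolding holomorphic_rel_def using assms by blast

section \<open>Homogeneous spaces of matrix groups\<close>

text \<open>The left coset gH without reference to a carrier: \<open>l_coset_eq\<close> identifies
  it with the library coset for every G. With a coset x in place of H the same function is left
  translation.\<close>

definition coset_proj :: "(complex^'m^'m::finite) set \<Rightarrow> complex^'m^'m \<Rightarrow> (complex^'m^'m) set" where
  "coset_proj H g = (**) g ` H"

text \<open>All groups here consist of complex orthogonal matrices, so inverses are transposes and
  the group axioms become closure conditions on matrices. Closedness of H makes the quotient
  Hausdorff.\<close>

locale matrix_pair =
  fixes G H :: "(complex^'m^'m::finite) set"
  assumes one_G: "mat 1 \<in> G"
    and mult_G: "\<And>a b. a \<in> G \<Longrightarrow> b \<in> G \<Longrightarrow> a ** b \<in> G"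
    and transpose_G: "\<And>a. a \<in> G \<Longrightarrow> transpose a \<in> G"
    and orthogonal_G: "\<And>a. a \<in> G \<Longrightarrow> transpose a ** a = mat 1"
    and H_sub: "H \<subseteq> G"
    and one_H: "mat 1 \<in> H"
    and mult_H: "\<And>a b. a \<in> H \<Longrightarrow> b \<in> H \<Longrightarrow> a ** b \<in> H"
    and transpose_H: "\<And>a. a \<in> H \<Longrightarrow> transpose a \<in> H"
    and closed_H: "closed H"
begin

abbreviation "\<pi> \<equiv> coset_proj H"
abbreviation "X \<equiv> coset_space G H"

lemma orthogonal_G': "a \<in> G \<Longrightarrow> a ** transpose a = mat 1"
  using orthogonal_G matrix_left_right_inverse by blast

lemma cancel_G: "a \<in> G \<Longrightarrow> transpose a ** (a ** b) = b" "a \<in> G \<Longrightarrow> a ** (transpose a ** b) = b"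
  by (simp_all add: matrix_mul_assoc orthogonal_G orthogonal_G')

lemma l_coset_eq: "(\<lambda>g. g <#\<^bsub>matrix_group G\<^esub> x) = (\<lambda>g. coset_proj x g)"
  by (auto simp: fun_eq_iff l_coset_def coset_proj_def matrix_group_def)

lemma translate_proj: "(**) g ` \<pi> a = \<pi> (g ** a)"
  by (auto simp: coset_proj_def image_image matrix_mul_assoc)

lemma proj_eq_iff:
  assumes "a \<in> G" "b \<in> G"
  shows "\<pi> a = \<pi> b \<longleftrightarrow> transpose a ** b \<in> H"
proof
  assume "\<pi> a = \<pi> b"
  moreover have "b \<in> \<pi> b" unfolding coset_proj_def using one_H by force
  ultimately obtain h where "h \<in> H" "b = a ** h" unfolding coset_proj_def by blast
  then show "transpose a ** b \<in> H" using assms by (simp add: cancel_G)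
next
  assume h: "transpose a ** b \<in> H"
  have *: "\<pi> (a ** h) \<subseteq> \<pi> a" if "h \<in> H" for a h
    using mult_H[OF that] by (auto simp: coset_proj_def matrix_mul_assoc[symmetric])
  have "b = a ** (transpose a ** b)" "a = b ** transpose (transpose a ** b)"
    using assms by (simp_all add: matrix_transpose_mul cancel_G)
  then show "\<pi> a = \<pi> b" using *[OF h, of a] *[OF transpose_H[OF h], of b] by auto
qed

lemma proj_mult_H: "a \<in> G \<Longrightarrow> h \<in> H \<Longrightarrow> \<pi> (a ** h) = \<pi> a"
  using H_sub proj_eq_iff[of a "a ** h"] mult_G[of a h] cancel_G(1)[of a h] by auto

lemma topspace_X: "topspace X = \<pi> ` G"
  by (simp add: coset_space_def topspace_quotient_topology l_coset_eq)

lemma lcosets_eq: "lcosets\<^bsub>matrix_group G\<^esub> H = \<pi> ` G"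
  using l_coset_eq[of H] by (auto simp: LCOSETS_def matrix_group_def fun_eq_iff)

lemma openin_X: "openin X U \<longleftrightarrow> U \<subseteq> \<pi> ` G \<and> openin (top_of_set G) {g \<in> G. \<pi> g \<in> U}"
  by (simp add: coset_space_def openin_quotient_topology l_coset_eq)

lemma continuous_proj: "continuous_map (top_of_set G) X \<pi>"
  unfolding continuous_map_def topspace_X by (simp add: openin_X image_subset_iff_funcset[symmetric])

lemma continuous_mult_right: "continuous_on S (\<lambda>g :: complex^'m^'m. g ** h)"
  unfolding matrix_matrix_mult_def
  by (intro continuous_on_vec_lambda continuous_on_sum continuous_on_mult continuous_on_component
      continuous_on_const continuous_on_id)

text \<open>The saturation of V is the union over h in H of the preimages of V under right
  multiplication by h, each of them open in G.\<close>

lemma open_map_proj: "open_map (top_of_set G) X \<pi>"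
  unfolding open_map_def
proof (intro allI impI)
  fix V assume V: "openin (top_of_set G) V"
  have VG: "V \<subseteq> G" using V openin_imp_subset by blast
  have eq: "{g \<in> G. \<pi> g \<in> \<pi> ` V} = (\<Union>h\<in>H. {g \<in> G. g ** h \<in> V})"
  proof (intro equalityI subsetI)
    fix g assume "g \<in> {g \<in> G. \<pi> g \<in> \<pi> ` V}"
    then obtain v where "g \<in> G" "v \<in> V" "\<pi> g = \<pi> v" by blast
    then have "transpose g ** v \<in> H" "g ** (transpose g ** v) \<in> V"
      using proj_eq_iff[of g v] VG by (auto simp: cancel_G)
    then show "g \<in> (\<Union>h\<in>H. {g \<in> G. g ** h \<in> V})" using \<open>g \<in> G\<close> by blast
  next
    fix g assume "g \<in> (\<Union>h\<in>H. {g \<in> G. g ** h \<in> V})"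
    then obtain h where "h \<in> H" "g \<in> G" "g ** h \<in> V" by blast
    then show "g \<in> {g \<in> G. \<pi> g \<in> \<pi> ` V}" using proj_mult_H[of g h] by (auto intro: rev_image_eqI)
  qed
  have "openin (top_of_set G) {g \<in> G. g ** h \<in> V}" if "h \<in> H" for h
  proof -
    have "(\<lambda>g. g ** h) \<in> G \<rightarrow> G" using that H_sub mult_G by blast
    then have "openin (top_of_set G) (G \<inter> (\<lambda>g. g ** h) -` V)"
      by (rule continuous_openin_preimage[OF continuous_mult_right _ V])
    moreover have "G \<inter> (\<lambda>g. g ** h) -` V = {g \<in> G. g ** h \<in> V}" by blast
    ultimately show ?thesis by simp
  qed
  then show "openin X (\<pi> ` V)" unfolding openin_X eq using VG by blast
qed

text \<open>The cosets of a and b differ iff \<open>transpose a ** b\<close> lies off H, an open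
  condition on the pair (a, b) because H is closed. A product neighbourhood of the pair therefore
  has disjoint images.\<close>

lemma Hausdorff_X: "Hausdorff_space X"
  unfolding Hausdorff_space_def topspace_X
proof (intro allI impI)
  fix x y assume "x \<in> \<pi> ` G \<and> y \<in> \<pi> ` G \<and> x \<noteq> y"
  then obtain a b where ab: "a \<in> G" "x = \<pi> a" "b \<in> G" "y = \<pi> b" "transpose a ** b \<notin> H"
    using proj_eq_iff by blast
  let ?f = "\<lambda>p :: (complex^'m^'m) \<times> (complex^'m^'m). transpose (fst p) ** snd p"
  have "continuous_on UNIV ?f"
    unfolding matrix_matrix_mult_def transpose_def
    by (intro continuous_on_vec_lambda continuous_on_sum continuous_on_mult) (auto intro!: continuous_intros)
  then have "open (?f -` (- H))"
    using closed_H by (intro open_vimage) auto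
  moreover have "(a, b) \<in> ?f -` (- H)" using ab(5) by simp
  ultimately obtain A B where AB: "open A" "open B" "(a, b) \<in> A \<times> B" "A \<times> B \<subseteq> ?f -` (- H)"
    by (rule open_prod_elim)
  have "openin X (\<pi> ` (G \<inter> A))" "openin X (\<pi> ` (G \<inter> B))"
    using open_map_proj AB(1,2) openin_open_Int unfolding open_map_def by blast+
  moreover have "disjnt (\<pi> ` (G \<inter> A)) (\<pi> ` (G \<inter> B))"
  proof -
    have "\<pi> a' \<noteq> \<pi> b'" if "a' \<in> G \<inter> A" "b' \<in> G \<inter> B" for a' b'
      using that AB(4) proj_eq_iff[of a' b'] by fastforce
    then show ?thesis unfolding disjnt_def by blast
  qed
  ultimately show "\<exists>U V. openin X U \<and> openin X V \<and> x \<in> U \<and> y \<in> V \<and> disjnt U V"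
    using ab AB(3) by blast
qed

lemma second_countable_X: "second_countable X"
proof (rule second_countable_open_map_image[OF continuous_proj open_map_proj])
  have "second_countable (euclidean :: (complex^'m^'m) topology)"
  proof -
    obtain B :: "(complex^'m^'m) set set" where "countable B" "topological_basis B"
      using ex_countable_basis by blast
    then show ?thesis
      unfolding second_countable_def by (metis open_openin topological_basisE topological_basis_open)
  qed
  then show "second_countable (top_of_set G)"
    by (rule second_countable_subtopology)
qed (simp add: topspace_X)

end

section \<open>Charts on the coset space\<close>

lemma holomorphic_map_on_open_vimage:
  assumes "holomorphic_map_on sA sB f S" "open T"
  shows "open (S \<inter> f -` T)"
  using continuous_open_preimage[OF smooth_on_imp_continuous_on[OF holomorphic_map_onD(1)[OF assms(1)]]
      holomorphic_map_onD(2)[OF assms(1)] assms(2)] .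

lemma mat_scale_mult:
  "mat_scale c (A ** B) = mat_scale c A ** B" "mat_scale c (A ** B) = A ** mat_scale c B"
  by (simp_all add: vec_eq_iff matrix_matrix_mult_def sum_distrib_left mult_ac)

lemma mat_scale_add: "mat_scale c (A + B) = mat_scale c A + mat_scale c B"
  by (simp add: vec_eq_iff algebra_simps)

lemma bilinear_matrix_mult: "bilinear ((**) :: complex^'n^'m \<Rightarrow> complex^'k^'n \<Rightarrow> complex^'k^'m)"
  unfolding bilinear_def linear_iff
  by (simp add: vec_eq_iff matrix_matrix_mult_def sum.distrib algebra_simps scaleR_right.sum)

lemma linear_matrix_mult_left: "linear ((**) (A :: complex^'n^'m) :: complex^'k^'n \<Rightarrow> complex^'k^'m)"
  and linear_matrix_mult_right: "linear (\<lambda>A :: complex^'n^'m. A ** (B :: complex^'k^'n))"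
  using bilinear_matrix_mult unfolding bilinear_def by auto

context matrix_pair
begin

lemma coset_charts_iff:
  "(U, \<phi>) \<in> coset_charts G H \<longleftrightarrow>
     openin X U \<and> inj_on \<phi> U \<and> open (\<phi> ` U) \<and>
     holomorphic_rel mat_scale (*s) (\<phi> \<circ> \<pi>) {g \<in> G. \<pi> g \<in> U} \<and>
     (\<forall>z \<in> \<phi> ` U. \<exists>V s. z \<in> V \<and> V \<subseteq> \<phi> ` U \<and> holomorphic_map_on (*s) mat_scale s V \<and> s ` V \<subseteq> G \<and>
        (\<forall>w\<in>V. \<pi> (s w) \<in> U \<and> \<phi> (\<pi> (s w)) = w))"
proof -
  have "g <#\<^bsub>matrix_group G\<^esub> H = \<pi> g" for g
    using l_coset_eq[of H] by meson
  then show ?thesis unfolding coset_charts_def Let_def by (simp only: mem_Collect_eq prod.case)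
qed

lemma coset_chartD:
  assumes "(U, \<phi>) \<in> coset_charts G H"
  shows "openin X U" "inj_on \<phi> U" "open (\<phi> ` U)" "U \<subseteq> \<pi> ` G"
    "holomorphic_rel mat_scale (*s) (\<phi> \<circ> \<pi>) {g \<in> G. \<pi> g \<in> U}"
  using assms openin_subset[of X U] by (simp_all add: coset_charts_iff topspace_X)

lemma coset_chart_sectionE:
  assumes "(U, \<phi>) \<in> coset_charts G H" "z \<in> \<phi> ` U"
  obtains V s where "z \<in> V" "V \<subseteq> \<phi> ` U" "holomorphic_map_on (*s) mat_scale s V" "s ` V \<subseteq> G"
    "\<And>w. w \<in> V \<Longrightarrow> \<pi> (s w) \<in> U" "\<And>w. w \<in> V \<Longrightarrow> \<phi> (\<pi> (s w)) = w"
    "\<And>w. w \<in> V \<Longrightarrow> inv_into U \<phi> w = \<pi> (s w)"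
proof -
  obtain V s where *: "z \<in> V" "V \<subseteq> \<phi> ` U" "holomorphic_map_on (*s) mat_scale s V" "s ` V \<subseteq> G"
    "\<forall>w\<in>V. \<pi> (s w) \<in> U \<and> \<phi> (\<pi> (s w)) = w"
    using bspec[OF assms(1)[unfolded coset_charts_iff, THEN conjunct2, THEN conjunct2, THEN conjunct2,
        THEN conjunct2] assms(2)] by (elim exE conjE)
  have "inv_into U \<phi> w = \<pi> (s w)" if "w \<in> V" for w
    using * that coset_chartD(2)[OF assms(1)] inv_into_f_f by metis
  then show thesis using that[of V s] * by metis
qed

lemma openin_saturated:
  assumes "openin X U"
  obtains O' where "open O'" "{g \<in> G. \<pi> g \<in> U} = G \<inter> O'"
  using assms unfolding openin_X openin_open by metis

text \<open>Charts are produced on the group: a function on an open saturated set D that separates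
  exactly the cosets descends to the quotient. The local sections in \<open>sec\<close> give both
  the openness of the image and the holomorphic inverse.\<close>

lemma coset_chartI:
  fixes \<zeta> :: "complex^'m^'m \<Rightarrow> complex^'n::finite"
  assumes D: "openin (top_of_set G) D" and hol: "holomorphic_rel mat_scale (*s) \<zeta> D"
    and DH: "\<And>g h. g \<in> D \<Longrightarrow> h \<in> H \<Longrightarrow> g ** h \<in> D"
    and inj: "\<And>a b. a \<in> D \<Longrightarrow> b \<in> D \<Longrightarrow> \<zeta> a = \<zeta> b \<longleftrightarrow> \<pi> a = \<pi> b"
    and sec: "\<And>z. z \<in> \<zeta> ` D \<Longrightarrow> \<exists>V s. z \<in> V \<and> holomorphic_map_on (*s) mat_scale s V \<and>
        (\<forall>w\<in>V. s w \<in> D \<and> \<zeta> (s w) = w)"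
  obtains \<phi> where "(\<pi> ` D, \<phi>) \<in> coset_charts G H" "\<And>g. g \<in> D \<Longrightarrow> \<phi> (\<pi> g) = \<zeta> g"
proof -
  define \<phi> where "\<phi> = (\<lambda>x. \<zeta> (SOME g. g \<in> D \<and> \<pi> g = x))"
  have DG: "D \<subseteq> G" using D openin_imp_subset by blast
  have \<phi>: "\<phi> (\<pi> g) = \<zeta> g" if "g \<in> D" for g
    unfolding \<phi>_def using someI[of "\<lambda>a. a \<in> D \<and> \<pi> a = \<pi> g" g] inj that by blast
  have img: "\<phi> ` \<pi> ` D = \<zeta> ` D"
    using \<phi> by (auto simp: image_image)
  have sat: "{g \<in> G. \<pi> g \<in> \<pi> ` D} = D"
  proof (intro equalityI subsetI)
    fix g assume "g \<in> {g \<in> G. \<pi> g \<in> \<pi> ` D}"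
    then obtain d where d: "g \<in> G" "d \<in> D" "\<pi> d = \<pi> g" by auto
    then have "transpose d ** g \<in> H" using proj_eq_iff DG by blast
    then have "d ** (transpose d ** g) \<in> D" using DH d by blast
    then show "g \<in> D" using d DG cancel_G(2)[of d g] by auto
  qed (use DG in blast)
  have "open (\<zeta> ` D)"
  proof (subst open_subopen, intro ballI)
    fix z assume "z \<in> \<zeta> ` D"
    from sec[OF this] obtain V s where V: "z \<in> V" "holomorphic_map_on (*s) mat_scale s V"
      "\<forall>w\<in>V. s w \<in> D \<and> \<zeta> (s w) = w" by blast
    then have "V \<subseteq> \<zeta> ` D" by (metis image_eqI subsetI)
    then show "\<exists>T. open T \<and> z \<in> T \<and> T \<subseteq> \<zeta> ` D" using V(1) holomorphic_map_onD(2)[OF V(2)] by blast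
  qed
  moreover have "openin X (\<pi> ` D)" using D open_map_proj unfolding open_map_def by blast
  moreover have "inj_on \<phi> (\<pi> ` D)" using \<phi> inj by (auto simp: inj_on_def)
  moreover have "holomorphic_rel mat_scale (*s) (\<phi> \<circ> \<pi>) D"
    using hol \<phi> unfolding holomorphic_rel_def by (simp add: Int_iff)
  moreover have "\<exists>V s. z \<in> V \<and> V \<subseteq> \<zeta> ` D \<and> holomorphic_map_on (*s) mat_scale s V \<and> s ` V \<subseteq> G \<and>
        (\<forall>w\<in>V. \<pi> (s w) \<in> \<pi> ` D \<and> \<phi> (\<pi> (s w)) = w)" if "z \<in> \<zeta> ` D" for z
  proof -
    from sec[OF that] obtain V s where V: "z \<in> V" "holomorphic_map_on (*s) mat_scale s V"
      "\<forall>w\<in>V. s w \<in> D \<and> \<zeta> (s w) = w" by blast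
    then have "V \<subseteq> \<zeta> ` D" by (metis image_eqI subsetI)
    then show ?thesis using V DG \<phi> by (intro exI[of _ V] exI[of _ s]) auto
  qed
  ultimately have "(\<pi> ` D, \<phi>) \<in> coset_charts G H"
    unfolding coset_charts_iff img sat by blast
  then show thesis using \<phi> that by blast
qed

lemma continuous_lift:
  assumes \<l>: "continuous_on G \<l>" "\<l> ` G \<subseteq> G" and f: "\<And>g. g \<in> G \<Longrightarrow> f (\<pi> g) = \<pi> (\<l> g)"
  shows "continuous_map X X f"
  unfolding continuous_map_def
proof (intro conjI allI impI)
  show "f \<in> topspace X \<rightarrow> topspace X" using \<l> f by (auto simp: topspace_X)
  fix V assume V: "openin X V"
  have "{g \<in> G. \<pi> g \<in> {x \<in> topspace X. f x \<in> V}} = G \<inter> \<l> -` {g \<in> G. \<pi> g \<in> V}"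
    using \<l>(2) f by (auto simp: topspace_X)
  moreover have "openin (top_of_set G) (G \<inter> \<l> -` {g \<in> G. \<pi> g \<in> V})"
    using V \<l> by (intro continuous_openin_preimage[of _ _ G]) (auto simp: openin_X)
  ultimately show "openin X {x \<in> topspace X. f x \<in> V}"
    unfolding openin_X by (auto simp: topspace_X)
qed

lemma continuous_on_linear: "linear (\<l> :: 'x::euclidean_space \<Rightarrow> 'y::euclidean_space) \<Longrightarrow> continuous_on S \<l>"
  by (simp add: linear_continuous_on linear_conv_bounded_linear)

text \<open>In charts the map is F \<circ> \<l> \<circ> s, with s a local section over the source
  and F a local extension of \<open>\<psi> \<circ> \<pi>\<close>. The function \<kappa> on scalars
  lets one lemma serve translations and transition maps (\<open>\<kappa> c = c\<close>) as well as
  the antiholomorphic involution (\<open>\<kappa> = cnj\<close>).\<close>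

lemma holomorphic_lift:
  fixes \<phi> \<psi> :: "(complex^'m^'m) set \<Rightarrow> complex^'n::finite"
  assumes U: "(U, \<phi>) \<in> coset_charts G H" and V: "(V, \<psi>) \<in> coset_charts G H"
    and lin: "linear \<l>" "\<And>c m. \<l> (mat_scale c m) = mat_scale (\<kappa> c) (\<l> m)" and sub: "\<l> ` G \<subseteq> G"
    and f: "\<And>g. g \<in> G \<Longrightarrow> f (\<pi> g) = \<pi> (\<l> g)"
  shows "holomorphic_map_on (*s) (\<lambda>c. (*s) (\<kappa> c)) (\<psi> \<circ> f \<circ> inv_into U \<phi>) (\<phi> ` {x\<in>U. f x \<in> V})"
proof (rule holomorphic_map_on_local)
  fix z assume "z \<in> \<phi> ` {x\<in>U. f x \<in> V}"
  then obtain x where x: "x \<in> U" "f x \<in> V" "z = \<phi> x" by blast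
  then obtain W s where W: "z \<in> W" "W \<subseteq> \<phi> ` U" "holomorphic_map_on (*s) mat_scale s W" "s ` W \<subseteq> G"
    "\<And>w. w \<in> W \<Longrightarrow> \<pi> (s w) \<in> U" "\<And>w. w \<in> W \<Longrightarrow> \<phi> (\<pi> (s w)) = w"
    "\<And>w. w \<in> W \<Longrightarrow> inv_into U \<phi> w = \<pi> (s w)"
    using x(1,3) by (auto intro: coset_chart_sectionE[OF U, of z])
  have "\<pi> (s z) = x" using W(1,5,6) x coset_chartD(2)[OF U] by (meson inj_onD)
  then have "\<l> (s z) \<in> {g \<in> G. \<pi> g \<in> V}" using x W(1,4) sub f by force
  then obtain N F where N: "\<l> (s z) \<in> N" "holomorphic_map_on mat_scale (*s) F N"
    "\<forall>g\<in>N \<inter> {g \<in> G. \<pi> g \<in> V}. F g = (\<psi> \<circ> \<pi>) g"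
    by (rule bspec[OF coset_chartD(5)[OF V, unfolded holomorphic_rel_def], THEN exE]) blast
  obtain Q where Q: "open Q" "{g \<in> G. \<pi> g \<in> V} = G \<inter> Q"
    by (rule openin_saturated[OF coset_chartD(1)[OF V]])
  define W' where "W' = W \<inter> (\<l> \<circ> s) -` (N \<inter> Q)"
  have \<l>: "holomorphic_map_on mat_scale (\<lambda>c. mat_scale (\<kappa> c)) \<l> UNIV"
    by (rule holomorphic_map_on_linear) (simp_all add: lin)
  have s: "holomorphic_map_on (*s) (\<lambda>c. mat_scale (\<kappa> c)) (\<l> \<circ> s) W"
    by (rule holomorphic_map_on_compose[OF W(3) \<l>]) simp
  have "open W'" unfolding W'_def
    by (rule holomorphic_map_on_open_vimage[OF s open_Int[OF holomorphic_map_onD(2)[OF N(2)] Q(1)]])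
  then have s': "holomorphic_map_on (*s) (\<lambda>c. mat_scale (\<kappa> c)) (\<l> \<circ> s) W'"
    by (rule holomorphic_map_on_subset[OF s]) (auto simp: W'_def)
  have hol: "holomorphic_map_on (*s) (\<lambda>c. (*s) (\<kappa> c)) (F \<circ> (\<l> \<circ> s)) W'"
    by (rule holomorphic_map_on_compose[OF s' holomorphic_map_on_scalars[OF N(2)]]) (auto simp: W'_def)
  have w: "\<l> (s w) \<in> N \<inter> {g \<in> G. \<pi> g \<in> V}" "f (\<pi> (s w)) = \<pi> (\<l> (s w))" if "w \<in> W'" for w
    using that W(4) sub f Q(2) unfolding W'_def by auto
  have "holomorphic_map_on (*s) (\<lambda>c. (*s) (\<kappa> c)) (\<psi> \<circ> f \<circ> inv_into U \<phi>) W'"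
  proof (rule holomorphic_map_on_cong[OF hol])
    fix w assume "w \<in> W'"
    then show "(F \<circ> (\<l> \<circ> s)) w = (\<psi> \<circ> f \<circ> inv_into U \<phi>) w"
      using w[OF \<open>w \<in> W'\<close>] N(3) W(7)[of w] by (auto simp: W'_def)
  qed
  moreover have "z \<in> W'" using W(1) N(1) Q(2) \<open>\<l> (s z) \<in> {g \<in> G. \<pi> g \<in> V}\<close> by (auto simp: W'_def)
  moreover have "W' \<subseteq> \<phi> ` {x\<in>U. f x \<in> V}"
  proof
    fix w assume "w \<in> W'"
    then have "\<pi> (s w) \<in> U" "f (\<pi> (s w)) \<in> V" "w = \<phi> (\<pi> (s w))"
      using w[OF \<open>w \<in> W'\<close>] W(5,6)[of w] by (auto simp: W'_def)
    then show "w \<in> \<phi> ` {x\<in>U. f x \<in> V}" by blast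
  qed
  ultimately show "\<exists>N. z \<in> N \<and> N \<subseteq> \<phi> ` {x\<in>U. f x \<in> V} \<and>
      holomorphic_map_on (*s) (\<lambda>c. (*s) (\<kappa> c)) (\<psi> \<circ> f \<circ> inv_into U \<phi>) N"
    by blast
qed

text \<open>Continuity of \<phi> descends from the group, the topology being the quotient one.
  Openness comes from the local sections: if Q is open with trace on G equal to the saturation of Y,
  the preimage of Q under a section is an open part of the image of Y.\<close>

lemma coset_chart_homeomorphic:
  fixes \<phi> :: "(complex^'m^'m) set \<Rightarrow> complex^'n::finite"
  assumes U: "(U, \<phi>) \<in> coset_charts G H"
  shows "homeomorphic_map (subtopology X U) (top_of_set (\<phi> ` U)) \<phi>"
proof (rule bijective_open_imp_homeomorphic_map)
  have op: "openin X U" and UX: "U \<subseteq> topspace X"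
    using coset_chartD(1,4)[OF U] topspace_X by auto
  have ts: "topspace (subtopology X U) = U" using UX by auto
  have cont: "continuous_on {g \<in> G. \<pi> g \<in> U} (\<phi> \<circ> \<pi>)"
    using holomorphic_rel_imp_continuous_on[OF coset_chartD(5)[OF U]] .
  show "continuous_map (subtopology X U) (top_of_set (\<phi> ` U)) \<phi>"
    unfolding continuous_map_in_subtopology
  proof
    show "continuous_map (subtopology X U) euclidean \<phi>"
      unfolding continuous_map_def ts
    proof (intro conjI allI impI)
      fix V :: "(complex^'n) set" assume "openin euclidean V"
      then have "openin (top_of_set {g \<in> G. \<pi> g \<in> U}) ({g \<in> G. \<pi> g \<in> U} \<inter> (\<phi> \<circ> \<pi>) -` V)"
        using cont by (simp add: continuous_openin_preimage_gen)
      then have "openin (top_of_set G) ({g \<in> G. \<pi> g \<in> U} \<inter> (\<phi> \<circ> \<pi>) -` V)"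
        using op openin_trans unfolding openin_X by blast
      moreover have "{g \<in> G. \<pi> g \<in> U} \<inter> (\<phi> \<circ> \<pi>) -` V = {g \<in> G. \<pi> g \<in> {x \<in> U. \<phi> x \<in> V}}" by auto
      ultimately have "openin X {x \<in> U. \<phi> x \<in> V}"
        using UX unfolding openin_X topspace_X by auto
      then show "openin (subtopology X U) {x \<in> U. \<phi> x \<in> V}"
        using openin_subset_topspace_eq op by (metis (no_types, lifting) openin_open_subtopology mem_Collect_eq subsetI)
    qed auto
    show "\<phi> \<in> topspace (subtopology X U) \<rightarrow> \<phi> ` U" unfolding ts by blast
  qed
  show "open_map (subtopology X U) (top_of_set (\<phi> ` U)) \<phi>"
    unfolding open_map_def
  proof (intro allI impI)
    fix Y assume "openin (subtopology X U) Y"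
    then have Y: "openin X Y" "Y \<subseteq> U" using op by (simp_all add: openin_open_subtopology)
    obtain Q where Q: "open Q" "{g \<in> G. \<pi> g \<in> Y} = G \<inter> Q"
      by (rule openin_saturated[OF Y(1)])
    have "open (\<phi> ` Y)"
    proof (subst open_subopen, intro ballI)
      fix z assume "z \<in> \<phi> ` Y"
      then obtain x where x: "x \<in> Y" "z = \<phi> x" by blast
      then obtain W s where W: "z \<in> W" "W \<subseteq> \<phi> ` U" "holomorphic_map_on (*s) mat_scale s W" "s ` W \<subseteq> G"
        "\<And>w. w \<in> W \<Longrightarrow> \<pi> (s w) \<in> U" "\<And>w. w \<in> W \<Longrightarrow> \<phi> (\<pi> (s w)) = w"
        using x Y(2) by (rule_tac coset_chart_sectionE[OF U, of z]) auto
      have "open (W \<inter> s -` Q)"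
        by (rule holomorphic_map_on_open_vimage[OF W(3) Q(1)])
      moreover have "\<pi> (s z) = x"
        using W(1,5,6) x Y(2) coset_chartD(2)[OF U] by (meson inj_onD subsetD)
      then have "z \<in> W \<inter> s -` Q" using W(1,4) x Q(2) by blast
      moreover have "W \<inter> s -` Q \<subseteq> \<phi> ` Y"
      proof
        fix w assume "w \<in> W \<inter> s -` Q"
        then have "\<pi> (s w) \<in> Y" "w = \<phi> (\<pi> (s w))" using W(4,6) Q(2) by auto
        then show "w \<in> \<phi> ` Y" by blast
      qed
      ultimately show "\<exists>T. open T \<and> z \<in> T \<and> T \<subseteq> \<phi> ` Y" by blast
    qed
    then show "openin (top_of_set (\<phi> ` U)) (\<phi> ` Y)"
      using Y(2) coset_chartD(3)[OF U] by (simp add: image_mono openin_open_eq)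
  qed
  show "\<phi> ` topspace (subtopology X U) = topspace (top_of_set (\<phi> ` U))" using ts by simp
  show "inj_on \<phi> (topspace (subtopology X U))" using coset_chartD(2)[OF U] ts by simp
qed

text \<open>Left translation by g acts on the atlas. Hence the translates of one nonempty chart
  cover the space, and a slice built in a chart at the base point can be moved by the conjugating
  element.\<close>

lemma translate_chart:
  fixes \<phi> :: "(complex^'m^'m) set \<Rightarrow> complex^'n::finite"
  assumes U: "(U, \<phi>) \<in> coset_charts G H" and g: "g \<in> G"
  shows "((`) ((**) g) ` U, \<lambda>x. \<phi> ((**) (transpose g) ` x)) \<in> coset_charts G H"
proof -
  let ?U = "(`) ((**) g) ` U" and ?\<phi> = "\<lambda>x. \<phi> ((**) (transpose g) ` x)"
  have UX: "U \<subseteq> \<pi> ` G" using coset_chartD(4)[OF U] .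
  have inv: "(**) (transpose g) ` ((**) g ` x) = x" for x
    using g by (auto simp: image_image cancel_G)
  have inv': "(**) g ` ((**) (transpose g) ` x) = x" for x
    using g by (auto simp: image_image cancel_G)
  have img: "?\<phi> ` ?U = \<phi> ` U" by (simp only: image_image[of ?\<phi>] inv)
  have mem: "\<pi> a \<in> ?U \<longleftrightarrow> \<pi> (transpose g ** a) \<in> U" for a
    using inv inv' translate_proj by (metis image_iff)
  have sat: "{a \<in> G. \<pi> a \<in> ?U} = {a \<in> G. transpose g ** a \<in> {b \<in> G. \<pi> b \<in> U}}"
    using mem mult_G transpose_G g by auto
  have lin: "linear ((**) (transpose g) :: complex^'m^'m \<Rightarrow> _)" by (rule linear_matrix_mult_left)
  have "openin (top_of_set G) (G \<inter> (**) (transpose g) -` {b \<in> G. \<pi> b \<in> U})"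
    using coset_chartD(1)[OF U] mult_G transpose_G g continuous_on_linear[OF lin]
    by (intro continuous_openin_preimage[of _ _ G]) (auto simp: openin_X)
  moreover have "G \<inter> (**) (transpose g) -` {b \<in> G. \<pi> b \<in> U} = {a \<in> G. \<pi> a \<in> ?U}"
    unfolding sat by blast
  moreover have "?U \<subseteq> \<pi> ` G" using UX mult_G g by (auto simp: translate_proj)
  ultimately have 1: "openin X ?U" unfolding openin_X by metis
  have 2: "inj_on ?\<phi> ?U"
    using coset_chartD(2)[OF U] unfolding inj_on_def by (auto simp: inv simp del: image_ident)
  have 3: "open (?\<phi> ` ?U)" using coset_chartD(3)[OF U] unfolding img .
  have 4: "holomorphic_rel mat_scale (*s) (?\<phi> \<circ> \<pi>) {a \<in> G. \<pi> a \<in> ?U}"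
    unfolding holomorphic_rel_def
  proof
    fix a assume a: "a \<in> {a \<in> G. \<pi> a \<in> ?U}"
    then obtain N F where N: "transpose g ** a \<in> N" "holomorphic_map_on mat_scale (*s) F N"
      "\<forall>q\<in>N \<inter> {b \<in> G. \<pi> b \<in> U}. F q = (\<phi> \<circ> \<pi>) q"
      using coset_chartD(5)[OF U] unfolding holomorphic_rel_def sat by blast
    let ?N = "(**) (transpose g) -` N"
    have "open ?N"
      by (intro open_vimage continuous_on_linear lin holomorphic_map_onD(2)[OF N(2)])
    then have h: "holomorphic_map_on mat_scale mat_scale ((**) (transpose g)) ?N"
      by (intro holomorphic_map_on_linear lin mat_scale_mult(2)[symmetric])
    have "holomorphic_map_on mat_scale (*s) (F \<circ> (**) (transpose g)) ?N"
      by (rule holomorphic_map_on_compose[OF h N(2)]) blast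
    moreover have "\<forall>q\<in>?N \<inter> {a \<in> G. \<pi> a \<in> ?U}. (F \<circ> (**) (transpose g)) q = (?\<phi> \<circ> \<pi>) q"
      unfolding sat using N(3) by (auto simp: translate_proj)
    ultimately show "\<exists>N F. a \<in> N \<and> holomorphic_map_on mat_scale (*s) F N \<and>
        (\<forall>q\<in>N \<inter> {a \<in> G. \<pi> a \<in> ?U}. F q = (?\<phi> \<circ> \<pi>) q)"
      using N(1) by blast
  qed
  have 5: "\<exists>V s. z \<in> V \<and> V \<subseteq> \<phi> ` U \<and> holomorphic_map_on (*s) mat_scale s V \<and> s ` V \<subseteq> G \<and>
        (\<forall>w\<in>V. \<pi> (s w) \<in> ?U \<and> ?\<phi> (\<pi> (s w)) = w)" if z: "z \<in> \<phi> ` U" for z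
  proof -
    obtain V s where V: "z \<in> V" "V \<subseteq> \<phi> ` U" "holomorphic_map_on (*s) mat_scale s V" "s ` V \<subseteq> G"
      "\<And>w. w \<in> V \<Longrightarrow> \<pi> (s w) \<in> U" "\<And>w. w \<in> V \<Longrightarrow> \<phi> (\<pi> (s w)) = w"
      using coset_chart_sectionE[OF U z] by metis
    have h: "holomorphic_map_on mat_scale mat_scale ((**) g :: complex^'m^'m \<Rightarrow> _) UNIV"
      by (intro holomorphic_map_on_linear linear_matrix_mult_left mat_scale_mult(2)[symmetric] open_UNIV)
    have "holomorphic_map_on (*s) mat_scale ((**) g \<circ> s) V"
      by (rule holomorphic_map_on_compose[OF V(3) h]) simp
    moreover have "((**) g \<circ> s) ` V \<subseteq> G" using V(4) mult_G g by auto
    moreover have "\<pi> (((**) g \<circ> s) w) \<in> ?U \<and> ?\<phi> (\<pi> (((**) g \<circ> s) w)) = w" if "w \<in> V" for w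
      using V(5,6)[OF that] by (simp add: translate_proj[symmetric] inv)
    ultimately show ?thesis using V(1,2) by blast
  qed
  show ?thesis unfolding coset_charts_iff img using 1 2 3 4 5 img by auto
qed

lemma chart_at:
  fixes \<phi> :: "(complex^'m^'m) set \<Rightarrow> complex^'n::finite"
  assumes "(U, \<phi>) \<in> coset_charts G H" "U \<noteq> {}" "x \<in> topspace X"
  obtains V and \<psi> :: "(complex^'m^'m) set \<Rightarrow> complex^'n" where "(V, \<psi>) \<in> coset_charts G H" "x \<in> V"
proof -
  obtain y where y: "y \<in> U" using assms by blast
  then have "y \<in> \<pi> ` G" using coset_chartD(4)[OF assms(1)] by blast
  then obtain a b where ab: "a \<in> G" "y = \<pi> a" "b \<in> G" "x = \<pi> b" using assms(3) topspace_X by auto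
  have "b ** transpose a \<in> G" using ab mult_G transpose_G by blast
  moreover have "x = (**) (b ** transpose a) ` y"
    unfolding ab(2,4) translate_proj matrix_mul_assoc[symmetric] orthogonal_G[OF ab(1)] by simp
  ultimately show thesis using translate_chart[OF assms(1)] y that by blast
qed

theorem complex_manifold_coset_space:
  assumes "(U, \<phi>) \<in> (coset_charts G H :: (_, 'n::finite) chart set)" "U \<noteq> {}"
  shows "complex_manifold X (coset_charts G H :: (_, 'n) chart set)"
  unfolding complex_manifold_def
proof (intro conjI Hausdorff_X second_countable_X)
  have "V \<subseteq> topspace X" if "(V, \<psi>) \<in> (coset_charts G H :: (_, 'n) chart set)" for V \<psi>
    using coset_chartD(4)[OF that] topspace_X by simp
  moreover have "\<exists>V \<psi>. (V, \<psi>) \<in> (coset_charts G H :: (_, 'n) chart set) \<and> x \<in> V"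
    if "x \<in> topspace X" for x
    using chart_at[OF assms that] by metis
  ultimately show "(\<Union>(U, \<phi>)\<in>(coset_charts G H :: (_, 'n) chart set). U) = topspace X"
    by fastforce
  show "\<forall>(U, \<phi>)\<in>(coset_charts G H :: (_, 'n) chart set). openin X U \<and> open (\<phi> ` U) \<and>
        homeomorphic_map (subtopology X U) (top_of_set (\<phi> ` U)) \<phi>"
    using coset_chart_homeomorphic coset_chartD(1,3) by blast
  have "holomorphic_map_on (*s) (*s) (\<psi> \<circ> inv_into U \<phi>) (\<phi> ` (U \<inter> V))"
    if "(U, \<phi>) \<in> (coset_charts G H :: (_, 'n) chart set)" "(V, \<psi>) \<in> (coset_charts G H :: (_, 'n) chart set)"
    for U V \<phi> \<psi>
  proof -
    have "holomorphic_map_on (*s) (*s) (\<psi> \<circ> id \<circ> inv_into U \<phi>) (\<phi> ` {x\<in>U. id x \<in> V})"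
      by (rule holomorphic_lift[OF that, of id "\<lambda>c. c" id]) (simp_all add: linear_id)
    moreover have "{x\<in>U. id x \<in> V} = U \<inter> V" by auto
    ultimately show ?thesis by (simp only: comp_id)
  qed
  then show "\<forall>(U, \<phi>)\<in>(coset_charts G H :: (_, 'n) chart set). \<forall>(V, \<psi>)\<in>(coset_charts G H :: (_, 'n) chart set).
        holomorphic_map_on (*s) (*s) (\<psi> \<circ> inv_into U \<phi>) (\<phi> ` (U \<inter> V))"
    by auto
qed

end

section \<open>A criterion for strong visibility\<close>

abbreviation cnj_mat :: "complex^'n^'m \<Rightarrow> complex^'n^'m" where
  "cnj_mat \<equiv> map_matrix cnj"

lemma cnj_mat_mult: "cnj_mat (A ** B) = cnj_mat A ** cnj_mat B"
  by (simp add: vec_eq_iff matrix_matrix_mult_def)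

lemma cnj_mat_cnj_mat [simp]: "cnj_mat (cnj_mat A) = A"
  by (simp add: vec_eq_iff)

lemma cnj_mat_transpose: "cnj_mat (transpose A) = transpose (cnj_mat A)"
  by (simp add: vec_eq_iff transpose_def)

lemma cnj_mat_mat_1 [simp]: "cnj_mat (mat 1) = mat 1"
  by (simp add: vec_eq_iff mat_def)

lemma linear_cnj_mat: "linear (cnj_mat :: complex^'n^'m \<Rightarrow> _)"
  by (rule linearI) (simp_all add: vec_eq_iff complex_eq_iff)

lemma cnj_mat_scale: "cnj_mat (mat_scale c A) = mat_scale (cnj c) (cnj_mat A)"
  by (simp add: vec_eq_iff)

lemma m_inv_matrix_group:
  fixes a :: "complex^'m^'m::finite"
  assumes "transpose a \<in> S" "transpose a ** a = mat 1"
  shows "inv\<^bsub>matrix_group S\<^esub> a = transpose a"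
proof -
  have *: "a ** transpose a = mat 1" using assms(2) matrix_left_right_inverse by blast
  show ?thesis
    unfolding m_inv_def
  proof (rule the_equality)
    show "transpose a \<in> carrier (matrix_group S) \<and>
        a \<otimes>\<^bsub>matrix_group S\<^esub> transpose a = \<one>\<^bsub>matrix_group S\<^esub> \<and>
        transpose a \<otimes>\<^bsub>matrix_group S\<^esub> a = \<one>\<^bsub>matrix_group S\<^esub>"
      by (simp add: matrix_group_def assms *)
    fix y assume "y \<in> carrier (matrix_group S) \<and> a \<otimes>\<^bsub>matrix_group S\<^esub> y = \<one>\<^bsub>matrix_group S\<^esub> \<and>
        y \<otimes>\<^bsub>matrix_group S\<^esub> a = \<one>\<^bsub>matrix_group S\<^esub>"
    then have "a ** y = mat 1" by (simp add: matrix_group_def)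
    then show "y = transpose a"
      using assms(2) by (metis matrix_mul_assoc matrix_mul_lid matrix_mul_rid)
  qed
qed

section \<open>Left translation as a holomorphic group action\<close>

context matrix_pair
begin

text \<open>The ambient set S is G when maximality among compact subgroups is at issue, and the set
  of invertible matrices when K has to be a matrix Lie group; in both the inverse of an element of G
  is its transpose.\<close>

lemma subgroup_iff:
  assumes "G \<subseteq> S"
  shows "K \<subseteq> G \<and> subgroup K (matrix_group S) \<longleftrightarrow>
    K \<subseteq> G \<and> mat 1 \<in> K \<and> (\<forall>a\<in>K. \<forall>b\<in>K. a ** b \<in> K) \<and> (\<forall>a\<in>K. transpose a \<in> K)"
proof -
  have "inv\<^bsub>matrix_group S\<^esub> a = transpose a" if "a \<in> G" for a
    using assms transpose_G[OF that] orthogonal_G[OF that] by (intro m_inv_matrix_group) auto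
  then have "(\<forall>a\<in>K. inv\<^bsub>matrix_group S\<^esub> a \<in> K) \<longleftrightarrow> (\<forall>a\<in>K. transpose a \<in> K)" if "K \<subseteq> G"
    using that by (metis subsetD)
  moreover have "subgroup K (matrix_group S) \<longleftrightarrow> K \<subseteq> S \<and> mat 1 \<in> K \<and>
      (\<forall>a\<in>K. \<forall>b\<in>K. a ** b \<in> K) \<and> (\<forall>a\<in>K. inv\<^bsub>matrix_group S\<^esub> a \<in> K)"
    by (auto simp: subgroup_def matrix_group_def)
  ultimately show ?thesis using assms by (cases "K \<subseteq> G") auto
qed

lemma left_translation_eq: "x \<in> topspace X \<Longrightarrow> left_translation G H g x = (**) g ` x"
  unfolding left_translation_def lcosets_eq topspace_X
  using l_coset_eq[of x] by (simp add: fun_eq_iff coset_proj_def)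

lemma left_translation_proj: "a \<in> G \<Longrightarrow> left_translation G H g (\<pi> a) = \<pi> (g ** a)"
  by (simp add: left_translation_eq topspace_X translate_proj)

lemma group_matrix_group:
  assumes "K \<subseteq> G" "mat 1 \<in> K" "\<And>a b. a \<in> K \<Longrightarrow> b \<in> K \<Longrightarrow> a ** b \<in> K" "\<And>a. a \<in> K \<Longrightarrow> transpose a \<in> K"
  shows "group (matrix_group K)"
proof (rule groupI)
  fix x assume "x \<in> carrier (matrix_group K)"
  then show "\<exists>y\<in>carrier (matrix_group K). y \<otimes>\<^bsub>matrix_group K\<^esub> x = \<one>\<^bsub>matrix_group K\<^esub>"
    using assms(1,4) orthogonal_G[of x] by (auto simp: matrix_group_def intro!: bexI[of _ "transpose x"])
qed (use assms in \<open>auto simp: matrix_group_def matrix_mul_assoc\<close>)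

lemma group_action_left_translation:
  assumes "K \<subseteq> G" "mat 1 \<in> K" "\<And>a b. a \<in> K \<Longrightarrow> b \<in> K \<Longrightarrow> a ** b \<in> K" "\<And>a. a \<in> K \<Longrightarrow> transpose a \<in> K"
  shows "group_action (matrix_group K) (topspace X) (left_translation G H)"
proof -
  let ?L = "left_translation G H"
  have maps: "?L g \<in> topspace X \<rightarrow> topspace X" if "g \<in> G" for g
    using that mult_G by (auto simp: topspace_X left_translation_proj)
  have ext: "?L g \<in> extensional (topspace X)" for g
    unfolding left_translation_def lcosets_eq topspace_X by simp
  have comp: "?L (g ** h) = compose (topspace X) (?L g) (?L h)" if "h \<in> G" for g h
  proof (rule extensionalityI[OF ext])
    show "compose (topspace X) (?L g) (?L h) \<in> extensional (topspace X)" by simp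
    fix x assume x: "x \<in> topspace X"
    then obtain a where "a \<in> G" "x = \<pi> a" by (auto simp: topspace_X)
    then show "?L (g ** h) x = compose (topspace X) (?L g) (?L h) x"
      using mult_G[OF that] by (simp add: compose_eq[OF x[unfolded \<open>x = \<pi> a\<close>]] left_translation_proj matrix_mul_assoc)
  qed
  have id: "?L (mat 1) x = x" if "x \<in> topspace X" for x
    using that by (auto simp: topspace_X left_translation_proj)
  have bij: "?L g \<in> Bij (topspace X)" if "g \<in> G" for g
  proof -
    have "?L (transpose g) (?L g x) = x" "?L g (?L (transpose g) x) = x" if "x \<in> topspace X" for x
      using that mult_G transpose_G \<open>g \<in> G\<close> by (auto simp: topspace_X left_translation_proj cancel_G)
    then have "bij_betw (?L g) (topspace X) (topspace X)"
      using maps[OF \<open>g \<in> G\<close>] maps[OF transpose_G[OF \<open>g \<in> G\<close>]]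
      by (intro bij_betwI[where g = "?L (transpose g)"])
    then show ?thesis using ext by (simp add: Bij_def)
  qed
  have "group_hom (matrix_group K) (BijGroup (topspace X)) ?L"
  proof (intro group_hom.intro group_hom_axioms.intro homI)
    show "group (matrix_group K)" by (rule group_matrix_group[OF assms])
    show "group (BijGroup (topspace X))" by (rule group_BijGroup)
    show "?L g \<in> carrier (BijGroup (topspace X))" if "g \<in> carrier (matrix_group K)" for g
      using that bij assms(1) by (auto simp: BijGroup_def matrix_group_def)
    show "?L (g \<otimes>\<^bsub>matrix_group K\<^esub> h) = ?L g \<otimes>\<^bsub>BijGroup (topspace X)\<^esub> ?L h"
      if "g \<in> carrier (matrix_group K)" "h \<in> carrier (matrix_group K)" for g h
      using that bij comp assms(1) by (auto simp: BijGroup_def matrix_group_def subset_iff)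
  qed
  then show ?thesis by (rule group_action.intro)
qed

text \<open>Joint continuity and joint smoothness are inherited from matrix multiplication: over a
  local section s the action reads \<open>F (g ** s z)\<close> in charts, where F extends
  \<open>\<psi> \<circ> \<pi>\<close> to an open set of matrices.\<close>

theorem holomorphic_action_left_translation:
  assumes K: "K \<subseteq> G" "mat 1 \<in> K" "\<And>a b. a \<in> K \<Longrightarrow> b \<in> K \<Longrightarrow> a ** b \<in> K" "\<And>a. a \<in> K \<Longrightarrow> transpose a \<in> K"
  shows "holomorphic_action K (left_translation G H) X (coset_charts G H :: (_, 'n::finite) chart set)"
  unfolding holomorphic_action_def
proof (intro conjI ballI)
  let ?L = "left_translation G H" and ?A = "coset_charts G H :: (_, 'n::finite) chart set"
  show "group_action (matrix_group K) (topspace X) ?L"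
    by (rule group_action_left_translation[OF assms])
  show "holomorphic_manifold_map X ?A X ?A (?L g)" if "g \<in> K" for g
  proof -
    have g: "g \<in> G" using that K by blast
    have lin: "linear ((**) g :: complex^'m^'m \<Rightarrow> _)" by (rule linear_matrix_mult_left)
    have sub: "(**) g ` G \<subseteq> G" using mult_G g by auto
    have "continuous_map X X (?L g)"
      by (rule continuous_lift[OF continuous_on_linear[OF lin] sub]) (simp add: left_translation_proj)
    moreover have "holomorphic_map_on (*s) (*s) (\<psi> \<circ> ?L g \<circ> inv_into U \<phi>) (\<phi> ` {x\<in>U. ?L g x \<in> V})"
      if "(U, \<phi>) \<in> ?A" "(V, \<psi>) \<in> ?A" for U V \<phi> \<psi>
      by (rule holomorphic_lift[OF that, of "(**) g" "\<lambda>c. c"])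
        (use lin sub in \<open>simp_all add: mat_scale_mult(2) left_translation_proj\<close>)
    ultimately show ?thesis unfolding holomorphic_manifold_map_def by auto
  qed
  have cm: "continuous_on UNIV (\<lambda>p :: (complex^'m^'m) \<times> (complex^'m^'m). fst p ** snd p)"
    by (rule bounded_bilinear.continuous_on[OF bilinear_matrix_mult[unfolded bilinear_conv_bounded_bilinear]
          continuous_on_fst[OF continuous_on_id] continuous_on_snd[OF continuous_on_id]])
  show "continuous_map (prod_topology (top_of_set K) X) X (\<lambda>(g, x). ?L g x)"
    unfolding continuous_map_def
  proof (intro conjI allI impI)
    show "(\<lambda>(g, x). ?L g x) \<in> topspace (prod_topology (top_of_set K) X) \<rightarrow> topspace X"
      using K(1) mult_G by (auto simp: topspace_X left_translation_proj subset_iff)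
    fix V assume "openin X V"
    then obtain Q where Q: "open Q" "{g \<in> G. \<pi> g \<in> V} = G \<inter> Q"
      by (rule openin_saturated)
    show "openin (prod_topology (top_of_set K) X)
        {p \<in> topspace (prod_topology (top_of_set K) X). (case p of (g, x) \<Rightarrow> ?L g x) \<in> V}"
    proof (subst openin_subopen, intro ballI)
      fix p assume "p \<in> {p \<in> topspace (prod_topology (top_of_set K) X). (case p of (g, x) \<Rightarrow> ?L g x) \<in> V}"
      then obtain k a where ka: "p = (k, \<pi> a)" "k \<in> K" "a \<in> G" "\<pi> (k ** a) \<in> V"
        by (auto simp: topspace_X left_translation_proj)
      have "k ** a \<in> Q" using ka K(1) mult_G Q(2) by blast
      then have 2: "(k, a) \<in> (\<lambda>p. fst p ** snd p) -` Q" by simp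
      have "open ((\<lambda>p :: (complex^'m^'m) \<times> (complex^'m^'m). fst p ** snd p) -` Q)"
        by (rule open_vimage[OF Q(1) cm])
      from this 2 obtain B C where BC: "open B" "open C" "(k, a) \<in> B \<times> C"
          "B \<times> C \<subseteq> (\<lambda>p. fst p ** snd p) -` Q"
        by (rule open_prod_elim)
      have "openin (top_of_set K) (K \<inter> B)" using BC(1) by (rule openin_open_Int)
      moreover have "openin X (\<pi> ` (G \<inter> C))"
        using open_map_proj openin_open_Int[OF BC(2), of G] unfolding open_map_def by blast
      ultimately have "openin (prod_topology (top_of_set K) X) ((K \<inter> B) \<times> \<pi> ` (G \<inter> C))"
        by (simp add: openin_prod_Times_iff)
      moreover have "p \<in> (K \<inter> B) \<times> \<pi> ` (G \<inter> C)" using ka BC(3) by auto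
      moreover have "?L g x \<in> V" if gx: "g \<in> K \<inter> B" "x \<in> \<pi> ` (G \<inter> C)" for g x
      proof -
        obtain c where c: "c \<in> G" "c \<in> C" "x = \<pi> c" using gx by blast
        then have "g ** c \<in> Q" "g ** c \<in> G" using gx BC(4) mult_G K(1) by auto
        then show ?thesis using Q(2) c by (auto simp: left_translation_proj)
      qed
      then have "(K \<inter> B) \<times> \<pi> ` (G \<inter> C) \<subseteq>
          {p \<in> topspace (prod_topology (top_of_set K) X). (case p of (g, x) \<Rightarrow> ?L g x) \<in> V}"
        by (auto simp: topspace_X)
      ultimately show "\<exists>T. openin (prod_topology (top_of_set K) X) T \<and> p \<in> T \<and>
          T \<subseteq> {p \<in> topspace (prod_topology (top_of_set K) X). (case p of (g, x) \<Rightarrow> ?L g x) \<in> V}"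
        by blast
    qed
  qed
  have "smooth_rel (\<lambda>(g, z). \<psi> (?L g (inv_into U \<phi> z)))
          {(g, z). g \<in> K \<and> z \<in> \<phi> ` U \<and> ?L g (inv_into U \<phi> z) \<in> V}"
    if U: "(U, \<phi>) \<in> ?A" and V: "(V, \<psi>) \<in> ?A" for U V \<phi> \<psi>
    unfolding smooth_rel_def
  proof
    fix p assume "p \<in> {(g, z). g \<in> K \<and> z \<in> \<phi> ` U \<and> ?L g (inv_into U \<phi> z) \<in> V}"
    then obtain k z where p: "p = (k, z)" "k \<in> K" "z \<in> \<phi> ` U" "?L k (inv_into U \<phi> z) \<in> V" by blast
    then obtain W s where W: "z \<in> W" "W \<subseteq> \<phi> ` U" "holomorphic_map_on (*s) mat_scale s W" "s ` W \<subseteq> G"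
      "\<And>w. w \<in> W \<Longrightarrow> inv_into U \<phi> w = \<pi> (s w)"
      by (auto intro: coset_chart_sectionE[OF U, of z])
    have Ls: "?L g (inv_into U \<phi> w) = \<pi> (g ** s w)" if "w \<in> W" for g w
      using W(4,5) that by (auto simp: left_translation_proj)
    have "k ** s z \<in> {g \<in> G. \<pi> g \<in> V}"
    proof -
      have "s z \<in> G" "k \<in> G" using W(1,4) p(2) K(1) by auto
      then show ?thesis using p(4) mult_G unfolding Ls[OF W(1)] by simp
    qed
    then obtain N F where N: "k ** s z \<in> N" "holomorphic_map_on mat_scale (*s) F N"
      "\<forall>g\<in>N \<inter> {g \<in> G. \<pi> g \<in> V}. F g = (\<psi> \<circ> \<pi>) g"
      by (rule bspec[OF coset_chartD(5)[OF V, unfolded holomorphic_rel_def], THEN exE]) blast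
    let ?m = "\<lambda>p :: (complex^'m^'m) \<times> (complex^'n). fst p ** s (snd p)"
    have sm: "smooth_on ?m (UNIV \<times> W)"
    proof (rule smooth_on_bilinear[where b = "(**)" and f = fst and g = "\<lambda>p. s (snd p)"])
      show "bounded_bilinear ((**) :: complex^'m^'m \<Rightarrow> complex^'m^'m \<Rightarrow> complex^'m^'m)"
        using bilinear_matrix_mult unfolding bilinear_conv_bounded_bilinear .
      have o: "open (UNIV \<times> W)" using holomorphic_map_onD(2)[OF W(3)] by (simp add: open_Times)
      show "smooth_on fst (UNIV \<times> W)" by (rule smooth_on_linear[OF bounded_linear_fst o])
      have "smooth_on (s \<circ> snd) (UNIV \<times> W)"
        by (rule smooth_on_compose[OF smooth_on_linear[OF bounded_linear_snd o] holomorphic_map_onD(1)[OF W(3)]]) auto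
      then show "smooth_on (\<lambda>x. s (snd x)) (UNIV \<times> W)" unfolding o_def .
    qed
    define M where "M = (UNIV \<times> W) \<inter> ?m -` N"
    have "open M" unfolding M_def
      using continuous_open_preimage[OF smooth_on_imp_continuous_on[OF sm] _ holomorphic_map_onD(2)[OF N(2)]] sm
      by (simp add: smooth_on_def)
    then have smM: "smooth_on ?m M"
      by (rule smooth_on_subset[OF sm]) (auto simp: M_def)
    have "smooth_on (F \<circ> ?m) M"
      by (rule smooth_on_compose[OF smM holomorphic_map_onD(1)[OF N(2)]]) (auto simp: M_def)
    moreover have "p \<in> M" using p(1) W(1) N(1) by (simp add: M_def)
    moreover have "(F \<circ> ?m) (g, w) = \<psi> (?L g (inv_into U \<phi> w))"
      if "(g, w) \<in> M" "g \<in> K" "?L g (inv_into U \<phi> w) \<in> V" for g w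
    proof -
      have w: "w \<in> W" using that by (simp add: M_def)
      have "g ** s w \<in> N \<inter> {g \<in> G. \<pi> g \<in> V}"
      proof -
        have "s w \<in> G" "g \<in> G" using W(4) w that(2) K(1) by auto
        then show ?thesis using that mult_G unfolding Ls[OF w] by (auto simp: M_def)
      qed
      then show ?thesis using N(3) Ls[OF w, of g] by simp
    qed
    ultimately show "\<exists>N F. p \<in> N \<and> smooth_on F N \<and>
        (\<forall>q\<in>N \<inter> {(g, z). g \<in> K \<and> z \<in> \<phi> ` U \<and> ?L g (inv_into U \<phi> z) \<in> V}.
          F q = (case q of (g, z) \<Rightarrow> \<psi> (?L g (inv_into U \<phi> z))))"
      by (intro exI[of _ M] exI[of _ "F \<circ> ?m"]) auto
  qed
  then show "case x of (U, \<phi>) \<Rightarrow> \<forall>(V, \<psi>)\<in>?A. smooth_rel (\<lambda>(g, z). \<psi> (?L g (inv_into U \<phi> z)))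
          {(g, z). g \<in> K \<and> z \<in> \<phi> ` U \<and> ?L g (inv_into U \<phi> z) \<in> V}" if "x \<in> ?A" for x
    using that by auto
qed

end

text \<open>What is left of strong visibility once the compact group has been conjugated to the real
  points of G. \<open>slice_meets\<close> yields (V.1), \<open>A_slice\<close> yields (S.1) for the
  map that sends gH to A conj(g) H, and the chart that straightens the slice shows that it is a real
  submanifold. \<open>connected_orbit\<close> concerns real k only: every other point is reached
  from there along a translate of the slice.\<close>

locale slice_data = matrix_pair G H
  for G H :: "(complex^'m^'m::finite) set" +
  fixes U\<^sub>0 :: "(complex^'m^'m) set set" and \<phi>\<^sub>0 :: "(complex^'m^'m) set \<Rightarrow> complex^'n::finite"
    and S\<^sub>0 :: "(complex^'m^'m) set set" and j :: 'n and A :: "complex^'m^'m"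
  assumes cnj_G: "\<And>g. g \<in> G \<Longrightarrow> cnj_mat g \<in> G"
    and cnj_H: "\<And>g. g \<in> H \<Longrightarrow> cnj_mat g \<in> H"
    and chart0: "(U\<^sub>0, \<phi>\<^sub>0) \<in> coset_charts G H" and ball0: "ball 0 1 \<subseteq> \<phi>\<^sub>0 ` U\<^sub>0"
    and slice0: "S\<^sub>0 \<subseteq> U\<^sub>0" "\<phi>\<^sub>0 ` S\<^sub>0 = {r *\<^sub>R axis j \<i> |r. \<bar>r\<bar> < 1}"
    and one_S0: "coset_proj H (mat 1) \<in> S\<^sub>0"
    and slice_meets: "\<And>g. g \<in> G \<Longrightarrow> \<exists>k\<in>G. cnj_mat k = k \<and> coset_proj H (k ** g) \<in> S\<^sub>0"
    and A: "A \<in> H" "cnj_mat A = A" "A ** A = mat 1"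
    and A_slice: "\<And>g. g \<in> G \<Longrightarrow> coset_proj H g \<in> S\<^sub>0 \<Longrightarrow> coset_proj H (A ** cnj_mat g) = coset_proj H g"
    and connected_orbit: "\<And>k. k \<in> G \<Longrightarrow> cnj_mat k = k \<Longrightarrow>
      \<exists>C. connectedin (coset_space G H) C \<and> coset_proj H (mat 1) \<in> C \<and> coset_proj H k \<in> C"
begin

lemma A_G: "A \<in> G"
  using A H_sub by blast

lemma connected_X: "connected_space X"
proof -
  have o: "\<pi> (mat 1) \<in> topspace X" using one_G by (simp add: topspace_X)
  have "connected (\<phi>\<^sub>0 ` S\<^sub>0)"
  proof -
    have "\<phi>\<^sub>0 ` S\<^sub>0 = (\<lambda>r. r *\<^sub>R axis j \<i>) ` {-1<..<1}" unfolding slice0(2) by (auto simp: abs_less_iff)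
    then show ?thesis by (auto intro!: connected_continuous_image continuous_intros)
  qed
  then have "connectedin (top_of_set (\<phi>\<^sub>0 ` U\<^sub>0)) (\<phi>\<^sub>0 ` S\<^sub>0)"
    using slice0(1) by (simp add: connectedin_subtopology image_mono)
  then have "connectedin (subtopology X U\<^sub>0) S\<^sub>0"
    using homeomorphic_map_connectedness[OF coset_chart_homeomorphic[OF chart0], of S\<^sub>0] slice0(1)
      coset_chartD(4)[OF chart0] by (auto simp: topspace_X)
  then have S: "connectedin X S\<^sub>0" by (simp add: connectedin_subtopology)
  have "\<exists>C. connectedin X C \<and> \<pi> (mat 1) \<in> C \<and> x \<in> C" if x: "x \<in> topspace X" for x
  proof -
    obtain g where g: "g \<in> G" "x = \<pi> g" using x by (auto simp: topspace_X)
    then obtain k where k: "k \<in> G" "cnj_mat k = k" "\<pi> (k ** g) \<in> S\<^sub>0" using slice_meets by blast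
    let ?L = "left_translation G H (transpose k)"
    have tk: "transpose k \<in> G" "cnj_mat (transpose k) = transpose k"
      using k transpose_G by (simp_all add: cnj_mat_transpose)
    have "(**) (transpose k) ` G \<subseteq> G" using mult_G tk by auto
    then have "continuous_map X X ?L"
      by (intro continuous_lift[OF continuous_on_linear[OF linear_matrix_mult_left]])
        (simp_all add: left_translation_proj)
    then have C1: "connectedin X (?L ` S\<^sub>0)" using S by (rule connectedin_continuous_map_image)
    have "?L (\<pi> (k ** g)) = x" using k g mult_G by (simp add: left_translation_proj cancel_G)
    then have x1: "x \<in> ?L ` S\<^sub>0" using k(3) by blast
    \<comment> \<open>The slice contains the base point, so its translate joins x to the coset of
      \<open>transpose k\<close>, and \<open>connected_orbit\<close> joins that coset to the base
      point.\<close>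
    have "?L (\<pi> (mat 1)) = \<pi> (transpose k)" by (simp add: left_translation_proj one_G)
    then have k1: "\<pi> (transpose k) \<in> ?L ` S\<^sub>0" using one_S0 by (metis imageI)
    obtain C where C: "connectedin X C" "\<pi> (mat 1) \<in> C" "\<pi> (transpose k) \<in> C"
      using connected_orbit[OF tk] by blast
    have "connectedin X (C \<union> ?L ` S\<^sub>0)"
      using C C1 k1 by (intro connectedin_Un) auto
    then show ?thesis using C x1 by blast
  qed
  then show ?thesis
    unfolding connected_space_subconnected using o
    by (metis connected_space_eq_not_separated connectedin_def connected_component_of_def connected_component_of_sym connected_component_of_trans)
qed

theorem strongly_visible_conjugate:
  assumes q: "q \<in> G" and K: "K = {q ** u ** transpose q |u. u \<in> G \<and> cnj_mat u = u}" and cK: "compact K"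
  shows "strongly_visible K (left_translation G H) X (coset_charts G H :: (_, 'n) chart set)"
proof -
  let ?L = "left_translation G H" and ?A = "coset_charts G H :: (_, 'n) chart set"
  have tq: "transpose q \<in> G" using q transpose_G by blast
  have KG: "K \<subseteq> G" using q tq mult_G unfolding K by blast
  have K1: "mat 1 \<in> K"
    using one_G orthogonal_G'[OF q] unfolding K by (auto intro!: exI[of _ "mat 1"])
  have Km: "a ** b \<in> K" if ab: "a \<in> K" "b \<in> K" for a b
  proof -
    obtain u v where "a = q ** u ** transpose q" "b = q ** v ** transpose q" "u ** v \<in> G"
      "cnj_mat (u ** v) = u ** v"
      using ab mult_G unfolding K by (auto simp: cnj_mat_mult)
    moreover from this have "a ** b = q ** (u ** v) ** transpose q"
      by (simp add: matrix_mul_assoc[symmetric] cancel_G q)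
    ultimately show ?thesis unfolding K by blast
  qed
  have Kt: "transpose a \<in> K" if a: "a \<in> K" for a
  proof -
    obtain u where "a = q ** u ** transpose q" "u \<in> G" "cnj_mat u = u" using a unfolding K by blast
    then have "transpose a = q ** transpose u ** transpose q" "transpose u \<in> G" "cnj_mat (transpose u) = transpose u"
      by (simp_all add: matrix_transpose_mul matrix_mul_assoc transpose_G cnj_mat_transpose)
    then show ?thesis unfolding K by blast
  qed
  have inv: "invertible a" if "a \<in> G" for a
    using orthogonal_G[OF that] orthogonal_G'[OF that] unfolding invertible_def by blast
  have lie: "matrix_lie_group K"
    unfolding matrix_lie_group_def
  proof
    have "G \<subseteq> {A. invertible A}" using inv by blast
    then show "subgroup K (matrix_group {A. invertible A})"
      using subgroup_iff[of "{A. invertible A}" K] KG K1 Km Kt by blast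
    show "closedin (top_of_set {A. invertible A}) K"
      using KG inv compact_imp_closed[OF cK] by (intro closed_subset) auto
  qed
  have U0ne: "U\<^sub>0 \<noteq> {}" using one_S0 slice0(1) by blast
  \<comment> \<open>The map g \<mapsto> A conj(g) of the real case, transported by left translation
    with q. It descends to cosets because conjugation preserves H.\<close>
  define l where "l = (\<lambda>g :: complex^'m^'m. q ** (A ** cnj_mat (transpose q ** g)))"
  have lin: "linear l"
    unfolding l_def using linear_compose[OF linear_compose[OF linear_compose[OF linear_matrix_mult_left linear_cnj_mat] linear_matrix_mult_left] linear_matrix_mult_left]
    by (simp add: o_def)
  have lscale: "l (mat_scale c m) = mat_scale (cnj c) (l m)" for c m
    by (simp add: l_def mat_scale_mult(2)[symmetric] cnj_mat_scale)
  have lG: "l g \<in> G" if "g \<in> G" for g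
    unfolding l_def using q tq A_G that by (intro mult_G cnj_G)
  have ll: "l (l g) = g" for g
  proof -
    have "l (l g) = q ** (A ** cnj_mat (A ** cnj_mat (transpose q ** g)))"
      by (simp add: l_def cancel_G q)
    also have "A ** cnj_mat (A ** cnj_mat (transpose q ** g)) = transpose q ** g"
      using A(2,3) by (metis cnj_mat_mult cnj_mat_cnj_mat matrix_mul_assoc matrix_mul_lid)
    finally show ?thesis by (simp add: cancel_G q)
  qed
  define f where "f = (\<lambda>x. \<pi> (l (SOME g. g \<in> G \<and> \<pi> g = x)))"
  have f: "f (\<pi> g) = \<pi> (l g)" if g: "g \<in> G" for g
  proof -
    define g' where "g' = (SOME a. a \<in> G \<and> \<pi> a = \<pi> g)"
    have g': "g' \<in> G" "\<pi> g' = \<pi> g"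
      using someI[of "\<lambda>a. a \<in> G \<and> \<pi> a = \<pi> g" g] g unfolding g'_def by auto
    define h where "h = transpose g ** g'"
    have "h \<in> H" using g' g proj_eq_iff[of g g'] by (simp add: h_def)
    moreover have "g' = g ** h" unfolding h_def by (simp add: cancel_G g)
    then have "l g' = l g ** cnj_mat h" by (simp add: l_def cnj_mat_mult matrix_mul_assoc)
    ultimately have "\<pi> (l g') = \<pi> (l g)" using proj_mult_H lG g cnj_H by simp
    then show ?thesis by (simp add: f_def g'_def)
  qed
  have fc: "continuous_map X X f"
    by (rule continuous_lift[OF continuous_on_linear[OF lin]]) (use lG f in auto)
  have ff: "f (f x) = x" if "x \<in> topspace X" for x
    using that f lG ll by (auto simp: topspace_X)
  have anti: "antiholomorphic_manifold_map X ?A X ?A f"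
  proof -
    have "antiholomorphic_map_on (*s) (*s) (\<psi> \<circ> f \<circ> inv_into U \<phi>) (\<phi> ` {x\<in>U. f x \<in> V})"
      if "(U, \<phi>) \<in> ?A" "(V, \<psi>) \<in> ?A" for U V \<phi> \<psi>
      unfolding antiholomorphic_map_on_def
      by (rule holomorphic_lift[OF that, where \<l> = l and \<kappa> = cnj]) (use lG lin lscale f in auto)
    then show ?thesis unfolding antiholomorphic_manifold_map_def using fc by auto
  qed
  have diffeo: "antiholomorphic_diffeo X ?A f"
    unfolding antiholomorphic_diffeo_def using anti fc ff by (auto simp: homeomorphic_maps_def)
  define S where "S = (`) ((**) q) ` S\<^sub>0"
  have S0G: "S\<^sub>0 \<subseteq> \<pi> ` G" using slice0(1) coset_chartD(4)[OF chart0] by blast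
  have SX: "S \<subseteq> topspace X"
    using S0G mult_G q by (auto simp: S_def topspace_X subset_iff translate_proj)
  have Smem: "\<exists>s\<in>G. x = \<pi> (q ** s) \<and> \<pi> s \<in> S\<^sub>0" if x: "x \<in> S" for x
  proof -
    obtain y where y: "y \<in> S\<^sub>0" "x = (**) q ` y" using x unfolding S_def by blast
    then obtain s where "s \<in> G" "y = \<pi> s" using S0G by blast
    then show ?thesis using y by (auto simp: translate_proj)
  qed
  have SmemI: "\<pi> (q ** s) \<in> S" if "\<pi> s \<in> S\<^sub>0" for s
    using that unfolding S_def translate_proj[symmetric] by blast
  have sub: "real_submanifold X ?A S"
    unfolding real_submanifold_def
  proof (intro conjI SX exI[of _ 1] ballI)
    fix p assume p: "p \<in> S"
    \<comment> \<open>In the translated chart the slice is already a segment of the line spanned by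
      \<open>axis j \<i>\<close>, so the identity on the unit ball serves as flattening map.\<close>
    let ?U = "(`) ((**) q) ` U\<^sub>0" and ?\<phi> = "\<lambda>x. \<phi>\<^sub>0 ((**) (transpose q) ` x)"
    let ?L = "span {axis j \<i>} :: (complex^'n) set"
    have iv: "(**) (transpose q) ` ((**) q ` x) = x" for x
      using q by (auto simp: image_image cancel_G)
    have SU: "S \<subseteq> ?U" using slice0(1) by (auto simp: S_def)
    have img: "?\<phi> ` ?U = \<phi>\<^sub>0 ` U\<^sub>0" "?\<phi> ` S = \<phi>\<^sub>0 ` S\<^sub>0"
      unfolding S_def by (simp_all only: image_image[of ?\<phi>] iv)
    have "?\<phi> p \<in> {r *\<^sub>R axis j \<i> |r. \<bar>r\<bar> < 1}" using p img(2) slice0(2) by blast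
    then have pb: "?\<phi> p \<in> ball 0 1" by auto
    have SU': "S \<inter> ?U = S" using SU by blast
    have "ball 0 1 \<inter> {r *\<^sub>R axis j \<i> |r. \<bar>r\<bar> < 1} = ball 0 1 \<inter> ?L"
      unfolding span_singleton by auto
    then have flat: "id ` (ball 0 1 \<inter> ?\<phi> ` (S \<inter> ?U)) = id ` ball 0 1 \<inter> ?L"
      unfolding SU' img(2) slice0(2) by simp
    have "dim ?L = 1" by (simp add: dim_eq_card_independent axis_eq_0_iff)
    moreover have "smooth_on (id :: complex^'n \<Rightarrow> _) (ball 0 1)" "smooth_on (id :: complex^'n \<Rightarrow> _) (id ` ball 0 1)"
      by (simp_all add: smooth_on_linear bounded_linear_ident[folded id_def])
    ultimately have fin: "p \<in> ?U \<and> ?\<phi> p \<in> ball 0 1 \<and> ball 0 1 \<subseteq> ?\<phi> ` ?U \<and>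
        smooth_on id (ball 0 1 :: (complex^'n) set) \<and>
        smooth_on id (id ` ball 0 1 :: (complex^'n) set) \<and> (\<forall>w\<in>ball 0 1 :: (complex^'n) set. id (id w) = w) \<and>
        subspace ?L \<and> dim ?L = 1 \<and> id ` (ball 0 1 \<inter> ?\<phi> ` (S \<inter> ?U)) = id ` ball 0 1 \<inter> ?L"
      using pb p SU ball0 flat img by auto
    have "\<exists>W (F :: complex^'n \<Rightarrow> complex^'n) F' L.
        p \<in> ?U \<and> ?\<phi> p \<in> W \<and> W \<subseteq> ?\<phi> ` ?U \<and>
        smooth_on F W \<and> smooth_on F' (F ` W) \<and> (\<forall>w\<in>W. F' (F w) = w) \<and>
        subspace L \<and> dim L = 1 \<and> F ` (W \<inter> ?\<phi> ` (S \<inter> ?U)) = F ` W \<inter> L"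
      by (rule exI[of _ "ball 0 1"], rule exI[of _ id], rule exI[of _ id], rule exI[of _ ?L], rule fin)
    then show "\<exists>(U, \<phi>)\<in>?A. \<exists>W (F :: complex^'n \<Rightarrow> complex^'n) F' L.
        p \<in> U \<and> \<phi> p \<in> W \<and> W \<subseteq> \<phi> ` U \<and>
        smooth_on F W \<and> smooth_on F' (F ` W) \<and> (\<forall>w\<in>W. F' (F w) = w) \<and>
        subspace L \<and> dim L = 1 \<and> F ` (W \<inter> \<phi> ` (S \<inter> U)) = F ` W \<inter> L"
      by (intro bexI[OF _ translate_chart[OF chart0 q]]) (simp only: prod.case)
  qed
  have decomp: "\<exists>u s. u \<in> G \<and> cnj_mat u = u \<and> s \<in> G \<and> \<pi> s \<in> S\<^sub>0 \<and> x = \<pi> (q ** (u ** s))"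
    if x: "x \<in> topspace X" for x
  proof -
    obtain a where a: "a \<in> G" "x = \<pi> a" using x by (auto simp: topspace_X)
    then obtain k where k: "k \<in> G" "cnj_mat k = k" "\<pi> (k ** (transpose q ** a)) \<in> S\<^sub>0"
      using slice_meets[OF mult_G[OF tq a(1)]] by blast
    have "q ** (transpose k ** (k ** (transpose q ** a))) = a" by (simp add: cancel_G k q)
    then show ?thesis
      using a k tq transpose_G[OF k(1)] by (metis cnj_mat_transpose mult_G)
  qed
  have V1: "topspace X = (\<Union>g\<in>K. ?L g ` S)"
  proof (intro equalityI subsetI)
    fix x assume "x \<in> topspace X"
    then obtain u s where us: "u \<in> G" "cnj_mat u = u" "s \<in> G" "\<pi> s \<in> S\<^sub>0" "x = \<pi> (q ** (u ** s))"
      using decomp by blast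
    have "?L (q ** u ** transpose q) (\<pi> (q ** s)) = \<pi> (q ** (u ** s))"
      using us q mult_G by (simp add: left_translation_proj matrix_mul_assoc[symmetric] cancel_G)
    moreover have "q ** u ** transpose q \<in> K" using us unfolding K by blast
    ultimately show "x \<in> (\<Union>g\<in>K. ?L g ` S)" using SmemI[OF us(4)] us(5) by (metis UN_I imageI)
  next
    fix x assume "x \<in> (\<Union>g\<in>K. ?L g ` S)"
    then show "x \<in> topspace X"
      using Smem KG mult_G q by (fastforce simp: topspace_X left_translation_proj)
  qed
  have S1: "f x = x" if "x \<in> S" for x
  proof -
    obtain s where s: "s \<in> G" "x = \<pi> (q ** s)" "\<pi> s \<in> S\<^sub>0" using Smem[OF \<open>x \<in> S\<close>] by blast
    then have "f x = \<pi> (q ** (A ** cnj_mat s))" using f mult_G q by (simp add: l_def cancel_G)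
    also have "\<dots> = (**) q ` \<pi> (A ** cnj_mat s)" by (simp add: translate_proj)
    also have "\<dots> = x" using A_slice s by (simp add: translate_proj)
    finally show ?thesis .
  qed
  have S2: "f x \<in> orbit (matrix_group K) ?L x" if "x \<in> topspace X" for x
  proof -
    obtain u s where us: "u \<in> G" "cnj_mat u = u" "s \<in> G" "\<pi> s \<in> S\<^sub>0" "x = \<pi> (q ** (u ** s))"
      using decomp[OF \<open>x \<in> topspace X\<close>] by blast
    \<comment> \<open>For x = q u s H, inserting A A = 1 gives \<sigma>(x) = q (A u A) (A conj(s))
      H, which is q (A u A) s H by \<open>A_slice\<close>. The element of K that takes x there is q
      v q^T with v = A u A u^T.\<close>
    define v where "v = A ** (u ** (A ** transpose u))"
    have v: "v \<in> G" "cnj_mat v = v"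
      using us A_G A mult_G transpose_G by (simp_all add: v_def cnj_mat_mult cnj_mat_transpose)
    have "f x = \<pi> (q ** (A ** (u ** cnj_mat s)))"
    proof -
      have "l (q ** (u ** s)) = q ** (A ** cnj_mat (u ** s))" by (simp add: l_def cancel_G q)
      then show ?thesis using us f[of "q ** (u ** s)"] mult_G q by (simp add: cnj_mat_mult)
    qed
    also have "A ** (u ** cnj_mat s) = A ** (u ** (A ** (A ** cnj_mat s)))"
      using A(3) by (simp add: matrix_mul_assoc)
    also have "\<pi> (q ** (A ** (u ** (A ** (A ** cnj_mat s))))) = (**) (q ** (A ** (u ** A))) ` \<pi> (A ** cnj_mat s)"
      by (simp add: translate_proj matrix_mul_assoc)
    also have "\<dots> = \<pi> (q ** (A ** (u ** (A ** s))))"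
      using A_slice us by (simp add: translate_proj matrix_mul_assoc)
    also have "\<dots> = ?L (q ** v ** transpose q) x"
      using us q mult_G by (simp add: left_translation_proj v_def matrix_mul_assoc[symmetric] cancel_G)
    finally show ?thesis
      using v unfolding orbit_def K by (auto simp: matrix_group_def)
  qed
  show ?thesis
    unfolding strongly_visible_def
    using lie complex_manifold_coset_space[OF chart0 U0ne] connected_X
      holomorphic_action_left_translation[OF KG K1 Km Kt] sub diffeo V1 S1 S2
    by (intro conjI exI[of _ S] exI[of _ f]) auto
qed

end

section \<open>Conjugating compact subgroups into the real points\<close>

text \<open>Were the span of the eigenvectors proper, its orthogonal complement V would be a nonzero
  f-invariant subspace. A maximiser of the quadratic form of f on the unit sphere of V would be an
  eigenvector in V, hence orthogonal to itself.\<close>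

lemma self_adjoint_eigenvectors_span:
  fixes f :: "'a::euclidean_space \<Rightarrow> 'a"
  assumes lin: "linear f" and sa: "\<And>x y. f x \<bullet> y = x \<bullet> f y"
  shows "span {x. \<exists>c. f x = c *\<^sub>R x} = UNIV"
proof (rule ccontr)
  let ?E = "{x. \<exists>c. f x = c *\<^sub>R x}"
  define V where "V = {v. \<forall>e\<in>?E. e \<bullet> v = 0}"
  assume "span ?E \<noteq> UNIV"
  then have "dim ?E \<noteq> DIM('a)" by (simp add: dim_eq_full)
  then have "dim ?E < DIM('a)" using dim_subset_UNIV[of ?E] by linarith
  from orthogonal_to_subspace_exists[OF this] obtain u where
    u: "u \<noteq> 0" "\<And>y. y \<in> span ?E \<Longrightarrow> orthogonal u y" by metis
  have uV: "u \<in> V"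
    using u(2)[OF span_base] by (auto simp: V_def orthogonal_def inner_commute)
  have Vsub: "subspace V" unfolding V_def subspace_def by (auto simp: inner_add_right)
  have Vinv: "f v \<in> V" if "v \<in> V" for v
    using that sa[symmetric] by (auto simp: V_def)
  let ?K = "V \<inter> sphere 0 1"
  have "compact ?K" using closed_subspace[OF Vsub] by (simp add: closed_Int_compact)
  moreover have "(1 / norm u) *\<^sub>R u \<in> ?K" using u(1) uV Vsub by (auto simp: subspace_scale)
  moreover have "continuous_on ?K (\<lambda>v. v \<bullet> f v)"
    by (intro continuous_intros linear_continuous_on) (use lin in \<open>simp add: linear_conv_bounded_linear\<close>)
  ultimately obtain v where v: "v \<in> ?K" and mx: "\<And>w. w \<in> ?K \<Longrightarrow> w \<bullet> f w \<le> v \<bullet> f v"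
    using continuous_attains_sup[of ?K "\<lambda>v. v \<bullet> f v"] by blast
  define c where "c = v \<bullet> f v"
  have Q: "0 \<le> c * (w \<bullet> w) - w \<bullet> f w" if w: "w \<in> V" for w
  proof (cases "w = 0")
    case False
    have "(1 / norm w) *\<^sub>R w \<in> ?K" using False w Vsub by (auto simp: subspace_scale)
    then have "((1 / norm w) *\<^sub>R w) \<bullet> f ((1 / norm w) *\<^sub>R w) \<le> c" using mx unfolding c_def by blast
    then have "(w \<bullet> f w) / (norm w)\<^sup>2 \<le> c"
      by (simp add: linear_scale[OF lin] power2_eq_square)
    then show ?thesis using False by (simp add: divide_le_eq power2_norm_eq_inner)
  qed simp
  \<comment> \<open>The form in \<open>Q\<close> is nonnegative on V and vanishes at v, so v lies in
    its kernel. Testing it on v - t w, with the residual w, gives - 2 t |w|^2 + t^2 q \<ge> 0 for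
    all t.\<close>
  define w where "w = c *\<^sub>R v - f v"
  have wV: "w \<in> V" unfolding w_def using v Vinv Vsub by (simp add: subspace_diff subspace_scale)
  define q where "q = c * (w \<bullet> w) - w \<bullet> f w"
  define b where "b = w \<bullet> w"
  have vv: "v \<bullet> v = 1" using v by (simp add: dot_square_norm)
  have wv: "c * (v \<bullet> w) - v \<bullet> f w = b"
    using sa[of v w] by (simp add: b_def w_def inner_diff_left)
  have "0 \<le> - 2 * t * b + t\<^sup>2 * q" for t
  proof -
    have "v - t *\<^sub>R w \<in> V" using v wV Vsub by (simp add: subspace_diff subspace_scale)
    from Q[OF this] have "0 \<le> c * ((v - t *\<^sub>R w) \<bullet> (v - t *\<^sub>R w)) - (v - t *\<^sub>R w) \<bullet> f (v - t *\<^sub>R w)" .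
    also have "\<dots> = (c * (v \<bullet> v) - v \<bullet> f v) - t * ((c * (v \<bullet> w) - v \<bullet> f w) + (c * (v \<bullet> w) - w \<bullet> f v)) + t\<^sup>2 * q"
      by (simp add: linear_diff[OF lin] linear_scale[OF lin] inner_diff_left inner_diff_right q_def
          power2_eq_square algebra_simps inner_commute)
    also have "w \<bullet> f v = v \<bullet> f w" using sa[of v w] by (simp add: inner_commute)
    also have "c * (v \<bullet> v) - v \<bullet> f v = 0" by (simp add: vv c_def)
    finally show ?thesis unfolding wv by simp
  qed
  note Qt = this
  have q0: "0 \<le> q" using Q[OF wV] by (simp add: q_def)
  have "b \<le> 0"
  proof (rule ccontr)
    assume "\<not> b \<le> 0"
    then have bp: "0 < b" by simp
    \<comment> \<open>Any small positive t would do; the denominator q + 1 stays positive even if q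
      vanishes.\<close>
    define t where "t = b / (q + 1)"
    have bt: "b = t * (q + 1)" and "t \<noteq> 0" using q0 bp by (simp_all add: t_def)
    have "0 \<le> - 2 * t * b + t\<^sup>2 * q" by (rule Qt)
    also have "\<dots> = t\<^sup>2 * (q - 2 * (q + 1))"
      unfolding bt by (simp add: power2_eq_square algebra_simps)
    also have "\<dots> < 0" using \<open>t \<noteq> 0\<close> q0 by (intro mult_pos_neg) auto
    finally show False by simp
  qed
  then have "w = 0" using inner_ge_zero[of w] unfolding b_def by (metis inner_eq_zero_iff order_antisym)
  then have "f v = c *\<^sub>R v" by (simp add: w_def)
  then have "v \<in> ?E" by blast
  then have "v \<bullet> v = 0" using v by (auto simp: V_def)
  then show False using vv by simp
qed

section \<open>Functional calculus for Hermitian matrices\<close>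

definition adjoint_mat :: "complex^'n^'m \<Rightarrow> complex^'m^'n" where
  "adjoint_mat A = transpose (cnj_mat A)"

lemma adjoint_mat_mult: "adjoint_mat (A ** B) = adjoint_mat B ** adjoint_mat A"
  by (simp add: adjoint_mat_def cnj_mat_mult matrix_transpose_mul)

lemma adjoint_mat_adjoint_mat [simp]: "adjoint_mat (adjoint_mat A) = A"
  by (simp add: adjoint_mat_def vec_eq_iff transpose_def)

text \<open>The inner product of the type class is the real part of the standard Hermitian form, and
  adjointness is meant in this real sense. It makes the spectral theorem for real self-adjoint maps
  applicable to complex matrices.\<close>

lemma inner_matrix_vector:
  fixes A :: "complex^'n^'m"
  shows "(A *v x) \<bullet> y = x \<bullet> (adjoint_mat A *v y)"
proof -
  have *: "(a * b) \<bullet> c = b \<bullet> (cnj a * c)" for a b c :: complex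
    by (simp add: inner_complex_def algebra_simps)
  have "(A *v x) \<bullet> y = (\<Sum>i\<in>UNIV. \<Sum>j\<in>UNIV. (A $ i $ j * x $ j) \<bullet> y $ i)"
    by (simp add: inner_vec_def matrix_vector_mult_def inner_sum_left)
  also have "\<dots> = (\<Sum>j\<in>UNIV. \<Sum>i\<in>UNIV. x $ j \<bullet> (cnj (A $ i $ j) * y $ i))"
    unfolding * by (rule sum.swap)
  also have "\<dots> = x \<bullet> (adjoint_mat A *v y)"
    by (simp add: inner_vec_def matrix_vector_mult_def inner_sum_right adjoint_mat_def transpose_def)
  finally show ?thesis .
qed

lemma linear_matrix_vector: "linear ((*v) (A :: complex^'n^'m))"
  by simp

lemma hermitian_eigenvectors_span:
  fixes p :: "complex^'n^'n"
  assumes "adjoint_mat p = p"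
  shows "span {x. \<exists>c::real. p *v x = c *\<^sub>R x} = UNIV"
  using assms inner_matrix_vector[of p] by (intro self_adjoint_eigenvectors_span) auto

lemma linear_eq_on_eigenvectors:
  fixes p :: "complex^'n^'n"
  assumes "adjoint_mat p = p" "linear f" "linear g"
    and "\<And>x c. p *v x = (c::real) *\<^sub>R x \<Longrightarrow> f x = g x"
  shows "f = g"
proof
  fix x
  have "x \<in> span {x. \<exists>c::real. p *v x = c *\<^sub>R x}" using hermitian_eigenvectors_span[OF assms(1)] by simp
  then show "f x = g x" by (rule linear_eq_on[OF assms(2,3)]) (use assms(4) in auto)
qed

lemma scale_ii_matrix_vector: "A *v (\<i> *s x) = \<i> *s (A *v (x :: complex^'n))"
  by (simp add: vec_eq_iff matrix_vector_mult_def sum_distrib_left mult_ac)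

lemma linear_scale_ii: "linear ((*s) \<i> :: complex^'n \<Rightarrow> _)"
  by (rule linearI) (simp_all add: vec_eq_iff complex_eq_iff algebra_simps)

lemma real_linear_ii_imp_complex_linear:
  fixes f :: "complex^'n \<Rightarrow> complex^'m"
  assumes "linear f" "\<And>x. f (\<i> *s x) = \<i> *s f x"
  shows "Vector_Spaces.linear (*s) (*s) f"
proof -
  have "f (c *s x) = c *s f x" for c x
  proof -
    have s: "c *s y = Re c *\<^sub>R y + Im c *\<^sub>R (\<i> *s y)" for y :: "complex^'k"
      by (simp add: vec_eq_iff complex_eq_iff)
    show ?thesis
      unfolding s by (simp add: linear_add[OF assms(1)] linear_scale[OF assms(1)] assms(2))
  qed
  then show ?thesis
    using linear_add[OF assms(1)] by (simp add: Vector_Spaces.linear_iff vec.vector_space_axioms)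
qed

text \<open>The matrix h(p) is defined on a real basis of eigenvectors. By independence an
  eigenvector for c only involves basis vectors for the same c, so h(p) acts by h c on every
  eigenvector; consequently it commutes with multiplication by \<i> and is a complex matrix.
  Orthogonality of distinct eigenspaces makes it Hermitian.\<close>

lemma hermitian_calculus:
  fixes p :: "complex^'n^'n" and h :: "real \<Rightarrow> real"
  assumes p: "adjoint_mat p = p"
  obtains n where "adjoint_mat n = n" "\<And>c x. p *v x = c *\<^sub>R x \<Longrightarrow> n *v x = h c *\<^sub>R x"
proof -
  let ?E = "{x. \<exists>c::real. p *v x = c *\<^sub>R x}"
  obtain B where B: "B \<subseteq> ?E" "independent B" "?E \<subseteq> span B"
    by (rule maximal_independent_subset)
  have "span B = UNIV"
    using span_minimal[OF B(3) subspace_span] hermitian_eigenvectors_span[OF p] by blast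
  have "\<forall>b\<in>B. \<exists>c::real. p *v b = c *\<^sub>R b" using B(1) by blast
  then obtain \<mu> where \<mu>: "\<And>b. b \<in> B \<Longrightarrow> p *v b = (\<mu> b :: real) *\<^sub>R b"
    by (metis bchoice)
  obtain f where f: "linear f" "\<And>b. b \<in> B \<Longrightarrow> f b = h (\<mu> b) *\<^sub>R b"
    using linear_independent_extend[OF B(2), of "\<lambda>b. h (\<mu> b) *\<^sub>R b"] by blast
  have finB: "finite B" using B(2) independent_bound by blast
  have eig: "f x = h c *\<^sub>R x" if x: "p *v x = c *\<^sub>R x" for c x
  proof -
    have "x \<in> span B" using \<open>span B = UNIV\<close> by simp
    then obtain r where r: "x = (\<Sum>b\<in>B. r b *\<^sub>R b)"
      unfolding span_finite[OF finB] by auto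
    have "(\<Sum>b\<in>B. (r b * (\<mu> b - c)) *\<^sub>R b) = p *v x - c *\<^sub>R x"
      unfolding r linear_sum[OF linear_matrix_vector] linear_scale[OF linear_matrix_vector]
      by (simp add: \<mu> scaleR_sum_right sum_subtractf[symmetric] algebra_simps)
    then have "(\<Sum>b\<in>B. (r b * (\<mu> b - c)) *\<^sub>R b) = 0" using x by simp
    then have "r b * (\<mu> b - c) = 0" if "b \<in> B" for b
      using independentD[OF B(2) finB subset_refl, of "\<lambda>b. r b * (\<mu> b - c)"] that by blast
    then have "r b *\<^sub>R (h (\<mu> b) *\<^sub>R b) = h c *\<^sub>R (r b *\<^sub>R b)" if "b \<in> B" for b
      using that by force
    then show ?thesis
      unfolding r linear_sum[OF f(1)] linear_scale[OF f(1)] scaleR_sum_right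
      by (intro sum.cong) (auto simp: f(2))
  qed
  have fi: "f (\<i> *s x) = \<i> *s f x" for x
  proof -
    have lin: "linear (\<lambda>x. f (\<i> *s x))" "linear (\<lambda>x. \<i> *s f x)"
      using linear_compose[OF linear_scale_ii f(1)] linear_compose[OF f(1) linear_scale_ii]
      by (simp_all add: o_def)
    have sc: "\<i> *s (c *\<^sub>R y) = c *\<^sub>R (\<i> *s y)" for c and y :: "complex^'n"
      by (simp add: vec_eq_iff)
    have "p *v (\<i> *s x) = c *\<^sub>R (\<i> *s x)" if "p *v x = c *\<^sub>R x" for c x
      by (simp add: scale_ii_matrix_vector that sc)
    then have "f (\<i> *s x) = \<i> *s f x" if "p *v x = c *\<^sub>R x" for c x
      using eig[OF that] eig[of "\<i> *s x" c] that by (simp add: sc)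
    then have "(\<lambda>x. f (\<i> *s x)) = (\<lambda>x. \<i> *s f x)"
      by (rule linear_eq_on_eigenvectors[OF p lin])
    then show ?thesis by meson
  qed
  define n where "n = matrix f"
  have nf: "n *v x = f x" for x
    unfolding n_def by (rule matrix_works[OF real_linear_ii_imp_complex_linear[OF f(1) fi]])
  have orth: "x \<bullet> y = 0" if "p *v x = c *\<^sub>R x" "p *v y = d *\<^sub>R y" "c \<noteq> d" for x y c d
  proof -
    have "c * (x \<bullet> y) = d * (x \<bullet> y)"
      using inner_matrix_vector[of p x y] p that by simp
    then show ?thesis using \<open>c \<noteq> d\<close> by simp
  qed
  have sa0: "f x \<bullet> y = x \<bullet> f y" if "p *v x = c *\<^sub>R x" "p *v y = d *\<^sub>R y" for x y c d
    using eig[OF that(1)] eig[OF that(2)] orth[OF that] by (cases "c = d") auto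
  have lin2: "linear (\<lambda>y. f x \<bullet> y)" "linear (\<lambda>y. x \<bullet> f y)" "linear (\<lambda>x. f x \<bullet> y)" "linear (\<lambda>x. x \<bullet> f y)" for x y
    using linear_add[OF f(1)] linear_scale[OF f(1)] by (auto simp: linear_iff inner_add_left inner_add_right)
  have sa1: "f x \<bullet> y = x \<bullet> f y" if "p *v x = c *\<^sub>R x" for x y c
    using linear_eq_on_eigenvectors[OF p lin2(1,2), of x x] sa0[OF that] by meson
  have sa: "f x \<bullet> y = x \<bullet> f y" for x y
    using linear_eq_on_eigenvectors[OF p lin2(3,4), of y y] sa1 by meson
  have "adjoint_mat n *v y = n *v y" for y
  proof -
    have "x \<bullet> (adjoint_mat n *v y - n *v y) = 0" for x
      using inner_matrix_vector[of n x y] sa[of x y] by (simp add: nf inner_diff_right)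
    then show ?thesis by (metis eq_iff_diff_eq_0 inner_eq_zero_iff)
  qed
  then have "adjoint_mat n = n" by (simp add: matrix_eq)
  then show thesis using that eig nf by metis
qed

text \<open>For eigenvectors x and y with eigenvalues c and d, r multiplies b x y by c d, and h is
  multiplicative; the general case follows because eigenvectors span. With the octonion product as b
  this keeps roots in G2 and Spin(7), with the bilinear form it keeps them orthogonal.\<close>

lemma bilinear_hermitian_calculus:
  fixes p :: "complex^'a^'a" and q :: "complex^'b^'b" and r :: "complex^'c^'c"
  assumes herm: "adjoint_mat p = p" "adjoint_mat q = q"
    and b: "bilinear b" "\<And>x y. b (p *v x) (q *v y) = r *v b x y"
    and h: "\<And>c d. h (c * d) = h c * h d"
    and l: "\<And>c x. p *v x = c *\<^sub>R x \<Longrightarrow> l *v x = h c *\<^sub>R x"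
    and m: "\<And>c x. q *v x = c *\<^sub>R x \<Longrightarrow> m *v x = h c *\<^sub>R x"
    and n: "\<And>c x. r *v x = c *\<^sub>R x \<Longrightarrow> n *v x = h c *\<^sub>R x"
  shows "b (l *v x) (m *v y) = n *v b x y"
proof -
  have lb: "linear (b x)" "linear (\<lambda>x. b x y)" for x y
    using b(1) by (auto simp: bilinear_def)
  have 0: "b (l *v x) (m *v y) = n *v b x y" if "p *v x = c *\<^sub>R x" "q *v y = d *\<^sub>R y" for x y c d
  proof -
    have "r *v b x y = (c * d) *\<^sub>R b x y"
      using b(2)[of x y] that linear_scale[OF lb(1)] linear_scale[OF lb(2)] by (simp add: mult.commute)
    from n[OF this] show ?thesis
      using l[OF that(1)] m[OF that(2)] linear_scale[OF lb(1)] linear_scale[OF lb(2)] h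
      by (simp add: mult.commute)
  qed
  have lin: "linear (\<lambda>y. b (l *v x) (m *v y))" "linear (\<lambda>y. n *v b x y)"
    "linear (\<lambda>x. b (l *v x) (m *v y))" "linear (\<lambda>x. n *v b x y)" for x y
    using linear_compose[OF linear_matrix_vector[of m] lb(1)] linear_compose[OF linear_matrix_vector[of l] lb(2)]
      linear_compose[OF lb(1) linear_matrix_vector[of n]] linear_compose[OF lb(2) linear_matrix_vector[of n]]
    by (auto simp: o_def)
  have 1: "b (l *v x) (m *v y) = n *v b x y" if "p *v x = c *\<^sub>R x" for x y c
    using linear_eq_on_eigenvectors[OF herm(2) lin(1,2), of x x] 0[OF that] by meson
  show ?thesis
    using linear_eq_on_eigenvectors[OF herm(1) lin(3,4), of y y] 1 by meson
qed

section \<open>Minimising the norm over a compact subgroup\<close>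

lemma inner_matrix_mult:
  fixes A :: "complex^'n^'m" and B :: "complex^'k^'n"
  shows "(A ** B) \<bullet> C = A \<bullet> (C ** adjoint_mat B)"
proof -
  have *: "(a * b) \<bullet> c = a \<bullet> (c * cnj b)" for a b c :: complex
    by (simp add: inner_complex_def algebra_simps)
  have "(\<Sum>k\<in>UNIV. \<Sum>j\<in>UNIV. (A $ i $ j * B $ j $ k) \<bullet> C $ i $ k) =
      (\<Sum>j\<in>UNIV. \<Sum>k\<in>UNIV. A $ i $ j \<bullet> (C $ i $ k * cnj (B $ j $ k)))" for i
    unfolding * by (rule sum.swap)
  then show ?thesis
    by (simp add: inner_vec_def matrix_matrix_mult_def inner_sum_left inner_sum_right adjoint_mat_def transpose_def)
qed

text \<open>A midpoint argument. If k moves q to q h, the point q n with n the fourth root of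
  \<open>h ** adjoint_mat h\<close> lies midway, and \<open>key\<close> measures how much smaller
  the norms are there. Minimality makes the defect a - a m vanish, whence
  \<open>h ** adjoint_mat h\<close> is the identity; for a complex orthogonal h this means that h is
  real.\<close>

lemma (in matrix_pair) compact_subgroup_conjugate_real:
  assumes clG: "closed G"
    and root: "\<And>g. g \<in> G \<Longrightarrow> \<exists>n\<in>G. adjoint_mat n = n \<and> n ** n ** n ** n = g ** adjoint_mat g"
    and K: "K \<subseteq> G" "mat 1 \<in> K" "\<And>a b. a \<in> K \<Longrightarrow> b \<in> K \<Longrightarrow> a ** b \<in> K" "compact K"
  obtains q where "q \<in> G" "\<And>k. k \<in> K \<Longrightarrow> cnj_mat (transpose q ** k ** q) = transpose q ** k ** q"
proof -
  define f where "f = (\<lambda>g :: complex^'m^'m. SUP k\<in>K. norm (k ** g))"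
  have bb: "bounded_bilinear ((**) :: complex^'m^'m \<Rightarrow> complex^'m^'m \<Rightarrow> complex^'m^'m)"
    using bilinear_matrix_mult unfolding bilinear_conv_bounded_bilinear .
  obtain C where C: "C > 0" "\<And>(a :: complex^'m^'m) (b :: complex^'m^'m). norm (a ** b) \<le> norm a * norm b * C"
    using bounded_bilinear.pos_bounded[OF bb] by metis
  obtain R where R: "R > 0" "\<And>k. k \<in> K \<Longrightarrow> norm k \<le> R"
    using compact_imp_bounded[OF K(4)] bounded_pos by blast
  have attained: "\<exists>k\<in>K. f g = norm (k ** g) \<and> (\<forall>l\<in>K. norm (l ** g) \<le> norm (k ** g))" for g
  proof -
    have "continuous_on K (\<lambda>k. norm (k ** g))"
      using continuous_mult_right[of K g] by (rule continuous_on_norm)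
    then obtain k where k: "k \<in> K" "\<And>l. l \<in> K \<Longrightarrow> norm (l ** g) \<le> norm (k ** g)"
      using continuous_attains_sup[OF K(4), of "\<lambda>k. norm (k ** g)"] K(2) by blast
    then have "f g = norm (k ** g)" unfolding f_def by (intro cSup_eq_maximum) auto
    then show ?thesis using k by blast
  qed
  have le_f: "norm (k ** g) \<le> f g" if "k \<in> K" for k g
    using attained[of g] that by auto
  have lip: "f g \<le> f g' + R * C * norm (g - g')" for g g'
  proof -
    obtain k where k: "k \<in> K" "f g = norm (k ** g)" using attained[of g] by blast
    have "k ** g = k ** g' + k ** (g - g')"
      using linear_add[OF linear_matrix_mult_left[of k], of g' "g - g'"] by simp
    then have "norm (k ** g) \<le> norm (k ** g') + norm (k ** (g - g'))"
      by (simp add: norm_triangle_ineq)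
    also have "norm (k ** (g - g')) \<le> norm k * norm (g - g') * C" by (rule C(2))
    also have "\<dots> \<le> R * C * norm (g - g')"
      using mult_right_mono[OF R(2)[OF k(1)], of "norm (g - g') * C"] C(1) by (simp add: mult_ac)
    finally show ?thesis using k(2) le_f[OF k(1), of g'] by linarith
  qed
  have "continuous_on UNIV f"
  proof (rule lipschitz_on_continuous_on[where L = "R * C"], rule lipschitz_onI)
    fix g g' :: "complex^'m^'m"
    show "dist (f g) (f g') \<le> R * C * dist g g'"
      using lip[of g g'] lip[of g' g] by (simp add: dist_norm norm_minus_commute abs_le_iff algebra_simps)
  qed (use R C in simp)
  \<comment> \<open>As the identity lies in K, f dominates the norm. Outside the ball of radius f(1)
    it exceeds f(1), so a minimum over the compact part of G is a minimum over G.\<close>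
  then have "continuous_on (G \<inter> cball 0 (f (mat 1))) f" by (rule continuous_on_subset) simp
  moreover have "compact (G \<inter> cball 0 (f (mat 1)))" using clG by (simp add: closed_Int_compact)
  moreover have norm_f: "norm g \<le> f g" for g using le_f[OF K(2), of g] by simp
  then have "G \<inter> cball 0 (f (mat 1)) \<noteq> {}" using one_G by auto
  ultimately have "\<exists>q\<in>G \<inter> cball 0 (f (mat 1)). \<forall>g\<in>G \<inter> cball 0 (f (mat 1)). f q \<le> f g"
    using continuous_attains_inf by blast
  then obtain q where q: "q \<in> G" "\<And>g. g \<in> G \<Longrightarrow> norm g \<le> f (mat 1) \<Longrightarrow> f q \<le> f g"
    by (auto simp: dist_norm)
  have qmin: "f q \<le> f g" if "g \<in> G" for g
    using q(2)[OF that] q(2)[OF one_G] norm_f[of g] norm_f[of "mat 1"] by linarith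
  have "cnj_mat (transpose q ** k ** q) = transpose q ** k ** q" if k: "k \<in> K" for k
  proof -
    define h where "h = transpose q ** k ** q"
    have hG: "h \<in> G" using k K(1) q(1) unfolding h_def by (intro mult_G transpose_G) auto
    have qh: "q ** h = k ** q"
      unfolding h_def matrix_mul_assoc[symmetric] by (rule cancel_G(2)[OF q(1)])
    obtain n where n: "n \<in> G" "adjoint_mat n = n" "n ** n ** n ** n = h ** adjoint_mat h"
      using root[OF hG] by blast
    define m where "m = n ** n"
    have m: "adjoint_mat m = m" "m ** m = h ** adjoint_mat h"
      using n by (simp_all add: m_def adjoint_mat_mult matrix_mul_assoc)
    \<comment> \<open>Expansion of |a - a m|^2. Hermitian n and m give |a n|^2 as the inner product
      of a and a m, and m m = \<open>h ** adjoint_mat h\<close> gives |a h| = |a m|.\<close>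
    have key: "2 * (norm (a ** n))\<^sup>2 = (norm a)\<^sup>2 + (norm (a ** h))\<^sup>2 - (norm (a - a ** m))\<^sup>2" for a
    proof -
      have "(norm (a ** n))\<^sup>2 = a \<bullet> (a ** m)"
        by (simp add: power2_norm_eq_inner inner_matrix_mult n m_def matrix_mul_assoc)
      moreover have "(norm (a ** h))\<^sup>2 = a \<bullet> (a ** (m ** m))"
        by (simp add: power2_norm_eq_inner inner_matrix_mult m(2) matrix_mul_assoc)
      moreover have "(norm (a ** m))\<^sup>2 = a \<bullet> (a ** (m ** m))"
        by (simp add: power2_norm_eq_inner inner_matrix_mult m(1) matrix_mul_assoc)
      moreover have "(norm (a - a ** m))\<^sup>2 = (norm a)\<^sup>2 - 2 * (a \<bullet> (a ** m)) + (norm (a ** m))\<^sup>2"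
        by (simp add: power2_norm_eq_inner inner_diff_left inner_diff_right inner_commute)
      ultimately show ?thesis by linarith
    qed
    \<comment> \<open>Taking l extremal at q n turns f q \<le> f (q n) into a bound on the single
      norm |a n|; a = l q and a h = l k q are both translates of q by elements of K.\<close>
    obtain l where l: "l \<in> K" "f (q ** n) = norm (l ** (q ** n))" using attained by blast
    define a where "a = l ** q"
    have aG: "a \<in> G" using l(1) K(1) q(1) mult_G unfolding a_def by blast
    have "f q \<le> norm (a ** n)"
      using qmin[OF mult_G[OF q(1) n(1)]] l(2) by (simp add: a_def matrix_mul_assoc)
    moreover have "norm a \<le> f q" unfolding a_def by (rule le_f[OF l(1)])
    moreover have "a ** h = (l ** k) ** q" unfolding a_def using qh by (metis matrix_mul_assoc)
    then have "norm (a ** h) \<le> f q" using le_f[OF K(3)[OF l(1) k]] by simp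
    ultimately have "(f q)\<^sup>2 \<le> (norm (a ** n))\<^sup>2" "(norm a)\<^sup>2 \<le> (f q)\<^sup>2" "(norm (a ** h))\<^sup>2 \<le> (f q)\<^sup>2"
      using norm_ge_zero[of a] by (auto intro!: power_mono order_trans[OF _ \<open>norm a \<le> f q\<close>])
    then have "(norm (a - a ** m))\<^sup>2 \<le> 0" using key[of a] by linarith
    then have "a = a ** m" by simp
    then have "m = mat 1" using cancel_G(1)[OF aG, of m] orthogonal_G[OF aG] by simp
    then have "h ** adjoint_mat h = mat 1" using m(2) by simp
    then have "adjoint_mat h = transpose h" using cancel_G(1)[OF hG, of "adjoint_mat h"] by simp
    then have "cnj_mat h = h" unfolding adjoint_mat_def by (metis transpose_transpose)
    then show ?thesis by (simp add: h_def)
  qed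
  then show thesis using that q(1) by blast
qed

section \<open>The complexified Cayley algebra\<close>

text \<open>Bilinear, not Hermitian: on \<open>complex^8\<close> this is the form that SO(8,C)
  preserves. Nonzero vectors can be isotropic, which is why so many constructions below have to
  secure a nonvanishing norm.\<close>

definition cdot :: "complex^'n \<Rightarrow> complex^'n \<Rightarrow> complex" where
  "cdot x y = (\<Sum>i\<in>UNIV. x $ i * y $ i)"

lemma UNIV_8: "(UNIV :: 8 set) = {0, 1, 2, 3, 4, 5, 6, 7}"
proof -
  have "card {0, 1, 2, 3, 4, 5, 6, 7 :: 8} = 8" by simp
  then show ?thesis by (intro card_subset_eq[symmetric]) auto
qed

lemma sum_8: "(\<Sum>i\<in>UNIV. f (i :: 8)) = f 0 + f 1 + f 2 + f 3 + f 4 + f 5 + f 6 + f 7"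
  unfolding UNIV_8 by (simp add: add.assoc)

lemma cayley_mult_nth:
  "(x \<bullet>\<^sub>C y) $ 0 = x$0 * y$0 - x$1 * y$1 - x$2 * y$2 - x$3 * y$3 - x$4 * y$4 - x$5 * y$5 - x$6 * y$6 - x$7 * y$7"
  "(x \<bullet>\<^sub>C y) $ 1 = x$0 * y$1 + x$1 * y$0 + x$2 * y$3 - x$3 * y$2 + x$4 * y$5 - x$5 * y$4 + x$6 * y$7 - x$7 * y$6"
  "(x \<bullet>\<^sub>C y) $ 2 = x$0 * y$2 + x$2 * y$0 + x$3 * y$1 - x$1 * y$3 + x$5 * y$7 - x$7 * y$5 + x$6 * y$4 - x$4 * y$6"
  "(x \<bullet>\<^sub>C y) $ 3 = x$0 * y$3 + x$3 * y$0 + x$1 * y$2 - x$2 * y$1 + x$5 * y$6 - x$6 * y$5 + x$4 * y$7 - x$7 * y$4"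
  "(x \<bullet>\<^sub>C y) $ 4 = x$0 * y$4 + x$4 * y$0 + x$5 * y$1 - x$1 * y$5 + x$2 * y$6 - x$6 * y$2 + x$7 * y$3 - x$3 * y$7"
  "(x \<bullet>\<^sub>C y) $ 5 = x$0 * y$5 + x$5 * y$0 + x$1 * y$4 - x$4 * y$1 + x$7 * y$2 - x$2 * y$7 + x$6 * y$3 - x$3 * y$6"
  "(x \<bullet>\<^sub>C y) $ 6 = x$0 * y$6 + x$6 * y$0 + x$7 * y$1 - x$1 * y$7 + x$4 * y$2 - x$2 * y$4 + x$3 * y$5 - x$5 * y$3"
  "(x \<bullet>\<^sub>C y) $ 7 = x$0 * y$7 + x$7 * y$0 + x$1 * y$6 - x$6 * y$1 + x$2 * y$5 - x$5 * y$2 + x$3 * y$4 - x$4 * y$3"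
  by (simp_all add: cayley_mult_def sum_8 cayley_coeff_def cayley_cyclic_def cayley_lines_def)

text \<open>Degen's eight-square identity for the given multiplication table: the norm of the
  octonions is multiplicative. Polarising it leads to the cancellation laws.\<close>

lemma eight_squares:
  fixes a0 a1 a2 a3 a4 a5 a6 a7 b0 b1 b2 b3 b4 b5 b6 b7 :: complex
  shows "(a0*b0 - a1*b1 - a2*b2 - a3*b3 - a4*b4 - a5*b5 - a6*b6 - a7*b7) ^ 2
   + (a0*b1 + a1*b0 + a2*b3 - a3*b2 + a4*b5 - a5*b4 + a6*b7 - a7*b6) ^ 2
   + (a0*b2 + a2*b0 + a3*b1 - a1*b3 + a5*b7 - a7*b5 + a6*b4 - a4*b6) ^ 2
   + (a0*b3 + a3*b0 + a1*b2 - a2*b1 + a5*b6 - a6*b5 + a4*b7 - a7*b4) ^ 2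
   + (a0*b4 + a4*b0 + a5*b1 - a1*b5 + a2*b6 - a6*b2 + a7*b3 - a3*b7) ^ 2
   + (a0*b5 + a5*b0 + a1*b4 - a4*b1 + a7*b2 - a2*b7 + a6*b3 - a3*b6) ^ 2
   + (a0*b6 + a6*b0 + a7*b1 - a1*b7 + a4*b2 - a2*b4 + a3*b5 - a5*b3) ^ 2
   + (a0*b7 + a7*b0 + a1*b6 - a6*b1 + a2*b5 - a5*b2 + a3*b4 - a4*b3) ^ 2
   = (a0^2 + a1^2 + a2^2 + a3^2 + a4^2 + a5^2 + a6^2 + a7^2) * (b0^2 + b1^2 + b2^2 + b3^2 + b4^2 + b5^2 + b6^2 + b7^2)"
  by algebra

lemma forall_8: "(\<forall>i::8. P i) \<longleftrightarrow> P 0 \<and> P 1 \<and> P 2 \<and> P 3 \<and> P 4 \<and> P 5 \<and> P 6 \<and> P 7"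
proof -
  have "(\<forall>i::8. P i) \<longleftrightarrow> (\<forall>i\<in>UNIV. P i)" by simp
  then show ?thesis unfolding UNIV_8 by simp
qed

lemma cdot_add [simp]: "cdot (x + y) z = cdot x z + cdot y z" "cdot z (x + y) = cdot z x + cdot z y"
  by (simp_all add: cdot_def sum.distrib algebra_simps)

lemma cdot_diff [simp]: "cdot (x - y) z = cdot x z - cdot y z" "cdot z (x - y) = cdot z x - cdot z y"
  by (simp_all add: cdot_def sum_subtractf algebra_simps)

lemma cdot_scale [simp]: "cdot (c *s x) z = c * cdot x z" "cdot z (c *s x) = c * cdot z x"
  by (simp_all add: cdot_def sum_distrib_left mult_ac)

lemma cdot_minus [simp]: "cdot (- x) z = - cdot x z" "cdot z (- x) = - cdot z x"
  by (simp_all add: cdot_def sum_negf)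

lemma cdot_zero [simp]: "cdot 0 z = 0" "cdot z 0 = 0"
  by (simp_all add: cdot_def)

lemma cdot_commute: "cdot x y = cdot y x"
  by (simp add: cdot_def mult.commute)

lemma cdot_axis [simp]: "cdot x (axis i 1) = x $ i" "cdot (axis i 1) x = x $ i"
proof -
  have "x $ k * axis i 1 $ k = (if k = i then x $ i else 0)" for k by (simp add: axis_def)
  then show "cdot x (axis i 1) = x $ i" by (simp add: cdot_def)
  then show "cdot (axis i 1) x = x $ i" by (simp add: cdot_commute)
qed

lemma cdot_eqI: "(\<And>z. cdot x z = cdot y z) \<Longrightarrow> x = y"
  by (metis cdot_axis(1) vec_eq_iff)

lemma cayley_add: "(x + y) \<bullet>\<^sub>C z = x \<bullet>\<^sub>C z + y \<bullet>\<^sub>C z" "z \<bullet>\<^sub>C (x + y) = z \<bullet>\<^sub>C x + z \<bullet>\<^sub>C y"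
  by (simp_all add: cayley_mult_def vec_eq_iff sum.distrib algebra_simps)

lemma cayley_diff: "(x - y) \<bullet>\<^sub>C z = x \<bullet>\<^sub>C z - y \<bullet>\<^sub>C z" "z \<bullet>\<^sub>C (x - y) = z \<bullet>\<^sub>C x - z \<bullet>\<^sub>C y"
  by (simp_all add: cayley_mult_def vec_eq_iff sum_subtractf algebra_simps)

lemma cayley_scale: "(c *s x) \<bullet>\<^sub>C z = c *s (x \<bullet>\<^sub>C z)" "z \<bullet>\<^sub>C (c *s x) = c *s (z \<bullet>\<^sub>C x)"
  by (simp_all add: cayley_mult_def vec_eq_iff sum_distrib_left mult_ac)

lemma cayley_minus: "(- x) \<bullet>\<^sub>C z = - (x \<bullet>\<^sub>C z)" "z \<bullet>\<^sub>C (- x) = - (z \<bullet>\<^sub>C x)"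
  by (simp_all add: cayley_mult_def vec_eq_iff sum_negf)

lemmas cayley_linear = cayley_add cayley_diff cayley_scale cayley_minus

lemma bilinear_cayley: "bilinear (\<bullet>\<^sub>C)"
proof -
  have r: "r *\<^sub>R x = complex_of_real r *s x" for r and x :: "complex^8"
    by (simp add: vec_eq_iff complex_eq_iff)
  show ?thesis unfolding bilinear_def linear_iff r by (simp add: cayley_linear)
qed

lemma cayley_e_nth: "cayley_e i $ j = (if j = i then 1 else 0)"
  by (simp add: cayley_e_def axis_def)

lemma cayley_one [simp]: "cayley_e 0 \<bullet>\<^sub>C x = x" "x \<bullet>\<^sub>C cayley_e 0 = x"
  by (simp_all add: vec_eq_iff forall_8 cayley_mult_nth cayley_e_nth)

lemma cdot_cayley_e [simp]: "cdot x (cayley_e i) = x $ i" "cdot (cayley_e i) x = x $ i"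
  by (simp_all add: cayley_e_def)

lemma cdot_cayley_norm: "cdot (x \<bullet>\<^sub>C y) (x \<bullet>\<^sub>C y) = cdot x x * cdot y y"
  using eight_squares[of "x$0" "y$0" "x$1" "y$1" "x$2" "y$2" "x$3" "y$3" "x$4" "y$4" "x$5" "y$5" "x$6" "y$6" "x$7" "y$7"]
  by (simp only: cdot_def sum_8 cayley_mult_nth power2_eq_square)

lemma cdot_cayley_left: "cdot (x \<bullet>\<^sub>C y) (x \<bullet>\<^sub>C z) = cdot x x * cdot y z"
proof -
  have "cdot (x \<bullet>\<^sub>C (y + z)) (x \<bullet>\<^sub>C (y + z)) = cdot x x * cdot (y + z) (y + z)" by (rule cdot_cayley_norm)
  then have "2 * cdot (x \<bullet>\<^sub>C y) (x \<bullet>\<^sub>C z) = 2 * (cdot x x * cdot y z)"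
    by (simp add: cayley_linear cdot_cayley_norm cdot_commute[of z y] cdot_commute[of "x \<bullet>\<^sub>C z" "x \<bullet>\<^sub>C y"] algebra_simps)
  then show ?thesis by simp
qed

lemma cdot_cayley_right: "cdot (x \<bullet>\<^sub>C z) (y \<bullet>\<^sub>C z) = cdot x y * cdot z z"
proof -
  have "cdot ((x + y) \<bullet>\<^sub>C z) ((x + y) \<bullet>\<^sub>C z) = cdot (x + y) (x + y) * cdot z z" by (rule cdot_cayley_norm)
  then have "2 * cdot (x \<bullet>\<^sub>C z) (y \<bullet>\<^sub>C z) = 2 * (cdot x y * cdot z z)"
    by (simp add: cayley_linear cdot_cayley_norm cdot_commute[of y x] cdot_commute[of "y \<bullet>\<^sub>C z" "x \<bullet>\<^sub>C z"] algebra_simps)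
  then show ?thesis by simp
qed

lemma cdot_cayley_polar:
  "cdot (x \<bullet>\<^sub>C y) (z \<bullet>\<^sub>C w) + cdot (z \<bullet>\<^sub>C y) (x \<bullet>\<^sub>C w) = 2 * cdot x z * cdot y w"
  using cdot_cayley_left[of "x + z" y w] cdot_cayley_left[of x y w] cdot_cayley_left[of z y w]
  by (simp add: cayley_linear cdot_commute[of z x] algebra_simps)

text \<open>Octonion conjugation, extended complex-linearly; not to be confused with the complex
  conjugation \<open>cnj_vec\<close> of the coordinates.\<close>

definition oconj :: "complex^8 \<Rightarrow> complex^8" where
  "oconj x = (2 * x $ 0) *s cayley_e 0 - x"

lemma oconj_nth: "oconj x $ i = (if i = 0 then x $ 0 else - x $ i)"
  by (simp add: oconj_def cayley_e_nth)

lemma oconj_linear [simp]: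
  "oconj (x + y) = oconj x + oconj y" "oconj (x - y) = oconj x - oconj y"
  "oconj (c *s x) = c *s oconj x" "oconj (- x) = - oconj x" "oconj 0 = 0"
  "oconj (oconj x) = x" "oconj (cayley_e 0) = cayley_e 0"
  by (simp_all add: vec_eq_iff oconj_nth cayley_e_nth)

lemma oconj_imag: "a $ 0 = 0 \<Longrightarrow> oconj a = - a"
  by (simp add: oconj_def)

lemma cdot_oconj [simp]: "cdot (oconj x) (oconj y) = cdot x y"
  by (simp add: cdot_def sum_8 oconj_nth)

lemma oconj_cayley: "oconj (x \<bullet>\<^sub>C y) = oconj y \<bullet>\<^sub>C oconj x"
  by (simp add: vec_eq_iff forall_8 oconj_nth cayley_mult_nth algebra_simps)

lemma cdot_cayley_adjoint_left: "cdot (x \<bullet>\<^sub>C y) z = cdot y (oconj x \<bullet>\<^sub>C z)"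
  using cdot_cayley_polar[of x y "cayley_e 0" z] by (simp add: oconj_def cayley_linear algebra_simps)

lemma cdot_cayley_adjoint_right: "cdot (y \<bullet>\<^sub>C x) z = cdot y (z \<bullet>\<^sub>C oconj x)"
proof -
  have "cdot (y \<bullet>\<^sub>C x) z = cdot (oconj x \<bullet>\<^sub>C oconj y) (oconj z)"
    unfolding oconj_cayley[symmetric] by simp
  also have "\<dots> = cdot (oconj y) (x \<bullet>\<^sub>C oconj z)"
    unfolding cdot_cayley_adjoint_left by simp
  also have "\<dots> = cdot y (oconj (x \<bullet>\<^sub>C oconj z))"
    using cdot_oconj[of y "oconj (x \<bullet>\<^sub>C oconj z)"] by simp
  finally show ?thesis by (simp add: oconj_cayley)
qed

text \<open>Left multiplication by \<open>oconj x\<close> is the adjoint of left multiplication by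
  x, and the latter scales the form by the norm of x. These laws replace associativity in everything
  that follows.\<close>

lemma cayley_cancel_left: "oconj x \<bullet>\<^sub>C (x \<bullet>\<^sub>C y) = cdot x x *s y" "x \<bullet>\<^sub>C (oconj x \<bullet>\<^sub>C y) = cdot x x *s y"
proof -
  show *: "oconj x \<bullet>\<^sub>C (x \<bullet>\<^sub>C y) = cdot x x *s y" for x y
  proof (rule cdot_eqI)
    fix z
    have "cdot (oconj x \<bullet>\<^sub>C (x \<bullet>\<^sub>C y)) z = cdot (x \<bullet>\<^sub>C y) (x \<bullet>\<^sub>C z)"
      using cdot_cayley_adjoint_left[of "oconj x"] by simp
    then show "cdot (oconj x \<bullet>\<^sub>C (x \<bullet>\<^sub>C y)) z = cdot (cdot x x *s y) z"
      by (simp add: cdot_cayley_left)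
  qed
  show "x \<bullet>\<^sub>C (oconj x \<bullet>\<^sub>C y) = cdot x x *s y" using *[of "oconj x"] by simp
qed

lemma cayley_cancel_right: "(y \<bullet>\<^sub>C x) \<bullet>\<^sub>C oconj x = cdot x x *s y" "(y \<bullet>\<^sub>C oconj x) \<bullet>\<^sub>C x = cdot x x *s y"
proof -
  show *: "(y \<bullet>\<^sub>C x) \<bullet>\<^sub>C oconj x = cdot x x *s y" for x y
  proof (rule cdot_eqI)
    fix z
    have "cdot ((y \<bullet>\<^sub>C x) \<bullet>\<^sub>C oconj x) z = cdot (y \<bullet>\<^sub>C x) (z \<bullet>\<^sub>C x)"
      using cdot_cayley_adjoint_right[of _ "oconj x"] by simp
    then show "cdot ((y \<bullet>\<^sub>C x) \<bullet>\<^sub>C oconj x) z = cdot (cdot x x *s y) z"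
      by (simp add: cdot_cayley_right mult.commute)
  qed
  show "(y \<bullet>\<^sub>C oconj x) \<bullet>\<^sub>C x = cdot x x *s y" using *[of y "oconj x"] by simp
qed

lemma cayley_cancel_polar: "oconj x \<bullet>\<^sub>C (y \<bullet>\<^sub>C z) + oconj y \<bullet>\<^sub>C (x \<bullet>\<^sub>C z) = (2 * cdot x y) *s z"
proof -
  have "oconj (x + y) \<bullet>\<^sub>C ((x + y) \<bullet>\<^sub>C z) = cdot (x + y) (x + y) *s z" by (rule cayley_cancel_left)
  then show ?thesis
    by (simp add: cayley_linear cayley_cancel_left cdot_commute[of y x] vec.scale_left_distrib algebra_simps)
qed

lemma imag_square: "a $ 0 = 0 \<Longrightarrow> a \<bullet>\<^sub>C (a \<bullet>\<^sub>C y) = - cdot a a *s y"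
  using cayley_cancel_left(1)[of a y] by (simp add: oconj_imag cayley_linear) (metis minus_minus)

subsection \<open>Triality pairs\<close>

text \<open>The relation between g and its companion g0 in the definition of Spin(7,C): g is a lift
  to the spin group and g0 its image in SO(7,C). With g0 = g it says that g is an
  automorphism.\<close>

definition tri :: "complex^8^8 \<Rightarrow> complex^8^8 \<Rightarrow> bool" where
  "tri g0 g \<longleftrightarrow> (\<forall>x y. (g0 *v x) \<bullet>\<^sub>C (g *v y) = g *v (x \<bullet>\<^sub>C y))"

definition Lmul :: "complex^8 \<Rightarrow> complex^8^8" where
  "Lmul a = (\<chi> k j. \<Sum>i\<in>UNIV. cayley_coeff i j k * a $ i)"

definition Rmul :: "complex^8 \<Rightarrow> complex^8^8" where
  "Rmul a = (\<chi> k i. \<Sum>j\<in>UNIV. cayley_coeff i j k * a $ j)"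

text \<open>For imaginary non-isotropic a this fixes the unit and is a half-turn on the imaginary
  octonions: a is fixed and its orthogonal complement there is negated. It depends on the line of a
  only, so no square root is needed to normalise a.\<close>

definition Cmul :: "complex^8 \<Rightarrow> complex^8^8" where
  "Cmul a = (\<chi> i j. (if i = j then if i = 0 then 1 else -1 else 0) + 2 * a $ i * a $ j * inverse (cdot a a))"

lemma Lmul_vec [simp]: "Lmul a *v y = a \<bullet>\<^sub>C y"
proof -
  have "(\<Sum>j\<in>UNIV. (\<Sum>i\<in>UNIV. cayley_coeff i j k * a $ i) * y $ j) =
      (\<Sum>i\<in>UNIV. \<Sum>j\<in>UNIV. cayley_coeff i j k * a $ i * y $ j)" for k
    unfolding sum_distrib_right by (rule sum.swap)
  then show ?thesis by (simp add: vec_eq_iff Lmul_def matrix_vector_mult_def cayley_mult_def)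
qed

lemma Rmul_vec [simp]: "Rmul a *v x = x \<bullet>\<^sub>C a"
  by (simp add: vec_eq_iff Rmul_def matrix_vector_mult_def cayley_mult_def sum_distrib_left sum_distrib_right mult_ac)

lemma Cmul_vec: "Cmul a *v x = oconj x + (2 * cdot a x / cdot a a) *s a"
proof -
  have "((if i = j then if i = 0 then 1 else -1 else 0) + 2 * a $ i * a $ j * inverse (cdot a a)) * x $ j =
      (if j = i then oconj x $ i else 0) + (2 * a $ i * inverse (cdot a a)) * (a $ j * x $ j)" for i j
    by (auto simp: oconj_nth algebra_simps)
  then show ?thesis
    by (simp add: vec_eq_iff Cmul_def matrix_vector_mult_def sum.distrib sum_distrib_left[symmetric]
        cdot_def[symmetric] divide_inverse)
qed

text \<open>Left multiplications by imaginary vectors generate the lifts used below, and their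
  companions are half-turns. The identity is the polarised cancellation law for x and a, with
  \<open>oconj a = - a\<close>.\<close>

lemma tri_Cmul_Lmul:
  assumes "a $ 0 = 0" "cdot a a \<noteq> 0"
  shows "tri (Cmul a) (Lmul a)"
  unfolding tri_def
proof (intro allI)
  fix x y
  have "oconj x \<bullet>\<^sub>C (a \<bullet>\<^sub>C y) - a \<bullet>\<^sub>C (x \<bullet>\<^sub>C y) = (2 * cdot x a) *s y"
    using cayley_cancel_polar[of x a y] by (simp add: oconj_imag assms cayley_linear)
  moreover have "(Cmul a *v x) \<bullet>\<^sub>C (a \<bullet>\<^sub>C y) = oconj x \<bullet>\<^sub>C (a \<bullet>\<^sub>C y) - (2 * cdot x a) *s y"
    using assms by (simp add: Cmul_vec cayley_linear imag_square cdot_commute[of a x] vec_eq_iff)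
  ultimately show "(Cmul a *v x) \<bullet>\<^sub>C (Lmul a *v y) = Lmul a *v (x \<bullet>\<^sub>C y)"
    by (simp add: algebra_simps)
qed

lemma tri_mult: "tri g0 g \<Longrightarrow> tri h0 h \<Longrightarrow> tri (g0 ** h0) (g ** h)"
  by (simp add: tri_def matrix_vector_mul_assoc[symmetric])

lemma tri_one: "tri (mat 1) (mat 1)"
  by (simp add: tri_def)

lemma mat_scale_vec: "mat_scale c A *v x = c *s (A *v x)"
  by (simp add: vec_eq_iff matrix_vector_mult_def sum_distrib_left mult_ac)

lemma matrix_vec_scale: "(A :: complex^'n^'m) *v (c *s x) = c *s (A *v x)"
  by (simp add: vec_eq_iff matrix_vector_mult_def sum_distrib_left mult_ac)

lemma tri_scale: "tri g0 g \<Longrightarrow> tri g0 (mat_scale c g)"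
  by (simp add: tri_def mat_scale_vec cayley_linear)

lemma tri_transpose:
  assumes "tri g0 g" "g0 ** transpose g0 = mat 1" "g ** transpose g = mat 1" "transpose g ** g = mat 1"
  shows "tri (transpose g0) (transpose g)"
  unfolding tri_def
proof (intro allI)
  fix x y
  have "(g0 *v (transpose g0 *v x)) \<bullet>\<^sub>C (g *v (transpose g *v y)) = g *v ((transpose g0 *v x) \<bullet>\<^sub>C (transpose g *v y))"
    using assms(1) by (simp add: tri_def)
  then have "x \<bullet>\<^sub>C y = g *v ((transpose g0 *v x) \<bullet>\<^sub>C (transpose g *v y))"
    by (simp add: matrix_vector_mul_assoc assms del: transpose_matrix_vector)
  then show "(transpose g0 *v x) \<bullet>\<^sub>C (transpose g *v y) = transpose g *v (x \<bullet>\<^sub>C y)"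
    by (simp add: matrix_vector_mul_assoc assms del: transpose_matrix_vector)
qed

definition cnj_vec :: "complex^'n \<Rightarrow> complex^'n" where
  "cnj_vec x = (\<chi> i. cnj (x $ i))"

lemma cnj_vec_nth [simp]: "cnj_vec x $ i = cnj (x $ i)"
  by (simp add: cnj_vec_def)

lemma cnj_vec_mult: "cnj_vec (A *v x) = cnj_mat A *v cnj_vec x"
  by (simp add: vec_eq_iff matrix_vector_mult_def)

lemma cnj_coeff [simp]: "cnj (cayley_coeff i j k) = cayley_coeff i j k"
  by (simp add: cayley_coeff_def)

lemma cnj_vec_cayley: "cnj_vec (x \<bullet>\<^sub>C y) = cnj_vec x \<bullet>\<^sub>C cnj_vec y"
  by (simp add: vec_eq_iff cayley_mult_def)

lemma cnj_vec_cayley_e [simp]: "cnj_vec (cayley_e i) = cayley_e i"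
  by (simp add: vec_eq_iff cayley_e_nth)

lemma cdot_cnj_vec: "cdot (cnj_vec x) (cnj_vec y) = cnj (cdot x y)"
  by (simp add: cdot_def)

lemma cnj_vec_cnj_vec [simp]: "cnj_vec (cnj_vec x) = x"
  by (simp add: vec_eq_iff)

lemma tri_cnj:
  assumes "tri g0 g" shows "tri (cnj_mat g0) (cnj_mat g)"
  unfolding tri_def
proof (intro allI)
  fix x y
  have "cnj_vec ((g0 *v cnj_vec x) \<bullet>\<^sub>C (g *v cnj_vec y)) = cnj_vec (g *v (cnj_vec x \<bullet>\<^sub>C cnj_vec y))"
    using assms by (simp add: tri_def)
  then show "(cnj_mat g0 *v x) \<bullet>\<^sub>C (cnj_mat g *v y) = cnj_mat g *v (x \<bullet>\<^sub>C y)"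
    unfolding cnj_vec_cayley cnj_vec_mult cnj_vec_cnj_vec .
qed

section \<open>The three groups\<close>

lemma cdot_transpose: "cdot (g *v x) y = cdot x (transpose g *v y)"
proof -
  have "(\<Sum>i\<in>UNIV. \<Sum>j\<in>UNIV. g $ i $ j * x $ j * y $ i) = (\<Sum>j\<in>UNIV. \<Sum>i\<in>UNIV. g $ i $ j * x $ j * y $ i)"
    by (rule sum.swap)
  then show ?thesis
    by (simp add: cdot_def matrix_vector_mult_def transpose_def sum_distrib_left sum_distrib_right mult_ac
        del: transpose_matrix_vector)
qed

lemma matrix_vec_minus: "(A :: complex^'n^'m) *v (- x) = - (A *v x)"
  by (simp add: vec_eq_iff matrix_vector_mult_def sum_negf)

lemma orthogonal_iff_cdot:
  fixes g :: "complex^'n^'n"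
  shows "transpose g ** g = mat 1 \<longleftrightarrow> (\<forall>x y. cdot (g *v x) (g *v y) = cdot x y)"
proof
  assume "transpose g ** g = mat 1"
  then show "\<forall>x y. cdot (g *v x) (g *v y) = cdot x y"
    by (simp add: cdot_transpose matrix_vector_mul_assoc del: transpose_matrix_vector)
next
  assume *: "\<forall>x y. cdot (g *v x) (g *v y) = cdot x y"
  have "(transpose g ** g) *v y = mat 1 *v y" for y
  proof (rule cdot_eqI)
    fix z
    have "cdot z ((transpose g ** g) *v y) = cdot z y"
      using * by (simp add: cdot_transpose matrix_vector_mul_assoc[symmetric] del: transpose_matrix_vector)
    then show "cdot ((transpose g ** g) *v y) z = cdot (mat 1 *v y) z" by (simp add: cdot_commute)
  qed
  then show "transpose g ** g = mat 1" by (simp add: matrix_eq del: transpose_matrix_vector)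
qed

lemma orthogonal_det_square: "transpose g ** g = mat 1 \<Longrightarrow> det g * det g = (1 :: complex)"
  by (metis det_I det_mul det_transpose)

lemma SO8C_D:
  assumes "g \<in> SO8C"
  shows "det g = 1" "transpose g ** g = mat 1" "g ** transpose g = mat 1"
    "cdot (g *v x) (g *v y) = cdot x y" "g *v (transpose g *v z) = z" "transpose g *v (g *v z) = z"
proof -
  show 1: "det g = 1" "transpose g ** g = mat 1" using assms by (auto simp: SO8C_def)
  show 2: "g ** transpose g = mat 1" using 1 matrix_left_right_inverse by blast
  show "cdot (g *v x) (g *v y) = cdot x y" using 1 orthogonal_iff_cdot by blast
  show "g *v (transpose g *v z) = z" "transpose g *v (g *v z) = z"
    using 1 2 by (simp_all add: matrix_vector_mul_assoc del: transpose_matrix_vector)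
qed

lemma SO8C_one: "mat 1 \<in> SO8C"
  by (simp add: SO8C_def transpose_mat)

lemma SO8C_mult:
  assumes "g \<in> SO8C" "h \<in> SO8C"
  shows "g ** h \<in> SO8C"
proof -
  have "cdot ((g ** h) *v x) ((g ** h) *v y) = cdot x y" for x y
    using assms by (simp add: matrix_vector_mul_assoc[symmetric] SO8C_D)
  then show ?thesis using assms orthogonal_iff_cdot[of "g ** h"] by (simp add: SO8C_def det_mul)
qed

lemma SO8C_transpose: "g \<in> SO8C \<Longrightarrow> transpose g \<in> SO8C"
  using SO8C_D(1)[of g] SO8C_D(3)[of g] by (simp add: SO8C_def det_transpose)

lemma det_cnj_mat: "det (cnj_mat g) = cnj (det g)"
  by (simp add: det_def cnj_sum cnj_prod)

lemma SO8C_cnj: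
  assumes "g \<in> SO8C" shows "cnj_mat g \<in> SO8C"
proof -
  have "transpose (cnj_mat g) ** cnj_mat g = cnj_mat (transpose g ** g)"
    by (simp add: cnj_mat_mult cnj_mat_transpose)
  then show ?thesis using assms by (simp add: SO8C_def det_cnj_mat)
qed

lemma fixes_transpose:
  assumes "g \<in> SO8C" "g *v x = x" shows "transpose g *v x = x"
  using SO8C_D(6)[OF assms(1), of x] assms(2) by simp

lemma SO7C_one: "mat 1 \<in> SO7C"
  by (simp add: SO7C_def SO8C_one)

lemma SO7C_mult: "g \<in> SO7C \<Longrightarrow> h \<in> SO7C \<Longrightarrow> g ** h \<in> SO7C"
  by (simp add: SO7C_def SO8C_mult matrix_vector_mul_assoc[symmetric])

lemma SO7C_transpose: "g \<in> SO7C \<Longrightarrow> transpose g \<in> SO7C"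
  using fixes_transpose by (auto simp: SO7C_def SO8C_transpose simp del: transpose_matrix_vector)

lemma cnj_mat_cayley_e: "g *v cayley_e i = cayley_e j \<Longrightarrow> cnj_mat g *v cayley_e i = cayley_e j"
  using cnj_vec_mult[of g "cayley_e i"] by simp

lemma SO7C_cnj: "g \<in> SO7C \<Longrightarrow> cnj_mat g \<in> SO7C"
  by (simp add: SO7C_def SO8C_cnj cnj_mat_cayley_e)

lemma G2C_iff: "g \<in> G2C \<longleftrightarrow> g \<in> SO8C \<and> tri g g"
  by (auto simp: G2C_def tri_def)

lemma Spin7C_iff: "g \<in> Spin7C \<longleftrightarrow> g \<in> SO8C \<and> (\<exists>g0\<in>SO7C. tri g0 g)"
  by (auto simp: Spin7C_def tri_def)

lemma Spin7CI: "g \<in> SO8C \<Longrightarrow> g0 \<in> SO7C \<Longrightarrow> tri g0 g \<Longrightarrow> g \<in> Spin7C"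
  using Spin7C_iff by blast

lemma G2C_sub_SO7C: "G2C \<subseteq> SO7C"
proof
  fix g assume g: "g \<in> G2C"
  then have "(g *v cayley_e 0) \<bullet>\<^sub>C (g *v y) = g *v y" for y
    unfolding G2C_iff tri_def by (metis cayley_one(1))
  from this[of "transpose g *v cayley_e 0"] have "g *v cayley_e 0 = cayley_e 0"
    using g by (simp add: G2C_iff SO8C_D del: transpose_matrix_vector)
  then show "g \<in> SO7C" using g by (simp add: SO7C_def G2C_iff)
qed

lemma G2C_sub_Spin7C: "G2C \<subseteq> Spin7C"
  using G2C_sub_SO7C G2C_iff Spin7CI by blast

lemma G2C_one_fixed: "g \<in> G2C \<Longrightarrow> g *v cayley_e 0 = cayley_e 0"
  using G2C_sub_SO7C by (auto simp: SO7C_def)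

lemma tri_transpose_SO8C: "tri g0 g \<Longrightarrow> g0 \<in> SO8C \<Longrightarrow> g \<in> SO8C \<Longrightarrow> tri (transpose g0) (transpose g)"
  by (rule tri_transpose) (simp_all add: SO8C_D(2,3))

lemma G2C_group:
  "mat 1 \<in> G2C" "g \<in> G2C \<Longrightarrow> h \<in> G2C \<Longrightarrow> g ** h \<in> G2C"
  "g \<in> G2C \<Longrightarrow> transpose g \<in> G2C" "g \<in> G2C \<Longrightarrow> cnj_mat g \<in> G2C"
  by (simp_all add: G2C_iff SO8C_one tri_one SO8C_mult tri_mult SO8C_transpose tri_transpose_SO8C SO8C_cnj tri_cnj)

lemma Spin7C_group:
  "mat 1 \<in> Spin7C" "g \<in> Spin7C \<Longrightarrow> h \<in> Spin7C \<Longrightarrow> g ** h \<in> Spin7C"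
  "g \<in> Spin7C \<Longrightarrow> transpose g \<in> Spin7C" "g \<in> Spin7C \<Longrightarrow> cnj_mat g \<in> Spin7C"
proof -
  show "mat 1 \<in> Spin7C" using SO8C_one SO7C_one tri_one Spin7CI by blast
  show "g ** h \<in> Spin7C" if gh: "g \<in> Spin7C" "h \<in> Spin7C"
  proof -
    obtain g0 h0 where "g0 \<in> SO7C" "h0 \<in> SO7C" "tri g0 g" "tri h0 h" using gh Spin7C_iff by blast
    then show ?thesis using gh Spin7CI[OF SO8C_mult SO7C_mult tri_mult] Spin7C_iff by metis
  qed
  show "transpose g \<in> Spin7C" if "g \<in> Spin7C"
  proof -
    obtain g0 where g0: "g0 \<in> SO7C" "tri g0 g" "g \<in> SO8C" using \<open>g \<in> Spin7C\<close> Spin7C_iff by blast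
    then have "tri (transpose g0) (transpose g)" by (intro tri_transpose_SO8C) (auto simp: SO7C_def)
    then show ?thesis using g0 SO8C_transpose SO7C_transpose Spin7CI by blast
  qed
  show "cnj_mat g \<in> Spin7C" if "g \<in> Spin7C"
    using that SO8C_cnj SO7C_cnj tri_cnj unfolding Spin7C_iff by blast
qed

lemma SL3C_group:
  "mat 1 \<in> SL3C" "g \<in> SL3C \<Longrightarrow> h \<in> SL3C \<Longrightarrow> g ** h \<in> SL3C"
  "g \<in> SL3C \<Longrightarrow> transpose g \<in> SL3C" "g \<in> SL3C \<Longrightarrow> cnj_mat g \<in> SL3C"
  using G2C_group fixes_transpose[of g "cayley_e 1"]
  by (simp_all add: SL3C_def G2C_iff matrix_vector_mul_assoc[symmetric] cnj_mat_cayley_e del: transpose_matrix_vector)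

text \<open>At y = e_0 the relation reads (g0 x) u = g x with u = g e_0 of norm one, and u can be
  cancelled. So the companion is unique and continuous in g.\<close>

lemma tri_companion:
  assumes "tri g0 g" "g \<in> SO8C"
  shows "g0 = Rmul (oconj (g *v cayley_e 0)) ** g"
proof -
  let ?u = "g *v cayley_e 0"
  have "cdot ?u ?u = 1" using SO8C_D(4)[OF assms(2)] by (simp add: cayley_e_nth)
  moreover have "(g0 *v x) \<bullet>\<^sub>C ?u = g *v x" for x using assms(1) unfolding tri_def by (metis cayley_one(2))
  ultimately have "g0 *v x = (g *v x) \<bullet>\<^sub>C oconj ?u" for x
    using cayley_cancel_right(1)[of "g0 *v x" ?u] by simp
  then show ?thesis by (simp add: matrix_eq matrix_vector_mul_assoc[symmetric])
qed

lemma tri_fixed_one: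
  assumes "tri g0 g" "g *v cayley_e 0 = cayley_e 0" "g \<in> SO8C"
  shows "g0 = g" "g \<in> G2C"
proof -
  show "g0 = g" using tri_companion[OF assms(1,3)] assms(2)
    by (simp add: matrix_eq matrix_vector_mul_assoc[symmetric])
  then show "g \<in> G2C" using assms G2C_iff by blast
qed

subsection \<open>Elements given by multiplications\<close>

text \<open>An orthogonal matrix has determinant 1 or -1, so an orthogonal square root settles the
  sign: \<open>Lmul a\<close> is the square of \<open>Lmul u\<close> for u = c (e_0 + a) with c^2 =
  1/2.\<close>

lemma Lmul_SO8C:
  assumes "a $ 0 = 0" "cdot a a = 1"
  shows "Lmul a \<in> SO8C"
proof -
  have orth: "transpose (Lmul u) ** Lmul u = mat 1" if "cdot u u = 1" for u
    using that by (simp add: orthogonal_iff_cdot cdot_cayley_left)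
  define c where "c = csqrt (1/2)"
  define u where "u = c *s (cayley_e 0 + a)"
  have cc: "c * c = 1/2" unfolding c_def by (metis power2_csqrt power2_eq_square)
  have "cdot u u = (c * c) * 2" using assms by (simp add: u_def cayley_e_nth)
  then have "cdot u u = 1" using cc by simp
  moreover have "Lmul u ** Lmul u = Lmul a"
  proof -
    have "u \<bullet>\<^sub>C (u \<bullet>\<^sub>C y) = (c * c) *s (2 *s (a \<bullet>\<^sub>C y))" for y
      using assms by (simp add: u_def cayley_linear imag_square vec_eq_iff algebra_simps)
    then have "u \<bullet>\<^sub>C (u \<bullet>\<^sub>C y) = a \<bullet>\<^sub>C y" for y using cc by (simp add: vec_eq_iff)
    then show ?thesis by (simp add: matrix_eq matrix_vector_mul_assoc[symmetric])
  qed
  ultimately have "det (Lmul a) = 1" using orthogonal_det_square[OF orth] det_mul by metis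
  then show ?thesis using orth assms(2) by (simp add: SO8C_def)
qed

lemma Rmul_SO8C:
  assumes "a $ 0 = 0" "cdot a a = 1"
  shows "Rmul a \<in> SO8C"
proof -
  have orth: "transpose (Rmul u) ** Rmul u = mat 1" if "cdot u u = 1" for u
    using that by (simp add: orthogonal_iff_cdot cdot_cayley_right)
  define c where "c = csqrt (1/2)"
  define u where "u = c *s (cayley_e 0 + a)"
  have cc: "c * c = 1/2" unfolding c_def by (metis power2_csqrt power2_eq_square)
  have "cdot u u = (c * c) * 2" using assms by (simp add: u_def cayley_e_nth)
  then have "cdot u u = 1" using cc by simp
  moreover have "Rmul u ** Rmul u = Rmul a"
  proof -
    have "(y \<bullet>\<^sub>C a) \<bullet>\<^sub>C a = - y" for y
      using cayley_cancel_right(1)[of y a] assms by (simp add: oconj_imag cayley_linear) (metis minus_minus)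
    then have "(y \<bullet>\<^sub>C u) \<bullet>\<^sub>C u = (c * c) *s (2 *s (y \<bullet>\<^sub>C a))" for y
      using assms by (simp add: u_def cayley_linear vec_eq_iff algebra_simps)
    then have "(y \<bullet>\<^sub>C u) \<bullet>\<^sub>C u = y \<bullet>\<^sub>C a" for y using cc by (simp add: vec_eq_iff)
    then show ?thesis by (simp add: matrix_eq matrix_vector_mul_assoc[symmetric])
  qed
  ultimately have "det (Rmul a) = 1" using orthogonal_det_square[OF orth] det_mul by metis
  then show ?thesis using orth assms(2) by (simp add: SO8C_def)
qed

text \<open>With b a unit multiple of a, the half-turn is x \<mapsto> - (b x) b, a product of a left
  and a right multiplication whose determinants are known.\<close>

lemma Cmul_SO7C:
  assumes "a $ 0 = 0" "cdot a a \<noteq> 0"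
  shows "Cmul a \<in> SO7C"
proof -
  define c where "c = inverse (csqrt (cdot a a))"
  define b where "b = c *s a"
  have cc: "c * c = inverse (cdot a a)"
    unfolding c_def by (metis inverse_mult_distrib power2_csqrt power2_eq_square)
  have b: "b $ 0 = 0" "cdot b b = 1" using assms cc by (simp_all add: b_def mult.assoc[symmetric])
  have "Cmul a *v x = ((b \<bullet>\<^sub>C x) \<bullet>\<^sub>C (- b))" for x
  proof -
    have "b \<bullet>\<^sub>C x = oconj x \<bullet>\<^sub>C b - (2 * cdot x b) *s cayley_e 0"
      using cayley_cancel_polar[of x b "cayley_e 0"] b by (simp add: oconj_imag cayley_linear algebra_simps)
    then have "(b \<bullet>\<^sub>C x) \<bullet>\<^sub>C b = (oconj x \<bullet>\<^sub>C b) \<bullet>\<^sub>C b - (2 * cdot x b) *s b" by (simp add: cayley_linear)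
    moreover have "(oconj x \<bullet>\<^sub>C b) \<bullet>\<^sub>C b = - oconj x"
      using cayley_cancel_right(1)[of "oconj x" b] b by (simp add: oconj_imag cayley_linear) (metis minus_minus)
    ultimately have 1: "(b \<bullet>\<^sub>C x) \<bullet>\<^sub>C (- b) = oconj x + (2 * cdot x b) *s b" by (simp add: cayley_linear)
    have "(2 * cdot x b) *s b = (2 * cdot a x * (c * c)) *s a"
      by (simp add: b_def vec_eq_iff cdot_commute mult_ac)
    then show ?thesis unfolding 1 cc by (simp add: Cmul_vec divide_inverse)
  qed
  then have "Cmul a = Rmul (- b) ** Lmul b" by (simp add: matrix_eq matrix_vector_mul_assoc[symmetric])
  moreover have "Rmul (- b) ** Lmul b \<in> SO8C" using b by (intro SO8C_mult Rmul_SO8C Lmul_SO8C) simp_all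
  moreover have "Cmul a *v cayley_e 0 = cayley_e 0" using assms by (simp add: Cmul_vec cayley_e_nth)
  ultimately show ?thesis by (simp add: SO7C_def)
qed

lemma Lmul_Spin7C: "a $ 0 = 0 \<Longrightarrow> cdot a a = 1 \<Longrightarrow> Lmul a \<in> Spin7C"
  using Spin7CI[OF Lmul_SO8C Cmul_SO7C tri_Cmul_Lmul] by simp

definition Imul :: "complex^8 \<Rightarrow> complex^8 \<Rightarrow> complex^8^8" where
  "Imul a b = mat_scale (- inverse (cdot (a \<bullet>\<^sub>C b) (a \<bullet>\<^sub>C b))) (Lmul (a \<bullet>\<^sub>C b) ** (Lmul a ** Lmul b))"

text \<open>For orthogonal imaginary \<open>a\<close> and \<open>b\<close> this is the automorphism that fixes the quaternion
  subalgebra generated by \<open>a\<close> and \<open>b\<close> and is \<open>-1\<close> on its orthogonal complement.\<close>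

lemma Imul_G2C:
  assumes "a $ 0 = 0" "b $ 0 = 0" "cdot a a \<noteq> 0" "cdot b b \<noteq> 0" "cdot a b = 0"
  shows "Imul a b \<in> G2C" "Imul a b = Cmul (a \<bullet>\<^sub>C b) ** (Cmul a ** Cmul b)"
proof -
  define d where "d = a \<bullet>\<^sub>C b"
  have "cdot d (cayley_e 0) = cdot b (oconj a)"
    unfolding d_def by (simp only: cdot_cayley_adjoint_left cayley_one)
  then have d0: "d $ 0 = 0" using assms by (simp add: oconj_imag cdot_commute)
  have dd: "cdot d d \<noteq> 0" using assms by (simp add: d_def cdot_cayley_norm)
  let ?g0 = "Cmul d ** (Cmul a ** Cmul b)"
  have tri: "tri ?g0 (Imul a b)"
    unfolding Imul_def d_def[symmetric]
    using assms d0 dd by (intro tri_scale tri_mult tri_Cmul_Lmul)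
  have e: "Imul a b *v cayley_e 0 = cayley_e 0"
    using dd imag_square[OF d0, of "cayley_e 0"]
    by (simp add: Imul_def mat_scale_vec matrix_vector_mul_assoc[symmetric] d_def[symmetric] vec_eq_iff)
  \<comment> \<open>The scalar in \<open>Imul\<close> normalises the lift so that it fixes e_0; the
    triality relation at y = e_0 then identifies lift and companion.\<close>
  have "Imul a b = ?g0"
  proof -
    have "(?g0 *v x) \<bullet>\<^sub>C (Imul a b *v cayley_e 0) = Imul a b *v x" for x
      using tri unfolding tri_def by (metis cayley_one(2))
    then show ?thesis unfolding e by (simp add: matrix_eq)
  qed
  moreover have "?g0 \<in> SO7C" using assms d0 dd by (intro SO7C_mult Cmul_SO7C)
  ultimately show "Imul a b \<in> G2C" "Imul a b = Cmul (a \<bullet>\<^sub>C b) ** (Cmul a ** Cmul b)"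
    using tri by (simp_all add: G2C_iff SO7C_def d_def)
qed

text \<open>The three half-turns take x to -x, then to -y, then to y: b is orthogonal to x, the
  half-turn about x + y exchanges x and y, and (x + y) b is orthogonal to y. The last point is where
  b has to be orthogonal to e_0 and x y too.\<close>

lemma Imul_swap:
  assumes x: "x $ 0 = 0" "cdot x x = 1" and y: "y $ 0 = 0" "cdot y y = 1"
    and xy: "1 + cdot x y \<noteq> 0"
    and b: "b $ 0 = 0" "cdot b b \<noteq> 0" "cdot b x = 0" "cdot b y = 0" "cdot b (x \<bullet>\<^sub>C y) = 0"
  shows "Imul (x + y) b \<in> G2C" "Imul (x + y) b *v x = y"
proof -
  let ?a = "x + y"
  have aa: "cdot ?a ?a = 2 * (1 + cdot x y)" using x y by (simp add: cdot_commute[of y x])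
  have aa0: "cdot ?a ?a \<noteq> 0" by (metis aa xy mult_eq_0_iff zero_neq_numeral)
  have a: "?a $ 0 = 0" "cdot ?a b = 0"
    using x y b by (simp_all add: cdot_commute)
  show "Imul ?a b \<in> G2C" using Imul_G2C(1)[OF a(1) b(1) aa0 b(2) a(2)] .
  have "Cmul b *v x = - x" using x b by (simp add: Cmul_vec oconj_imag)
  moreover have "Cmul ?a *v (- x) = - y"
  proof -
    have "cdot ?a x = 1 + cdot x y" using x by (simp add: cdot_commute[of y x])
    then have "2 * cdot ?a x / cdot ?a ?a = 1" using aa aa0 by (metis divide_self)
    then have "Cmul ?a *v x = oconj x + 1 *s ?a" by (simp only: Cmul_vec)
    then have "Cmul ?a *v x = y" by (simp add: oconj_imag x)
    then show ?thesis
      by (simp add: matrix_vec_minus)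
  qed
  moreover have "Cmul (?a \<bullet>\<^sub>C b) *v (- y) = y"
  proof -
    have "cdot (?a \<bullet>\<^sub>C b) y = cdot b (oconj ?a \<bullet>\<^sub>C y)" by (rule cdot_cayley_adjoint_left)
    also have "oconj ?a \<bullet>\<^sub>C y = - (x \<bullet>\<^sub>C y) - y \<bullet>\<^sub>C y"
      by (simp add: oconj_imag[OF x(1)] oconj_imag[OF y(1)] cayley_linear)
    also have "\<dots> = cayley_e 0 - x \<bullet>\<^sub>C y" using imag_square[OF y(1), of "cayley_e 0"] y(2) by simp
    finally have "cdot (?a \<bullet>\<^sub>C b) y = 0" using b by simp
    then show ?thesis using y by (simp add: Cmul_vec oconj_imag)
  qed
  ultimately show "Imul ?a b *v x = y"
    unfolding Imul_G2C(2)[OF a(1) b(1) aa0 b(2) a(2)] by (simp add: matrix_vector_mul_assoc[symmetric])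
qed

subsection \<open>Closedness and fourth roots\<close>

lemma continuous_matrix_mult:
  fixes f :: "'a::topological_space \<Rightarrow> complex^'n^'m" and g :: "'a \<Rightarrow> complex^'k^'n"
  shows "continuous_on S f \<Longrightarrow> continuous_on S g \<Longrightarrow> continuous_on S (\<lambda>x. f x ** g x)"
  using bounded_bilinear.continuous_on[OF bilinear_matrix_mult[unfolded bilinear_conv_bounded_bilinear]] .

lemma continuous_cayley:
  "continuous_on S f \<Longrightarrow> continuous_on S g \<Longrightarrow> continuous_on S (\<lambda>x. f x \<bullet>\<^sub>C g x)"
  using bounded_bilinear.continuous_on[OF bilinear_cayley[unfolded bilinear_conv_bounded_bilinear]] .

lemma continuous_matrix_vec: "continuous_on S f \<Longrightarrow> continuous_on S (\<lambda>x. (f x :: complex^'n^'m) *v y)"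
  unfolding matrix_vector_mult_def
  by (intro continuous_on_vec_lambda continuous_on_sum continuous_on_mult continuous_on_component continuous_on_const)

lemma continuous_transpose: "continuous_on S f \<Longrightarrow> continuous_on S (\<lambda>x. transpose (f x :: complex^'n^'m))"
  unfolding transpose_def by (intro continuous_on_vec_lambda continuous_on_component)

lemma closed_SO8C: "closed SO8C"
proof -
  have "continuous_on UNIV (\<lambda>g :: complex^8^8. det g)"
    unfolding det_def by (intro continuous_intros)
  then have "closed {g :: complex^8^8. det g = 1}" by (intro closed_Collect_eq) auto
  moreover have "closed {g :: complex^8^8. transpose g ** g = mat 1}"
    by (intro closed_Collect_eq continuous_matrix_mult continuous_transpose) auto
  ultimately show ?thesis unfolding SO8C_def by (rule closed_Collect_conj)
qed

lemma closed_fixes: "closed {g :: complex^'n^'n. g *v x = x}"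
  by (intro closed_Collect_eq continuous_matrix_vec) auto

lemma closed_SO7C: "closed SO7C"
proof -
  have "SO7C = SO8C \<inter> {g. g *v cayley_e 0 = cayley_e 0}" by (auto simp: SO7C_def)
  then show ?thesis using closed_SO8C closed_fixes by (metis closed_Int)
qed

lemma closed_tri:
  assumes "continuous_on UNIV f"
  shows "closed {g. tri (f g) g}"
  unfolding tri_def
  by (intro closed_Collect_all closed_Collect_eq continuous_cayley continuous_matrix_vec assms continuous_on_id)

lemma closed_G2C: "closed G2C"
proof -
  have "G2C = SO8C \<inter> {g. tri g g}" by (auto simp: G2C_iff)
  then show ?thesis using closed_SO8C closed_tri[OF continuous_on_id] by (metis closed_Int)
qed

lemma closed_SL3C: "closed SL3C"
proof -
  have "SL3C = G2C \<inter> {g. g *v cayley_e 1 = cayley_e 1}" by (auto simp: SL3C_def)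
  then show ?thesis using closed_G2C closed_fixes by (metis closed_Int)
qed

lemma linear_Rmul_oconj: "linear (\<lambda>x. Rmul (oconj x))"
proof (rule linearI)
  have r: "r *\<^sub>R x = complex_of_real r *s x" for r and x :: "complex^8"
    by (simp add: vec_eq_iff complex_eq_iff)
  show "Rmul (oconj (x + y)) = Rmul (oconj x) + Rmul (oconj y)" for x y
    by (simp add: Rmul_def vec_eq_iff sum.distrib algebra_simps)
  show "Rmul (oconj (c *\<^sub>R x)) = c *\<^sub>R Rmul (oconj x)" for c x
    unfolding r oconj_linear by (simp add: Rmul_def vec_eq_iff sum_distrib_left complex_eq_iff scaleR_sum_right mult_ac)
qed

text \<open>The existential companion is replaced by the explicit one, which is continuous in g, so
  membership becomes a closed condition.\<close>

lemma closed_Spin7C: "closed Spin7C"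
proof -
  let ?c = "\<lambda>g. Rmul (oconj (g *v cayley_e 0)) ** g"
  have "continuous_on UNIV (\<lambda>x. Rmul (oconj x))"
    using linear_Rmul_oconj by (simp add: linear_continuous_on linear_conv_bounded_linear)
  from continuous_on_compose2[OF this continuous_matrix_vec[OF continuous_on_id]]
  have c: "continuous_on UNIV ?c"
    by (intro continuous_matrix_mult continuous_on_id) auto
  have "Spin7C = SO8C \<inter> (?c -` SO7C \<inter> {g. tri (?c g) g})"
  proof (intro equalityI subsetI)
    fix g assume "g \<in> Spin7C"
    then obtain g0 where g: "g \<in> SO8C" "g0 \<in> SO7C" "tri g0 g" using Spin7C_iff by blast
    then show "g \<in> SO8C \<inter> (?c -` SO7C \<inter> {g. tri (?c g) g})"
      using tri_companion[OF g(3,1)] by simp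
  qed (use Spin7CI in blast)
  then show ?thesis
    using closed_Int[OF closed_SO8C closed_Int[OF closed_vimage[OF closed_SO7C c] closed_tri[OF c]]]
    by (simp only:)
qed

section \<open>Fourth roots inside the groups\<close>

definition root4 :: "real \<Rightarrow> real" where "root4 c = sqrt (sqrt c)"

lemma root4: "root4 (c * d) = root4 c * root4 d" "root4 1 = 1"
  "c \<ge> 0 \<Longrightarrow> root4 c * root4 c * root4 c * root4 c = c"
  "c \<ge> 0 \<Longrightarrow> sqrt (root4 c) * sqrt (root4 c) = root4 c"
proof -
  show "root4 (c * d) = root4 c * root4 d" "root4 1 = 1" by (simp_all add: root4_def real_sqrt_mult)
  assume c: "c \<ge> 0"
  have "root4 c * root4 c = sqrt c" using c by (simp add: root4_def)
  then show "root4 c * root4 c * root4 c * root4 c = c" using c by (simp add: mult.assoc)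
  show "sqrt (root4 c) * sqrt (root4 c) = root4 c" using c by (simp add: root4_def)
qed

text \<open>On eigenvectors the claims reduce to roots of eigenvalues, which are nonnegative. The
  square root m of n is carried along for the determinant: once both are orthogonal, det n is the
  square of 1 or -1.\<close>

lemma fourth_root_exists:
  fixes g :: "complex^'n^'n"
  obtains n m where "adjoint_mat n = n" "n ** n ** n ** n = g ** adjoint_mat g" "m ** m = n"
    "\<And>c x. (g ** adjoint_mat g) *v x = c *\<^sub>R x \<Longrightarrow> n *v x = root4 c *\<^sub>R x"
    "\<And>c x. (g ** adjoint_mat g) *v x = c *\<^sub>R x \<Longrightarrow> m *v x = sqrt (root4 c) *\<^sub>R x"
proof -
  let ?p = "g ** adjoint_mat g"
  have p: "adjoint_mat ?p = ?p" by (simp add: adjoint_mat_mult)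
  obtain n where n: "adjoint_mat n = n" "\<And>c x. ?p *v x = c *\<^sub>R x \<Longrightarrow> n *v x = root4 c *\<^sub>R x"
    by (rule hermitian_calculus[OF p, of root4]) blast
  obtain m where m: "adjoint_mat m = m" "\<And>c x. ?p *v x = c *\<^sub>R x \<Longrightarrow> m *v x = sqrt (root4 c) *\<^sub>R x"
    by (rule hermitian_calculus[OF p, of "\<lambda>c. sqrt (root4 c)"]) blast
  have pos: "c \<ge> 0" if "?p *v x = c *\<^sub>R x" "x \<noteq> 0" for c x
  proof -
    have "c * (x \<bullet> x) = (?p *v x) \<bullet> x" using that by simp
    also have "\<dots> = (g *v (adjoint_mat g *v x)) \<bullet> x" by (simp add: matrix_vector_mul_assoc)
    also have "\<dots> = (adjoint_mat g *v x) \<bullet> (adjoint_mat g *v x)" by (rule inner_matrix_vector)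
    finally have "c * (x \<bullet> x) \<ge> 0" by simp
    then show ?thesis using that(2) inner_gt_zero_iff[of x] by (metis not_le zero_le_mult_iff)
  qed
  have ls: "A *v (c *\<^sub>R x) = c *\<^sub>R (A *v x)" for A :: "complex^'n^'n" and c x
    using linear_scale[OF linear_matrix_vector] .
  have "(*v) (n ** n ** n ** n) = (*v) ?p"
  proof (rule linear_eq_on_eigenvectors[OF p linear_matrix_vector linear_matrix_vector])
    fix x :: "complex^'n" and c :: real assume e: "?p *v x = c *\<^sub>R x"
    show "(n ** n ** n ** n) *v x = ?p *v x"
    proof (cases "x = 0")
      case False
      have "(n ** n ** n ** n) *v x = (root4 c * root4 c * root4 c * root4 c) *\<^sub>R x"
        using n(2)[OF e] by (simp add: matrix_vector_mul_assoc[symmetric] ls)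
      then show ?thesis using root4(3)[OF pos[OF e False]] e by simp
    qed simp
  qed
  then have n4: "n ** n ** n ** n = ?p" by (simp add: matrix_eq fun_eq_iff)
  have "(*v) (m ** m) = (*v) n"
  proof (rule linear_eq_on_eigenvectors[OF p linear_matrix_vector linear_matrix_vector])
    fix x :: "complex^'n" and c :: real assume e: "?p *v x = c *\<^sub>R x"
    show "(m ** m) *v x = n *v x"
    proof (cases "x = 0")
      case False
      have "(m ** m) *v x = (sqrt (root4 c) * sqrt (root4 c)) *\<^sub>R x"
        using m(2)[OF e] by (simp add: matrix_vector_mul_assoc[symmetric] ls)
      then show ?thesis using root4(4)[OF pos[OF e False]] n(2)[OF e] by simp
    qed simp
  qed
  then have "m ** m = n" by (simp add: matrix_eq fun_eq_iff)
  then show thesis using that n m n4 by blast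
qed

text \<open>Orthogonality says that the bilinear form is preserved, so the calculus for bilinear
  identities applies once the form is made vector-valued by multiplying it with
  \<open>cayley_e 0\<close> and r is the identity matrix. The condition \<open>h 1 = 1\<close> is
  the one for that identity matrix.\<close>

lemma orthogonal_calculus:
  fixes p n :: "complex^8^8"
  assumes "adjoint_mat p = p" "transpose p ** p = mat 1" "\<And>c d. h (c * d) = h c * h d" "h 1 = (1 :: real)"
    and n: "\<And>c x. p *v x = c *\<^sub>R x \<Longrightarrow> n *v x = h c *\<^sub>R x"
  shows "transpose n ** n = mat 1"
proof -
  have r: "r *\<^sub>R x = complex_of_real r *s x" for r and x :: "complex^8"
    by (simp add: vec_eq_iff complex_eq_iff)
  let ?b = "\<lambda>(x :: complex^8) (y :: complex^8). cdot x y *s cayley_e 0 :: complex^8"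
  have cr: "cdot (r *\<^sub>R x) y = complex_of_real r * cdot x y" "cdot x (r *\<^sub>R y) = complex_of_real r * cdot x y"
    for r and x y :: "complex^8"
    by (simp_all only: r cdot_scale)
  have b: "bilinear ?b"
    unfolding bilinear_def linear_iff by (simp add: cr vec_eq_iff complex_eq_iff algebra_simps)
  have 1: "mat 1 *v x = h c *\<^sub>R x" if "mat 1 *v x = c *\<^sub>R x" for c and x :: "complex^8"
  proof (cases "x = 0")
    case False
    have "1 *\<^sub>R x = c *\<^sub>R x" using that by simp
    then have "c = 1" using False by (metis scaleR_right_imp_eq)
    then show ?thesis using assms(4) by simp
  qed simp
  have *: "?b (n *v x) (n *v y) = mat 1 *v ?b x y" for x y
  proof (rule bilinear_hermitian_calculus[where b = ?b and p = p and q = p and r = "mat 1" and h = h])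
    show "?b (p *v x) (p *v y) = mat 1 *v ?b x y" for x y
      using assms(2) orthogonal_iff_cdot[of p] by simp
  qed (use assms(1,3) b n 1 in auto)
  have "cdot (n *v x) (n *v y) = cdot x y" for x y
    using arg_cong[OF *[of x y], of "\<lambda>z. z $ 0"] by (simp add: cayley_e_nth)
  then show ?thesis using orthogonal_iff_cdot by blast
qed

lemma SO8C_adjoint: "g \<in> SO8C \<Longrightarrow> adjoint_mat g \<in> SO8C"
  by (simp add: adjoint_mat_def SO8C_cnj SO8C_transpose)

lemma SO8C_root:
  assumes g: "g \<in> SO8C"
  obtains n where "n \<in> SO8C" "adjoint_mat n = n" "n ** n ** n ** n = g ** adjoint_mat g"
    "\<And>c x. (g ** adjoint_mat g) *v x = c *\<^sub>R x \<Longrightarrow> n *v x = root4 c *\<^sub>R x"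
proof -
  obtain n m where nm: "adjoint_mat n = n" "n ** n ** n ** n = g ** adjoint_mat g" "m ** m = n"
    "\<And>c x. (g ** adjoint_mat g) *v x = c *\<^sub>R x \<Longrightarrow> n *v x = root4 c *\<^sub>R x"
    "\<And>c x. (g ** adjoint_mat g) *v x = c *\<^sub>R x \<Longrightarrow> m *v x = sqrt (root4 c) *\<^sub>R x"
    by (rule fourth_root_exists[of g]) blast
  let ?p = "g ** adjoint_mat g"
  have p: "adjoint_mat ?p = ?p" "transpose ?p ** ?p = mat 1"
    using SO8C_D(2)[OF SO8C_mult[OF g SO8C_adjoint[OF g]]] by (simp_all add: adjoint_mat_mult)
  have "transpose n ** n = mat 1"
    by (rule orthogonal_calculus[OF p, where h = root4]) (simp_all add: root4 nm(4))
  moreover have "transpose m ** m = mat 1"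
    by (rule orthogonal_calculus[OF p, where h = "\<lambda>c. sqrt (root4 c)"]) (simp_all add: root4 real_sqrt_mult nm(5))
  then have "det n = 1" using orthogonal_det_square[of m] by (metis det_mul nm(3))
  ultimately show thesis using that nm(1,2,4) by (simp add: SO8C_def)
qed

lemma tri_adjoint:
  assumes "tri g0 g" "g0 \<in> SO8C" "g \<in> SO8C"
  shows "tri (g0 ** adjoint_mat g0) (g ** adjoint_mat g)"
  unfolding adjoint_mat_def cnj_mat_transpose[symmetric]
  using tri_mult[OF assms(1) tri_cnj[OF tri_transpose_SO8C[OF assms]]] .

lemma tri_calculus:
  assumes "tri (g0 ** adjoint_mat g0) (g ** adjoint_mat g)"
    "\<And>c x. (g0 ** adjoint_mat g0) *v x = c *\<^sub>R x \<Longrightarrow> n0 *v x = root4 c *\<^sub>R x"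
    "\<And>c x. (g ** adjoint_mat g) *v x = c *\<^sub>R x \<Longrightarrow> n *v x = root4 c *\<^sub>R x"
  shows "tri n0 n"
proof -
  have "(n0 *v x) \<bullet>\<^sub>C (n *v y) = n *v (x \<bullet>\<^sub>C y)" for x y
  proof (rule bilinear_hermitian_calculus[where b = "(\<bullet>\<^sub>C)" and p = "g0 ** adjoint_mat g0"
        and q = "g ** adjoint_mat g" and r = "g ** adjoint_mat g" and h = root4])
    show "((g0 ** adjoint_mat g0) *v x) \<bullet>\<^sub>C ((g ** adjoint_mat g) *v y) = (g ** adjoint_mat g) *v (x \<bullet>\<^sub>C y)"
      for x y using assms(1) unfolding tri_def by blast
  qed (simp_all add: adjoint_mat_mult root4 assms(2,3) bilinear_cayley)
  then show ?thesis by (simp add: tri_def)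
qed

lemma SO7C_root:
  assumes g: "g \<in> SO7C"
  obtains n where "n \<in> SO7C" "adjoint_mat n = n" "n ** n ** n ** n = g ** adjoint_mat g"
    "\<And>c x. (g ** adjoint_mat g) *v x = c *\<^sub>R x \<Longrightarrow> n *v x = root4 c *\<^sub>R x"
proof -
  have g8: "g \<in> SO8C" using g by (simp add: SO7C_def)
  obtain n where n: "n \<in> SO8C" "adjoint_mat n = n" "n ** n ** n ** n = g ** adjoint_mat g"
    "\<And>c x. (g ** adjoint_mat g) *v x = c *\<^sub>R x \<Longrightarrow> n *v x = root4 c *\<^sub>R x"
    by (rule SO8C_root[OF g8]) blast
  have "adjoint_mat g \<in> SO7C" using g by (simp add: adjoint_mat_def SO7C_cnj SO7C_transpose)
  then have "(g ** adjoint_mat g) *v cayley_e 0 = 1 *\<^sub>R cayley_e 0"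
    using g by (simp add: SO7C_def matrix_vector_mul_assoc[symmetric])
  from n(4)[OF this] have "n *v cayley_e 0 = cayley_e 0" by (simp add: root4)
  then show thesis using that n by (simp add: SO7C_def)
qed

lemma root_G2C:
  assumes "g \<in> G2C"
  shows "\<exists>n\<in>G2C. adjoint_mat n = n \<and> n ** n ** n ** n = g ** adjoint_mat g"
proof -
  have g: "g \<in> SO8C" "tri g g" using assms G2C_iff by auto
  obtain n where n: "n \<in> SO8C" "adjoint_mat n = n" "n ** n ** n ** n = g ** adjoint_mat g"
    "\<And>c x. (g ** adjoint_mat g) *v x = c *\<^sub>R x \<Longrightarrow> n *v x = root4 c *\<^sub>R x"
    by (rule SO8C_root[OF g(1)]) blast
  have "tri n n" using tri_calculus[OF tri_adjoint[OF g(2,1,1)] n(4,4)] .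
  then show ?thesis using n G2C_iff by blast
qed

text \<open>The roots for g and for its companion are taken with the same function of the
  eigenvalues, so the triality relation passes to them.\<close>

lemma root_Spin7C:
  assumes "g \<in> Spin7C"
  shows "\<exists>n\<in>Spin7C. adjoint_mat n = n \<and> n ** n ** n ** n = g ** adjoint_mat g"
proof -
  obtain g0 where g: "g \<in> SO8C" "g0 \<in> SO7C" "tri g0 g" "g0 \<in> SO8C"
    using assms by (auto simp: Spin7C_iff SO7C_def)
  obtain n where n: "n \<in> SO8C" "adjoint_mat n = n" "n ** n ** n ** n = g ** adjoint_mat g"
    "\<And>c x. (g ** adjoint_mat g) *v x = c *\<^sub>R x \<Longrightarrow> n *v x = root4 c *\<^sub>R x"
    by (rule SO8C_root[OF g(1)]) blast
  obtain n0 where n0: "n0 \<in> SO7C"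
    "\<And>c x. (g0 ** adjoint_mat g0) *v x = c *\<^sub>R x \<Longrightarrow> n0 *v x = root4 c *\<^sub>R x"
    by (rule SO7C_root[OF g(2)]) blast
  have "tri n0 n" using tri_calculus[OF tri_adjoint[OF g(3,4,1)] n0(2) n(4)] .
  then show ?thesis using n n0 Spin7CI by blast
qed

lemma root_SO7C: "g \<in> SO7C \<Longrightarrow> \<exists>n\<in>SO7C. adjoint_mat n = n \<and> n ** n ** n ** n = g ** adjoint_mat g"
  by (metis SO7C_root)

text \<open>The group of real points is compact, since real orthogonal matrices all have the norm of
  the identity. Its conjugate by q contains K, and maximality of K gives equality.\<close>

lemma (in matrix_pair) maximal_compact_conjugate:
  assumes clG: "closed G" and cnj: "\<And>g. g \<in> G \<Longrightarrow> cnj_mat g \<in> G"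
    and root: "\<And>g. g \<in> G \<Longrightarrow> \<exists>n\<in>G. adjoint_mat n = n \<and> n ** n ** n ** n = g ** adjoint_mat g"
    and K: "maximal_compact_subgroup G K"
  obtains q where "q \<in> G" "K = {q ** u ** transpose q |u. u \<in> G \<and> cnj_mat u = u}"
proof -
  have KG: "K \<subseteq> G" "subgroup K (matrix_group G)" "compact K"
    using K unfolding maximal_compact_subgroup_def subgroup_def matrix_group_def by auto
  then have Ks: "mat 1 \<in> K" "\<And>a b. a \<in> K \<Longrightarrow> b \<in> K \<Longrightarrow> a ** b \<in> K" "\<And>a. a \<in> K \<Longrightarrow> transpose a \<in> K"
    using subgroup_iff[of G K] by auto
  obtain q where q: "q \<in> G" "\<And>k. k \<in> K \<Longrightarrow> cnj_mat (transpose q ** k ** q) = transpose q ** k ** q"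
    using compact_subgroup_conjugate_real[OF clG root KG(1) Ks(1,2) KG(3)] by metis
  define U where "U = {u \<in> G. cnj_mat u = u}"
  define L where "L = {q ** u ** transpose q |u. u \<in> G \<and> cnj_mat u = u}"
  have LU: "L = (\<lambda>u. q ** u ** transpose q) ` U" unfolding L_def U_def by blast
  have tq: "transpose q \<in> G" using q transpose_G by blast
  have "norm u = norm (mat 1 :: complex^'m^'m)" if "u \<in> U" for u
  proof -
    have u: "u \<in> G" "adjoint_mat u = transpose u" using that by (auto simp: U_def adjoint_mat_def)
    have "u \<bullet> u = mat 1 \<bullet> (u ** adjoint_mat u)" using inner_matrix_mult[of "mat 1" u u] by simp
    also have "\<dots> = mat 1 \<bullet> (mat 1 :: complex^'m^'m)" using u orthogonal_G' by simp
    finally show ?thesis by (simp add: norm_eq_sqrt_inner)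
  qed
  then have "bounded U" unfolding bounded_iff by (metis order_refl)
  moreover have "closed U"
  proof -
    have "U = G \<inter> {u. cnj_mat u = u}" unfolding U_def by blast
    moreover have "closed {u :: complex^'m^'m. cnj_mat u = u}"
      by (intro closed_Collect_eq continuous_on_linear linear_cnj_mat continuous_on_id)
    ultimately show ?thesis using clG by (simp add: closed_Int)
  qed
  ultimately have "compact U" by (simp add: compact_eq_bounded_closed)
  then have cL: "compact L"
    unfolding LU by (intro compact_continuous_image continuous_matrix_mult continuous_on_const continuous_on_id)
  have LG: "L \<subseteq> G" unfolding L_def using q tq mult_G by blast
  have "subgroup L (matrix_group G)"
  proof -
    have "mat 1 \<in> L"
      using one_G orthogonal_G'[OF q(1)] unfolding L_def by (auto intro!: exI[of _ "mat 1"])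
    moreover have "a ** b \<in> L" if ab: "a \<in> L" "b \<in> L" for a b
    proof -
      obtain u v where "a = q ** u ** transpose q" "b = q ** v ** transpose q" "u ** v \<in> G"
        "cnj_mat (u ** v) = u ** v"
        using ab mult_G unfolding L_def by (auto simp: cnj_mat_mult)
      moreover from this have "a ** b = q ** (u ** v) ** transpose q"
        by (simp add: matrix_mul_assoc[symmetric] cancel_G q)
      ultimately show ?thesis unfolding L_def by blast
    qed
    moreover have "transpose a \<in> L" if a: "a \<in> L" for a
    proof -
      obtain u where "a = q ** u ** transpose q" "u \<in> G" "cnj_mat u = u" using a unfolding L_def by blast
      then have "transpose a = q ** transpose u ** transpose q" "transpose u \<in> G" "cnj_mat (transpose u) = transpose u"
        by (simp_all add: matrix_transpose_mul matrix_mul_assoc transpose_G cnj_mat_transpose)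
      then show ?thesis unfolding L_def by blast
    qed
    ultimately show ?thesis using subgroup_iff[of G L] LG by blast
  qed
  moreover have "K \<subseteq> L"
  proof
    fix k assume k: "k \<in> K"
    have "transpose q ** k ** q \<in> G" using k KG(1) q tq mult_G by blast
    moreover have "k = q ** (transpose q ** k ** q) ** transpose q"
      using orthogonal_G'[OF q(1)] by (simp add: matrix_mul_assoc[symmetric] cancel_G q(1))
    ultimately show "k \<in> L" using q(2)[OF k] unfolding L_def by blast
  qed
  ultimately have "L = K" using K cL unfolding maximal_compact_subgroup_def by blast
  then show thesis using that[of q] q(1) L_def by blast
qed

subsection \<open>Lifting to the spin group\<close>

lemma Cmul_lift:
  assumes "a $ 0 = 0" "cdot a a \<noteq> 0"
  shows "\<exists>h\<in>SO8C. tri (Cmul a) h"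
proof -
  define c where "c = inverse (csqrt (cdot a a))"
  have cc: "c * c = inverse (cdot a a)"
    unfolding c_def by (metis inverse_mult_distrib power2_csqrt power2_eq_square)
  have b: "(c *s a) $ 0 = 0" "cdot (c *s a) (c *s a) = 1" using assms cc by (simp_all add: mult.assoc[symmetric])
  have "Lmul (c *s a) = mat_scale c (Lmul a)" by (simp add: matrix_eq mat_scale_vec cayley_linear)
  then show ?thesis using Lmul_SO8C[OF b] tri_scale[OF tri_Cmul_Lmul[OF assms], of c] by metis
qed

lemma Cmul_cayley_e:
  assumes "i \<noteq> 0" "a $ i = 0" shows "Cmul a *v cayley_e i = - cayley_e i"
  using assms by (simp add: Cmul_vec oconj_imag cayley_e_nth)

text \<open>Orthogonality to the fixed basis vectors makes g diagonal with one free entry, and the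
  determinant determines that entry.\<close>

lemma SO7C_fixes_all_but_one:
  assumes g: "g \<in> SO7C" and fix_e: "\<And>i. i \<noteq> j \<Longrightarrow> g *v cayley_e i = cayley_e i"
  shows "g = mat 1"
proof -
  have g8: "g \<in> SO8C" using g by (simp add: SO7C_def)
  have col: "(g *v cayley_e i) $ k = g $ k $ i" for i k
    by (simp add: matrix_vector_mult_def cayley_e_nth if_distrib[of "\<lambda>x. _ * x"] cong: if_cong)
  have "g $ k $ i = (if i \<noteq> j then if k = i then 1 else 0 else if k = j then g $ j $ j else 0)" for k i
  proof (cases "i = j")
    case True
    have "g $ k $ j = 0" if "k \<noteq> j"
    proof -
      have "cdot (g *v cayley_e j) (g *v cayley_e k) = 0" using SO8C_D(4)[OF g8] that by (simp add: cayley_e_nth)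
      then show ?thesis using fix_e[OF that] col by simp
    qed
    then show ?thesis using True by simp
  next
    case False
    then show ?thesis using fix_e[OF False] col[of i k] by (simp add: cayley_e_nth)
  qed
  note ent = this
  have "det g = (\<Prod>i\<in>UNIV. g $ i $ i)" by (rule det_diagonal) (subst ent, auto)
  also have "\<dots> = (\<Prod>i\<in>UNIV. if i = j then g $ j $ j else 1)" by (intro prod.cong refl) (subst ent, auto)
  also have "\<dots> = g $ j $ j" by simp
  finally have "g $ j $ j = 1" using SO8C_D(1)[OF g8] by simp
  then have "g $ k $ i = mat 1 $ k $ i" for k i using ent[of k i] by (simp add: mat_def)
  then show ?thesis by (simp add: vec_eq_iff)
qed

text \<open>A Cartan-Dieudonne argument with half-turns, by induction on the number of basis vectors
  outside the fixed set F. Two half-turns bring g e_i back to e_i; each of them negates the e_k with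
  k in F other than e_0, which is why they come in pairs.\<close>

lemma SO7C_lift_aux:
  "card (- F) = n \<Longrightarrow> 0 \<in> F \<Longrightarrow> g \<in> SO7C \<Longrightarrow> (\<And>i. i \<in> F \<Longrightarrow> g *v cayley_e i = cayley_e i) \<Longrightarrow>
    \<exists>h\<in>SO8C. tri g h"
proof (induction n arbitrary: F g rule: less_induct)
  case (less n)
  note fix_e = less.prems(4)
  show ?case
  proof (cases "\<exists>j. - F \<subseteq> {j}")
    case True
    then obtain j where "- F \<subseteq> {j}" by blast
    then have "g = mat 1" by (intro SO7C_fixes_all_but_one[OF less.prems(3), of j]) (use fix_e in blast)
    then show ?thesis using SO8C_one tri_one by blast
  next
    case False
    then obtain i j where ij: "i \<notin> F" "j \<notin> F" "i \<noteq> j" by blast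
    have g8: "g \<in> SO8C" using less.prems(3) by (simp add: SO7C_def)
    define v where "v = g *v cayley_e i"
    have vk: "v $ k = 0" if "k \<in> F" for k
    proof -
      have "cdot v (g *v cayley_e k) = 0" unfolding v_def using SO8C_D(4)[OF g8] that ij by (auto simp: cayley_e_nth)
      then show ?thesis using fix_e[OF that] by simp
    qed
    have vv: "cdot v v = 1" unfolding v_def using SO8C_D(4)[OF g8] by (simp add: cayley_e_nth)
    have i0: "i \<noteq> 0" "j \<noteq> 0" using ij less.prems(2) by auto
    have step: ?thesis if c: "\<And>k. k \<in> F \<Longrightarrow> c $ k = 0" "cdot c c \<noteq> 0" and d: "\<And>k. k \<in> F \<Longrightarrow> d $ k = 0" "cdot d d \<noteq> 0"
      and cd: "Cmul d *v (Cmul c *v v) = cayley_e i" for c d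
    proof -
      let ?m = "Cmul d ** Cmul c"
      have c0: "c $ 0 = 0" "d $ 0 = 0" using c d less.prems(2) by auto
      have m7: "?m \<in> SO7C" using c0 c d by (intro SO7C_mult Cmul_SO7C)
      have fix_m: "(?m ** g) *v cayley_e k = cayley_e k" if "k \<in> insert i F" for k
      proof (cases "k = i")
        case True then show ?thesis using cd by (simp add: matrix_vector_mul_assoc[symmetric] v_def)
      next
        case False
        then have kF: "k \<in> F" using that by blast
        show ?thesis
        proof (cases "k = 0")
          case True then show ?thesis using SO7C_mult[OF m7 less.prems(3)] by (simp add: SO7C_def)
        next
          case False
          then show ?thesis
            using fix_e[OF kF] c(1)[OF kF] d(1)[OF kF]
            by (simp add: matrix_vector_mul_assoc[symmetric] Cmul_cayley_e matrix_vec_minus)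
        qed
      qed
      have "card (- insert i F) < n"
        unfolding less.prems(1)[symmetric] using ij(1) by (intro psubset_card_mono) auto
      from less.IH[OF this refl _ SO7C_mult[OF m7 less.prems(3)] fix_m] less.prems(2)
      obtain h where h: "h \<in> SO8C" "tri (?m ** g) h" by blast
      obtain h1 h2 where h12: "h1 \<in> SO8C" "h2 \<in> SO8C" "tri (Cmul d) h1" "tri (Cmul c) h2"
        using Cmul_lift[OF c0(2) d(2)] Cmul_lift[OF c0(1) c(2)] by blast
      have m8: "?m \<in> SO8C" "h1 ** h2 \<in> SO8C" "tri ?m (h1 ** h2)"
        using m7 h12 SO8C_mult tri_mult by (auto simp: SO7C_def)
      have "tri (transpose ?m ** (?m ** g)) (transpose (h1 ** h2) ** h)"
        by (rule tri_mult[OF tri_transpose_SO8C[OF m8(3,1,2)] h(2)])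
      moreover have "transpose ?m ** (?m ** g) = g"
        using SO8C_D(2)[OF m8(1)] by (metis matrix_mul_assoc matrix_mul_lid)
      moreover have "transpose (h1 ** h2) ** h \<in> SO8C" using SO8C_mult[OF SO8C_transpose[OF m8(2)] h(1)] .
      ultimately show ?thesis by metis
    qed
    have c1: "(v - cayley_e i) $ k = 0" "(v + cayley_e i) $ k = 0" and d1: "cayley_e i $ k = 0" "cayley_e j $ k = 0"
      if "k \<in> F" for k
      using vk[OF that] that ij by (auto simp: cayley_e_nth)
    have d2: "cdot (cayley_e k) (cayley_e k) \<noteq> 0" for k by (simp add: cayley_e_nth)
    \<comment> \<open>The vector v - e_i may be isotropic, but its norm and that of v + e_i add up
      to 4, so one of the two is usable. The first sends v to -e_i and the half-turn about e_j
      corrects the sign; the second sends v to e_i, which the half-turn about e_i keeps.\<close>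
    show ?thesis
    proof (cases "cdot (v - cayley_e i) (v - cayley_e i) = 0")
      case False
      let ?c = "v - cayley_e i"
      have "cdot ?c ?c = 2 * cdot ?c v" using vv by (simp add: cayley_e_nth)
      then have "2 * cdot ?c v / cdot ?c ?c = 1" using False by (metis divide_self)
      then have "Cmul ?c *v v = oconj v + 1 *s ?c" by (simp only: Cmul_vec)
      also have "\<dots> = - cayley_e i" using vk[OF less.prems(2)] by (simp add: oconj_imag)
      finally have "Cmul (cayley_e j) *v (Cmul ?c *v v) = cayley_e i"
        using i0 ij by (simp add: Cmul_cayley_e matrix_vec_minus cayley_e_nth)
      with False show ?thesis
        by (intro step[of ?c "cayley_e j"]) (simp_all only: c1 d1 d2 not_False_eq_True)
    next
      case True
      let ?c = "v + cayley_e i"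
      have s: "cdot ?c ?c + cdot (v - cayley_e i) (v - cayley_e i) = 4" using vv by (simp add: cayley_e_nth)
      then have "cdot ?c ?c = 4" using True by (simp only: add_0_right)
      then have cc: "cdot ?c ?c \<noteq> 0" by (metis zero_neq_numeral)
      have "cdot ?c ?c = 2 * cdot ?c v" using vv by (simp add: cayley_e_nth)
      then have "2 * cdot ?c v / cdot ?c ?c = 1" using cc by (metis divide_self)
      then have "Cmul ?c *v v = oconj v + 1 *s ?c" by (simp only: Cmul_vec)
      also have "\<dots> = cayley_e i" using vk[OF less.prems(2)] by (simp add: oconj_imag)
      finally have "Cmul ?c *v v = cayley_e i" .
      moreover have "Cmul (cayley_e i) *v cayley_e i = cayley_e i"
        using i0 by (simp add: Cmul_vec oconj_imag cayley_e_nth vec_eq_iff)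
      ultimately have "Cmul (cayley_e i) *v (Cmul ?c *v v) = cayley_e i" by (simp only:)
      with cc show ?thesis
        by (intro step[of ?c "cayley_e i"]) (simp_all only: c1 d1 d2 not_False_eq_True)
    qed
  qed
qed

lemma SO7C_lift:
  assumes "g \<in> SO7C"
  obtains h where "h \<in> Spin7C" "tri g h"
proof -
  have "\<exists>h\<in>SO8C. tri g h"
    by (rule SO7C_lift_aux[OF refl, of "{0}"]) (use assms in \<open>auto simp: SO7C_def\<close>)
  then show thesis using that assms Spin7CI by blast
qed

section \<open>Slices from a vector-valued invariant\<close>

lemma scaleR_eq_smult: "r *\<^sub>R x = complex_of_real r *s (x :: complex^'n)"
  by (simp add: vec_eq_iff complex_eq_iff)

lemma scaleR_eq_mat_scale: "r *\<^sub>R A = mat_scale (complex_of_real r) (A :: complex^'n^'m)"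
  by (simp add: vec_eq_iff complex_eq_iff)

lemma complex_linear_imp_linear: "(\<And>x y. f (x + y) = f x + f y) \<Longrightarrow> (\<And>c x. f (c *s x) = c *s f x) \<Longrightarrow>
    linear (f :: complex^'n \<Rightarrow> complex^'m)"
  by (rule linearI) (simp_all add: scaleR_eq_smult)

lemma holomorphic_cdot:
  assumes "holomorphic_map_on sA (*s) f S" "holomorphic_map_on sA (*s) g S"
  shows "holomorphic_map_on sA (*) (\<lambda>x. cdot (f x) (g x)) S"
proof (rule holomorphic_map_on_bilinear[OF _ _ _ _ assms])
  show "bilinear cdot" unfolding bilinear_def linear_iff by (simp add: scaleR_eq_smult scaleR_conv_of_real)
qed (simp_all add: algebra_simps)

lemma holomorphic_cayley:
  assumes "holomorphic_map_on sA (*s) f S" "holomorphic_map_on sA (*s) g S"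
  shows "holomorphic_map_on sA (*s) (\<lambda>x. f x \<bullet>\<^sub>C g x) S"
  by (rule holomorphic_map_on_bilinear[OF bilinear_cayley _ _ _ assms])
    (simp_all add: cayley_linear vec.scale_right_distrib)

lemma holomorphic_matrix_mult:
  assumes "holomorphic_map_on sA mat_scale f S" "holomorphic_map_on sA mat_scale g S"
  shows "holomorphic_map_on sA mat_scale (\<lambda>x. f x ** g x) S"
  by (rule holomorphic_map_on_bilinear[where b = "(**)" and f = f and g = g])
    (rule bilinear_matrix_mult mat_scale_mult[symmetric] mat_scale_add assms)+

lemma holomorphic_smult:
  assumes "holomorphic_map_on sA (*) f S" "holomorphic_map_on sA (*s) g S"
  shows "holomorphic_map_on sA (*s) (\<lambda>x. f x *s g x) S"
proof (rule holomorphic_map_on_bilinear[OF _ _ _ _ assms])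
  show "bilinear ((*s) :: complex \<Rightarrow> complex^'b \<Rightarrow> _)"
    unfolding bilinear_def linear_iff scaleR_eq_smult scaleR_conv_of_real
    by (simp add: vec.scale_left_distrib vec.scale_right_distrib mult_ac)
qed (simp_all add: vec.scale_right_distrib mult_ac)

lemma holomorphic_mat_scale:
  assumes "holomorphic_map_on sA (*) f S" "holomorphic_map_on sA mat_scale g S"
  shows "holomorphic_map_on sA mat_scale (\<lambda>x. mat_scale (f x) (g x)) S"
proof (rule holomorphic_map_on_bilinear[OF _ _ _ _ assms])
  show "bilinear (mat_scale :: complex \<Rightarrow> complex^'b^'c \<Rightarrow> _)"
    unfolding bilinear_def linear_iff scaleR_eq_mat_scale scaleR_conv_of_real
    by (simp add: vec_eq_iff algebra_simps)
qed (simp_all add: vec_eq_iff algebra_simps)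

lemma holomorphic_Lmul: "holomorphic_map_on sA (*s) f S \<Longrightarrow> holomorphic_map_on sA mat_scale (\<lambda>x. Lmul (f x)) S"
proof -
  assume f: "holomorphic_map_on sA (*s) f S"
  have "holomorphic_map_on (*s) mat_scale Lmul UNIV"
  proof (rule holomorphic_map_on_linear)
    have 1: "Lmul (c *s x) = mat_scale c (Lmul x)" "Lmul (x + y) = Lmul x + Lmul y" for c x y
      by (simp_all add: matrix_eq mat_scale_vec cayley_linear matrix_vector_mult_add_rdistrib)
    then show "linear Lmul" by (intro linearI) (simp_all add: scaleR_eq_smult scaleR_eq_mat_scale)
    show "Lmul (c *s x) = mat_scale c (Lmul x)" for c x by (rule 1)
  qed simp
  from holomorphic_map_on_compose[OF f this] show ?thesis by (simp add: o_def)
qed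

lemma holomorphic_Cmul:
  assumes f: "holomorphic_map_on sA (*s) f S" and "\<And>x. x \<in> S \<Longrightarrow> cdot (f x) (f x) \<noteq> 0"
  shows "holomorphic_map_on sA mat_scale (\<lambda>x. Cmul (f x)) S"
proof -
  let ?J = "(\<chi> i j. if i = j then if i = 0 then 1 else -1 else 0) :: complex^8^8"
  let ?b = "\<lambda>x y. (\<chi> i j. 2 * x $ i * y $ j) :: complex^8^8"
  have J: "holomorphic_map_on sA mat_scale (\<lambda>x. ?J) S"
    by (rule holomorphic_map_on_const) (simp add: vec_eq_iff, rule holomorphic_map_onD(2)[OF f])
  have B: "holomorphic_map_on sA mat_scale (\<lambda>x. ?b (f x) (f x)) S"
  proof (rule holomorphic_map_on_bilinear[where b = ?b and f = f and g = f, OF _ _ _ _ f f])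
    show "bilinear ?b"
      unfolding bilinear_def linear_iff scaleR_eq_smult scaleR_eq_mat_scale by (simp add: vec_eq_iff algebra_simps)
  qed (simp_all add: vec_eq_iff algebra_simps)
  have I: "holomorphic_map_on sA (*) (\<lambda>x. inverse (cdot (f x) (f x))) S"
    by (rule holomorphic_map_on_inverse[OF holomorphic_cdot[OF f f] assms(2)])
  have "holomorphic_map_on sA mat_scale (\<lambda>x. ?J + mat_scale (inverse (cdot (f x) (f x))) (?b (f x) (f x))) S"
    by (rule holomorphic_map_on_add[OF J holomorphic_mat_scale[OF I B] mat_scale_add])
  moreover have "?J + mat_scale (inverse (cdot a a)) (?b a a) = Cmul a" for a
    by (simp add: Cmul_def vec_eq_iff)
  ultimately show ?thesis by simp
qed

lemma holomorphic_mat_vec: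
  assumes "holomorphic_map_on sA mat_scale f S"
  shows "holomorphic_map_on sA (*s) (\<lambda>x. f x *v y) S"
proof -
  have "holomorphic_map_on mat_scale (*s) (\<lambda>m. m *v y) UNIV"
    by (rule holomorphic_map_on_linear)
      (rule linearI, simp_all add: matrix_vector_mult_add_rdistrib scaleR_eq_mat_scale scaleR_eq_smult mat_scale_vec)
  from holomorphic_map_on_compose[OF assms this] show ?thesis by (simp add: o_def)
qed

lemma holomorphic_id: "open S \<Longrightarrow> holomorphic_map_on sA sA (\<lambda>x. x) S"
  using holomorphic_map_on_linear[of "\<lambda>x. x" sA sA S] by (simp add: linear_id[unfolded id_def])

lemma holomorphic_vec_const: "open S \<Longrightarrow> holomorphic_map_on sA (*s) (\<lambda>x. c :: complex^'n) S"
  by (rule holomorphic_map_on_const) simp_all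

lemma holomorphic_complex_const: "open S \<Longrightarrow> holomorphic_map_on sA (*) (\<lambda>x. c :: complex) S"
  by (rule holomorphic_map_on_const) simp_all

lemma holomorphic_vec_add:
  "holomorphic_map_on sA (*s) f S \<Longrightarrow> holomorphic_map_on sA (*s) g S \<Longrightarrow>
    holomorphic_map_on sA (*s) (\<lambda>x. f x + g x :: complex^'n) S"
  by (rule holomorphic_map_on_add) (simp_all add: vec.scale_right_distrib)

lemma holomorphic_matvec_left:
  assumes "holomorphic_map_on sA (*s) f S"
  shows "holomorphic_map_on sA (*s) (\<lambda>x. (A :: complex^'n^'m) *v f x) S"
proof -
  have "holomorphic_map_on (*s) (*s) ((*v) A) UNIV"
    by (rule holomorphic_map_on_linear) (simp_all add: matrix_vec_scale)
  from holomorphic_map_on_compose[OF assms this] show ?thesis by (simp add: o_def)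
qed

text \<open>Affine coordinates of the projective point of x where the entry at \<alpha> is nonzero.
  Rescaling x does not change them, so they can be read off a vector that is known up to a
  factor.\<close>

definition ratio_coords :: "('n \<Rightarrow> 8) \<Rightarrow> 8 \<Rightarrow> complex^8 \<Rightarrow> complex^'n" where
  "ratio_coords \<iota> \<alpha> x = (\<chi> j. x $ \<iota> j / x $ \<alpha>)"

lemma holomorphic_ratio_coords:
  assumes W: "holomorphic_map_on sA (*s) W S" and ne: "\<And>x. x \<in> S \<Longrightarrow> W x $ \<alpha> \<noteq> 0"
  shows "holomorphic_map_on sA (*s) (\<lambda>x. ratio_coords \<iota> \<alpha> (W x)) S"
proof -
  let ?p = "\<lambda>x :: complex^8. \<chi> j. x $ \<iota> j"
  have "holomorphic_map_on (*s) (*s) ?p UNIV"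
    by (rule holomorphic_map_on_linear) (rule complex_linear_imp_linear, simp_all add: vec_eq_iff)
  from holomorphic_map_on_compose[OF W this] have P: "holomorphic_map_on sA (*s) (\<lambda>x. ?p (W x)) S"
    by (simp add: o_def)
  have "holomorphic_map_on sA (*) (\<lambda>x. cdot (W x) (axis \<alpha> 1)) S"
    by (rule holomorphic_cdot[OF W holomorphic_vec_const[OF holomorphic_map_onD(2)[OF W]]])
  then have "holomorphic_map_on sA (*) (\<lambda>x. inverse (W x $ \<alpha>)) S"
    using ne by (intro holomorphic_map_on_inverse) simp_all
  from holomorphic_smult[OF this P] show ?thesis
    by (simp add: ratio_coords_def vec_eq_iff divide_inverse mult.commute
        flip: vector_smult_component) (simp add: vec_eq_iff divide_inverse mult.commute vector_scalar_mult_def)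
qed

definition diag_mat :: "('n \<Rightarrow> complex) \<Rightarrow> complex^'n^'n" where
  "diag_mat s = (\<chi> i j. if i = j then s i else 0)"

lemma diag_mat_vec: "(diag_mat s *v x) $ i = s i * x $ i"
proof -
  have "(if i = j then s i else 0) * x $ j = (if j = i then s i * x $ i else 0)" for j by simp
  then show ?thesis by (simp add: diag_mat_def matrix_vector_mult_def)
qed

text \<open>Places the unit ball in the range of the charts, which is the complement of the quadric
  1 + (z, z) = 0.\<close>

lemma sum_square_norm_less_one:
  assumes "norm (z :: complex^'n) < 1" shows "1 + (\<Sum>j\<in>UNIV. z $ j * z $ j) \<noteq> 0"
proof
  assume "1 + (\<Sum>j\<in>UNIV. z $ j * z $ j) = 0"
  then have "(\<Sum>j\<in>UNIV. z $ j * z $ j) = - 1" by (simp add: add_eq_0_iff)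
  then have "1 = norm (\<Sum>j\<in>UNIV. z $ j * z $ j)" by simp
  also have "\<dots> \<le> (\<Sum>j\<in>UNIV. norm (z $ j * z $ j))" by (rule norm_sum)
  also have "\<dots> = (norm z)\<^sup>2"
    by (simp add: norm_vec_def L2_set_def sum_nonneg norm_mult power2_eq_square)
  also have "\<dots> < 1" using assms by (simp add: power_less_one_iff abs_square_less_1)
  finally show False by simp
qed

text \<open>All requirements are reduced to a vector W g that depends on the coset only; ratios of
  its entries are the chart. In these coordinates A conj(g) has entries cnj z_i up to sign, with
  sign -1 at j, so the points r \<i> on the j-th axis, that is the slice, are fixed.\<close>

lemma slice_data_from_vector:
  fixes G H :: "(complex^8^8) set" and W :: "complex^8^8 \<Rightarrow> complex^8" and \<iota> :: "'n::finite \<Rightarrow> 8" and s :: "8 \<Rightarrow> complex"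
  assumes pair: "matrix_pair G H" and hol: "holomorphic_map_on mat_scale (*s) W UNIV"
    and cnj: "\<And>g. g \<in> G \<Longrightarrow> cnj_mat g \<in> G" "\<And>g. g \<in> H \<Longrightarrow> cnj_mat g \<in> H"
    and WH: "\<And>g h. g \<in> G \<Longrightarrow> h \<in> H \<Longrightarrow> W (g ** h) = W g"
    and inj: "\<And>a b. a \<in> G \<Longrightarrow> b \<in> G \<Longrightarrow> W a $ \<alpha> \<noteq> 0 \<Longrightarrow> W b $ \<alpha> \<noteq> 0 \<Longrightarrow>
      ratio_coords \<iota> \<alpha> (W a) = ratio_coords \<iota> \<alpha> (W b) \<Longrightarrow> transpose a ** b \<in> H"
    and range: "\<And>g. g \<in> G \<Longrightarrow> W g $ \<alpha> \<noteq> 0 \<Longrightarrow> 1 + (\<Sum>j\<in>UNIV. ratio_coords \<iota> \<alpha> (W g) $ j * ratio_coords \<iota> \<alpha> (W g) $ j) \<noteq> 0"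
    and sec: "\<And>z. 1 + (\<Sum>j\<in>UNIV. z $ j * z $ j) \<noteq> 0 \<Longrightarrow> \<exists>V \<sigma>. z \<in> V \<and> holomorphic_map_on (*s) mat_scale \<sigma> V \<and>
        (\<forall>w\<in>V. \<sigma> w \<in> G \<and> W (\<sigma> w) $ \<alpha> \<noteq> 0 \<and> ratio_coords \<iota> \<alpha> (W (\<sigma> w)) = w)"
    and meets: "\<And>g. g \<in> G \<Longrightarrow> \<exists>k\<in>G. cnj_mat k = k \<and> W (k ** g) $ \<alpha> \<noteq> 0 \<and>
        (\<exists>r. \<bar>r\<bar> < 1 \<and> ratio_coords \<iota> \<alpha> (W (k ** g)) = r *\<^sub>R axis j \<i>)"
    and A: "diag_mat s \<in> H" "\<And>i. s i = 1 \<or> s i = -1" "s \<alpha> = 1" "s (\<iota> j) = -1"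
      "\<And>g. g \<in> G \<Longrightarrow> W (diag_mat s ** cnj_mat g) = diag_mat s *v cnj_vec (W g)"
    and W1: "W (mat 1) $ \<alpha> \<noteq> 0" "ratio_coords \<iota> \<alpha> (W (mat 1)) = 0"
    and conn: "\<And>k. k \<in> G \<Longrightarrow> cnj_mat k = k \<Longrightarrow>
      \<exists>C. connectedin (coset_space G H) C \<and> coset_proj H (mat 1) \<in> C \<and> coset_proj H k \<in> C"
  obtains U\<^sub>0 and \<phi>\<^sub>0 :: "(complex^8^8) set \<Rightarrow> complex^'n" and S\<^sub>0
    where "slice_data G H U\<^sub>0 \<phi>\<^sub>0 S\<^sub>0 j (diag_mat s)"
proof -
  interpret matrix_pair G H by (rule pair)
  define D where "D = {g \<in> G. W g $ \<alpha> \<noteq> 0}"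
  define \<zeta> :: "complex^8^8 \<Rightarrow> complex^'n" where "\<zeta> = (\<lambda>g. ratio_coords \<iota> \<alpha> (W g))"
  have contW: "continuous_on UNIV W" using smooth_on_imp_continuous_on[OF holomorphic_map_onD(1)[OF hol]] .
  define N where "N = {g. W g $ \<alpha> \<noteq> 0}"
  have oN: "open N" unfolding N_def
    by (intro open_Collect_neq continuous_on_component contW continuous_on_const)
  have DN: "D = G \<inter> N" by (auto simp: D_def N_def)
  have oD: "openin (top_of_set G) D" unfolding DN using oN by (rule openin_open_Int)
  have h1: "holomorphic_map_on mat_scale (*s) W N" by (rule holomorphic_map_on_subset[OF hol oN]) simp
  have "holomorphic_map_on mat_scale (*s) \<zeta> N"
    unfolding \<zeta>_def by (rule holomorphic_ratio_coords[OF h1]) (simp add: N_def)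
  then have h\<zeta>: "holomorphic_rel mat_scale (*s) \<zeta> D" by (rule holomorphic_relI) (simp_all add: DN)
  have inj': "\<zeta> a = \<zeta> b \<longleftrightarrow> \<pi> a = \<pi> b" if ab: "a \<in> D" "b \<in> D" for a b
  proof
    have abG: "a \<in> G" "b \<in> G" using ab by (auto simp: D_def)
    show "\<pi> a = \<pi> b" if "\<zeta> a = \<zeta> b"
      using inj[OF abG] ab that proj_eq_iff[OF abG] by (simp add: D_def \<zeta>_def)
    show "\<zeta> a = \<zeta> b" if "\<pi> a = \<pi> b"
    proof -
      have "transpose a ** b \<in> H" using that proj_eq_iff[OF abG] by simp
      from WH[OF abG(1) this] show ?thesis by (simp add: \<zeta>_def cancel_G(2)[OF abG(1)])
    qed
  qed
  have sec': "\<exists>V \<sigma>. z \<in> V \<and> holomorphic_map_on (*s) mat_scale \<sigma> V \<and> (\<forall>w\<in>V. \<sigma> w \<in> D \<and> \<zeta> (\<sigma> w) = w)"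
    if "z \<in> \<zeta> ` D" for z
    using sec[of z] that range by (auto simp: D_def \<zeta>_def)
  have DH: "g ** h \<in> D" if "g \<in> D" "h \<in> H" for g h
    using that WH H_sub mult_G by (auto simp: D_def)
  obtain \<phi>\<^sub>0 where \<phi>: "(\<pi> ` D, \<phi>\<^sub>0) \<in> coset_charts G H" "\<And>g. g \<in> D \<Longrightarrow> \<phi>\<^sub>0 (\<pi> g) = \<zeta> g"
    by (rule coset_chartI[OF oD h\<zeta> DH inj' sec']) blast+
  have surj: "\<exists>g\<in>D. \<zeta> g = z" if "norm z < 1" for z
    using sec[OF sum_square_norm_less_one[OF that]] unfolding D_def \<zeta>_def by blast
  define L where "L = {r *\<^sub>R axis j \<i> |r. \<bar>r\<bar> < 1} "
  define S\<^sub>0 where "S\<^sub>0 = {x \<in> \<pi> ` D. \<phi>\<^sub>0 x \<in> L}"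
  have D1: "mat 1 \<in> D" using one_G W1(1) by (simp add: D_def)
  have nL: "norm z < 1" if "z \<in> L" for z
    using that by (auto simp: L_def norm_eq_sqrt_inner[of "axis j \<i>"] inner_axis_axis simp flip: norm_eq_sqrt_inner)
  have S0: "\<pi> g \<in> S\<^sub>0 \<longleftrightarrow> g \<in> D \<and> \<zeta> g \<in> L" if "g \<in> G" for g
  proof
    assume "\<pi> g \<in> S\<^sub>0"
    then obtain d where d: "d \<in> D" "\<pi> g = \<pi> d" "\<phi>\<^sub>0 (\<pi> d) \<in> L" by (auto simp: S\<^sub>0_def)
    then have "transpose d ** g \<in> H" using proj_eq_iff[of d g] \<open>g \<in> G\<close> by (simp add: D_def)
    from DH[OF d(1) this] have "g \<in> D" using d(1) cancel_G(2)[of d g] by (simp add: D_def)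
    then show "g \<in> D \<and> \<zeta> g \<in> L" using d \<phi>(2) by metis
  qed (auto simp: S\<^sub>0_def \<phi>(2))
  have sg: "cnj (s i) = s i" "s i * s i = 1" for i using A(2)[of i] by auto
  have "slice_data G H (\<pi> ` D) \<phi>\<^sub>0 S\<^sub>0 j (diag_mat s)"
  proof
    show "ball 0 1 \<subseteq> \<phi>\<^sub>0 ` \<pi> ` D"
    proof
      fix z :: "complex^'n" assume "z \<in> ball 0 1"
      then obtain g where "g \<in> D" "\<zeta> g = z" using surj[of z] by auto
      then show "z \<in> \<phi>\<^sub>0 ` \<pi> ` D" using \<phi>(2) by force
    qed
    show "S\<^sub>0 \<subseteq> \<pi> ` D" by (auto simp: S\<^sub>0_def)
    show "\<phi>\<^sub>0 ` S\<^sub>0 = {r *\<^sub>R axis j \<i> |r. \<bar>r\<bar> < 1}"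
    proof (fold L_def, intro equalityI subsetI)
      fix z assume z: "z \<in> L"
      then obtain g where "g \<in> D" "\<zeta> g = z" using surj[OF nL] by blast
      then have "\<phi>\<^sub>0 (\<pi> g) = z" "\<pi> g \<in> S\<^sub>0" using \<phi>(2) z by (auto simp: S\<^sub>0_def)
      then show "z \<in> \<phi>\<^sub>0 ` S\<^sub>0" by force
    qed (auto simp: S\<^sub>0_def)
    have "0 \<in> L" by (auto simp: L_def intro!: exI[of _ 0])
    then show "\<pi> (mat 1) \<in> S\<^sub>0" using S0[OF one_G] D1 W1(2) by (simp add: \<zeta>_def)
    show "\<exists>k\<in>G. cnj_mat k = k \<and> \<pi> (k ** g) \<in> S\<^sub>0" if g: "g \<in> G" for g
    proof -
      obtain k r where k: "k \<in> G" "cnj_mat k = k" "W (k ** g) $ \<alpha> \<noteq> 0" "\<bar>r\<bar> < 1"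
        "ratio_coords \<iota> \<alpha> (W (k ** g)) = r *\<^sub>R axis j \<i>"
        using meets[OF g] by blast
      have "k ** g \<in> G" using mult_G k g by blast
      moreover have "\<zeta> (k ** g) \<in> L" using k by (auto simp: \<zeta>_def L_def)
      ultimately have "\<pi> (k ** g) \<in> S\<^sub>0" using k(3) S0[of "k ** g"] by (simp add: D_def)
      then show ?thesis using k by blast
    qed
    show "cnj_mat (diag_mat s) = diag_mat s" by (simp add: vec_eq_iff diag_mat_def sg)
    show "diag_mat s ** diag_mat s = mat 1"
      by (simp add: matrix_eq matrix_vector_mul_assoc[symmetric] vec_eq_iff diag_mat_vec mult.assoc[symmetric] sg)
    show "\<pi> (diag_mat s ** cnj_mat g) = \<pi> g" if g: "g \<in> G" and "\<pi> g \<in> S\<^sub>0" for g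
    proof -
      have gD: "g \<in> D" "\<zeta> g \<in> L" using S0[OF g] that(2) by auto
      let ?a = "diag_mat s ** cnj_mat g"
      have aG: "?a \<in> G" using A(1) H_sub cnj(1)[OF g] mult_G by blast
      have Wa: "W ?a $ i = s i * cnj (W g $ i)" for i using A(5)[OF g] by (simp add: diag_mat_vec)
      have "?a \<in> D" using aG gD(1) A(3) by (simp add: D_def Wa)
      moreover have "\<zeta> ?a = \<zeta> g"
      proof -
        obtain r where r: "\<zeta> g = r *\<^sub>R axis j \<i>" using gD(2) by (auto simp: L_def)
        have "\<zeta> ?a $ i = s (\<iota> i) * cnj (\<zeta> g $ i)" for i
          by (simp add: \<zeta>_def ratio_coords_def Wa A(3))
        then show ?thesis unfolding r using A(4) by (simp add: vec_eq_iff axis_def)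
      qed
      ultimately show ?thesis using inj' gD(1) by blast
    qed
  qed (use cnj \<phi>(1) A(1) conn in auto)
  then show thesis by (rule that)
qed

section \<open>Transitivity of the real groups on orthonormal pairs\<close>

text \<open>A dimension count in real 8-space: fewer than eight real vectors have a common real unit
  normal. It supplies the auxiliary directions for the swaps, factorisations and curves.\<close>

lemma real_perp_exists:
  assumes "length xs < 8" "\<And>v. v \<in> set xs \<Longrightarrow> cnj_vec v = v"
  obtains b :: "complex^8" where "cnj_vec b = b" "cdot b b = 1" "\<And>v. v \<in> set xs \<Longrightarrow> cdot b v = 0"
proof -
  let ?re = "\<lambda>v :: complex^8. (\<chi> i. Re (v $ i)) :: real^8"
  have "dim (?re ` set xs) \<le> card (?re ` set xs)" by (intro dim_le_card') simp
  also have "\<dots> \<le> length xs" by (metis card_length length_map set_map)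
  finally have "dim (?re ` set xs) < DIM(real^8)" using assms(1) by simp
  then obtain x where x: "x \<noteq> 0" "\<And>y. y \<in> span (?re ` set xs) \<Longrightarrow> orthogonal x y"
    using orthogonal_to_subspace_exists by metis
  define u where "u = (1 / norm x) *\<^sub>R x"
  have uu: "u \<bullet> u = 1" using x(1) by (simp add: u_def dot_square_norm power2_eq_square)
  have uv: "u \<bullet> ?re v = 0" if "v \<in> set xs" for v
    using x(2)[OF span_base[OF imageI[OF that]]] by (simp add: u_def orthogonal_def)
  define b :: "complex^8" where "b = (\<chi> i. of_real (u $ i))"
  have "cdot b b = of_real (u \<bullet> u)" by (simp add: b_def cdot_def inner_vec_def)
  moreover have "cdot b v = 0" if v: "v \<in> set xs" for v
  proof -
    have "v $ i = of_real (Re (v $ i))" for i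
      using assms(2)[OF v] by (metis Reals_cnj_iff of_real_Re cnj_vec_nth)
    then have "cdot b v = (\<Sum>i\<in>UNIV. of_real (u $ i) * of_real (Re (v $ i)))"
      by (simp add: b_def cdot_def)
    also have "\<dots> = of_real (u \<bullet> ?re v)" by (simp add: inner_vec_def)
    finally show ?thesis using uv[OF v] by simp
  qed
  moreover have "cnj_vec b = b" by (simp add: b_def vec_eq_iff)
  ultimately show thesis using that uu by simp
qed

lemma real_cdot_self:
  assumes "cnj_vec v = (v :: complex^8)"
  obtains r where "r \<ge> 0" "cdot v v = of_real (r\<^sup>2)" "r = 0 \<Longrightarrow> v = 0"
proof -
  have v: "v $ i = of_real (Re (v $ i))" for i
    using assms by (metis Reals_cnj_iff of_real_Re cnj_vec_nth)
  let ?q = "\<Sum>i\<in>UNIV. (Re (v $ i))\<^sup>2"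
  have "cdot v v = (\<Sum>i\<in>UNIV. of_real (Re (v $ i)) * of_real (Re (v $ i)))"
    unfolding cdot_def using v by (metis (no_types, lifting))
  then have c: "cdot v v = of_real ?q" by (simp add: power2_eq_square)
  have q: "?q \<ge> 0" by (simp add: sum_nonneg)
  have "v = 0" if "?q = 0"
  proof -
    have "Re (v $ i) = 0" for i using that by (simp add: sum_nonneg_eq_0_iff)
    then show ?thesis using v by (metis of_real_0 vec_eq_iff zero_index)
  qed
  then show thesis using that[of "sqrt ?q"] c q by simp
qed

lemma cnj_vec_arith [simp]:
  "cnj_vec (x + y) = cnj_vec x + cnj_vec y" "cnj_vec (x - y) = cnj_vec x - cnj_vec y"
  "cnj_vec (c *s x) = cnj c *s cnj_vec x" "cnj_vec (- x) = - cnj_vec x"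
  by (simp_all add: vec_eq_iff)

text \<open>For u = 0 the direction m is undetermined and is filled in by any real unit vector
  orthogonal to the list, so degenerate points need no separate treatment later.\<close>

lemma real_normalize:
  fixes u :: "complex^8"
  assumes u: "cnj_vec u = u" and xs: "length xs < 8" "\<And>v. v \<in> set xs \<Longrightarrow> cnj_vec v = v"
    and perp: "\<And>v. v \<in> set xs \<Longrightarrow> cdot u v = 0"
  obtains r m where "r \<ge> 0" "u = of_real r *s m" "cnj_vec m = m" "cdot m m = 1"
    "\<And>v. v \<in> set xs \<Longrightarrow> cdot m v = 0" "cdot u u = of_real (r\<^sup>2)"
proof -
  obtain r where r: "r \<ge> 0" "cdot u u = of_real (r\<^sup>2)" "r = 0 \<Longrightarrow> u = 0" by (rule real_cdot_self[OF u]) blast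
  show thesis
  proof (cases "r = 0")
    case True
    obtain b where "cnj_vec b = b" "cdot b b = 1" "\<And>v. v \<in> set xs \<Longrightarrow> cdot b v = 0"
      by (rule real_perp_exists[OF xs]) blast+
    then show thesis using that[of r b] r True by simp
  next
    case False
    let ?m = "of_real (1 / r) *s u"
    have "cdot ?m ?m = of_real ((1 / r) * (1 / r) * r\<^sup>2)" by (simp add: r(2) mult.assoc)
    also have "(1 / r) * (1 / r) * r\<^sup>2 = 1" using False by (simp add: power2_eq_square)
    finally have "cdot ?m ?m = 1" by simp
    moreover have "u = of_real r *s ?m" using False by (simp add: vec_eq_iff)
    moreover have "cnj_vec ?m = ?m" using u by simp
    ultimately show thesis using that[of r ?m] r perp by simp
  qed
qed

lemma cnj_mat_Lmul: "cnj_mat (Lmul a) = Lmul (cnj_vec a)"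
  by (simp add: vec_eq_iff Lmul_def)

lemma cnj_mat_Imul:
  assumes "cnj_vec a = a" "cnj_vec b = b" shows "cnj_mat (Imul a b) = Imul a b"
proof -
  have d: "cnj_vec (a \<bullet>\<^sub>C b) = a \<bullet>\<^sub>C b" by (simp only: cnj_vec_cayley assms)
  then have "cnj (cdot (a \<bullet>\<^sub>C b) (a \<bullet>\<^sub>C b)) = cdot (a \<bullet>\<^sub>C b) (a \<bullet>\<^sub>C b)" by (metis cdot_cnj_vec)
  then show ?thesis
    unfolding Imul_def cnj_mat_scale cnj_mat_mult cnj_mat_Lmul d assms by simp
qed

lemma G2C_real_swap:
  assumes x: "x $ 0 = 0" "cdot x x = 1" "cnj_vec x = x" and y: "y $ 0 = 0" "cdot y y = 1" "cnj_vec y = y"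
    and "cdot x y = 0"
  shows "\<exists>k\<in>G2C. cnj_mat k = k \<and> k *v x = y"
proof -
  have "cnj_vec v = v" if "v \<in> set [cayley_e 0, x, y, x \<bullet>\<^sub>C y]" for v
    using that x y by (auto simp: cnj_vec_cayley)
  then obtain b where b: "cnj_vec b = b" "cdot b b = 1" "\<And>v. v \<in> set [cayley_e 0, x, y, x \<bullet>\<^sub>C y] \<Longrightarrow> cdot b v = 0"
    using real_perp_exists[of "[cayley_e 0, x, y, x \<bullet>\<^sub>C y]"] by (metis (mono_tags) length_Cons list.size(3) numeral_less_iff eval_nat_numeral(3) One_nat_def less_Suc_eq numeral_nat)
  have b0: "b $ 0 = 0" "cdot b x = 0" "cdot b y = 0" "cdot b (x \<bullet>\<^sub>C y) = 0"
    using b(3)[of "cayley_e 0"] b(3)[of x] b(3)[of y] b(3)[of "x \<bullet>\<^sub>C y"] by simp_all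
  have "1 + cdot x y \<noteq> 0" "cdot b b \<noteq> 0" using assms(7) b(2) by simp_all
  note sw = Imul_swap[OF x(1,2) y(1,2) this(1) b0(1) this(2) b0(2-4)]
  have "cnj_mat (Imul (x + y) b) = Imul (x + y) b" by (rule cnj_mat_Imul) (simp_all add: x y b)
  then show ?thesis using sw by blast
qed

text \<open>Passing through a u orthogonal to both x and y avoids the antipodal case y = -x, where x
  + y would vanish.\<close>

lemma G2C_real_transitive:
  assumes x: "x $ 0 = 0" "cdot x x = 1" "cnj_vec x = x" and y: "y $ 0 = 0" "cdot y y = 1" "cnj_vec y = y"
  shows "\<exists>k\<in>G2C. cnj_mat k = k \<and> k *v x = y"
proof -
  have "cnj_vec v = v" if "v \<in> set [cayley_e 0, x, y]" for v
    using that x y by auto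
  then obtain u where u: "cnj_vec u = u" "cdot u u = 1" "\<And>v. v \<in> set [cayley_e 0, x, y] \<Longrightarrow> cdot u v = 0"
    using real_perp_exists[of "[cayley_e 0, x, y]"] by auto
  have u0: "u $ 0 = 0" "cdot x u = 0" "cdot u y = 0"
    using u(3)[of "cayley_e 0"] u(3)[of x] u(3)[of y] by (simp_all add: cdot_commute)
  obtain k l where k: "k \<in> G2C" "cnj_mat k = k" "k *v x = u" and l: "l \<in> G2C" "cnj_mat l = l" "l *v u = y"
    using G2C_real_swap[OF x u0(1) u(2,1) u0(2)] G2C_real_swap[OF u0(1) u(2,1) y u0(3)] by blast
  then have "l ** k \<in> G2C" "cnj_mat (l ** k) = l ** k" "(l ** k) *v x = y"
    by (simp_all add: G2C_group cnj_mat_mult matrix_vector_mul_assoc[symmetric])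
  then show ?thesis by blast
qed

text \<open>The swap of v and w takes x itself as its auxiliary vector. It fixes x because the
  half-turn about x does, while the other two, about vectors orthogonal to x, each negate
  it.\<close>

lemma G2C_real_swap_fix:
  assumes x: "x $ 0 = 0" "cdot x x = 1" "cnj_vec x = x"
    and v: "v $ 0 = 0" "cdot v v = 1" "cnj_vec v = v" "cdot x v = 0"
    and w: "w $ 0 = 0" "cdot w w = 1" "cnj_vec w = w" "cdot x w = 0"
    and vw: "cdot v w = 0" "cdot x (v \<bullet>\<^sub>C w) = 0"
  shows "\<exists>k\<in>G2C. cnj_mat k = k \<and> k *v x = x \<and> k *v v = w"
proof -
  have 1: "1 + cdot v w \<noteq> 0" "cdot x x \<noteq> 0" using x vw by simp_all
  note sw = Imul_swap[OF v(1,2) w(1,2) 1(1) x(1) 1(2) v(4) w(4) vw(2)]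
  have a: "(v + w) $ 0 = 0" "cdot (v + w) (v + w) = 2" "cdot (v + w) x = 0"
    using v w vw by (simp_all add: cdot_commute[of w v] cdot_commute[of v x] cdot_commute[of w x])
  have eq: "Imul (v + w) x = Cmul ((v + w) \<bullet>\<^sub>C x) ** (Cmul (v + w) ** Cmul x)"
    by (rule Imul_G2C(2)) (simp_all only: a x, simp_all)
  have "Cmul x *v x = x" using x by (simp add: Cmul_vec oconj_imag vec_eq_iff)
  moreover have "Cmul (v + w) *v x = - x" unfolding Cmul_vec a(3) by (simp add: oconj_imag x)
  moreover have "cdot ((v + w) \<bullet>\<^sub>C x) x = 0"
    using cdot_cayley_right[of "v + w" x "cayley_e 0"] a(1) by simp
  then have "Cmul ((v + w) \<bullet>\<^sub>C x) *v x = - x" unfolding Cmul_vec by (simp add: oconj_imag x)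
  ultimately have "Imul (v + w) x *v x = x"
    unfolding eq by (simp add: matrix_vector_mul_assoc[symmetric] matrix_vec_minus)
  moreover have "cnj_mat (Imul (v + w) x) = Imul (v + w) x" by (rule cnj_mat_Imul) (simp_all add: x v w)
  ultimately show ?thesis using sw by blast
qed

text \<open>The intermediate u is orthogonal to v x and x w: by adjointness of multiplications these
  conditions say that x is orthogonal to v u and u w, as the two swaps demand.\<close>

lemma G2C_real_transitive_fix:
  assumes x: "x $ 0 = 0" "cdot x x = 1" "cnj_vec x = x"
    and v: "v $ 0 = 0" "cdot v v = 1" "cnj_vec v = v" "cdot x v = 0"
    and w: "w $ 0 = 0" "cdot w w = 1" "cnj_vec w = w" "cdot x w = 0"
  shows "\<exists>k\<in>G2C. cnj_mat k = k \<and> k *v x = x \<and> k *v v = w"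
proof -
  let ?l = "[cayley_e 0, x, v, w, v \<bullet>\<^sub>C x, x \<bullet>\<^sub>C w]"
  have "cnj_vec y = y" if "y \<in> set ?l" for y
    using that x v w by (auto simp: cnj_vec_cayley)
  then obtain u where u: "cnj_vec u = u" "cdot u u = 1" "\<And>y. y \<in> set ?l \<Longrightarrow> cdot u y = 0"
    using real_perp_exists[of ?l] by auto
  have u0: "u $ 0 = 0" "cdot x u = 0" "cdot u w = 0" "cdot v u = 0" "cdot u (v \<bullet>\<^sub>C x) = 0" "cdot u (x \<bullet>\<^sub>C w) = 0"
    using u(3)[of "cayley_e 0"] u(3)[of x] u(3)[of v] u(3)[of w] u(3)[of "v \<bullet>\<^sub>C x"] u(3)[of "x \<bullet>\<^sub>C w"]
    by (simp_all add: cdot_commute)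
  have "cdot x (v \<bullet>\<^sub>C u) = 0"
    using cdot_cayley_adjoint_left[of v u x] u0(5) v(1) by (simp add: cdot_commute[of x] oconj_imag cayley_linear)
  moreover have "cdot x (u \<bullet>\<^sub>C w) = 0"
    using cdot_cayley_adjoint_right[of u w x] u0(6) w(1) by (simp add: cdot_commute[of x] oconj_imag cayley_linear)
  ultimately obtain k l where k: "k \<in> G2C" "cnj_mat k = k" "k *v x = x" "k *v v = u"
    and l: "l \<in> G2C" "cnj_mat l = l" "l *v x = x" "l *v u = w"
    using G2C_real_swap_fix[OF x v u0(1) u(2,1) u0(2,4)] G2C_real_swap_fix[OF x u0(1) u(2,1) u0(2) w u0(3)] by blast
  then have "l ** k \<in> G2C" "cnj_mat (l ** k) = l ** k" "(l ** k) *v x = x" "(l ** k) *v v = w"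
    by (simp_all add: G2C_group cnj_mat_mult matrix_vector_mul_assoc[symmetric])
  then show ?thesis by blast
qed

lemma orthogonal_image:
  assumes "k \<in> SO8C" "cnj_mat k = k" "cnj_vec x = x"
  shows "cdot (k *v x) (k *v y) = cdot x y" "cnj_vec (k *v x) = k *v x"
  using SO8C_D(4)[OF assms(1)] assms by (simp_all add: cnj_vec_mult)

lemma real_cayley_e:
  "i \<noteq> 0 \<Longrightarrow> cayley_e i $ 0 = 0" "cdot (cayley_e i) (cayley_e i) = 1" "cnj_vec (cayley_e i) = cayley_e i"
  by (simp_all add: cayley_e_nth)

lemma G2C_real_pairs:
  assumes r: "r $ 0 = 0" "cdot r r = 1" "cnj_vec r = r" and s: "s $ 0 = 0" "cdot s s = 1" "cnj_vec s = s"
    and rs: "cdot r s = 0"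
  obtains k where "k \<in> G2C" "cnj_mat k = k" "k *v r = cayley_e 1" "k *v s = cayley_e 2"
proof -
  obtain k where k: "k \<in> G2C" "cnj_mat k = k" "k *v r = cayley_e 1"
    using G2C_real_transitive[OF r real_cayley_e, of 1] by auto
  have k8: "k \<in> SO8C" using k G2C_iff by blast
  have "cdot (k *v s) (k *v cayley_e 0) = 0" using SO8C_D(4)[OF k8, of s "cayley_e 0"] s by simp
  then have ks: "(k *v s) $ 0 = 0" using G2C_one_fixed[OF k(1)] by simp
  have ks1: "cdot (cayley_e 1) (k *v s) = 0" using SO8C_D(4)[OF k8, of r s] rs k(3) by simp
  have ne: "(1 :: 8) \<noteq> 0" "(2 :: 8) \<noteq> 0" by simp_all
  have kss: "cdot (k *v s) (k *v s) = 1" using orthogonal_image(1)[OF k8 k(2) s(3)] s(2) by simp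
  have e12: "cdot (cayley_e 1) (cayley_e 2) = 0" by (simp add: cayley_e_nth)
  obtain l where l: "l \<in> G2C" "cnj_mat l = l" "l *v cayley_e 1 = cayley_e 1" "l *v (k *v s) = cayley_e 2"
    using G2C_real_transitive_fix[OF real_cayley_e(1)[OF ne(1)] real_cayley_e(2,3) ks kss
        orthogonal_image(2)[OF k8 k(2) s(3)] ks1 real_cayley_e(1)[OF ne(2)] real_cayley_e(2,3) e12]
    by blast
  show thesis
    by (rule that[of "l ** k"]) (use k l in \<open>simp_all add: G2C_group cnj_mat_mult matrix_vector_mul_assoc[symmetric]\<close>)
qed

text \<open>As a is imaginary of norm one, a (a x) = -x, so the product of the two left
  multiplications takes e_0 to x. Orthogonality of a and x makes a x imaginary, so that both factors
  are lifts of half-turns.\<close>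

lemma Spin7_factor:
  assumes a: "a $ 0 = 0" "cdot a a = 1" and x: "cdot x x = 1" "cdot a x = 0"
  shows "Lmul a ** Lmul (- (a \<bullet>\<^sub>C x)) \<in> Spin7C" "(Lmul a ** Lmul (- (a \<bullet>\<^sub>C x))) *v cayley_e 0 = x"
    "Cmul a ** Cmul (- (a \<bullet>\<^sub>C x)) \<in> SO7C" "tri (Cmul a ** Cmul (- (a \<bullet>\<^sub>C x))) (Lmul a ** Lmul (- (a \<bullet>\<^sub>C x)))"
proof -
  have "cdot x a = 0" using x(2) by (simp only: cdot_commute)
  then have b: "(- (a \<bullet>\<^sub>C x)) $ 0 = 0" "cdot (- (a \<bullet>\<^sub>C x)) (- (a \<bullet>\<^sub>C x)) = 1"
    using cdot_cayley_adjoint_left[of a x "cayley_e 0"] a x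
    by (simp_all add: oconj_imag cdot_cayley_norm)
  show "Lmul a ** Lmul (- (a \<bullet>\<^sub>C x)) \<in> Spin7C" by (intro Spin7C_group(2) Lmul_Spin7C a b)
  show "(Lmul a ** Lmul (- (a \<bullet>\<^sub>C x))) *v cayley_e 0 = x"
    using a by (simp add: matrix_vector_mul_assoc[symmetric] cayley_linear imag_square vec_eq_iff)
  show "Cmul a ** Cmul (- (a \<bullet>\<^sub>C x)) \<in> SO7C" using a b by (intro SO7C_mult Cmul_SO7C) simp_all
  show "tri (Cmul a ** Cmul (- (a \<bullet>\<^sub>C x))) (Lmul a ** Lmul (- (a \<bullet>\<^sub>C x)))"
    using a b by (intro tri_mult tri_Cmul_Lmul) simp_all
qed

text \<open>The transpose of such a product takes r to e_0. The image of s is then imaginary, and G2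
  moves it to e_1 without disturbing e_0.\<close>

lemma Spin7C_real_pairs:
  assumes r: "cdot r r = 1" "cnj_vec r = r" and s: "cdot s s = 1" "cnj_vec s = s" and rs: "cdot r s = 0"
  obtains k where "k \<in> Spin7C" "cnj_mat k = k" "k *v r = cayley_e 0" "k *v s = cayley_e 1"
proof -
  have "cnj_vec y = y" if "y \<in> set [cayley_e 0, r]" for y using that r by auto
  then obtain a where a: "cnj_vec a = a" "cdot a a = 1" "\<And>y. y \<in> set [cayley_e 0, r] \<Longrightarrow> cdot a y = 0"
    using real_perp_exists[of "[cayley_e 0, r]"] by auto
  have a0: "a $ 0 = 0" "cdot a r = 0" using a(3)[of "cayley_e 0"] a(3)[of r] by simp_all
  let ?m = "Lmul a ** Lmul (- (a \<bullet>\<^sub>C r))"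
  note m = Spin7_factor(1,2)[OF a0(1) a(2) r(1) a0(2)]
  have mr: "cnj_mat ?m = ?m" using a(1) r(2) by (simp add: cnj_mat_mult cnj_mat_Lmul cnj_vec_cayley)
  define k where "k = transpose ?m"
  have k: "k \<in> Spin7C" "cnj_mat k = k" using m mr Spin7C_group(3) by (auto simp: k_def cnj_mat_transpose)
  have k8: "k \<in> SO8C" "?m \<in> SO8C" using k m Spin7C_iff by auto
  have kr: "k *v r = cayley_e 0" using SO8C_D(6)[OF k8(2), of "cayley_e 0"] m(2) unfolding k_def by simp
  have ks: "(k *v s) $ 0 = 0" using SO8C_D(4)[OF k8(1), of r s] rs kr by simp
  obtain l where l: "l \<in> G2C" "cnj_mat l = l" "l *v (k *v s) = cayley_e 1"
    using G2C_real_transitive[OF ks _ orthogonal_image(2)[OF k8(1) k(2) s(2)] real_cayley_e, of 1]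
      orthogonal_image(1)[OF k8(1) k(2) s(2), of s] s(1) by auto
  show thesis
    by (rule that[of "l ** k"])
      (use k l kr G2C_sub_Spin7C G2C_one_fixed in
        \<open>auto simp: Spin7C_group cnj_mat_mult matrix_vector_mul_assoc[symmetric] subset_iff\<close>)
qed

section \<open>Polar form of points on the complex sphere\<close>

definition slice_vec :: "8 \<Rightarrow> 8 \<Rightarrow> real \<Rightarrow> complex^8" where
  "slice_vec \<alpha> \<beta> t = of_real (cosh t) *s cayley_e \<alpha> + (\<i> * of_real (sinh t)) *s cayley_e \<beta>"

lemma complex_unit_polar:
  fixes x :: "complex^8"
  assumes "cdot x x = 1"
  obtains r s t where "cdot r r = 1" "cnj_vec r = r" "cdot s s = 1" "cnj_vec s = s" "cdot r s = 0"
    "x = of_real (cosh t) *s r + (\<i> * of_real (sinh t)) *s s" "x $ 0 = 0 \<Longrightarrow> r $ 0 = 0 \<and> s $ 0 = 0"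
proof -
  define u :: "complex^8" where "u = (\<chi> i. of_real (Re (x $ i)))"
  define v :: "complex^8" where "v = (\<chi> i. of_real (Im (x $ i)))"
  have uv: "cnj_vec u = u" "cnj_vec v = v" by (simp_all add: u_def v_def vec_eq_iff)
  have xuv: "x = u + \<i> *s v" by (simp add: u_def v_def vec_eq_iff complex_eq mult.commute)
  have rl: "cnj (cdot a b) = cdot a b" if "cnj_vec a = a" "cnj_vec b = b" for a b :: "complex^8"
    using that cdot_cnj_vec by metis
  have im: "Im (cdot u v) = 0" "Im (cdot u u) = 0" "Im (cdot v v) = 0"
    using rl uv by (metis complex_cnj complex_eq_iff Im_complex_of_real Reals_cnj_iff complex_is_Real_iff)+
  have "1 = cdot u u - cdot v v + 2 * \<i> * cdot u v"
    using assms unfolding xuv by (simp add: cdot_commute[of v u] algebra_simps)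
  then have re: "Re (cdot u u) - Re (cdot v v) = 1" "Re (cdot u v) = 0"
    using im by (simp_all add: complex_eq_iff)
  then have uv0: "cdot u v = 0" using im by (simp add: complex_eq_iff)
  \<comment> \<open>For imaginary x the unit joins the list of vectors to be avoided, so r and s
    come out imaginary too, even where the imaginary part of x vanishes and s is arbitrary.\<close>
  define l where "l = (if x $ 0 = 0 then [cayley_e 0] else [])"
  have x0: "u $ 0 = 0 \<and> v $ 0 = 0" if "x $ 0 = 0" using that by (simp add: u_def v_def)
  have lset: "x $ 0 = 0 \<and> y = cayley_e 0" if "y \<in> set l" for y
    using that by (cases "x $ 0 = 0") (simp_all add: l_def)
  have l1: "length l < 8" "\<And>y. y \<in> set l \<Longrightarrow> cnj_vec y = y" "\<And>y. y \<in> set l \<Longrightarrow> cdot u y = 0"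
  proof -
    show "length l < 8" by (simp add: l_def)
    show "cnj_vec y = y" "cdot u y = 0" if "y \<in> set l" for y
      using lset[OF that] x0 by auto
  qed
  obtain p r where r: "p \<ge> 0" "u = of_real p *s r" "cnj_vec r = r" "cdot r r = 1"
    "\<And>y. y \<in> set l \<Longrightarrow> cdot r y = 0" "cdot u u = of_real (p\<^sup>2)"
    by (rule real_normalize[OF uv(1) l1]) blast+
  have pp: "p\<^sup>2 = 1 + Re (cdot v v)" using re(1) r(6) by simp
  have vv0: "Re (cdot v v) \<ge> 0" using real_cdot_self[OF uv(2)] by (metis Re_complex_of_real zero_le_power2)
  have p0: "p > 0" using pp vv0 r(1) by (cases "p = 0") auto
  have rv: "cdot v r = 0" using uv0 r(2) p0 by (simp add: cdot_commute)
  have l2: "length (r # l) < 8" "\<And>y. y \<in> set (r # l) \<Longrightarrow> cnj_vec y = y" "\<And>y. y \<in> set (r # l) \<Longrightarrow> cdot v y = 0"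
  proof -
    show "length (r # l) < 8" by (simp add: l_def)
    show "cnj_vec y = y" "cdot v y = 0" if "y \<in> set (r # l)" for y
      using lset[of y] that x0 rv r(3) by auto
  qed
  obtain q s where s: "q \<ge> 0" "v = of_real q *s s" "cnj_vec s = s" "cdot s s = 1"
    "\<And>y. y \<in> set (r # l) \<Longrightarrow> cdot s y = 0" "cdot v v = of_real (q\<^sup>2)"
    by (rule real_normalize[OF uv(2) l2]) blast+
  define t where "t = arsinh q"
  have "sinh t = q" by (simp add: t_def)
  moreover have "cosh t = p"
  proof -
    have "(cosh t)\<^sup>2 = p\<^sup>2" using pp s(6) cosh_square_eq[of t] \<open>sinh t = q\<close> by simp
    then show ?thesis using p0 cosh_real_pos[of t] by (simp add: power2_eq_iff)
  qed
  moreover have "r $ 0 = 0 \<and> s $ 0 = 0" if "x $ 0 = 0"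
    using r(5)[of "cayley_e 0"] s(5)[of "cayley_e 0"] that by (simp add: l_def)
  moreover have "cdot r s = 0" using s(5)[of r] by (simp add: cdot_commute)
  moreover have "x = of_real p *s r + (\<i> * of_real q) *s s"
    unfolding xuv r(2) s(2) by (simp add: vec_eq_iff)
  ultimately show thesis using that[of r s t] r s by simp
qed

lemma Spin7C_meets_slice:
  assumes "cdot x x = 1"
  obtains k t where "k \<in> Spin7C" "cnj_mat k = k" "k *v x = slice_vec 0 1 t"
proof -
  obtain r s t where rst: "cdot r r = 1" "cnj_vec r = r" "cdot s s = 1" "cnj_vec s = s" "cdot r s = 0"
    "x = of_real (cosh t) *s r + (\<i> * of_real (sinh t)) *s s"
    by (rule complex_unit_polar[OF assms]) blast
  obtain k where k: "k \<in> Spin7C" "cnj_mat k = k" "k *v r = cayley_e 0" "k *v s = cayley_e 1"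
    by (rule Spin7C_real_pairs[OF rst(1-5)]) blast
  then have "k *v x = slice_vec 0 1 t"
    unfolding rst(6) slice_vec_def by (simp add: matrix_vector_right_distrib matrix_vec_scale)
  then show thesis using that k by blast
qed

lemma G2C_meets_slice:
  assumes "cdot x x = 1" "x $ 0 = 0"
  obtains k t where "k \<in> G2C" "cnj_mat k = k" "k *v x = slice_vec 1 2 t"
proof -
  obtain r s t where rst: "cdot r r = 1" "cnj_vec r = r" "cdot s s = 1" "cnj_vec s = s" "cdot r s = 0"
    "x = of_real (cosh t) *s r + (\<i> * of_real (sinh t)) *s s" "x $ 0 = 0 \<Longrightarrow> r $ 0 = 0 \<and> s $ 0 = 0"
    by (rule complex_unit_polar[OF assms(1)]) blast
  have "r $ 0 = 0" "s $ 0 = 0" using rst(7) assms(2) by auto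
  then obtain k where k: "k \<in> G2C" "cnj_mat k = k" "k *v r = cayley_e 1" "k *v s = cayley_e 2"
    using G2C_real_pairs[of r s] rst by metis
  then have "k *v x = slice_vec 1 2 t"
    unfolding rst(6) slice_vec_def by (simp add: matrix_vector_right_distrib matrix_vec_scale)
  then show thesis using that k by blast
qed

text \<open>\<open>\<iota>\<close> enumerates the coordinates other than \<open>\<alpha>\<close> and possibly \<open>0\<close>.\<close>

lemma ratio_coords_slice_vec:
  assumes "inj \<iota>" "\<alpha> \<notin> range \<iota>" "\<iota> j = \<beta>" "d * cosh t + e \<noteq> 0"
  shows "ratio_coords \<iota> \<alpha> (of_real d *s slice_vec \<alpha> \<beta> t + of_real e *s cayley_e \<alpha>) =
    (d * sinh t / (d * cosh t + e)) *\<^sub>R axis j \<i>"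
proof -
  have ab: "\<alpha> \<noteq> \<beta>" using assms by auto
  have ne: "of_real (d * cosh t + e) \<noteq> (0 :: complex)" using assms(4) by (metis of_real_eq_0_iff)
  have "ratio_coords \<iota> \<alpha> (of_real d *s slice_vec \<alpha> \<beta> t + of_real e *s cayley_e \<alpha>) $ i =
    ((d * sinh t / (d * cosh t + e)) *\<^sub>R axis j \<i>) $ i" for i
  proof -
    have "\<iota> i \<noteq> \<alpha>" using assms(2) by auto
    moreover have "\<iota> i = \<beta> \<longleftrightarrow> i = j" using assms(1,3) by (auto dest: injD)
    ultimately show ?thesis
      using ab ne unfolding scaleR_eq_smult
      by (simp add: ratio_coords_def slice_vec_def cayley_e_nth axis_def)
  qed
  then show ?thesis by (simp add: vec_eq_iff)
qed

section \<open>Local sections and coordinates\<close>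

lemma open_holomorphic_nonzero:
  assumes "holomorphic_map_on sA (*) f S" shows "open {x \<in> S. f x \<noteq> 0}"
proof -
  have "{x \<in> S. f x \<noteq> 0} = S \<inter> f -` (- {0})" by blast
  moreover have "open (- {0 :: complex})" by (simp add: open_Compl)
  ultimately show ?thesis using holomorphic_map_on_open_vimage[OF assms, of "- {0}"] by simp
qed

lemma holomorphic_complex_mult:
  assumes "holomorphic_map_on sA (*) f S" "holomorphic_map_on sA (*) g S"
  shows "holomorphic_map_on sA (*) (\<lambda>x. f x * g x :: complex) S"
proof (rule holomorphic_map_on_bilinear[where b = "(*)" and f = f and g = g, OF _ _ _ _ assms])
  show "bilinear ((*) :: complex \<Rightarrow> _)" unfolding bilinear_def linear_iff by (simp add: algebra_simps)
qed (simp_all add: algebra_simps)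

text \<open>The vector a = x_j e_i - x_i e_j is imaginary, orthogonal to x and linear in x, so - (a,
  a)^(-1) L_a L_(a x) is a rational lift that takes e_0 to x. It becomes orthogonal after scaling by
  c with c^2 (x, x) = 1; the companion S0 is blind to that scale, so no square root has to be chosen
  holomorphically.\<close>

lemma spin_section_aux:
  assumes q: "q $ i * q $ i + q $ j * q $ j \<noteq> 0" "cdot q q \<noteq> 0" and ij: "i \<noteq> j" "i \<noteq> 0" "j \<noteq> 0"
  obtains V S0 S where "q \<in> V" "holomorphic_map_on (*s) mat_scale S0 V" "holomorphic_map_on (*s) mat_scale S V"
    "\<And>x. x \<in> V \<Longrightarrow> cdot x x \<noteq> 0 \<and> S0 x \<in> SO7C \<and> tri (S0 x) (S x) \<and> S x *v cayley_e 0 = x"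
    "\<And>x c. x \<in> V \<Longrightarrow> c * c * cdot x x = 1 \<Longrightarrow> mat_scale c (S x) \<in> SO8C"
proof -
  define a :: "complex^8 \<Rightarrow> complex^8" where "a = (\<lambda>x. x $ j *s cayley_e i - x $ i *s cayley_e j)"
  have a0: "a x $ 0 = 0" "cdot (a x) (a x) = x $ i * x $ i + x $ j * x $ j" "cdot (a x) x = 0" for x
    using ij by (simp_all add: a_def cayley_e_nth algebra_simps)
  have ax0: "(a x \<bullet>\<^sub>C x) $ 0 = 0" for x
    using cdot_cayley_adjoint_left[of "a x" x "cayley_e 0"] a0 by (simp add: oconj_imag cdot_commute[of x "a x"])
  have axN: "cdot (a x \<bullet>\<^sub>C x) (a x \<bullet>\<^sub>C x) = cdot (a x) (a x) * cdot x x" for x by (rule cdot_cayley_norm)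
  define V where "V = {x \<in> {x \<in> UNIV. cdot (a x) (a x) \<noteq> 0}. cdot x x \<noteq> 0}"
  have ha0: "holomorphic_map_on (*s) (*s) a UNIV"
  proof (rule holomorphic_map_on_linear)
    show *: "a (c *s x) = c *s a x" for c x by (simp add: a_def vec_eq_iff algebra_simps)
    show "linear a" by (rule complex_linear_imp_linear[OF _ *]) (simp add: a_def vec_eq_iff algebra_simps)
  qed simp
  note oV1 = open_holomorphic_nonzero[OF holomorphic_cdot[OF ha0 ha0]]
  have oV: "open V" unfolding V_def
    by (rule open_holomorphic_nonzero[OF holomorphic_cdot[OF holomorphic_id[OF oV1] holomorphic_id[OF oV1]]])
  have ha: "holomorphic_map_on (*s) (*s) a V" by (rule holomorphic_map_on_subset[OF ha0 oV]) simp
  have hx: "holomorphic_map_on (*s) (*s) (\<lambda>x :: complex^8. x) V" by (rule holomorphic_id[OF oV])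
  note hax = holomorphic_cayley[OF ha hx]
  have nz: "cdot (a x) (a x) \<noteq> 0" "cdot x x \<noteq> 0" if "x \<in> V" for x using that by (auto simp: V_def)
  define S0 where "S0 = (\<lambda>x. Cmul (a x) ** Cmul (a x \<bullet>\<^sub>C x))"
  define S where "S = (\<lambda>x. mat_scale (- 1 * inverse (cdot (a x) (a x))) (Lmul (a x) ** Lmul (a x \<bullet>\<^sub>C x)))"
  show thesis
  proof
    show "q \<in> V" using q by (simp add: V_def a0)
    show "holomorphic_map_on (*s) mat_scale S0 V"
      unfolding S0_def
      by (rule holomorphic_matrix_mult[OF holomorphic_Cmul[OF ha nz(1)] holomorphic_Cmul[OF hax]])
        (simp_all add: axN nz)
    have i: "holomorphic_map_on (*s) (*) (\<lambda>x. inverse (cdot (a x) (a x))) V"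
      by (rule holomorphic_map_on_inverse[OF holomorphic_cdot[OF ha ha] nz(1)])
    have m: "holomorphic_map_on (*s) (*) (\<lambda>x. - 1 * inverse (cdot (a x) (a x))) V"
      by (rule holomorphic_complex_mult[OF holomorphic_complex_const[OF oV] i])
    show "holomorphic_map_on (*s) mat_scale S V"
      unfolding S_def
      by (rule holomorphic_mat_scale[OF m holomorphic_matrix_mult[OF holomorphic_Lmul[OF ha] holomorphic_Lmul[OF hax]]])
    fix x assume x: "x \<in> V"
    have "S0 x \<in> SO7C" unfolding S0_def using nz[OF x] by (intro SO7C_mult Cmul_SO7C a0 ax0) (simp_all add: axN)
    moreover have "tri (S0 x) (S x)"
      unfolding S0_def S_def using nz[OF x] by (intro tri_scale tri_mult tri_Cmul_Lmul a0 ax0) (simp_all add: axN)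
    moreover have "S x *v cayley_e 0 = x"
      unfolding S_def using nz[OF x] imag_square[OF a0(1), of x x]
      by (simp add: mat_scale_vec matrix_vector_mul_assoc[symmetric] vec_eq_iff)
    ultimately show "cdot x x \<noteq> 0 \<and> S0 x \<in> SO7C \<and> tri (S0 x) (S x) \<and> S x *v cayley_e 0 = x" using nz[OF x] by blast
    fix c assume c: "c * c * cdot x x = 1"
    define d where "d = inverse (csqrt (cdot (a x) (a x)))"
    have dd: "d * d = inverse (cdot (a x) (a x))"
      unfolding d_def by (metis inverse_mult_distrib power2_csqrt power2_eq_square)
    have 1: "((- d) *s a x) $ 0 = 0" "cdot ((- d) *s a x) ((- d) *s a x) = 1"
      using a0(1) dd nz(1)[OF x] by (simp_all add: mult.assoc[symmetric])
    have "cdot ((c * d) *s (a x \<bullet>\<^sub>C x)) ((c * d) *s (a x \<bullet>\<^sub>C x)) = (c * c * cdot x x) * (d * d * cdot (a x) (a x))"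
      by (simp add: axN mult_ac)
    then have 2: "((c * d) *s (a x \<bullet>\<^sub>C x)) $ 0 = 0" "cdot ((c * d) *s (a x \<bullet>\<^sub>C x)) ((c * d) *s (a x \<bullet>\<^sub>C x)) = 1"
      using ax0 dd c nz(1)[OF x] by simp_all
    have "mat_scale c (S x) *v y = (Lmul ((- d) *s a x) ** Lmul ((c * d) *s (a x \<bullet>\<^sub>C x))) *v y" for y
    proof -
      have "(Lmul ((- d) *s a x) ** Lmul ((c * d) *s (a x \<bullet>\<^sub>C x))) *v y = (- c * (d * d)) *s (a x \<bullet>\<^sub>C ((a x \<bullet>\<^sub>C x) \<bullet>\<^sub>C y))"
        by (simp add: matrix_vector_mul_assoc[symmetric] cayley_linear mult_ac)
      then show ?thesis by (simp add: S_def mat_scale_vec matrix_vector_mul_assoc[symmetric] dd)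
    qed
    then have "mat_scale c (S x) = Lmul ((- d) *s a x) ** Lmul ((c * d) *s (a x \<bullet>\<^sub>C x))" by (simp add: matrix_eq)
    then show "mat_scale c (S x) \<in> SO8C" using SO8C_mult[OF Lmul_SO8C[OF 1] Lmul_SO8C[OF 2]] by simp
  qed
qed

text \<open>A suitable pair of indices is missing only if q is a multiple of e_0: if q_i^2 + q_j^2
  vanishes for all distinct nonzero i and j, every q_i with i nonzero is 0. Then e_1 q is a multiple
  of e_1, where the indices 1 and 2 work, and left multiplication by -e_1 carries the section
  back.\<close>

lemma spin_section:
  assumes q: "cdot q q \<noteq> 0"
  obtains V S0 S where "q \<in> V" "holomorphic_map_on (*s) mat_scale S0 V" "holomorphic_map_on (*s) mat_scale S V"
    "\<And>x. x \<in> V \<Longrightarrow> cdot x x \<noteq> 0 \<and> S0 x \<in> SO7C \<and> tri (S0 x) (S x) \<and> S x *v cayley_e 0 = x"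
    "\<And>x c. x \<in> V \<Longrightarrow> c * c * cdot x x = 1 \<Longrightarrow> mat_scale c (S x) \<in> SO8C"
proof (cases "\<exists>i j. i \<noteq> j \<and> i \<noteq> 0 \<and> j \<noteq> 0 \<and> q $ i * q $ i + q $ j * q $ j \<noteq> 0")
  case True
  then show thesis using spin_section_aux[OF _ q] that by metis
next
  case False
  then have z: "q $ i * q $ i + q $ j * q $ j = 0" if "i \<noteq> j" "i \<noteq> 0" "j \<noteq> 0" for i j using that by blast
  have "2 * (q $ 1 * q $ 1) = (q $ 1 * q $ 1 + q $ 2 * q $ 2) + (q $ 1 * q $ 1 + q $ 3 * q $ 3)
      - (q $ 2 * q $ 2 + q $ 3 * q $ 3)"
    by (simp add: algebra_simps)
  also have "\<dots> = 0"
  proof -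
    have "q $ 1 * q $ 1 + q $ 2 * q $ 2 = 0" "q $ 1 * q $ 1 + q $ 3 * q $ 3 = 0" "q $ 2 * q $ 2 + q $ 3 * q $ 3 = 0"
      by (rule z; simp)+
    then show ?thesis by (simp only:) simp
  qed
  finally have "2 * (q $ 1 * q $ 1) = 0" .
  then have q1: "q $ 1 = 0" by simp
  have qk: "q $ k = 0" if "k \<noteq> 0" for k using z[of 1 k] that q1 by (cases "k = 1") auto
  let ?e = "cayley_e 1"
  have e: "(- ?e) $ 0 = 0" "cdot (- ?e) (- ?e) = 1" by (simp_all add: cayley_e_nth)
  have "q $ 0 * q $ 0 \<noteq> 0"
    using q qk by (simp add: cdot_def sum_8)
  then have eq: "(?e \<bullet>\<^sub>C q) $ 1 * (?e \<bullet>\<^sub>C q) $ 1 + (?e \<bullet>\<^sub>C q) $ 2 * (?e \<bullet>\<^sub>C q) $ 2 \<noteq> 0"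
    "cdot (?e \<bullet>\<^sub>C q) (?e \<bullet>\<^sub>C q) \<noteq> 0"
    using q by (simp_all add: cayley_mult_nth cayley_e_nth qk cdot_cayley_norm)
  obtain V S0 S where V: "?e \<bullet>\<^sub>C q \<in> V" "holomorphic_map_on (*s) mat_scale S0 V" "holomorphic_map_on (*s) mat_scale S V"
    "\<And>x. x \<in> V \<Longrightarrow> cdot x x \<noteq> 0 \<and> S0 x \<in> SO7C \<and> tri (S0 x) (S x) \<and> S x *v cayley_e 0 = x"
    "\<And>x c. x \<in> V \<Longrightarrow> c * c * cdot x x = 1 \<Longrightarrow> mat_scale c (S x) \<in> SO8C"
    using spin_section_aux[OF eq, of thesis] by simp
  let ?V = "UNIV \<inter> (*v) (Lmul ?e) -` V"
  have h0: "holomorphic_map_on (*s) (*s) ((*v) (Lmul ?e)) UNIV"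
    by (rule holomorphic_matvec_left[OF holomorphic_id[OF open_UNIV]])
  have oV: "open ?V" by (rule holomorphic_map_on_open_vimage[OF h0 holomorphic_map_onD(2)[OF V(2)]])
  have h: "holomorphic_map_on (*s) (*s) ((*v) (Lmul ?e)) ?V" by (rule holomorphic_map_on_subset[OF h0 oV]) simp
  have hc: "holomorphic_map_on (*s) mat_scale (\<lambda>x :: complex^8. M :: complex^8^8) ?V" for M
    by (rule holomorphic_map_on_const) (simp add: vec_eq_iff, rule oV)
  have h1: "holomorphic_map_on (*s) mat_scale (\<lambda>x. Cmul (- ?e) ** (S0 \<circ> (*v) (Lmul ?e)) x) ?V"
    by (rule holomorphic_matrix_mult[OF hc holomorphic_map_on_compose[OF h V(2)]]) auto
  have h2: "holomorphic_map_on (*s) mat_scale (\<lambda>x. Lmul (- ?e) ** (S \<circ> (*v) (Lmul ?e)) x) ?V"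
    by (rule holomorphic_matrix_mult[OF hc holomorphic_map_on_compose[OF h V(3)]]) auto
  have n: "cdot (?e \<bullet>\<^sub>C x) (?e \<bullet>\<^sub>C x) = cdot x x" for x by (simp add: cdot_cayley_norm cayley_e_nth)
  show thesis
  proof (rule that[OF _ h1 h2])
    show "q \<in> ?V" using V(1) by simp
    fix x assume "x \<in> ?V"
    then have x: "?e \<bullet>\<^sub>C x \<in> V" by simp
    note f = V(4)[OF x]
    have e1: "cdot (- ?e) (- ?e) \<noteq> 0" using e(2) by simp
    have "(Lmul (- ?e) ** S (?e \<bullet>\<^sub>C x)) *v cayley_e 0 = x"
      using f imag_square[of ?e x] by (simp add: matrix_vector_mul_assoc[symmetric] cayley_linear cayley_e_nth)
    then show "cdot x x \<noteq> 0 \<and> Cmul (- ?e) ** (S0 \<circ> (*v) (Lmul ?e)) x \<in> SO7C \<and>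
        tri (Cmul (- ?e) ** (S0 \<circ> (*v) (Lmul ?e)) x) (Lmul (- ?e) ** (S \<circ> (*v) (Lmul ?e)) x) \<and>
        (Lmul (- ?e) ** (S \<circ> (*v) (Lmul ?e)) x) *v cayley_e 0 = x"
      using f n[of x] SO7C_mult[OF Cmul_SO7C[OF e(1) e1]] tri_mult[OF tri_Cmul_Lmul[OF e(1) e1]] by simp
    fix c assume "c * c * cdot x x = 1"
    then have "mat_scale c (S (?e \<bullet>\<^sub>C x)) \<in> SO8C" using V(5)[OF x] n[of x] by simp
    then show "mat_scale c (Lmul (- ?e) ** (S \<circ> (*v) (Lmul ?e)) x) \<in> SO8C"
      using SO8C_mult[OF Lmul_SO8C[OF e]] by (simp add: mat_scale_mult(2))
  qed
qed

text \<open>A real element brings x to the slice, where the data are explicit: e_4 is orthogonal to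
  the quaternion algebra of e_1 and e_2, which contains the slice, and 1 + cosh t is nonzero. So a
  single swap joins e_1 to the slice point.\<close>

lemma G2C_transitive:
  assumes x: "x $ 0 = 0" "cdot x x = 1"
  obtains g where "g \<in> G2C" "g *v cayley_e 1 = x"
proof -
  obtain k t where k: "k \<in> G2C" "cnj_mat k = k" "k *v x = slice_vec 1 2 t" by (rule G2C_meets_slice[OF x(2,1)]) blast
  let ?y = "slice_vec 1 2 t"
  have k8: "k \<in> SO8C" using k G2C_iff by blast
  have y: "?y $ 0 = 0" "cdot ?y ?y = 1"
    using SO8C_D(4)[OF k8, of x x] x(2) unfolding k(3)[symmetric]
    by (simp_all add: k(3)) (simp add: slice_vec_def cayley_e_nth)
  have ch: "1 + complex_of_real (cosh t) \<noteq> 0"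
  proof -
    have "1 + cosh t > 0" using cosh_real_ge_1[of t] by linarith
    then show ?thesis by (metis of_real_1 of_real_add of_real_eq_0_iff less_irrefl)
  qed
  have e: "cayley_e 1 $ 0 = 0" "cdot (cayley_e 1) (cayley_e 1) = 1" "cayley_e 4 $ 0 = 0" "cdot (cayley_e 4) (cayley_e 4) \<noteq> 0"
    "cdot (cayley_e 4) (cayley_e 1) = 0" "cdot (cayley_e 4) ?y = 0" "cdot (cayley_e 4) (cayley_e 1 \<bullet>\<^sub>C ?y) = 0"
    "1 + cdot (cayley_e 1) ?y \<noteq> 0"
    using ch by (simp_all add: cayley_e_nth slice_vec_def cayley_mult_nth)
  note sw = Imul_swap[OF e(1,2) y e(8) e(3,4) e(5-7)]
  let ?g = "transpose k ** Imul (cayley_e 1 + ?y) (cayley_e 4)"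
  have "?g \<in> G2C" using sw(1) k G2C_group by blast
  moreover have "?g *v cayley_e 1 = transpose k *v (k *v x)"
    using sw(2) k(3) by (simp add: matrix_vector_mul_assoc[symmetric] del: transpose_matrix_vector)
  ultimately show thesis using that SO8C_D(6)[OF k8] by simp
qed

text \<open>The associator \<open>[e\<^sub>1, x, e\<^sub>2]\<close> is orthogonal to the quaternion subalgebra generated by \<open>e\<^sub>1\<close> and \<open>x\<close>.\<close>

definition assoc_vec :: "complex^8 \<Rightarrow> complex^8" where
  "assoc_vec x = (cayley_e 1 \<bullet>\<^sub>C x) \<bullet>\<^sub>C cayley_e 2 - cayley_e 1 \<bullet>\<^sub>C (x \<bullet>\<^sub>C cayley_e 2)"

lemma assoc_vec_nth:
  "assoc_vec x $ 0 = 0" "assoc_vec x $ 1 = 0" "assoc_vec x $ 2 = 0" "assoc_vec x $ 3 = 0"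
  "assoc_vec x $ 4 = 2 * x $ 7" "assoc_vec x $ 5 = 2 * x $ 6" "assoc_vec x $ 6 = - 2 * x $ 5" "assoc_vec x $ 7 = - 2 * x $ 4"
  by (simp_all add: assoc_vec_def cayley_mult_nth cayley_e_nth)

text \<open>The swap that takes e_1 to x needs an auxiliary vector holomorphic in x, which is the
  associator, and it needs non-isotropic data. These fail at some q, for instance in the span of
  e_1, e_2, e_3; therefore q is moved to e_4, where the associator is -2 e_7.\<close>

lemma G2C_section:
  assumes q: "q $ 0 = 0" "cdot q q = 1"
  obtains V S where "q \<in> V" "holomorphic_map_on (*s) mat_scale S V"
    "\<And>x. x \<in> V \<Longrightarrow> x $ 0 = 0 \<Longrightarrow> cdot x x = 1 \<Longrightarrow> S x \<in> G2C \<and> S x *v cayley_e 1 = x"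
proof -
  obtain g1 where g1: "g1 \<in> G2C" "g1 *v cayley_e 1 = q" by (rule G2C_transitive[OF q]) blast
  have e4: "cayley_e 4 $ 0 = 0" "cdot (cayley_e 4) (cayley_e 4) = 1" by (simp_all add: cayley_e_nth)
  obtain g2 where g2: "g2 \<in> G2C" "g2 *v cayley_e 1 = cayley_e 4" by (rule G2C_transitive[OF e4]) blast
  define g where "g = transpose (g1 ** transpose g2)"
  have g: "g \<in> G2C" "transpose g \<in> G2C" using g1 g2 G2C_group unfolding g_def by (auto simp: transpose_transpose)
  have g8: "g \<in> SO8C" "g1 \<in> SO8C" "g2 \<in> SO8C" using g g1 g2 G2C_iff by auto
  have gq: "g *v q = cayley_e 4"
    unfolding g_def matrix_transpose_mul transpose_transpose matrix_vector_mul_assoc[symmetric] g1(2)[symmetric]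
      SO8C_D(6)[OF g8(2)] by (rule g2(2))
  define a where "a = (\<lambda>x. cayley_e 1 + x)"
  let ?d = "\<lambda>x. a x \<bullet>\<^sub>C assoc_vec x"
  have hid: "holomorphic_map_on (*s) (*s) (\<lambda>x :: complex^8. x) UNIV" by (rule holomorphic_id) simp
  note hc = holomorphic_vec_const[OF open_UNIV, where sA = "(*s) :: complex \<Rightarrow> complex^8 \<Rightarrow> _"]
  have ha: "holomorphic_map_on (*s) (*s) a UNIV"
    unfolding a_def by (rule holomorphic_vec_add[OF hc hid])
  have hb: "holomorphic_map_on (*s) (*s) assoc_vec UNIV"
  proof (rule holomorphic_map_on_linear)
    show *: "assoc_vec (c *s x) = c *s assoc_vec x" for c x by (simp add: assoc_vec_def cayley_linear vec.scale_right_diff_distrib)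
    show "linear assoc_vec" by (rule complex_linear_imp_linear[OF _ *]) (simp add: assoc_vec_def cayley_linear)
  qed simp
  \<comment> \<open>By multiplicativity of the norm this one condition makes both \<open>a x\<close>
    and \<open>assoc_vec x\<close> non-isotropic.\<close>
  define V0 where "V0 = {x \<in> UNIV. cdot (?d x) (?d x) \<noteq> 0}"
  have oV0: "open V0" unfolding V0_def
    by (rule open_holomorphic_nonzero[OF holomorphic_cdot[OF holomorphic_cayley[OF ha hb] holomorphic_cayley[OF ha hb]]])
  note ha' = holomorphic_map_on_subset[OF ha oV0 subset_UNIV] and hb' = holomorphic_map_on_subset[OF hb oV0 subset_UNIV]
  note hd' = holomorphic_cayley[OF ha' hb']
  have i: "holomorphic_map_on (*s) (*) (\<lambda>x. inverse (cdot (?d x) (?d x))) V0"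
    by (rule holomorphic_map_on_inverse[OF holomorphic_cdot[OF hd' hd']]) (simp add: V0_def)
  have m: "holomorphic_map_on (*s) (*) (\<lambda>x. - inverse (cdot (?d x) (?d x))) V0"
    using holomorphic_complex_mult[OF holomorphic_complex_const[OF oV0, of _ "- 1"] i] by simp
  have hS: "holomorphic_map_on (*s) mat_scale (\<lambda>x. Imul (a x) (assoc_vec x)) V0"
    unfolding Imul_def
    by (rule holomorphic_mat_scale[OF m holomorphic_matrix_mult[OF holomorphic_Lmul[OF hd']
            holomorphic_matrix_mult[OF holomorphic_Lmul[OF ha'] holomorphic_Lmul[OF hb']]]])
  have S0: "Imul (a x) (assoc_vec x) \<in> G2C" "Imul (a x) (assoc_vec x) *v cayley_e 1 = x"
    if x: "x \<in> V0" "x $ 0 = 0" "cdot x x = 1" for x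
  proof -
    have d: "cdot (a x) (a x) * cdot (assoc_vec x) (assoc_vec x) \<noteq> 0"
      using x(1) by (simp add: V0_def cdot_cayley_norm)
    have "cdot (a x) (a x) = 2 * (1 + cdot (cayley_e 1) x)"
      using x by (simp add: a_def cayley_e_nth)
    then have 1: "1 + cdot (cayley_e 1) x \<noteq> 0" "cdot (assoc_vec x) (assoc_vec x) \<noteq> 0"
      using d by (metis mult_zero_left mult_zero_right, metis mult_zero_right)
    have e1: "cayley_e 1 $ 0 = 0" "cdot (cayley_e 1) (cayley_e 1) = 1" by (simp_all add: cayley_e_nth)
    have p: "cdot (assoc_vec x) (cayley_e 1) = 0" "cdot (assoc_vec x) x = 0" "cdot (assoc_vec x) (cayley_e 1 \<bullet>\<^sub>C x) = 0"
      by (simp_all add: cdot_def sum_8 assoc_vec_nth cayley_mult_nth cayley_e_nth)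
    show "Imul (a x) (assoc_vec x) \<in> G2C" "Imul (a x) (assoc_vec x) *v cayley_e 1 = x"
      using Imul_swap[OF e1 x(2,3) 1(1) assoc_vec_nth(1) 1(2) p] by (simp_all add: a_def)
  qed
  let ?V = "UNIV \<inter> (*v) g -` V0"
  have h0: "holomorphic_map_on (*s) (*s) ((*v) g) UNIV" by (rule holomorphic_matvec_left[OF hid])
  have oV: "open ?V" by (rule holomorphic_map_on_open_vimage[OF h0 oV0])
  have h: "holomorphic_map_on (*s) (*s) ((*v) g) ?V" by (rule holomorphic_map_on_subset[OF h0 oV]) simp
  have hcg: "holomorphic_map_on (*s) mat_scale (\<lambda>x :: complex^8. transpose g) ?V"
    by (rule holomorphic_map_on_const) (simp add: vec_eq_iff, rule oV)
  have h1: "holomorphic_map_on (*s) mat_scale (\<lambda>x. transpose g ** ((\<lambda>x. Imul (a x) (assoc_vec x)) \<circ> (*v) g) x) ?V"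
    by (rule holomorphic_matrix_mult[OF hcg holomorphic_map_on_compose[OF h hS]]) auto
  show thesis
  proof (rule that[OF _ h1])
    show "q \<in> ?V"
      by (simp add: gq V0_def cdot_cayley_norm a_def cayley_e_nth)
        (simp add: cdot_def sum_8 assoc_vec_nth cayley_e_nth)
    fix x assume x: "x \<in> ?V" "x $ 0 = 0" "cdot x x = 1"
    have "cdot (g *v x) (g *v cayley_e 0) = 0" using SO8C_D(4)[OF g8(1), of x "cayley_e 0"] x by simp
    then have g0: "(g *v x) $ 0 = 0" using G2C_one_fixed[OF g(1)] by simp
    have gx: "g *v x \<in> V0" "cdot (g *v x) (g *v x) = 1" using x SO8C_D(4)[OF g8(1)] by auto
    note s = S0[OF gx(1) g0 gx(2)]
    show "transpose g ** ((\<lambda>x. Imul (a x) (assoc_vec x)) \<circ> (*v) g) x \<in> G2C \<and>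
        (transpose g ** ((\<lambda>x. Imul (a x) (assoc_vec x)) \<circ> (*v) g) x) *v cayley_e 1 = x"
      using G2C_group(2)[OF g(2) s(1)] s(2) SO8C_D(6)[OF g8(1), of x]
      by (simp add: matrix_vector_mul_assoc[symmetric] del: transpose_matrix_vector)
  qed
qed

section \<open>Stereographic coordinates\<close>

lemma cdot_split:
  fixes \<iota> :: "'n::finite \<Rightarrow> 8"
  assumes "inj \<iota>" "\<alpha> \<notin> range \<iota>" "\<And>i. i \<noteq> \<alpha> \<Longrightarrow> i \<notin> range \<iota> \<Longrightarrow> x $ i = 0"
  shows "cdot x x = x $ \<alpha> * x $ \<alpha> + (\<Sum>j\<in>UNIV. x $ \<iota> j * x $ \<iota> j)"
proof -
  have "cdot x x = (\<Sum>i\<in>insert \<alpha> (range \<iota>). x $ i * x $ i)"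
    unfolding cdot_def by (rule sum.mono_neutral_right) (use assms(3) in auto)
  also have "\<dots> = x $ \<alpha> * x $ \<alpha> + (\<Sum>i\<in>range \<iota>. x $ i * x $ i)" using assms(2) by (subst sum.insert) auto
  also have "(\<Sum>i\<in>range \<iota>. x $ i * x $ i) = (\<Sum>j\<in>UNIV. x $ \<iota> j * x $ \<iota> j)"
    by (subst sum.reindex[OF assms(1)]) simp
  finally show ?thesis .
qed

definition embed :: "('n \<Rightarrow> 8) \<Rightarrow> complex^'n \<Rightarrow> complex^8" where
  "embed \<iota> z = (\<chi> i. if i \<in> range \<iota> then z $ inv_into UNIV \<iota> i else 0)"

lemma embed_nth: "inj \<iota> \<Longrightarrow> embed \<iota> z $ \<iota> j = z $ j" "i \<notin> range \<iota> \<Longrightarrow> embed \<iota> z $ i = 0"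
  by (simp_all add: embed_def)

lemma holomorphic_embed: "open S \<Longrightarrow> holomorphic_map_on (*s) (*s) (embed \<iota>) S"
proof (rule holomorphic_map_on_linear)
  show *: "embed \<iota> (c *s x) = c *s embed \<iota> x" for c x by (simp add: embed_def vec_eq_iff)
  show "linear (embed \<iota>)" by (rule complex_linear_imp_linear[OF _ *]) (simp add: embed_def vec_eq_iff)
qed

text \<open>The second point of the quadric on the line through the pole -e_\<alpha> with direction
  e_\<alpha> + z. Adding e_\<alpha> leaves a multiple of that direction, from which
  \<open>ratio_coords\<close> recovers z.\<close>

definition stereo :: "8 \<Rightarrow> ('n::finite \<Rightarrow> 8) \<Rightarrow> complex^'n \<Rightarrow> complex^8" where
  "stereo \<alpha> \<iota> z = (2 * inverse (1 + cdot z z)) *s (cayley_e \<alpha> + embed \<iota> z) + (- 1) *s cayley_e \<alpha>"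

lemma cdot_embed:
  assumes "inj \<iota>" "\<alpha> \<notin> range \<iota>"
  shows "cdot (cayley_e \<alpha> + embed \<iota> z) (cayley_e \<alpha> + embed \<iota> z) = 1 + cdot z z"
proof -
  have "embed \<iota> z $ \<alpha> = 0" "cayley_e \<alpha> $ \<iota> j = 0" for j
    using assms(2) by (auto simp: embed_nth cayley_e_nth)
  then show ?thesis
    by (subst cdot_split[OF assms]) (simp_all add: embed_nth assms(1) cayley_e_nth cdot_def)
qed

lemma stereo:
  assumes \<iota>: "inj \<iota>" "\<alpha> \<notin> range \<iota>" and z: "1 + cdot z z \<noteq> 0"
  shows "cdot (stereo \<alpha> \<iota> z) (stereo \<alpha> \<iota> z) = 1" "(stereo \<alpha> \<iota> z + cayley_e \<alpha>) $ \<alpha> \<noteq> 0"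
    "ratio_coords \<iota> \<alpha> (stereo \<alpha> \<iota> z + cayley_e \<alpha>) = z"
    "i \<noteq> \<alpha> \<Longrightarrow> i \<notin> range \<iota> \<Longrightarrow> stereo \<alpha> \<iota> z $ i = 0"
proof -
  let ?c = "2 * inverse (1 + cdot z z)" and ?v = "cayley_e \<alpha> + embed \<iota> z"
  have v: "?v $ \<alpha> = 1" "?v $ \<iota> j = z $ j" for j
    using \<iota> by (auto simp: embed_nth cayley_e_nth)
  have s: "stereo \<alpha> \<iota> z = ?c *s ?v - cayley_e \<alpha>" by (simp add: stereo_def vec_eq_iff)
  have c: "?c \<noteq> 0" "?c * (1 + cdot z z) = 2" using z by simp_all
  have "cdot (stereo \<alpha> \<iota> z) (stereo \<alpha> \<iota> z) = ?c * (?c * cdot ?v ?v) - 2 * (?c * ?v $ \<alpha>) + 1"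
  proof -
    have "cdot (c *s v - cayley_e \<alpha>) (c *s v - cayley_e \<alpha>) = c * (c * cdot v v) - 2 * (c * v $ \<alpha>) + 1" for c v
      by (simp add: cayley_e_nth algebra_simps)
    then show ?thesis unfolding s .
  qed
  also have "\<dots> = 1" unfolding cdot_embed[OF \<iota>] c(2) v(1) by simp
  finally show "cdot (stereo \<alpha> \<iota> z) (stereo \<alpha> \<iota> z) = 1" .
  have w: "stereo \<alpha> \<iota> z + cayley_e \<alpha> = ?c *s ?v" unfolding s by simp
  show "(stereo \<alpha> \<iota> z + cayley_e \<alpha>) $ \<alpha> \<noteq> 0" unfolding w vector_smult_component v(1) using c(1) by simp
  show "ratio_coords \<iota> \<alpha> (stereo \<alpha> \<iota> z + cayley_e \<alpha>) = z"
    unfolding w ratio_coords_def vector_smult_component v using c(1) by (simp add: vec_eq_iff)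
  show "stereo \<alpha> \<iota> z $ i = 0" if "i \<noteq> \<alpha>" "i \<notin> range \<iota>"
    using that by (simp add: s embed_nth cayley_e_nth)
qed

lemma open_quadric_complement: "open {z :: complex^'n. 1 + cdot z z \<noteq> 0}"
  unfolding cdot_def by (intro open_Collect_neq continuous_intros)

lemma holomorphic_stereo: "holomorphic_map_on (*s) (*s) (stereo \<alpha> \<iota>) {z. 1 + cdot z z \<noteq> 0}"
proof -
  let ?S = "{z :: complex^'a. 1 + cdot z z \<noteq> 0}"
  have o: "open ?S" by (rule open_quadric_complement)
  have c: "holomorphic_map_on (*s) (*s) (\<lambda>x. v) ?S" for v :: "complex^8" by (rule holomorphic_vec_const[OF o])
  have n: "holomorphic_map_on (*s) (*) (\<lambda>z. 1 + cdot z z) ?S"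
    by (rule holomorphic_map_on_add[OF holomorphic_complex_const[OF o] holomorphic_cdot[OF holomorphic_id[OF o] holomorphic_id[OF o]]])
      (simp add: algebra_simps)
  have i: "holomorphic_map_on (*s) (*) (\<lambda>z. inverse (1 + cdot z z)) ?S"
    by (rule holomorphic_map_on_inverse[OF n]) simp
  have "holomorphic_map_on (*s) (*s) (\<lambda>z. inverse (1 + cdot z z) *s (2 *s (cayley_e \<alpha> + embed \<iota> z)) + (- 1) *s cayley_e \<alpha>) ?S"
    by (rule holomorphic_vec_add[OF holomorphic_smult[OF i holomorphic_smult[OF holomorphic_complex_const[OF o]
              holomorphic_vec_add[OF c holomorphic_embed[OF o]]]] c])
  then show ?thesis by (simp add: stereo_def[abs_def] mult.commute)
qed

text \<open>The formula serves twice: the coordinates avoid the quadric 1 + (z, z) = 0, and the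
  entry of x at \<alpha> can be computed from them, which gives injectivity.\<close>

lemma ratio_coords_stereo_range:
  assumes \<iota>: "inj \<iota>" "\<alpha> \<notin> range \<iota>" and x: "\<And>i. i \<noteq> \<alpha> \<Longrightarrow> i \<notin> range \<iota> \<Longrightarrow> x $ i = 0" "cdot x x = 1"
    and ne: "(x + cayley_e \<alpha>) $ \<alpha> \<noteq> 0"
  shows "1 + cdot (ratio_coords \<iota> \<alpha> (x + cayley_e \<alpha>)) (ratio_coords \<iota> \<alpha> (x + cayley_e \<alpha>)) = 2 / (x $ \<alpha> + 1)"
proof -
  have \<alpha>: "\<iota> j \<noteq> \<alpha>" for j using \<iota>(2) by auto
  have n: "x $ \<alpha> + 1 \<noteq> 0" using ne by (simp add: cayley_e_nth)
  have "cdot (ratio_coords \<iota> \<alpha> (x + cayley_e \<alpha>)) (ratio_coords \<iota> \<alpha> (x + cayley_e \<alpha>)) =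
      (\<Sum>j\<in>UNIV. x $ \<iota> j * x $ \<iota> j) / ((x $ \<alpha> + 1) * (x $ \<alpha> + 1))"
    by (simp add: cdot_def ratio_coords_def cayley_e_nth \<alpha> sum_divide_distrib)
  also have "(\<Sum>j\<in>UNIV. x $ \<iota> j * x $ \<iota> j) = 1 - x $ \<alpha> * x $ \<alpha>"
    using cdot_split[OF \<iota> x(1)] x(2) by (simp add: algebra_simps)
  also have "1 + (1 - x $ \<alpha> * x $ \<alpha>) / ((x $ \<alpha> + 1) * (x $ \<alpha> + 1)) = 2 / (x $ \<alpha> + 1)"
    using n by (simp add: divide_simps) (simp add: algebra_simps)
  finally show ?thesis .
qed

lemma ratio_coords_stereo_inj:
  assumes \<iota>: "inj \<iota>" "\<alpha> \<notin> range \<iota>" and x: "\<And>i. i \<noteq> \<alpha> \<Longrightarrow> i \<notin> range \<iota> \<Longrightarrow> x $ i = 0" "cdot x x = 1" "(x + cayley_e \<alpha>) $ \<alpha> \<noteq> 0"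
    and y: "\<And>i. i \<noteq> \<alpha> \<Longrightarrow> i \<notin> range \<iota> \<Longrightarrow> y $ i = 0" "cdot y y = 1" "(y + cayley_e \<alpha>) $ \<alpha> \<noteq> 0"
    and eq: "ratio_coords \<iota> \<alpha> (x + cayley_e \<alpha>) = ratio_coords \<iota> \<alpha> (y + cayley_e \<alpha>)"
  shows "x = y"
proof -
  have \<alpha>: "\<iota> j \<noteq> \<alpha>" for j using \<iota>(2) by auto
  have n: "x $ \<alpha> + 1 \<noteq> 0" "y $ \<alpha> + 1 \<noteq> 0" using x(3) y(3) by (simp_all add: cayley_e_nth)
  have "2 / (x $ \<alpha> + 1) = 2 / (y $ \<alpha> + 1)"
    using ratio_coords_stereo_range[OF \<iota> x] ratio_coords_stereo_range[OF \<iota> y] eq by simp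
  then have a: "x $ \<alpha> = y $ \<alpha>" using n by (simp add: frac_eq_eq)
  have "x $ \<iota> j / (x $ \<alpha> + 1) = y $ \<iota> j / (y $ \<alpha> + 1)" for j
    using arg_cong[OF eq, of "\<lambda>v. v $ j"] by (simp add: ratio_coords_def cayley_e_nth \<alpha>)
  then have b: "x $ \<iota> j = y $ \<iota> j" for j using a n by simp
  have "x $ i = y $ i" for i using a b x(1)[of i] y(1)[of i] by (cases "i = \<alpha>"; cases "i \<in> range \<iota>") auto
  then show ?thesis by (simp add: vec_eq_iff)
qed

section \<open>The spinor of an orthogonal matrix\<close>

text \<open>If \<open>h\<close> is a spin lift of \<open>g\<close> and \<open>f\<^sub>i = g e\<^sub>i\<close>, then \<open>v \<mapsto> - f\<^sub>k (f\<^sub>i (f\<^sub>j v))\<close> is conjugate under \<open>h\<close>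
  to a diagonal involution. Three of these involutions have \<open>h e\<^sub>0\<close> as their only common fixed line, so
  the product of the corresponding projections recovers \<open>h e\<^sub>0\<close> up to scale from \<open>g\<close> alone.\<close>

definition spin_step :: "complex^8^8 \<Rightarrow> 8 \<Rightarrow> 8 \<Rightarrow> 8 \<Rightarrow> complex^8 \<Rightarrow> complex^8" where
  "spin_step g i j k v = v + (-1) *s ((g *v cayley_e k) \<bullet>\<^sub>C ((g *v cayley_e i) \<bullet>\<^sub>C ((g *v cayley_e j) \<bullet>\<^sub>C v)))"

definition spinor :: "complex^8^8 \<Rightarrow> complex^8" where
  "spinor g = spin_step g 2 5 7 (spin_step g 1 4 5 (spin_step g 1 2 3 (cayley_e 0)))"

lemma cayley_e_mult_nth:
  "(cayley_e 1 \<bullet>\<^sub>C w) $ 0 = - w $ 1" "(cayley_e 1 \<bullet>\<^sub>C w) $ 1 = w $ 0" "(cayley_e 1 \<bullet>\<^sub>C w) $ 2 = - w $ 3" "(cayley_e 1 \<bullet>\<^sub>C w) $ 3 = w $ 2" "(cayley_e 1 \<bullet>\<^sub>C w) $ 4 = - w $ 5" "(cayley_e 1 \<bullet>\<^sub>C w) $ 5 = w $ 4" "(cayley_e 1 \<bullet>\<^sub>C w) $ 6 = - w $ 7" "(cayley_e 1 \<bullet>\<^sub>C w) $ 7 = w $ 6"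
  "(cayley_e 2 \<bullet>\<^sub>C w) $ 0 = - w $ 2" "(cayley_e 2 \<bullet>\<^sub>C w) $ 1 = w $ 3" "(cayley_e 2 \<bullet>\<^sub>C w) $ 2 = w $ 0" "(cayley_e 2 \<bullet>\<^sub>C w) $ 3 = - w $ 1" "(cayley_e 2 \<bullet>\<^sub>C w) $ 4 = w $ 6" "(cayley_e 2 \<bullet>\<^sub>C w) $ 5 = - w $ 7" "(cayley_e 2 \<bullet>\<^sub>C w) $ 6 = - w $ 4" "(cayley_e 2 \<bullet>\<^sub>C w) $ 7 = w $ 5"
  "(cayley_e 3 \<bullet>\<^sub>C w) $ 0 = - w $ 3" "(cayley_e 3 \<bullet>\<^sub>C w) $ 1 = - w $ 2" "(cayley_e 3 \<bullet>\<^sub>C w) $ 2 = w $ 1" "(cayley_e 3 \<bullet>\<^sub>C w) $ 3 = w $ 0" "(cayley_e 3 \<bullet>\<^sub>C w) $ 4 = - w $ 7" "(cayley_e 3 \<bullet>\<^sub>C w) $ 5 = - w $ 6" "(cayley_e 3 \<bullet>\<^sub>C w) $ 6 = w $ 5" "(cayley_e 3 \<bullet>\<^sub>C w) $ 7 = w $ 4"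
  "(cayley_e 4 \<bullet>\<^sub>C w) $ 0 = - w $ 4" "(cayley_e 4 \<bullet>\<^sub>C w) $ 1 = w $ 5" "(cayley_e 4 \<bullet>\<^sub>C w) $ 2 = - w $ 6" "(cayley_e 4 \<bullet>\<^sub>C w) $ 3 = w $ 7" "(cayley_e 4 \<bullet>\<^sub>C w) $ 4 = w $ 0" "(cayley_e 4 \<bullet>\<^sub>C w) $ 5 = - w $ 1" "(cayley_e 4 \<bullet>\<^sub>C w) $ 6 = w $ 2" "(cayley_e 4 \<bullet>\<^sub>C w) $ 7 = - w $ 3"
  "(cayley_e 5 \<bullet>\<^sub>C w) $ 0 = - w $ 5" "(cayley_e 5 \<bullet>\<^sub>C w) $ 1 = - w $ 4" "(cayley_e 5 \<bullet>\<^sub>C w) $ 2 = w $ 7" "(cayley_e 5 \<bullet>\<^sub>C w) $ 3 = w $ 6" "(cayley_e 5 \<bullet>\<^sub>C w) $ 4 = w $ 1" "(cayley_e 5 \<bullet>\<^sub>C w) $ 5 = w $ 0" "(cayley_e 5 \<bullet>\<^sub>C w) $ 6 = - w $ 3" "(cayley_e 5 \<bullet>\<^sub>C w) $ 7 = - w $ 2"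
  "(cayley_e 6 \<bullet>\<^sub>C w) $ 0 = - w $ 6" "(cayley_e 6 \<bullet>\<^sub>C w) $ 1 = w $ 7" "(cayley_e 6 \<bullet>\<^sub>C w) $ 2 = w $ 4" "(cayley_e 6 \<bullet>\<^sub>C w) $ 3 = - w $ 5" "(cayley_e 6 \<bullet>\<^sub>C w) $ 4 = - w $ 2" "(cayley_e 6 \<bullet>\<^sub>C w) $ 5 = w $ 3" "(cayley_e 6 \<bullet>\<^sub>C w) $ 6 = w $ 0" "(cayley_e 6 \<bullet>\<^sub>C w) $ 7 = - w $ 1"
  "(cayley_e 7 \<bullet>\<^sub>C w) $ 0 = - w $ 7" "(cayley_e 7 \<bullet>\<^sub>C w) $ 1 = - w $ 6" "(cayley_e 7 \<bullet>\<^sub>C w) $ 2 = - w $ 5" "(cayley_e 7 \<bullet>\<^sub>C w) $ 3 = - w $ 4" "(cayley_e 7 \<bullet>\<^sub>C w) $ 4 = w $ 3" "(cayley_e 7 \<bullet>\<^sub>C w) $ 5 = w $ 2" "(cayley_e 7 \<bullet>\<^sub>C w) $ 6 = w $ 1" "(cayley_e 7 \<bullet>\<^sub>C w) $ 7 = w $ 0"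
  by (simp_all add: cayley_mult_nth cayley_e_nth)

lemma spin_step_tri:
  assumes "tri g h"
  shows "spin_step g i j k (h *v y) = h *v spin_step (mat 1) i j k y"
  using assms by (simp add: spin_step_def tri_def matrix_vector_mult_diff_distrib)

text \<open>Each step is twice the projection onto the quaternion algebra spanned by e_0 and one
  line of the multiplication table. The three index sets meet in 0 alone, so the composite is 8
  times the projection to e_0.\<close>

lemma spin_step_one:
  "spin_step (mat 1) 1 2 3 y $ m = (if m \<in> {0, 1, 2, 3} then 2 * y $ m else 0)"
  "spin_step (mat 1) 1 4 5 y $ m = (if m \<in> {0, 1, 4, 5} then 2 * y $ m else 0)"
  "spin_step (mat 1) 2 5 7 y $ m = (if m \<in> {0, 2, 5, 7} then 2 * y $ m else 0)"
proof -
  have "\<forall>m. spin_step (mat 1) 1 2 3 y $ m = (if m \<in> {0, 1, 2, 3} then 2 * y $ m else 0)"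
    "\<forall>m. spin_step (mat 1) 1 4 5 y $ m = (if m \<in> {0, 1, 4, 5} then 2 * y $ m else 0)"
    "\<forall>m. spin_step (mat 1) 2 5 7 y $ m = (if m \<in> {0, 2, 5, 7} then 2 * y $ m else 0)"
    unfolding forall_8 by (simp_all add: spin_step_def cayley_e_mult_nth)
  then show "spin_step (mat 1) 1 2 3 y $ m = (if m \<in> {0, 1, 2, 3} then 2 * y $ m else 0)"
    "spin_step (mat 1) 1 4 5 y $ m = (if m \<in> {0, 1, 4, 5} then 2 * y $ m else 0)"
    "spin_step (mat 1) 2 5 7 y $ m = (if m \<in> {0, 2, 5, 7} then 2 * y $ m else 0)" by blast+
qed

text \<open>Conjugated by h, the composite projects to the line of h e_0; applied to e_0 it yields
  the coefficient (h^T e_0)_0 = (h e_0)_0. The result is quadratic in h and so does not see its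
  sign.\<close>

lemma spinor_eq:
  assumes "tri g h" "h \<in> SO8C"
  shows "spinor g = (8 * (h *v cayley_e 0) $ 0) *s (h *v cayley_e 0)"
proof -
  let ?y = "transpose h *v cayley_e 0"
  have "cayley_e 0 = h *v ?y" using SO8C_D(5)[OF assms(2)] by simp
  then have "spinor g = h *v spin_step (mat 1) 2 5 7 (spin_step (mat 1) 1 4 5 (spin_step (mat 1) 1 2 3 ?y))"
    unfolding spinor_def using spin_step_tri[OF assms(1)] by metis
  also have "spin_step (mat 1) 2 5 7 (spin_step (mat 1) 1 4 5 (spin_step (mat 1) 1 2 3 ?y)) = (8 * ?y $ 0) *s cayley_e 0"
    by (simp add: vec_eq_iff spin_step_one cayley_e_nth del: transpose_matrix_vector)
  also have "?y $ 0 = (h *v cayley_e 0) $ 0"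
    using cdot_transpose[of h "cayley_e 0" "cayley_e 0"] by (simp del: transpose_matrix_vector)
  finally show ?thesis by (simp add: matrix_vec_scale)
qed

lemma holomorphic_spinor: "holomorphic_map_on mat_scale (*s) spinor UNIV"
proof -
  have f: "holomorphic_map_on mat_scale (*s) (\<lambda>g. g *v cayley_e i) UNIV" for i
    by (rule holomorphic_mat_vec[OF holomorphic_id[OF open_UNIV]])
  have s: "holomorphic_map_on mat_scale (*s) (\<lambda>g. spin_step g i j k (v g)) UNIV"
    if "holomorphic_map_on mat_scale (*s) v UNIV" for v i j k
    unfolding spin_step_def
    by (rule holomorphic_vec_add[OF that holomorphic_smult[OF holomorphic_complex_const[OF open_UNIV]
            holomorphic_cayley[OF f holomorphic_cayley[OF f holomorphic_cayley[OF f that]]]]])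
  have "holomorphic_map_on mat_scale (*s) (\<lambda>g. spinor g) UNIV"
    unfolding spinor_def by (rule s[OF s[OF s[OF holomorphic_vec_const[OF open_UNIV]]]])
  then show ?thesis by simp
qed

text \<open>Such an m is right multiplication by u = m e_0, and x (y u) = (x y) u for all x and y
  makes u a scalar. Three pairs of basis vectors suffice to see this entry by entry.\<close>

lemma tri_one_scalar:
  assumes "tri (mat 1) m" shows "m *v cayley_e 0 = (m *v cayley_e 0) $ 0 *s cayley_e 0"
proof -
  define u where "u = m *v cayley_e 0"
  have t: "x \<bullet>\<^sub>C (m *v y) = m *v (x \<bullet>\<^sub>C y)" for x y using assms by (simp add: tri_def)
  have mu: "m *v y = y \<bullet>\<^sub>C u" for y using t[of y "cayley_e 0"] by (simp add: u_def)
  have a: "x \<bullet>\<^sub>C (y \<bullet>\<^sub>C u) = (x \<bullet>\<^sub>C y) \<bullet>\<^sub>C u" for x y using t[of x y] unfolding mu .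
  let ?e = "cayley_e :: 8 \<Rightarrow> complex^8"
  have e: "?e 1 \<bullet>\<^sub>C ?e 2 = ?e 3" "?e 1 \<bullet>\<^sub>C ?e 4 = ?e 5" "?e 2 \<bullet>\<^sub>C ?e 4 = - ?e 6"
    by (simp_all add: vec_eq_iff forall_8 cayley_e_mult_nth cayley_e_nth)
  have n: "(?e 1 \<bullet>\<^sub>C (?e 2 \<bullet>\<^sub>C u)) $ k = (?e 3 \<bullet>\<^sub>C u) $ k" "(?e 1 \<bullet>\<^sub>C (?e 4 \<bullet>\<^sub>C u)) $ k = (?e 5 \<bullet>\<^sub>C u) $ k"
    "(?e 2 \<bullet>\<^sub>C (?e 4 \<bullet>\<^sub>C u)) $ k = - (?e 6 \<bullet>\<^sub>C u) $ k" for k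
    using a[of "?e 1" "?e 2"] a[of "?e 1" "?e 4"] a[of "?e 2" "?e 4"]
    by (simp_all only: e cayley_minus vector_uminus_component)
  have "u $ 4 = 0" "u $ 5 = 0" "u $ 6 = 0" "u $ 7 = 0"
    using n(1)[of 7] n(1)[of 6] n(1)[of 5] n(1)[of 4] by (simp_all add: cayley_e_mult_nth)
  moreover have "u $ 2 = 0" "u $ 3 = 0"
    using n(2)[of 2] n(2)[of 3] n(2)[of 6] n(2)[of 7] by (simp_all add: cayley_e_mult_nth)
  moreover have "u $ 1 = 0"
    using n(3)[of 1] n(3)[of 3] n(3)[of 5] n(3)[of 7] by (simp_all add: cayley_e_mult_nth)
  ultimately have "\<forall>i. u $ i = (u $ 0 *s ?e 0) $ i" unfolding forall_8 by (simp add: cayley_e_nth)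
  then have "u = u $ 0 *s ?e 0" unfolding vec_eq_iff .
  then show ?thesis unfolding u_def .
qed

text \<open>The conjugate of h is another lift of the real matrix g, so p = h e_0 and its conjugate
  differ by a scalar with square 1. The value -1 is impossible, since \<i> p would then be a real
  vector of norm -1.\<close>

lemma real_spinor:
  assumes g: "g \<in> SO7C" "cnj_mat g = g" and h: "tri g h" "h \<in> SO8C"
  shows "cnj_vec (h *v cayley_e 0) = h *v cayley_e 0"
proof -
  let ?p = "h *v cayley_e 0"
  have g8: "g \<in> SO8C" using g by (simp add: SO7C_def)
  have "tri g (cnj_mat h)" using tri_cnj[OF h(1)] g(2) by simp
  from tri_mult[OF tri_transpose_SO8C[OF h(1) g8 h(2)] this]
  have t: "tri (mat 1) (transpose h ** cnj_mat h)" using SO8C_D(2)[OF g8] by simp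
  define c where "c = ((transpose h ** cnj_mat h) *v cayley_e 0) $ 0"
  have "transpose h *v (cnj_mat h *v cayley_e 0) = c *s cayley_e 0"
    using tri_one_scalar[OF t] unfolding c_def matrix_vector_mul_assoc .
  then have "cnj_mat h *v cayley_e 0 = c *s ?p"
    using SO8C_D(5)[OF h(2), of "cnj_mat h *v cayley_e 0"] by (simp add: matrix_vec_scale)
  then have cp: "cnj_vec ?p = c *s ?p" by (simp add: cnj_vec_mult)
  have p1: "cdot ?p ?p = 1" using SO8C_D(4)[OF h(2)] by (simp add: cayley_e_nth)
  have "cdot (cnj_vec ?p) (cnj_vec ?p) = 1" unfolding cdot_cnj_vec p1 by simp
  then have "c * c = 1" unfolding cp using p1 by simp
  then have "c = 1 \<or> c = - 1" by (metis power2_eq_1_iff power2_eq_square)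
  then show ?thesis
  proof
    assume "c = - 1"
    then have "cnj_vec (\<i> *s ?p) = \<i> *s ?p" using cp by (simp add: vec_eq_iff)
    then obtain r where "cdot (\<i> *s ?p) (\<i> *s ?p) = complex_of_real (r\<^sup>2)" by (rule real_cdot_self) blast
    then have "complex_of_real (r\<^sup>2) = - 1" using p1 by simp
    then have "r\<^sup>2 = - 1" by (metis of_real_1 of_real_eq_iff of_real_minus)
    then show ?thesis using zero_le_power2[of r] by simp
  qed (use cp in simp)
qed

section \<open>Connected real orbits\<close>

lemma (in matrix_pair) connectedin_curve:
  assumes "continuous_on UNIV \<kappa>" "\<And>t::real. \<kappa> t \<in> G"
  shows "connectedin X (range (\<lambda>t. \<pi> (\<kappa> t)))"
proof -
  have "continuous_map euclideanreal (top_of_set G) \<kappa>"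
    using assms by (simp add: continuous_map_in_subtopology)
  from continuous_map_compose[OF this continuous_proj]
  have "continuous_map euclideanreal X (\<pi> \<circ> \<kappa>)" .
  from connectedin_continuous_map_image[OF this, of UNIV] show ?thesis by (simp add: o_def image_image)
qed

text \<open>The list may contain e itself, so that m comes out orthogonal to e as well as to
  prescribed directions orthogonal to both x and e.\<close>

lemma real_angle:
  fixes x e :: "complex^8"
  assumes x: "cnj_vec x = x" "cdot x x = 1" and e: "cnj_vec e = e" "cdot e e = 1"
    and xs: "length xs < 8" "\<And>v. v \<in> set xs \<Longrightarrow> cnj_vec v = v"
    "\<And>v. v \<in> set xs \<Longrightarrow> v = e \<or> cdot x v = 0 \<and> cdot e v = 0"
  obtains t m where "x = of_real (cos t) *s e + of_real (sin t) *s m" "cnj_vec m = m" "cdot m m = 1"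
    "\<And>v. v \<in> set xs \<Longrightarrow> cdot m v = 0"
proof -
  define c where "c = cdot x e"
  have cc: "cnj c = c" unfolding c_def using cdot_cnj_vec[of x e] x e by simp
  define u where "u = x - c *s e"
  have u: "cnj_vec u = u" using x e cc by (simp add: u_def)
  have perp: "cdot u v = 0" if "v \<in> set xs" for v
    using xs(3)[OF that] e by (auto simp: u_def c_def)
  obtain r m where m: "r \<ge> 0" "u = of_real r *s m" "cnj_vec m = m" "cdot m m = 1"
    "\<And>v. v \<in> set xs \<Longrightarrow> cdot m v = 0" "cdot u u = of_real (r\<^sup>2)"
    by (rule real_normalize[OF u xs(1,2) perp]) blast+
  obtain a where a: "c = of_real a" using cc by (metis Reals_cnj_iff Reals_cases)
  have "cdot u u = 1 - c * c" using x e by (simp add: u_def c_def cdot_commute[of e x] algebra_simps)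
  then have "complex_of_real (r\<^sup>2) = of_real (1 - a\<^sup>2)" using m(6) a by (simp add: power2_eq_square)
  then have "a\<^sup>2 + r\<^sup>2 = 1" unfolding of_real_eq_iff by simp
  then obtain t where t: "a = cos t" "r = sin t" by (rule sincos_total_2pi)
  have "x = c *s e + u" by (simp add: u_def)
  then have "x = of_real (cos t) *s e + of_real (sin t) *s m" using a m(2) t by simp
  then show thesis using that m by blast
qed

lemma continuous_on_complex_linear:
  fixes f :: "complex^8 \<Rightarrow> complex^8^8" and g :: "real \<Rightarrow> complex^8"
  assumes "continuous_on UNIV g" "\<And>x y. f (x + y) = f x + f y" "\<And>c x. f (c *s x) = mat_scale c (f x)"
  shows "continuous_on UNIV (\<lambda>t. f (g t))"
proof -
  have "linear f" using assms by (intro linearI) (simp_all add: scaleR_eq_smult scaleR_eq_mat_scale)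
  then have "continuous_on UNIV f" by (simp add: linear_continuous_on linear_conv_bounded_linear)
  then show ?thesis by (rule continuous_on_compose2[OF _ assms(1)]) simp
qed

lemma continuous_Lmul: "continuous_on UNIV g \<Longrightarrow> continuous_on (UNIV :: real set) (\<lambda>t. Lmul (g t))"
  by (erule continuous_on_complex_linear) (simp_all add: matrix_eq mat_scale_vec cayley_linear matrix_vector_mult_add_rdistrib)

lemma continuous_Rmul: "continuous_on UNIV g \<Longrightarrow> continuous_on (UNIV :: real set) (\<lambda>t. Rmul (g t))"
  by (erule continuous_on_complex_linear) (simp_all add: matrix_eq mat_scale_vec cayley_linear matrix_vector_mult_add_rdistrib)

lemma continuous_circle: "continuous_on UNIV (\<lambda>t::real. complex_of_real (cos t) *s a + complex_of_real (sin t) *s (b :: complex^8))"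
  unfolding vector_scalar_mult_def by (intro continuous_intros continuous_on_vec_lambda)

text \<open>The point e_0 is moved along a great circle to x. The vector a is orthogonal to the
  plane of the circle, so one a serves in the factorisation by two left multiplications for every
  t.\<close>

lemma spin_curve:
  assumes x: "cnj_vec x = x" "cdot x x = 1"
  obtains \<kappa>0 \<kappa> :: "real \<Rightarrow> complex^8^8" and t1 where "continuous_on UNIV \<kappa>0" "continuous_on UNIV \<kappa>"
    "\<And>t. \<kappa>0 t \<in> SO7C \<and> \<kappa> t \<in> Spin7C \<and> tri (\<kappa>0 t) (\<kappa> t)"
    "\<kappa> 0 *v cayley_e 0 = cayley_e 0" "\<kappa> t1 *v cayley_e 0 = x"
proof -
  let ?e = "cayley_e 0"
  obtain t1 m where m: "x = of_real (cos t1) *s ?e + of_real (sin t1) *s m" "cnj_vec m = m" "cdot m m = 1"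
    "\<And>v. v \<in> set [?e] \<Longrightarrow> cdot m v = 0"
    by (rule real_angle[OF x, of ?e "[?e]"]) (auto simp: cayley_e_nth)
  have m0: "m $ 0 = 0" using m(4)[of ?e] by simp
  have "cnj_vec v = v" if "v \<in> set [?e, m]" for v using that m by auto
  then obtain a where a: "cnj_vec a = a" "cdot a a = 1" "\<And>v. v \<in> set [?e, m] \<Longrightarrow> cdot a v = 0"
    using real_perp_exists[of "[?e, m]"] by auto
  have a0: "a $ 0 = 0" "cdot a m = 0" using a(3)[of ?e] a(3)[of m] by simp_all
  define y where "y = (\<lambda>t. complex_of_real (cos t) *s ?e + complex_of_real (sin t) *s m)"
  have cs: "complex_of_real (cos t) * complex_of_real (cos t) + complex_of_real (sin t) * complex_of_real (sin t) = 1" for t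
    using sin_cos_squared_add3[of t] by (metis of_real_1 of_real_add of_real_mult)
  have y: "cdot (y t) (y t) = 1" "cdot a (y t) = 0" for t
    using cs m m0 a0 by (simp_all add: y_def cayley_e_nth)
  define \<kappa> where "\<kappa> = (\<lambda>t. Lmul a ** Lmul (- (a \<bullet>\<^sub>C y t)))"
  note S = Spin7_factor[OF a0(1) a(2) y]
  have cy: "continuous_on UNIV y" unfolding y_def by (rule continuous_circle)
  have "continuous_on UNIV (\<lambda>t. - (a \<bullet>\<^sub>C y t))"
    by (intro continuous_on_minus continuous_cayley continuous_on_const cy)
  then have c\<kappa>: "continuous_on UNIV \<kappa>"
    unfolding \<kappa>_def by (intro continuous_matrix_mult continuous_on_const continuous_Lmul)
  define \<kappa>0 where "\<kappa>0 = (\<lambda>t. Cmul a ** Cmul (- (a \<bullet>\<^sub>C y t)))"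
  \<comment> \<open>Continuity of the companion is read off its explicit formula in terms of the
    lift.\<close>
  have "\<kappa>0 t = Rmul (oconj (y t)) ** \<kappa> t" for t
    using tri_companion[OF S(4)[of t]] S(1,2)[of t] Spin7C_iff unfolding \<kappa>0_def \<kappa>_def by metis
  moreover have "continuous_on UNIV (\<lambda>t. oconj (y t))"
    unfolding oconj_def vector_scalar_mult_def by (intro continuous_intros continuous_on_vec_lambda cy)
  ultimately have "continuous_on UNIV \<kappa>0"
    using c\<kappa> by (simp add: fun_eq_iff[symmetric]) (intro continuous_matrix_mult continuous_Rmul, simp_all)
  moreover have "\<kappa>0 t \<in> SO7C \<and> \<kappa> t \<in> Spin7C \<and> tri (\<kappa>0 t) (\<kappa> t)" for t
    using S[of t] unfolding \<kappa>0_def \<kappa>_def by blast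
  moreover have "\<kappa> 0 *v ?e = ?e" "\<kappa> t1 *v ?e = x"
    using S(2)[of 0] S(2)[of t1] m(1) by (simp_all add: \<kappa>_def y_def)
  ultimately show thesis using that c\<kappa> by blast
qed

text \<open>With a t on the circle through e_1 and m, the automorphism \<open>Imul (a t) b\<close>
  sends e_1 to its mirror image 2 cos t a(t) - e_1 in the line of a t. This turns e_1 by twice the
  angle, so x is reached at t1 / 2. Orthogonality of b to m e_1 is used to make (a t) b orthogonal
  to e_1.\<close>

lemma G2C_curve:
  assumes x: "cnj_vec x = x" "cdot x x = 1" "x $ 0 = 0"
  obtains \<kappa> :: "real \<Rightarrow> complex^8^8" and t1 where "continuous_on UNIV \<kappa>" "\<And>t. \<kappa> t \<in> G2C"
    "\<kappa> 0 *v cayley_e 1 = cayley_e 1" "\<kappa> t1 *v cayley_e 1 = x"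
proof -
  let ?e = "cayley_e 1" and ?o = "cayley_e 0"
  obtain t1 m where m: "x = of_real (cos t1) *s ?e + of_real (sin t1) *s m" "cnj_vec m = m" "cdot m m = 1"
    "\<And>v. v \<in> set [?o, ?e] \<Longrightarrow> cdot m v = 0"
    by (rule real_angle[OF x(1,2), of ?e "[?o, ?e]"]) (auto simp: cayley_e_nth x)
  have m0: "m $ 0 = 0" "cdot m ?e = 0" using m(4)[of ?o] m(4)[of ?e] by simp_all
  have "cnj_vec v = v" if "v \<in> set [?o, ?e, m, m \<bullet>\<^sub>C ?e]" for v using that m by (auto simp: cnj_vec_cayley)
  then obtain b where b: "cnj_vec b = b" "cdot b b = 1" "\<And>v. v \<in> set [?o, ?e, m, m \<bullet>\<^sub>C ?e] \<Longrightarrow> cdot b v = 0"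
    using real_perp_exists[of "[?o, ?e, m, m \<bullet>\<^sub>C ?e]"] by auto
  have b0: "b $ 0 = 0" "cdot b ?e = 0" "cdot b m = 0" "cdot b (m \<bullet>\<^sub>C ?e) = 0"
    using b(3)[of ?o] b(3)[of ?e] b(3)[of m] b(3)[of "m \<bullet>\<^sub>C ?e"] by simp_all
  define a where "a = (\<lambda>t. complex_of_real (cos t) *s ?e + complex_of_real (sin t) *s m)"
  have cs: "complex_of_real (cos t) * complex_of_real (cos t) + complex_of_real (sin t) * complex_of_real (sin t) = 1" for t
    using sin_cos_squared_add3[of t] by (metis of_real_1 of_real_add of_real_mult)
  have m1: "m $ 1 = 0" "b $ 1 = 0" using m0 b0 by simp_all
  have mb: "cdot m b = 0" using b0(3) by (simp only: cdot_commute[of m b])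
  have a0: "a t $ 0 = 0" "cdot (a t) (a t) = 1" "cdot (a t) b = 0" for t
    using cs m m0 m1 b0 mb by (simp_all add: a_def cayley_e_nth)
  have ee: "?e \<bullet>\<^sub>C ?e = - ?o" using imag_square[of ?e ?o] by (simp add: cayley_e_nth)
  have abe: "cdot (a t \<bullet>\<^sub>C b) ?e = 0" for t
  proof -
    have "cdot (a t \<bullet>\<^sub>C b) ?e = - cdot b (a t \<bullet>\<^sub>C ?e)"
      unfolding cdot_cayley_adjoint_left by (simp add: oconj_imag[OF a0(1)] cayley_linear)
    also have "a t \<bullet>\<^sub>C ?e = complex_of_real (cos t) *s (- ?o) + complex_of_real (sin t) *s (m \<bullet>\<^sub>C ?e)"
      by (simp add: a_def cayley_linear ee)
    finally show ?thesis using b0 by simp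
  qed
  have nz: "cdot (a t) (a t) \<noteq> 0" "cdot b b \<noteq> 0" for t using a0 b by simp_all
  note G = Imul_G2C[OF a0(1) b0(1) nz a0(3)]
  have ab1: "cdot (a t \<bullet>\<^sub>C b) (a t \<bullet>\<^sub>C b) = 1" for t by (simp add: cdot_cayley_norm a0 b)
  define \<kappa> where "\<kappa> = (\<lambda>t. Imul (a t) b)"
  have "\<kappa> t = mat_scale (- 1) (Lmul (a t \<bullet>\<^sub>C b) ** (Lmul (a t) ** Lmul b))" for t
    by (simp add: \<kappa>_def Imul_def ab1)
  then have \<kappa>: "\<kappa> = (\<lambda>t. Lmul (- (a t \<bullet>\<^sub>C b)) ** (Lmul (a t) ** Lmul b))"
    by (simp add: fun_eq_iff matrix_eq mat_scale_vec matrix_vector_mul_assoc[symmetric] cayley_linear)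
  have ca: "continuous_on UNIV a" unfolding a_def by (rule continuous_circle)
  have "continuous_on UNIV \<kappa>" unfolding \<kappa>
    by (intro continuous_matrix_mult continuous_Lmul continuous_on_minus continuous_cayley continuous_on_const ca)
  moreover have "\<kappa> t \<in> G2C" for t unfolding \<kappa>_def by (rule G(1))
  moreover have act: "\<kappa> t *v ?e = (2 * of_real (cos t)) *s a t - ?e" for t
  proof -
    have "Cmul b *v ?e = - ?e" using b0 by (simp add: Cmul_vec oconj_imag cayley_e_nth)
    moreover have ae: "cdot (a t) ?e = of_real (cos t)" by (simp add: a_def cayley_e_nth m1)
    then have "Cmul (a t) *v ?e = (2 * of_real (cos t)) *s a t - ?e"
      unfolding Cmul_vec a0(2) by (simp add: oconj_imag cayley_e_nth)
    then have "Cmul (a t) *v (- ?e) = ?e - (2 * of_real (cos t)) *s a t" by (simp add: matrix_vec_minus)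
    moreover have "Cmul (a t \<bullet>\<^sub>C b) *v (?e - (2 * of_real (cos t)) *s a t) = (2 * of_real (cos t)) *s a t - ?e"
    proof -
      have "cdot (a t \<bullet>\<^sub>C b) (a t) = 0"
        using cdot_cayley_left[of "a t" b ?o] b0(1) by simp
      then have "cdot (a t \<bullet>\<^sub>C b) (?e - (2 * of_real (cos t)) *s a t) = 0"
        unfolding cdot_diff cdot_scale abe by simp
      moreover have "oconj (?e - (2 * of_real (cos t)) *s a t) = - (?e - (2 * of_real (cos t)) *s a t)"
        by (rule oconj_imag) (simp add: a0 cayley_e_nth)
      ultimately show ?thesis unfolding Cmul_vec by simp
    qed
    ultimately show ?thesis unfolding \<kappa>_def G(2) by (simp add: matrix_vector_mul_assoc[symmetric])
  qed
  have "\<kappa> 0 *v ?e = ?e" unfolding act by (simp add: a_def vec_eq_iff)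
  moreover have "\<kappa> (t1 / 2) *v ?e = x"
  proof -
    let ?c = "complex_of_real (cos (t1 / 2))" and ?s = "complex_of_real (sin (t1 / 2))"
    have C1: "complex_of_real (cos t1) = 2 * ?c * ?c - 1"
    proof -
      have "cos t1 = 2 * cos (t1 / 2) * cos (t1 / 2) - 1"
        using cos_double_cos[of "t1 / 2"] by (simp add: power2_eq_square)
      then have "complex_of_real (cos t1) = complex_of_real (2 * cos (t1 / 2) * cos (t1 / 2) - 1)" by (simp only:)
      then show ?thesis by (simp only: of_real_mult of_real_diff of_real_numeral of_real_1)
    qed
    have S1: "complex_of_real (sin t1) = 2 * ?c * ?s"
      using sin_double[of "t1 / 2"] by simp
    show ?thesis
      unfolding act m(1) C1 S1 by (simp add: a_def vec_eq_iff algebra_simps)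
  qed
  ultimately show thesis using that by blast
qed

section \<open>The three pairs\<close>

definition sign_diag :: "8 set \<Rightarrow> 8 \<Rightarrow> complex" where
  "sign_diag T i = (if i \<in> T then -1 else 1)"

lemma prod_8: "(\<Prod>i\<in>UNIV. f (i :: 8)) = f 0 * f 1 * f 2 * f 3 * f 4 * f 5 * f 6 * f 7"
  unfolding UNIV_8 by (simp add: mult.assoc)

text \<open>The complements {0, 2, 4, 6} and {0, 1, 4, 5} index quaternion subalgebras, and changing
  the sign off such a subalgebra is an automorphism. The first set belongs to the slice in e_0 and
  e_1, the second to the slice in e_1 and e_2.\<close>

lemma sign_diag_G2C:
  assumes "T = {1, 3, 5, 7} \<or> T = {2, 3, 6, 7}"
  shows "diag_mat (sign_diag T) \<in> G2C"
proof -
  let ?A = "diag_mat (sign_diag T)"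
  have s: "sign_diag T i * sign_diag T i = 1" for i by (simp add: sign_diag_def)
  have "cdot (?A *v x) (?A *v y) = cdot x y" for x y
  proof -
    have "sign_diag T i * x $ i * (sign_diag T i * y $ i) = x $ i * y $ i" for i
      by (simp add: sign_diag_def)
    then show ?thesis by (simp only: cdot_def diag_mat_vec)
  qed
  moreover have "det ?A = 1"
  proof -
    have "det ?A = (\<Prod>i\<in>UNIV. ?A $ i $ i)" by (rule det_diagonal) (simp add: diag_mat_def)
    also have "\<dots> = 1"
      using assms by (elim disjE) (simp_all add: prod_8 diag_mat_def sign_diag_def)
    finally show ?thesis .
  qed
  moreover have "tri ?A ?A"
    unfolding tri_def
  proof (intro allI)
    fix x y
    have "\<forall>k. ((?A *v x) \<bullet>\<^sub>C (?A *v y)) $ k = (?A *v (x \<bullet>\<^sub>C y)) $ k"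
      using assms unfolding forall_8 diag_mat_vec cayley_mult_nth
      by (elim disjE) (simp_all add: sign_diag_def algebra_simps)
    then show "(?A *v x) \<bullet>\<^sub>C (?A *v y) = ?A *v (x \<bullet>\<^sub>C y)" by (simp add: vec_eq_iff)
  qed
  ultimately show ?thesis using orthogonal_iff_cdot[of ?A] by (simp add: G2C_iff SO8C_def)
qed

lemma diag_mat_cayley_e: "diag_mat s *v cayley_e i = s i *s cayley_e i"
  by (simp add: vec_eq_iff diag_mat_vec cayley_e_nth)

lemma matrix_pair_Spin7C: "matrix_pair Spin7C G2C"
proof
  show "transpose a ** a = mat 1" if "a \<in> Spin7C" for a using that Spin7C_iff SO8C_D(2) by blast
qed (use Spin7C_group G2C_group G2C_sub_Spin7C closed_G2C in auto)

lemma matrix_pair_SO7C: "matrix_pair SO7C G2C"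
proof
  show "transpose a ** a = mat 1" if "a \<in> SO7C" for a using that SO8C_D(2) unfolding SO7C_def by blast
qed (use SO7C_one SO7C_mult SO7C_transpose G2C_group G2C_sub_SO7C closed_G2C in auto)

lemma matrix_pair_G2C: "matrix_pair G2C SL3C"
proof
  show "transpose a ** a = mat 1" if "a \<in> G2C" for a using that G2C_iff SO8C_D(2) by blast
qed (use G2C_group SL3C_group closed_SL3C in \<open>auto simp: SL3C_def\<close>)

lemma sinh_cosh_bounds:
  fixes t :: real
  shows "cosh t \<noteq> 0" "1 + cosh t \<noteq> 0" "\<bar>sinh t / (cosh t + 1)\<bar> < 1" "\<bar>sinh t / cosh t\<bar> < 1"
proof -
  have c: "cosh t \<ge> 1" by (rule cosh_real_ge_1)
  then show "cosh t \<noteq> 0" "1 + cosh t \<noteq> 0" by linarith+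
  have "(sinh t)\<^sup>2 < (cosh t)\<^sup>2" using cosh_square_eq[of t] by simp
  then have "\<bar>sinh t\<bar> < cosh t" using c by (metis abs_le_square_iff abs_of_nonneg not_le order_trans zero_le_one)
  then show "\<bar>sinh t / (cosh t + 1)\<bar> < 1" "\<bar>sinh t / cosh t\<bar> < 1"
    using c by (simp_all add: abs_divide divide_less_eq)
qed

text \<open>The coordinates of \<open>gH\<close> are the stereographic coordinates of the point \<open>g e\<^sub>\<alpha>\<close> of the complex
  sphere, with pole \<open>- e\<^sub>\<alpha>\<close>.\<close>

lemma slice_data_sphere:
  fixes G H :: "(complex^8^8) set" and \<iota> :: "'n::finite \<Rightarrow> 8"
  assumes pair: "matrix_pair G H" and G8: "G \<subseteq> SO8C"
    and cnj: "\<And>g. g \<in> G \<Longrightarrow> cnj_mat g \<in> G" "\<And>g. g \<in> H \<Longrightarrow> cnj_mat g \<in> H"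
    and \<iota>: "inj \<iota>" "\<alpha> \<notin> range \<iota>" "\<iota> j = \<beta>" and H: "\<And>g. g \<in> G \<Longrightarrow> g \<in> H \<longleftrightarrow> g *v cayley_e \<alpha> = cayley_e \<alpha>"
    and zero: "\<And>g i. g \<in> G \<Longrightarrow> i \<noteq> \<alpha> \<Longrightarrow> i \<notin> range \<iota> \<Longrightarrow> (g *v cayley_e \<alpha>) $ i = 0"
    and sec: "\<And>q. cdot q q = 1 \<Longrightarrow> (\<And>i. i \<noteq> \<alpha> \<Longrightarrow> i \<notin> range \<iota> \<Longrightarrow> q $ i = 0) \<Longrightarrow>
      \<exists>V S. q \<in> V \<and> holomorphic_map_on (*s) mat_scale S V \<and>
        (\<forall>x\<in>V. cdot x x = 1 \<longrightarrow> (\<forall>i. i \<noteq> \<alpha> \<longrightarrow> i \<notin> range \<iota> \<longrightarrow> x $ i = 0) \<longrightarrow> S x \<in> G \<and> S x *v cayley_e \<alpha> = x)"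
    and meets: "\<And>g. g \<in> G \<Longrightarrow> \<exists>k\<in>G. cnj_mat k = k \<and> (\<exists>t. k *v (g *v cayley_e \<alpha>) = slice_vec \<alpha> \<beta> t)"
    and T: "T = {1, 3, 5, 7} \<or> T = {2, 3, 6, 7}" "diag_mat (sign_diag T) \<in> H" "\<alpha> \<notin> T" "\<beta> \<in> T"
    and conn: "\<And>k. k \<in> G \<Longrightarrow> cnj_mat k = k \<Longrightarrow> \<exists>\<kappa> t1. continuous_on UNIV \<kappa> \<and> (\<forall>t::real. \<kappa> t \<in> G) \<and>
        \<kappa> 0 *v cayley_e \<alpha> = cayley_e \<alpha> \<and> \<kappa> t1 *v cayley_e \<alpha> = k *v cayley_e \<alpha>"
  obtains U\<^sub>0 and \<phi>\<^sub>0 :: "(complex^8^8) set \<Rightarrow> complex^'n" and S\<^sub>0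
    where "slice_data G H U\<^sub>0 \<phi>\<^sub>0 S\<^sub>0 j (diag_mat (sign_diag T))"
proof -
  interpret matrix_pair G H by (rule pair)
  let ?e = "cayley_e \<alpha>"
  define W where "W = (\<lambda>g :: complex^8^8. g *v ?e + ?e)"
  have norm1: "cdot (g *v ?e) (g *v ?e) = 1" if "g \<in> G" for g
    using SO8C_D(4) G8 that by (metis cdot_cayley_e(1) cayley_e_nth subsetD)
  have same: "transpose a ** b \<in> H" if "a \<in> G" "b \<in> G" "a *v ?e = b *v ?e" for a b
    using that H[of "transpose a ** b"] mult_G transpose_G SO8C_D(6)[of a ?e] G8
    by (auto simp: matrix_vector_mul_assoc[symmetric] simp del: transpose_matrix_vector)
  have cmp: "coset_proj H a = coset_proj H b" if "a \<in> G" "b \<in> G" "a *v ?e = b *v ?e" for a b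
    using same[OF that] proj_eq_iff that by blast
  have rc: "cdot z z = (\<Sum>j\<in>UNIV. z $ j * z $ j)" for z :: "complex^'n" by (simp add: cdot_def)
  show thesis
  proof (rule slice_data_from_vector[OF pair, where W = W and \<iota> = \<iota> and \<alpha> = \<alpha> and s = "sign_diag T" and j = j])
    have "holomorphic_map_on mat_scale (*s) (\<lambda>g. W g) UNIV"
      unfolding W_def
      by (rule holomorphic_vec_add[OF holomorphic_mat_vec[OF holomorphic_id[OF open_UNIV]] holomorphic_vec_const[OF open_UNIV]])
    then show "holomorphic_map_on mat_scale (*s) W UNIV" by simp
    show "W (g ** h) = W g" if "g \<in> G" "h \<in> H" for g h
      using that H[of h] H_sub by (auto simp: W_def matrix_vector_mul_assoc[symmetric])
    show "transpose a ** b \<in> H"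
      if "a \<in> G" "b \<in> G" "W a $ \<alpha> \<noteq> 0" "W b $ \<alpha> \<noteq> 0" "ratio_coords \<iota> \<alpha> (W a) = ratio_coords \<iota> \<alpha> (W b)" for a b
    proof (rule same[OF that(1,2)])
      show "a *v ?e = b *v ?e"
        using that unfolding W_def
        by (intro ratio_coords_stereo_inj[OF \<iota>(1,2)]) (simp_all add: zero norm1)
    qed
    show "1 + (\<Sum>j\<in>UNIV. ratio_coords \<iota> \<alpha> (W g) $ j * ratio_coords \<iota> \<alpha> (W g) $ j) \<noteq> 0"
      if "g \<in> G" "W g $ \<alpha> \<noteq> 0" for g
    proof -
      have "1 + cdot (ratio_coords \<iota> \<alpha> (W g)) (ratio_coords \<iota> \<alpha> (W g)) = 2 / ((g *v ?e) $ \<alpha> + 1)"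
        using that unfolding W_def
        by (intro ratio_coords_stereo_range[OF \<iota>(1,2)]) (simp_all add: zero norm1)
      moreover have "(g *v ?e) $ \<alpha> + 1 \<noteq> 0" using that(2) by (simp add: W_def cayley_e_nth)
      ultimately show ?thesis unfolding rc[symmetric] by simp
    qed
    show "\<exists>V \<sigma>. z \<in> V \<and> holomorphic_map_on (*s) mat_scale \<sigma> V \<and>
        (\<forall>w\<in>V. \<sigma> w \<in> G \<and> W (\<sigma> w) $ \<alpha> \<noteq> 0 \<and> ratio_coords \<iota> \<alpha> (W (\<sigma> w)) = w)"
      if "1 + (\<Sum>j\<in>UNIV. z $ j * z $ j) \<noteq> 0" for z :: "complex^'n"
    proof -
      have z: "1 + cdot z z \<noteq> 0" using that unfolding rc .
      obtain V S where V: "stereo \<alpha> \<iota> z \<in> V" "holomorphic_map_on (*s) mat_scale S V"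
        "\<And>x. x \<in> V \<Longrightarrow> cdot x x = 1 \<Longrightarrow> (\<And>i. i \<noteq> \<alpha> \<Longrightarrow> i \<notin> range \<iota> \<Longrightarrow> x $ i = 0) \<Longrightarrow> S x \<in> G \<and> S x *v ?e = x"
        using sec[OF stereo(1)[OF \<iota>(1,2) z] stereo(4)[OF \<iota>(1,2) z]] by blast
      let ?V = "{z. 1 + cdot z z \<noteq> 0} \<inter> stereo \<alpha> \<iota> -` V"
      have oV: "open ?V" by (rule holomorphic_map_on_open_vimage[OF holomorphic_stereo holomorphic_map_onD(2)[OF V(2)]])
      have h: "holomorphic_map_on (*s) (*s) (stereo \<alpha> \<iota>) ?V"
        by (rule holomorphic_map_on_subset[OF holomorphic_stereo oV]) simp
      have "holomorphic_map_on (*s) mat_scale (S \<circ> stereo \<alpha> \<iota>) ?V"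
        by (rule holomorphic_map_on_compose[OF h V(2)]) auto
      moreover have "(S \<circ> stereo \<alpha> \<iota>) w \<in> G \<and> W ((S \<circ> stereo \<alpha> \<iota>) w) $ \<alpha> \<noteq> 0 \<and> ratio_coords \<iota> \<alpha> (W ((S \<circ> stereo \<alpha> \<iota>) w)) = w"
        if "w \<in> ?V" for w
      proof -
        have w: "1 + cdot w w \<noteq> 0" "stereo \<alpha> \<iota> w \<in> V" using that by auto
        note st = stereo[OF \<iota>(1,2) w(1)]
        have "S (stereo \<alpha> \<iota> w) \<in> G \<and> S (stereo \<alpha> \<iota> w) *v ?e = stereo \<alpha> \<iota> w"
          by (rule V(3)[OF w(2) st(1,4)])
        then show ?thesis using st(2,3) by (simp add: W_def)
      qed
      moreover have "z \<in> ?V" using z V(1) by simp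
      ultimately show ?thesis
        by (intro exI[of _ ?V] exI[of _ "S \<circ> stereo \<alpha> \<iota>"] conjI ballI) simp_all
    qed
    show "\<exists>k\<in>G. cnj_mat k = k \<and> W (k ** g) $ \<alpha> \<noteq> 0 \<and> (\<exists>r. \<bar>r\<bar> < 1 \<and> ratio_coords \<iota> \<alpha> (W (k ** g)) = r *\<^sub>R axis j \<i>)"
      if g: "g \<in> G" for g
    proof -
      obtain k t where k: "k \<in> G" "cnj_mat k = k" "k *v (g *v ?e) = slice_vec \<alpha> \<beta> t" using meets[OF g] by blast
      have ab: "\<alpha> \<noteq> \<beta>" using \<iota> by auto
      \<comment> \<open>In stereographic coordinates the slice parameter becomes sinh t / (cosh t +
        1) = tanh (t / 2), so the curve stays inside the unit ball.\<close>
      have W: "W (k ** g) = of_real 1 *s slice_vec \<alpha> \<beta> t + of_real 1 *s ?e"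
        unfolding W_def matrix_vector_mul_assoc[symmetric] k(3) by simp
      have "1 * cosh t + 1 \<noteq> 0" using sinh_cosh_bounds(2)[of t] by simp
      from ratio_coords_slice_vec[OF \<iota> this] have "ratio_coords \<iota> \<alpha> (W (k ** g)) = (sinh t / (cosh t + 1)) *\<^sub>R axis j \<i>"
        unfolding W by simp
      moreover have "W (k ** g) $ \<alpha> = of_real (1 + cosh t)"
        unfolding W using ab by (simp add: slice_vec_def cayley_e_nth)
      then have "W (k ** g) $ \<alpha> \<noteq> 0" using sinh_cosh_bounds(2)[of t] by (metis of_real_eq_0_iff)
      ultimately show ?thesis using k sinh_cosh_bounds(3)[of t] by blast
    qed
    show "diag_mat (sign_diag T) \<in> H" by (rule T(2))
    show "sign_diag T i = 1 \<or> sign_diag T i = -1" for i by (simp add: sign_diag_def)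
    show s: "sign_diag T \<alpha> = 1" "sign_diag T (\<iota> j) = -1" using T \<iota>(3) by (simp_all add: sign_diag_def)
    show "W (diag_mat (sign_diag T) ** cnj_mat g) = diag_mat (sign_diag T) *v cnj_vec (W g)" for g
      by (simp add: W_def matrix_vector_mul_assoc[symmetric] matrix_vector_right_distrib cnj_vec_mult diag_mat_cayley_e s)
    show "W (mat 1) $ \<alpha> \<noteq> 0" by (simp add: W_def cayley_e_nth)
    have "\<iota> i \<noteq> \<alpha>" for i using \<iota>(2) by auto
    then show "ratio_coords \<iota> \<alpha> (W (mat 1)) = 0" by (simp add: W_def ratio_coords_def vec_eq_iff cayley_e_nth)
    show "\<exists>C. connectedin (coset_space G H) C \<and> coset_proj H (mat 1) \<in> C \<and> coset_proj H k \<in> C"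
      if k: "k \<in> G" "cnj_mat k = k" for k
    proof -
      obtain \<kappa> t1 where \<kappa>: "continuous_on UNIV \<kappa>" "\<And>t::real. \<kappa> t \<in> G" "\<kappa> 0 *v ?e = ?e" "\<kappa> t1 *v ?e = k *v ?e"
        using conn[OF k] by blast
      have "coset_proj H (mat 1) = coset_proj H (\<kappa> 0)" "coset_proj H k = coset_proj H (\<kappa> t1)"
        using cmp[OF one_G \<kappa>(2)[of 0]] cmp[OF k(1) \<kappa>(2)[of t1]] \<kappa>(3,4) by simp_all
      then show ?thesis using connectedin_curve[OF \<kappa>(1,2)] by blast
    qed
  qed (use cnj that in blast)+
qed

lemma slice_data_Spin7C:
  fixes \<iota> :: "'n::finite \<Rightarrow> 8"
  assumes \<iota>: "inj \<iota>" "range \<iota> = - {0}" "\<iota> j = 1"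
  obtains U\<^sub>0 and \<phi>\<^sub>0 :: "(complex^8^8) set \<Rightarrow> complex^'n" and S\<^sub>0 A
    where "slice_data Spin7C G2C U\<^sub>0 \<phi>\<^sub>0 S\<^sub>0 j A"
proof (rule slice_data_sphere[OF matrix_pair_Spin7C, where \<iota> = \<iota> and \<alpha> = 0 and \<beta> = 1 and j = j and T = "{1, 3, 5, 7}"])
  show "Spin7C \<subseteq> SO8C" using Spin7C_iff by blast
  show "g \<in> G2C \<longleftrightarrow> g *v cayley_e 0 = cayley_e 0" if "g \<in> Spin7C" for g
    using that G2C_one_fixed tri_fixed_one(2) Spin7C_iff by blast
  show "(g *v cayley_e 0) $ i = 0" if "i \<noteq> 0" "i \<notin> range \<iota>" for g :: "complex^8^8" and i
    using that \<iota>(2) by auto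
  show "\<exists>V S. q \<in> V \<and> holomorphic_map_on (*s) mat_scale S V \<and>
      (\<forall>x\<in>V. cdot x x = 1 \<longrightarrow> (\<forall>i. i \<noteq> 0 \<longrightarrow> i \<notin> range \<iota> \<longrightarrow> x $ i = 0) \<longrightarrow> S x \<in> Spin7C \<and> S x *v cayley_e 0 = x)"
    if "cdot q q = 1" for q
  proof -
    have "cdot q q \<noteq> 0" using that by simp
    then obtain V S0 S where V: "q \<in> V" "holomorphic_map_on (*s) mat_scale S V"
      "\<And>x. x \<in> V \<Longrightarrow> cdot x x \<noteq> 0 \<and> S0 x \<in> SO7C \<and> tri (S0 x) (S x) \<and> S x *v cayley_e 0 = x"
      "\<And>x c. x \<in> V \<Longrightarrow> c * c * cdot x x = 1 \<Longrightarrow> mat_scale c (S x) \<in> SO8C"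
      by (rule spin_section) blast+
    \<comment> \<open>On the unit sphere the scale 1 is admissible, so the lift S is orthogonal as
      it stands.\<close>
    have "S x \<in> Spin7C" if "x \<in> V" "cdot x x = 1" for x
    proof -
      have "mat_scale 1 (S x) \<in> SO8C" using V(4)[OF that(1), of 1] that(2) by simp
      moreover have "mat_scale 1 (S x) = S x" by (simp add: vec_eq_iff)
      ultimately show ?thesis using V(3)[OF that(1)] Spin7CI by metis
    qed
    then show ?thesis using V(1,2,3) by (intro exI[of _ V] exI[of _ S] conjI ballI impI) simp_all
  qed
  show "\<exists>k\<in>Spin7C. cnj_mat k = k \<and> (\<exists>t. k *v (g *v cayley_e 0) = slice_vec 0 1 t)" if "g \<in> Spin7C" for g
  proof -
    have "cdot (g *v cayley_e 0) (g *v cayley_e 0) = 1"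
      using that SO8C_D(4)[of g] by (simp add: Spin7C_iff cayley_e_nth)
    from Spin7C_meets_slice[OF this] show ?thesis by metis
  qed
  show "\<exists>\<kappa> t1. continuous_on UNIV \<kappa> \<and> (\<forall>t::real. \<kappa> t \<in> Spin7C) \<and>
        \<kappa> 0 *v cayley_e 0 = cayley_e 0 \<and> \<kappa> t1 *v cayley_e 0 = k *v cayley_e 0" if k: "k \<in> Spin7C" "cnj_mat k = k" for k
  proof -
    have x: "cnj_vec (k *v cayley_e 0) = k *v cayley_e 0" "cdot (k *v cayley_e 0) (k *v cayley_e 0) = 1"
      using k SO8C_D(4)[of k] by (simp_all add: Spin7C_iff cayley_e_nth cnj_vec_mult)
    obtain \<kappa>0 and \<kappa> :: "real \<Rightarrow> complex^8^8" and t1 where "continuous_on UNIV \<kappa>" "\<And>t. \<kappa>0 t \<in> SO7C \<and> \<kappa> t \<in> Spin7C \<and> tri (\<kappa>0 t) (\<kappa> t)"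
      "\<kappa> 0 *v cayley_e 0 = cayley_e 0" "\<kappa> t1 *v cayley_e 0 = k *v cayley_e 0"
      by (rule spin_curve[OF x]) blast
    then show ?thesis by blast
  qed
qed (use \<iota> Spin7C_group G2C_group sign_diag_G2C that in auto)

lemma slice_data_G2C:
  fixes \<iota> :: "'n::finite \<Rightarrow> 8"
  assumes \<iota>: "inj \<iota>" "range \<iota> = - {0, 1}" "\<iota> j = 2"
  obtains U\<^sub>0 and \<phi>\<^sub>0 :: "(complex^8^8) set \<Rightarrow> complex^'n" and S\<^sub>0 A
    where "slice_data G2C SL3C U\<^sub>0 \<phi>\<^sub>0 S\<^sub>0 j A"
proof (rule slice_data_sphere[OF matrix_pair_G2C, where \<iota> = \<iota> and \<alpha> = 1 and \<beta> = 2 and j = j and T = "{2, 3, 6, 7}"])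
  show "G2C \<subseteq> SO8C" using G2C_iff by blast
  show "g \<in> SL3C \<longleftrightarrow> g *v cayley_e 1 = cayley_e 1" if "g \<in> G2C" for g
    using that by (simp add: SL3C_def)
  have imag: "(g *v cayley_e 1) $ 0 = 0" if "g \<in> G2C" for g
    using SO8C_D(4)[of g "cayley_e 1" "cayley_e 0"] that G2C_one_fixed[OF that] by (simp add: G2C_iff cayley_e_nth)
  show "(g *v cayley_e 1) $ i = 0" if "g \<in> G2C" "i \<noteq> 1" "i \<notin> range \<iota>" for g i
    using that \<iota>(2) imag by auto
  show "\<exists>V S. q \<in> V \<and> holomorphic_map_on (*s) mat_scale S V \<and>
      (\<forall>x\<in>V. cdot x x = 1 \<longrightarrow> (\<forall>i. i \<noteq> 1 \<longrightarrow> i \<notin> range \<iota> \<longrightarrow> x $ i = 0) \<longrightarrow> S x \<in> G2C \<and> S x *v cayley_e 1 = x)"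
    if q: "cdot q q = 1" "\<And>i. i \<noteq> 1 \<Longrightarrow> i \<notin> range \<iota> \<Longrightarrow> q $ i = 0" for q
  proof -
    have "q $ 0 = 0" using q(2)[of 0] \<iota>(2) by simp
    then obtain V S where V: "q \<in> V" "holomorphic_map_on (*s) mat_scale S V"
      "\<And>x. x \<in> V \<Longrightarrow> x $ 0 = 0 \<Longrightarrow> cdot x x = 1 \<Longrightarrow> S x \<in> G2C \<and> S x *v cayley_e 1 = x"
      by (rule G2C_section[OF _ q(1)]) blast+
    moreover have "x $ 0 = 0" if "\<forall>i. i \<noteq> 1 \<longrightarrow> i \<notin> range \<iota> \<longrightarrow> x $ i = 0" for x :: "complex^8"
      using that[rule_format, of 0] \<iota>(2) by simp
    ultimately show ?thesis by blast
  qed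
  show "\<exists>k\<in>G2C. cnj_mat k = k \<and> (\<exists>t. k *v (g *v cayley_e 1) = slice_vec 1 2 t)" if "g \<in> G2C" for g
  proof -
    have "cdot (g *v cayley_e 1) (g *v cayley_e 1) = 1"
      using that SO8C_D(4)[of g] by (simp add: G2C_iff cayley_e_nth)
    from G2C_meets_slice[OF this imag[OF that]] show ?thesis by metis
  qed
  show "\<exists>\<kappa> t1. continuous_on UNIV \<kappa> \<and> (\<forall>t::real. \<kappa> t \<in> G2C) \<and>
        \<kappa> 0 *v cayley_e 1 = cayley_e 1 \<and> \<kappa> t1 *v cayley_e 1 = k *v cayley_e 1" if k: "k \<in> G2C" "cnj_mat k = k" for k
  proof -
    have x: "cnj_vec (k *v cayley_e 1) = k *v cayley_e 1" "cdot (k *v cayley_e 1) (k *v cayley_e 1) = 1"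
      using k SO8C_D(4)[of k] by (simp_all add: G2C_iff cayley_e_nth cnj_vec_mult)
    obtain \<kappa> :: "real \<Rightarrow> complex^8^8" and t1 where "continuous_on UNIV \<kappa>" "\<And>t. \<kappa> t \<in> G2C"
      "\<kappa> 0 *v cayley_e 1 = cayley_e 1" "\<kappa> t1 *v cayley_e 1 = k *v cayley_e 1"
      by (rule G2C_curve[OF x imag[OF k(1)]]) blast
    then show ?thesis by blast
  qed
  show "diag_mat (sign_diag {2, 3, 6, 7}) \<in> SL3C"
    using sign_diag_G2C[of "{2, 3, 6, 7}"] by (simp add: SL3C_def diag_mat_cayley_e sign_diag_def)
qed (use \<iota> G2C_group SL3C_group that in auto)

text \<open>Equal coordinates of a and b give p = c q for the images p and q of e_0 under their
  lifts. Both have norm one, so c^2 = 1, and c times the lift of b is again a lift of b. Thus the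
  sign ambiguity of the lift is absorbed by that of homogeneous coordinates.\<close>

lemma slice_data_SO7C:
  fixes \<iota> :: "'n::finite \<Rightarrow> 8"
  assumes \<iota>: "inj \<iota>" "range \<iota> = - {0}" "\<iota> j = 1"
  obtains U\<^sub>0 and \<phi>\<^sub>0 :: "(complex^8^8) set \<Rightarrow> complex^'n" and S\<^sub>0 A
    where "slice_data SO7C G2C U\<^sub>0 \<phi>\<^sub>0 S\<^sub>0 j A"
proof -
  interpret matrix_pair SO7C G2C by (rule matrix_pair_SO7C)
  let ?e = "cayley_e 0" and ?T = "{1, 3, 5, 7} :: 8 set"
  let ?A = "diag_mat (sign_diag ?T)"
  have \<iota>0: "0 \<notin> range \<iota>" "\<iota> i \<noteq> 0" for i using \<iota>(2) by auto
  have rc: "cdot z z = (\<Sum>j\<in>UNIV. z $ j * z $ j)" for z :: "complex^'n" by (simp add: cdot_def)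
  have g8: "g \<in> SO8C" if "g \<in> SO7C" for g using that by (simp add: SO7C_def)
  have n1: "cdot (h *v ?e) (h *v ?e) = 1" if "h \<in> SO8C" for h using SO8C_D(4)[OF that] by (simp add: cayley_e_nth)
  have lift: "\<exists>h. h \<in> SO8C \<and> tri g h" if "g \<in> SO7C" for g
    using SO7C_lift[OF that] Spin7C_iff by metis
  have rat: "ratio_coords \<iota> 0 (spinor g) = ratio_coords \<iota> 0 (h *v ?e)" "spinor g $ 0 = 8 * (h *v ?e) $ 0 * (h *v ?e) $ 0"
    if "tri g h" "h \<in> SO8C" "spinor g $ 0 \<noteq> 0 \<or> (h *v ?e) $ 0 \<noteq> 0" for g h
    using that(3) unfolding spinor_eq[OF that(1,2)] by (auto simp: ratio_coords_def vec_eq_iff)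
  have same: "transpose a ** b \<in> G2C" if ab: "a \<in> SO7C" "b \<in> SO7C" "tri a h" "tri b k" "h \<in> SO8C" "k \<in> SO8C" "h *v ?e = k *v ?e" for a b h k
  proof -
    have t: "tri (transpose a ** b) (transpose h ** k)"
      by (rule tri_mult[OF tri_transpose_SO8C[OF ab(3) g8[OF ab(1)] ab(5)] ab(4)])
    have "(transpose h ** k) *v ?e = transpose h *v (h *v ?e)"
      unfolding ab(7) matrix_vector_mul_assoc[symmetric] ..
    then have f: "(transpose h ** k) *v ?e = ?e" using SO8C_D(6)[OF ab(5)] by simp
    have "transpose h ** k \<in> SO8C" using SO8C_mult[OF SO8C_transpose] ab by blast
    from tri_fixed_one[OF t f this] show ?thesis by simp
  qed
  \<comment> \<open>The scalar is 1 or -1, and -1 has determinant 1 because the dimension 8 is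
    even.\<close>
  have neg8: "mat_scale c h \<in> SO8C" if "h \<in> SO8C" "c * c = 1" for c h
  proof -
    have "cdot (mat_scale c h *v x) (mat_scale c h *v y) = cdot x y" for x y
      using SO8C_D(4)[OF that(1)] that(2) by (simp add: mat_scale_vec mult.assoc[symmetric])
    moreover have "mat_scale c h = h \<or> mat_scale c h = mat_scale (- 1) (mat 1) ** h"
    proof -
      have "c = 1 \<or> c = - 1" using that(2) by (metis power2_eq_1_iff power2_eq_square)
      then show ?thesis by (auto simp: matrix_eq mat_scale_vec matrix_vector_mul_assoc[symmetric] vec_eq_iff)
    qed
    moreover have "det (mat_scale (- 1) (mat 1) :: complex^8^8) = 1"
    proof -
      have "det (mat_scale (- 1) (mat 1) :: complex^8^8) = (\<Prod>i\<in>UNIV. (mat_scale (- 1) (mat 1) :: complex^8^8) $ i $ i)"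
        by (rule det_diagonal) (simp add: mat_def)
      then show ?thesis by (simp add: mat_def)
    qed
    then have "det (mat_scale (- 1) (mat 1) ** h) = 1" using SO8C_D(1)[OF that(1)] by (simp add: det_mul)
    ultimately show ?thesis using orthogonal_iff_cdot[of "mat_scale c h"] SO8C_D(1)[OF that(1)] unfolding SO8C_def by auto
  qed
  show thesis
  proof (rule slice_data_from_vector[OF matrix_pair_SO7C, where W = spinor and \<iota> = \<iota> and \<alpha> = 0 and s = "sign_diag ?T" and j = j])
    show "holomorphic_map_on mat_scale (*s) spinor UNIV" by (rule holomorphic_spinor)
    show "spinor (g ** h) = spinor g" if "g \<in> SO7C" "h \<in> G2C" for g h
    proof -
      obtain k where k: "k \<in> SO8C" "tri g k" using lift[OF \<open>g \<in> SO7C\<close>] by blast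
      have h: "h \<in> SO8C" "tri h h" "h *v ?e = ?e" using that(2) G2C_iff G2C_one_fixed by auto
      show ?thesis
        unfolding spinor_eq[OF k(2,1)] spinor_eq[OF tri_mult[OF k(2) h(2)] SO8C_mult[OF k(1) h(1)]]
        by (simp add: matrix_vector_mul_assoc[symmetric] h(3))
    qed
    show "transpose a ** b \<in> G2C"
      if ab: "a \<in> SO7C" "b \<in> SO7C" "spinor a $ 0 \<noteq> 0" "spinor b $ 0 \<noteq> 0" "ratio_coords \<iota> 0 (spinor a) = ratio_coords \<iota> 0 (spinor b)" for a b
    proof -
      obtain h k where h: "h \<in> SO8C" "tri a h" and k: "k \<in> SO8C" "tri b k" using lift ab by meson
      let ?p = "h *v ?e" and ?q = "k *v ?e"
      have ne: "?p $ 0 \<noteq> 0" "?q $ 0 \<noteq> 0"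
        using ab(3,4) unfolding spinor_eq[OF h(2,1)] spinor_eq[OF k(2,1)] by auto
      have eq: "ratio_coords \<iota> 0 ?p = ratio_coords \<iota> 0 ?q"
        using ab(5) rat(1)[OF h(2,1)] rat(1)[OF k(2,1)] ne by simp
      define c where "c = ?p $ 0 / ?q $ 0"
      have pq: "?p $ i = c * ?q $ i" for i
      proof (cases "i = 0")
        case False
        then obtain l where "i = \<iota> l" using \<iota>(2) by (metis ComplI imageE singletonD)
        then have "?p $ i / ?p $ 0 = ?q $ i / ?q $ 0"
          using arg_cong[OF eq, of "\<lambda>v. v $ l"] by (simp add: ratio_coords_def)
        then show ?thesis using ne by (simp add: c_def field_simps)
      qed (use ne in \<open>simp add: c_def\<close>)
      then have pc: "?p = c *s ?q" by (simp add: vec_eq_iff)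
      have "1 = c * c * cdot ?q ?q" using n1[OF h(1)] unfolding pc by (simp add: mult.assoc)
      then have cc: "c * c = 1" using n1[OF k(1)] by (simp only: mult_1_right)
      show ?thesis
        by (rule same[OF ab(1,2) h(2) tri_scale[OF k(2)] h(1) neg8[OF k(1) cc]]) (simp add: mat_scale_vec pc)
    qed
    show "1 + (\<Sum>j\<in>UNIV. ratio_coords \<iota> 0 (spinor g) $ j * ratio_coords \<iota> 0 (spinor g) $ j) \<noteq> 0"
      if g: "g \<in> SO7C" "spinor g $ 0 \<noteq> 0" for g
    proof -
      obtain h where h: "h \<in> SO8C" "tri g h" using lift[OF g(1)] by blast
      let ?p = "h *v ?e"
      have p0: "?p $ 0 \<noteq> 0" using g(2) unfolding spinor_eq[OF h(2,1)] by auto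
      have "cdot ?p ?p = ?p $ 0 * ?p $ 0 + (\<Sum>j\<in>UNIV. ?p $ \<iota> j * ?p $ \<iota> j)"
        by (rule cdot_split[OF \<iota>(1) \<iota>0(1)]) (use \<iota>(2) in auto)
      then have s: "?p $ 0 * ?p $ 0 + (\<Sum>j\<in>UNIV. ?p $ \<iota> j * ?p $ \<iota> j) = 1" using n1[OF h(1)] by simp
      have "(\<Sum>j\<in>UNIV. ratio_coords \<iota> 0 ?p $ j * ratio_coords \<iota> 0 ?p $ j) = (\<Sum>j\<in>UNIV. ?p $ \<iota> j * ?p $ \<iota> j) / (?p $ 0 * ?p $ 0)"
        by (simp add: ratio_coords_def sum_divide_distrib)
      then have "1 + (\<Sum>j\<in>UNIV. ratio_coords \<iota> 0 ?p $ j * ratio_coords \<iota> 0 ?p $ j) =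
          (?p $ 0 * ?p $ 0 + (\<Sum>j\<in>UNIV. ?p $ \<iota> j * ?p $ \<iota> j)) / (?p $ 0 * ?p $ 0)"
        using p0 by (simp add: add_divide_distrib)
      also have "\<dots> \<noteq> 0" unfolding s using p0 by simp
      finally show ?thesis using rat(1)[OF h(2,1)] p0 by simp
    qed
    show "\<exists>V \<sigma>. z \<in> V \<and> holomorphic_map_on (*s) mat_scale \<sigma> V \<and>
        (\<forall>w\<in>V. \<sigma> w \<in> SO7C \<and> spinor (\<sigma> w) $ 0 \<noteq> 0 \<and> ratio_coords \<iota> 0 (spinor (\<sigma> w)) = w)"
      if "1 + (\<Sum>j\<in>UNIV. z $ j * z $ j) \<noteq> 0" for z :: "complex^'n"
    proof -
      let ?X = "\<lambda>z. ?e + embed \<iota> z"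
      have N: "cdot (?X w) (?X w) = 1 + cdot w w" for w by (rule cdot_embed[OF \<iota>(1) \<iota>0(1)])
      have "cdot (?X z) (?X z) \<noteq> 0" unfolding N using that unfolding rc .
      then obtain V S0 S where V: "?X z \<in> V" "holomorphic_map_on (*s) mat_scale S0 V"
        "\<And>x. x \<in> V \<Longrightarrow> cdot x x \<noteq> 0 \<and> S0 x \<in> SO7C \<and> tri (S0 x) (S x) \<and> S x *v ?e = x"
        "\<And>x c. x \<in> V \<Longrightarrow> c * c * cdot x x = 1 \<Longrightarrow> mat_scale c (S x) \<in> SO8C"
        by (rule spin_section) blast+
      have hX: "holomorphic_map_on (*s) (*s) ?X UNIV"
        by (rule holomorphic_vec_add[OF holomorphic_vec_const holomorphic_embed]) simp_all
      let ?V = "UNIV \<inter> ?X -` V"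
      have oV: "open ?V" by (rule holomorphic_map_on_open_vimage[OF hX holomorphic_map_onD(2)[OF V(2)]])
      have h: "holomorphic_map_on (*s) (*s) ?X ?V" by (rule holomorphic_map_on_subset[OF hX oV]) simp
      have "holomorphic_map_on (*s) mat_scale (S0 \<circ> ?X) ?V"
        by (rule holomorphic_map_on_compose[OF h V(2)]) auto
      moreover have "(S0 \<circ> ?X) w \<in> SO7C \<and> spinor ((S0 \<circ> ?X) w) $ 0 \<noteq> 0 \<and> ratio_coords \<iota> 0 (spinor ((S0 \<circ> ?X) w)) = w"
        if "w \<in> ?V" for w
      proof -
        have w: "?X w \<in> V" using that by simp
        note f = V(3)[OF w]
        \<comment> \<open>This root only serves to verify the coordinates at the point w; the
          section S0 does not involve it and stays holomorphic.\<close>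
        define c where "c = inverse (csqrt (cdot (?X w) (?X w)))"
        have cc: "c * c = inverse (cdot (?X w) (?X w))"
          unfolding c_def by (metis inverse_mult_distrib power2_csqrt power2_eq_square)
        have c: "c * c * cdot (?X w) (?X w) = 1" "c \<noteq> 0" using cc f by auto
        let ?h = "mat_scale c (S (?X w))"
        have h: "?h \<in> SO8C" "tri (S0 (?X w)) ?h" using V(4)[OF w c(1)] tri_scale f by blast+
        have p: "?h *v ?e = c *s ?X w" using f by (simp add: mat_scale_vec)
        have X0: "?X w $ 0 = 1" "?X w $ \<iota> i = w $ i" for i
          using \<iota>0 by (simp_all add: embed_nth \<iota>(1) cayley_e_nth)
        have p0: "(?h *v ?e) $ 0 \<noteq> 0" unfolding p vector_smult_component X0 using c(2) by simp
        have "ratio_coords \<iota> 0 (?h *v ?e) = w"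
          unfolding p ratio_coords_def vector_smult_component X0 using c(2) by (simp add: vec_eq_iff)
        then show ?thesis using rat[OF h(2,1)] p0 f by simp
      qed
      moreover have "z \<in> ?V" using V(1) by simp
      ultimately show ?thesis by (intro exI[of _ ?V] exI[of _ "S0 \<circ> ?X"] conjI ballI) simp_all
    qed
    show "\<exists>k\<in>SO7C. cnj_mat k = k \<and> spinor (k ** g) $ 0 \<noteq> 0 \<and>
        (\<exists>r. \<bar>r\<bar> < 1 \<and> ratio_coords \<iota> 0 (spinor (k ** g)) = r *\<^sub>R axis j \<i>)" if g: "g \<in> SO7C" for g
    proof -
      obtain h where h: "h \<in> SO8C" "tri g h" using lift[OF g] by blast
      obtain l t where l: "l \<in> Spin7C" "cnj_mat l = l" "l *v (h *v ?e) = slice_vec 0 1 t"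
        by (rule Spin7C_meets_slice[OF n1[OF h(1)]]) blast
      obtain k where k: "k \<in> SO7C" "tri k l" and l8: "l \<in> SO8C" using l(1) Spin7C_iff by blast
      have lr: "cnj_vec (l *v ?e) = l *v ?e" using l(2) by (simp add: cnj_vec_mult)
      \<comment> \<open>Both k and its conjugate are companions of the real matrix l, and companions
        are unique.\<close>
      have "tri (cnj_mat k) l" using tri_cnj[OF k(2)] l(2) by simp
      then have kr: "cnj_mat k = k" using tri_companion[OF _ l8] k(2) by metis
      let ?m = "l ** h"
      have m: "?m \<in> SO8C" "tri (k ** g) ?m" using SO8C_mult[OF l8 h(1)] tri_mult[OF k(2) h(2)] by auto
      have p: "?m *v ?e = of_real 1 *s slice_vec 0 1 t + of_real 0 *s ?e"
        using l(3) by (simp add: matrix_vector_mul_assoc[symmetric])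
      \<comment> \<open>The weights 1 and 0 mean that no multiple of e_0 is added: projective
        coordinates give the slice parameter tanh t.\<close>
      have "1 * cosh t + 0 \<noteq> 0" using sinh_cosh_bounds(1)[of t] by simp
      from ratio_coords_slice_vec[OF \<iota>(1) \<iota>0(1) \<iota>(3) this]
      have r: "ratio_coords \<iota> 0 (?m *v ?e) = (sinh t / cosh t) *\<^sub>R axis j \<i>" unfolding p by simp
      have "(?m *v ?e) $ 0 = of_real (cosh t)" unfolding p by (simp add: slice_vec_def cayley_e_nth)
      then have p0: "(?m *v ?e) $ 0 \<noteq> 0" using sinh_cosh_bounds(1)[of t] by (metis of_real_eq_0_iff)
      show ?thesis
        using k(1) kr rat[OF m(2,1)] p0 r sinh_cosh_bounds(4)[of t] by (intro bexI[of _ k]) auto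
    qed
    show "?A \<in> G2C" by (rule sign_diag_G2C) simp
    then have A: "?A \<in> SO8C" "tri ?A ?A" using G2C_iff by auto
    show "sign_diag ?T i = 1 \<or> sign_diag ?T i = -1" for i by (simp add: sign_diag_def)
    show s: "sign_diag ?T 0 = 1" "sign_diag ?T (\<iota> j) = -1" using \<iota>(3) by (simp_all add: sign_diag_def)
    show "spinor (?A ** cnj_mat g) = ?A *v cnj_vec (spinor g)" if "g \<in> SO7C" for g
    proof -
      obtain h where h: "h \<in> SO8C" "tri g h" using lift[OF \<open>g \<in> SO7C\<close>] by blast
      have t: "tri (?A ** cnj_mat g) (?A ** cnj_mat h)" by (rule tri_mult[OF A(2) tri_cnj[OF h(2)]])
      have h8: "?A ** cnj_mat h \<in> SO8C" by (rule SO8C_mult[OF A(1) SO8C_cnj[OF h(1)]])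
      have p: "(?A ** cnj_mat h) *v ?e = ?A *v cnj_vec (h *v ?e)"
        by (simp add: matrix_vector_mul_assoc[symmetric] cnj_vec_mult)
      have p0: "(?A *v cnj_vec (h *v ?e)) $ 0 = cnj ((h *v ?e) $ 0)" by (simp add: diag_mat_vec s)
      show ?thesis
        unfolding spinor_eq[OF t h8] spinor_eq[OF h(2,1)] p p0 by (simp add: matrix_vec_scale)
    qed
    have sp1: "spinor (mat 1) = 8 *s ?e"
      using spinor_eq[OF tri_one SO8C_one] by (simp add: cayley_e_nth)
    show "spinor (mat 1) $ 0 \<noteq> 0" unfolding sp1 by (simp add: cayley_e_nth)
    show "ratio_coords \<iota> 0 (spinor (mat 1)) = 0" unfolding sp1 by (simp add: ratio_coords_def vec_eq_iff cayley_e_nth \<iota>0)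
    show "\<exists>C. connectedin (coset_space SO7C G2C) C \<and> coset_proj G2C (mat 1) \<in> C \<and> coset_proj G2C k \<in> C"
      if k: "k \<in> SO7C" "cnj_mat k = k" for k
    proof -
      obtain h where h: "h \<in> SO8C" "tri k h" using lift[OF k(1)] by blast
      obtain \<kappa>0 \<kappa> :: "real \<Rightarrow> complex^8^8" and t1 where \<kappa>: "continuous_on UNIV \<kappa>0" "\<And>t. \<kappa>0 t \<in> SO7C \<and> \<kappa> t \<in> Spin7C \<and> tri (\<kappa>0 t) (\<kappa> t)"
        "\<kappa> 0 *v ?e = ?e" "\<kappa> t1 *v ?e = h *v ?e"
        by (rule spin_curve[OF real_spinor[OF k h(2,1)] n1[OF h(1)]]) blast
      have \<kappa>8: "\<kappa>0 t \<in> SO7C" "\<kappa> t \<in> SO8C" "tri (\<kappa>0 t) (\<kappa> t)" for t using \<kappa>(2)[of t] Spin7C_iff by auto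
      have e: "mat 1 *v ?e = \<kappa> 0 *v ?e" using \<kappa>(3) by simp
      have "coset_proj G2C (mat 1) = coset_proj G2C (\<kappa>0 0)" "coset_proj G2C k = coset_proj G2C (\<kappa>0 t1)"
        using same[OF one_G \<kappa>8(1) tri_one \<kappa>8(3) SO8C_one \<kappa>8(2) e] same[OF k(1) \<kappa>8(1) h(2) \<kappa>8(3) h(1) \<kappa>8(2) \<kappa>(4)[symmetric]]
          proj_eq_iff[OF one_G \<kappa>8(1)] proj_eq_iff[OF k(1) \<kappa>8(1)] by simp_all
      then show ?thesis using connectedin_curve[OF \<kappa>(1) \<kappa>8(1)] by blast
    qed
  qed (use SO7C_cnj G2C_group(4) that in blast)+
qed

text \<open>The index type is known through its cardinality only, so the enumeration of the
  coordinates is arbitrary and j is whichever index it sends to \<beta>.\<close>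

lemma coordinate_enumeration:
  assumes "CARD('n::finite) = card (- F)" "\<beta> \<notin> F"
  obtains \<iota> :: "'n::finite \<Rightarrow> 8" and j where "inj \<iota>" "range \<iota> = - F" "\<iota> j = \<beta>"
proof -
  obtain \<iota> where "bij_betw \<iota> (UNIV :: 'n set) (- F :: 8 set)"
    using finite_same_card_bij[of "UNIV :: 'n set" "- F"] assms(1) by auto
  then have "inj \<iota>" "range \<iota> = - F" by (auto simp: bij_betw_def)
  then show thesis using that assms(2) by (metis ComplI imageE)
qed

theorem theorem1p2:
  fixes G H :: "(complex^8^8) set"
    and \<theta> :: "complex^8^8 \<Rightarrow> complex^8^8"
  assumes "(G, H, CARD('n::finite)) \<in> {(SO7C, G2C, 7), (Spin7C, G2C, 7), (G2C, SL3C, 6)}"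
    and "cartan_involution G \<theta>"
    and "\<theta> ` H = H"
  shows "strongly_visible {g \<in> G. \<theta> g = g} (left_translation G H)
           (coset_space G H) (coset_charts G H :: ((complex^8^8) set, 'n) chart set)"
proof -
  let ?K = "{g \<in> G. \<theta> g = g}"
  have max: "maximal_compact_subgroup G ?K" and cK: "compact ?K"
    using assms(2) by (auto simp: cartan_involution_def maximal_compact_subgroup_def)
  \<comment> \<open>These are the complex dimensions of the quotients: one coordinate is lost to
    normalisation, and for G2 also the coordinate 0, since the orbit of e_1 is imaginary.\<close>
  have c7: "card (- {0 :: 8}) = 7" "card (- {0, 1 :: 8}) = 6" by (simp_all add: Compl_eq_Diff_UNIV card_Diff_subset)
  have "\<exists>U\<^sub>0 \<phi>\<^sub>0 S\<^sub>0 j A. slice_data G H U\<^sub>0 (\<phi>\<^sub>0 :: (complex^8^8) set \<Rightarrow> complex^'n) S\<^sub>0 j A"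
    using assms(1)
  proof (elim insertE emptyE)
    assume *: "(G, H, CARD('n)) = (SO7C, G2C, 7)"
    then obtain \<iota> :: "'n \<Rightarrow> 8" and j where "inj \<iota>" "range \<iota> = - {0}" "\<iota> j = 1"
      using coordinate_enumeration[of "{0}" 1] c7 by auto
    then show ?thesis using slice_data_SO7C[of \<iota> j] * by (metis prod.inject)
  next
    assume *: "(G, H, CARD('n)) = (Spin7C, G2C, 7)"
    then obtain \<iota> :: "'n \<Rightarrow> 8" and j where "inj \<iota>" "range \<iota> = - {0}" "\<iota> j = 1"
      using coordinate_enumeration[of "{0}" 1] c7 by auto
    then show ?thesis using slice_data_Spin7C[of \<iota> j] * by (metis prod.inject)
  next
    assume *: "(G, H, CARD('n)) = (G2C, SL3C, 6)"
    then obtain \<iota> :: "'n \<Rightarrow> 8" and j where "inj \<iota>" "range \<iota> = - {0, 1}" "\<iota> j = 2"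
      using coordinate_enumeration[of "{0, 1}" 2] c7 by auto
    then show ?thesis using slice_data_G2C[of \<iota> j] * by (metis prod.inject)
  qed
  then obtain U\<^sub>0 S\<^sub>0 j A and \<phi>\<^sub>0 :: "(complex^8^8) set \<Rightarrow> complex^'n" where "slice_data G H U\<^sub>0 \<phi>\<^sub>0 S\<^sub>0 j A"
    by blast
  then interpret slice_data G H U\<^sub>0 \<phi>\<^sub>0 S\<^sub>0 j A .
  have "closed G" "\<And>g. g \<in> G \<Longrightarrow> \<exists>n\<in>G. adjoint_mat n = n \<and> n ** n ** n ** n = g ** adjoint_mat g"
    using assms(1) closed_SO7C closed_Spin7C closed_G2C root_SO7C root_Spin7C root_G2C by auto
  then obtain q where "q \<in> G" "?K = {q ** u ** transpose q |u. u \<in> G \<and> cnj_mat u = u}"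
    using maximal_compact_conjugate[OF _ cnj_G _ max] by blast
  then show ?thesis using cK by (rule strongly_visible_conjugate)
qed

end
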